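(* Let $d\geq 3$. There exist a $(d-2)$-purely unrectifiable set $E\subset\mathbb{R}^d$ and a $(d-2)$-dimensional probability measure $\mu$ supported on $E$ such that for every even Hölder continuous function $\Omega:\mathbb{S}^{d-1}\to\mathbb{R}$ with $\int_{\mathbb{S}^{d-1}}\Omega(\xi)\,d\mathscr{H}^{d-1}(\xi)=0$ the following hold. (1) The $(d-2)$-dimensional potential $$T(\mu)(x)=\int_{\mathbb{R}^d}\frac{\Omega\left(\frac{x-y}{|x-y|}\right)}{|x-y|^{d-2}}\,d\mu(y),\qquad x\notin\operatorname{supp}(\mu),$$ belongs to $L^\infty(\mathbb{R}^d\setminus\operatorname{supp}(\mu))$ if and only if $$\int_{\mathbb{S}^{d-1}}\xi_i\,\xi_j\,\Omega(\xi)\,d\mathscr{H}^{d-1}(\xi)=0\quad\text{for all } i,j\in\{1,\dots,d\}.$$ (2) Unless $\Omega$ vanishes identically, the singular integral operator associated to $\Omega$ fails to exist in the sense of principal value $\mu$-almost everywhere, i.e. for $\mu$-almost every $x\in\mathbb{R}^d$ the limit $$\lim_{\varepsilon\to0^+}\int_{\{y:\,|x-y|>\varepsilon\}}\frac{\Omega\left(\frac{x-y}{|x-y|}\right)}{|x-y|^{d-2}}\,d\mu(y)$$ does not exist.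
   Context: $\mathscr{H}^m$ denotes $m$-dimensional Hausdorff measure. A set $A\subset\mathbb{R}^d$ is $m$-rectifiable if there are Lipschitz maps $f_i:\mathbb{R}^m\to\mathbb{R}^d$, $i=1,2,\dots$, such that $\mathscr{H}^m(A\setminus\bigcup_i f_i(\mathbb{R}^m))=0$. A set $B\subset\mathbb{R}^d$ is $m$-purely unrectifiable if $\mathscr{H}^m(B\cap A)=0$ for every $m$-rectifiable set $A\subset\mathbb{R}^d$. A Borel measure $\mu$ on $\mathbb{R}^d$ has $m$-growth if there is a constant $C>0$ such that $\mu(B(x,r))\le Cr^m$ for every ball $B(x,r)\subset\mathbb{R}^d$. A measure $\mu$ is an $m$-dimensional measure if $\mathscr{H}^m(\operatorname{supp}\mu)<\infty$ and $\mu$ has $m$-growth. A function $\Omega$ on the sphere is even if $\Omega(-\xi)=\Omega(\xi)$. Hölder continuous means $\alpha$-Hölder continuous for some $\alpha\in(0,1]$. *)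

theory Defs
  imports "HOL-Probability.Probability"
begin

section \<open>Hausdorff measure\<close>

text \<open>The summand of a covering, \<open>\<omega>\<^sub>m (diam U / 2)\<^sup>m\<close> with \<open>\<omega>\<^sub>m\<close> the volume of the
  unit ball of \<open>\<real>\<^sup>m\<close>.  The empty set is treated separately because \<open>0 ^ 0 = 1\<close>.\<close>

definition hausdorff_gauge :: "nat \<Rightarrow> 'a::metric_space set \<Rightarrow> ennreal" where
  "hausdorff_gauge m U =
     (if U = {} then 0 else ennreal (unit_ball_vol (real m) * (diameter U / 2) ^ m))"

text \<open>Boundedness is required since the library's \<open>diameter\<close> is only meaningful for bounded sets.\<close>

definition hausdorff_covers :: "real \<Rightarrow> 'a::metric_space set \<Rightarrow> (nat \<Rightarrow> 'a set) set" where
  "hausdorff_covers \<delta> A =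
     {U. A \<subseteq> (\<Union>i. U i) \<and> (\<forall>i. bounded (U i) \<and> diameter (U i) \<le> \<delta>)}"

definition hausdorff_pre :: "nat \<Rightarrow> real \<Rightarrow> 'a::metric_space set \<Rightarrow> ennreal" where
  "hausdorff_pre m \<delta> A = (INF U\<in>hausdorff_covers \<delta> A. \<Sum>i. hausdorff_gauge m (U i))"

definition hausdorff_outer :: "nat \<Rightarrow> 'a::metric_space set \<Rightarrow> ennreal" where
  "hausdorff_outer m A = (SUP \<delta>\<in>{0<..}. hausdorff_pre m \<delta> A)"

text \<open>The measure on the Borel sets, used for integration.  It agrees with the outer measure on
  Borel sets, by \<open>emeasure_hausdorff\<close> below.\<close>

definition hausdorff :: "nat \<Rightarrow> 'a::metric_space measure" where
  "hausdorff m = measure_of UNIV (sets borel) (hausdorff_outer m)"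

lemma space_hausdorff [simp]: "space (hausdorff m) = UNIV"
  by (simp add: hausdorff_def space_measure_of_conv)

lemma sets_hausdorff [simp, measurable_cong]: "sets (hausdorff m) = sets borel"
  unfolding hausdorff_def by (metis sets.sigma_sets_eq sets_measure_of space_borel top_greatest Pow_UNIV)

lemma hausdorff_gauge_empty [simp]: "hausdorff_gauge m {} = 0"
  by (simp add: hausdorff_gauge_def)

lemma hausdorff_covers_mono:
  "A \<subseteq> B \<Longrightarrow> \<delta> \<le> \<delta>' \<Longrightarrow> hausdorff_covers \<delta> B \<subseteq> hausdorff_covers \<delta>' A"
  unfolding hausdorff_covers_def by (auto intro: order_trans)

lemma hausdorff_pre_mono:
  "A \<subseteq> B \<Longrightarrow> \<delta> \<le> \<delta>' \<Longrightarrow> hausdorff_pre m \<delta>' A \<le> hausdorff_pre m \<delta> B"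
  unfolding hausdorff_pre_def by (intro INF_superset_mono hausdorff_covers_mono) auto

lemma hausdorff_pre_le_outer: "0 < \<delta> \<Longrightarrow> hausdorff_pre m \<delta> A \<le> hausdorff_outer m A"
  unfolding hausdorff_outer_def by (rule SUP_upper) simp

lemma hausdorff_outer_mono: "A \<subseteq> B \<Longrightarrow> hausdorff_outer m A \<le> hausdorff_outer m B"
  unfolding hausdorff_outer_def by (intro SUP_mono) (use hausdorff_pre_mono in blast)

lemma hausdorff_outer_empty [simp]: "hausdorff_outer m {} = 0"
proof -
  have "hausdorff_pre m \<delta> ({} :: 'a set) = 0" if "\<delta> > 0" for \<delta>
  proof -
    have "hausdorff_pre m \<delta> ({} :: 'a set) \<le> (\<Sum>i::nat. hausdorff_gauge m ({} :: 'a set))"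
      unfolding hausdorff_pre_def
      by (rule INF_lower2[of "\<lambda>_. {}"]) (use that in \<open>auto simp: hausdorff_covers_def\<close>)
    then show ?thesis by simp
  qed
  then show ?thesis by (simp add: hausdorff_outer_def SUP_eq_const)
qed

lemma hausdorff_pre_countably_subadditive:
  "hausdorff_pre m \<delta> (\<Union>i. A i) \<le> (\<Sum>i. hausdorff_pre m \<delta> (A i))"
proof (rule ennreal_le_epsilon)
  fix e :: real
  assume e: "0 < e" and fin: "(\<Sum>i. hausdorff_pre m \<delta> (A i)) < top"
  have "\<exists>U\<in>hausdorff_covers \<delta> (A n). (\<Sum>i. hausdorff_gauge m (U i))
           < hausdorff_pre m \<delta> (A n) + e * (1/2) ^ Suc n" for n
  proof -
    have "hausdorff_pre m \<delta> (A n) < hausdorff_pre m \<delta> (A n) + e * (1/2) ^ Suc n"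
      using e fin by (auto simp: less_top dest!: ennreal_suminf_lessD)
    then show ?thesis
      unfolding hausdorff_pre_def[of m \<delta> "A n"] INF_less_iff .
  qed
  then obtain B where B: "\<And>n. B n \<in> hausdorff_covers \<delta> (A n)"
    and Ble: "\<And>n. (\<Sum>i. hausdorff_gauge m (B n i)) \<le> hausdorff_pre m \<delta> (A n) + e * (1/2) ^ Suc n"
    by (metis less_imp_le)
  define C where "C = case_prod B \<circ> prod_decode"
  have "C \<in> hausdorff_covers \<delta> (\<Union>i. A i)"
    unfolding hausdorff_covers_def
  proof (safe, goal_cases)
    case (1 x n)
    then obtain i where "x \<in> B n i" using B[of n] by (auto simp: hausdorff_covers_def)
    then have "x \<in> C (prod_encode (n, i))" by (simp add: C_def)
    then show ?case by blast
  next
    case (2 i)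
    show ?case using B[of "fst (prod_decode i)"]
      by (simp add: C_def hausdorff_covers_def split_def)
  next
    case (3 i)
    show ?case using B[of "fst (prod_decode i)"]
      by (simp add: C_def hausdorff_covers_def split_def)
  qed
  then have "hausdorff_pre m \<delta> (\<Union>i. A i) \<le> (\<Sum>i. hausdorff_gauge m (C i))"
    unfolding hausdorff_pre_def by (rule INF_lower)
  also have "\<dots> = (\<Sum>n. \<Sum>i. hausdorff_gauge m (B n i))"
    unfolding C_def comp_def by (intro suminf_ennreal_2dimen) auto
  also have "\<dots> \<le> (\<Sum>n. hausdorff_pre m \<delta> (A n) + e * (1/2) ^ Suc n)"
    by (intro suminf_le Ble) auto
  also have "\<dots> = (\<Sum>n. hausdorff_pre m \<delta> (A n)) + (\<Sum>n. ennreal e * ennreal ((1/2) ^ Suc n))"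
    using e by (subst suminf_add[symmetric])
      (auto simp del: ennreal_suminf_cmult simp add: ennreal_mult[symmetric])
  also have "\<dots> = (\<Sum>n. hausdorff_pre m \<delta> (A n)) + e"
    unfolding ennreal_suminf_cmult
    by (subst suminf_ennreal_eq[OF zero_le_power power_half_series]) auto
  finally show "hausdorff_pre m \<delta> (\<Union>i. A i) \<le> (\<Sum>n. hausdorff_pre m \<delta> (A n)) + e" .
qed

lemma hausdorff_outer_countably_subadditive:
  "hausdorff_outer m (\<Union>i. A i) \<le> (\<Sum>i. hausdorff_outer m (A i))"
proof -
  have "hausdorff_pre m \<delta> (\<Union>i. A i) \<le> (\<Sum>i. hausdorff_outer m (A i))" if "\<delta> > 0" for \<delta>
    by (rule order_trans[OF hausdorff_pre_countably_subadditive])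
       (intro suminf_le hausdorff_pre_le_outer that; simp)
  then show ?thesis
    unfolding hausdorff_outer_def[of m "\<Union>i. A i"] by (intro SUP_least) simp
qed

lemma outer_measure_space_hausdorff: "outer_measure_space (Pow UNIV) (hausdorff_outer m)"
  unfolding outer_measure_space_def positive_def increasing_def countably_subadditive_def
  using hausdorff_outer_countably_subadditive hausdorff_outer_mono by auto

lemma hausdorff_outer_subadditive:
  "hausdorff_outer m (A \<union> B) \<le> hausdorff_outer m A + hausdorff_outer m B"
proof -
  have "subadditive (Pow UNIV) (hausdorff_outer m :: 'a set \<Rightarrow> ennreal)"
    using outer_measure_space_hausdorff[of m, where 'a = 'a]
    by (intro ring_of_sets.countably_subadditive_subadditive[OF ring_of_sets_Pow])
       (auto simp: outer_measure_space_def)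
  from subadditiveD[OF this, of A B]
  have "A \<inter> B = {} \<Longrightarrow> ?thesis" by auto
  moreover have ?thesis
  proof -
    have "hausdorff_outer m (A \<union> (B - A)) \<le> hausdorff_outer m A + hausdorff_outer m (B - A)"
      using subadditiveD[OF \<open>subadditive _ _\<close>, of A "B - A"] by auto
    also have "\<dots> \<le> hausdorff_outer m A + hausdorff_outer m B"
      by (intro add_left_mono hausdorff_outer_mono) auto
    finally show ?thesis by simp
  qed
  ultimately show ?thesis by blast
qed

lemma hausdorff_outer_separated:
  assumes "r > 0" and sep: "\<And>x y. x \<in> A \<Longrightarrow> y \<in> B \<Longrightarrow> r \<le> dist x y"
  shows "hausdorff_outer m A + hausdorff_outer m B \<le> hausdorff_outer m (A \<union> B)"
proof -
  have *: "hausdorff_pre m \<delta> A + hausdorff_pre m \<delta> B \<le> hausdorff_outer m (A \<union> B)"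
    if \<delta>: "0 < \<delta>" "\<delta> < r" for \<delta>
  proof -
    have "hausdorff_pre m \<delta> A + hausdorff_pre m \<delta> B \<le> (\<Sum>i. hausdorff_gauge m (U i))"
      if U: "U \<in> hausdorff_covers \<delta> (A \<union> B)" for U
    proof -
      define V where "V = (\<lambda>i. if U i \<inter> A = {} then {} else U i)"
      define W where "W = (\<lambda>i. if U i \<inter> A = {} then U i else {})"
      have V: "V \<in> hausdorff_covers \<delta> A"
        using U \<delta> unfolding hausdorff_covers_def V_def by fastforce
      have "B \<subseteq> (\<Union>i. W i)"
      proof
        fix y assume y: "y \<in> B"
        then obtain i where i: "y \<in> U i" using U by (auto simp: hausdorff_covers_def)
        have "U i \<inter> A = {}"
        proof (rule ccontr)
          assume "U i \<inter> A \<noteq> {}"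
          then obtain x where x: "x \<in> U i" "x \<in> A" by blast
          have "dist x y \<le> diameter (U i)"
            using U x i by (intro diameter_bounded_bound) (auto simp: hausdorff_covers_def)
          also have "\<dots> \<le> \<delta>" using U by (auto simp: hausdorff_covers_def)
          finally show False using sep[OF x(2) y] \<delta> by simp
        qed
        with i show "y \<in> (\<Union>i. W i)" by (auto simp: W_def)
      qed
      then have W: "W \<in> hausdorff_covers \<delta> B"
        using U \<delta> unfolding hausdorff_covers_def W_def by auto
      have "hausdorff_pre m \<delta> A + hausdorff_pre m \<delta> B
              \<le> (\<Sum>i. hausdorff_gauge m (V i)) + (\<Sum>i. hausdorff_gauge m (W i))"
        unfolding hausdorff_pre_def by (intro add_mono INF_lower V W)
      also have "\<dots> = (\<Sum>i. hausdorff_gauge m (V i) + hausdorff_gauge m (W i))"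
        by (intro suminf_add) auto
      also have "\<dots> = (\<Sum>i. hausdorff_gauge m (U i))"
        by (intro suminf_cong) (auto simp: V_def W_def)
      finally show ?thesis .
    qed
    then have "hausdorff_pre m \<delta> A + hausdorff_pre m \<delta> B \<le> hausdorff_pre m \<delta> (A \<union> B)"
      unfolding hausdorff_pre_def[of m \<delta> "A \<union> B"] by (rule INF_greatest)
    then show ?thesis using hausdorff_pre_le_outer[OF \<delta>(1)] order_trans by blast
  qed
  have "hausdorff_outer m A + hausdorff_outer m B
          = (SUP \<delta>\<in>{0<..}. hausdorff_pre m \<delta> A + hausdorff_pre m \<delta> B)"
    unfolding hausdorff_outer_def
  proof (rule SUP_add_directed_ennreal[symmetric])
    fix i j :: real assume "i \<in> {0<..}" "j \<in> {0<..}"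
    then show "\<exists>k\<in>{0<..}. hausdorff_pre m i A + hausdorff_pre m j B
                 \<le> hausdorff_pre m k A + hausdorff_pre m k B"
      by (intro bexI[of _ "min i j"] add_mono hausdorff_pre_mono) auto
  qed
  also have "\<dots> \<le> hausdorff_outer m (A \<union> B)"
  proof (rule SUP_least)
    fix \<delta> :: real assume \<delta>: "\<delta> \<in> {0<..}"
    have "hausdorff_pre m \<delta> A + hausdorff_pre m \<delta> B
            \<le> hausdorff_pre m (min \<delta> (r/2)) A + hausdorff_pre m (min \<delta> (r/2)) B"
      by (intro add_mono hausdorff_pre_mono) auto
    also have "\<dots> \<le> hausdorff_outer m (A \<union> B)"
      using \<delta> \<open>r > 0\<close> by (intro *) auto
    finally show "hausdorff_pre m \<delta> A + hausdorff_pre m \<delta> B \<le> hausdorff_outer m (A \<union> B)" .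
  qed
  finally show ?thesis .
qed

lemma hausdorff_outer_separated_sum:
  fixes R :: "nat \<Rightarrow> 'a::metric_space set"
  assumes sep: "\<And>k. \<exists>r>0. \<forall>j<k. \<forall>x\<in>R k. \<forall>y\<in>R j. r \<le> dist x y"
  shows "(\<Sum>k<n. hausdorff_outer m (R k)) \<le> hausdorff_outer m (\<Union>k<n. R k)"
proof (induction n)
  case 0
  show ?case by simp
next
  case (Suc n)
  obtain r where r: "r > 0" "\<forall>j<n. \<forall>x\<in>R n. \<forall>y\<in>R j. r \<le> dist x y"
    using sep[of n] by blast
  have "(\<Sum>k<Suc n. hausdorff_outer m (R k)) \<le> hausdorff_outer m (\<Union>k<n. R k) + hausdorff_outer m (R n)"
    using Suc.IH by (simp add: add_right_mono)
  also have "\<dots> \<le> hausdorff_outer m ((\<Union>k<n. R k) \<union> R n)"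
    using r by (intro hausdorff_outer_separated[of r]) (auto, metis dist_commute)
  also have "(\<Union>k<n. R k) \<union> R n = (\<Union>k<Suc n. R k)"
    by (auto simp: lessThan_Suc)
  finally show ?case .
qed

lemma hausdorff_outer_closed_split:
  fixes A F :: "'a::metric_space set"
  assumes F: "closed F"
  shows "hausdorff_outer m (A \<inter> F) + hausdorff_outer m (A - F) \<le> hausdorff_outer m A"
proof (cases "F = {} \<or> hausdorff_outer m A = top")
  case True
  then show ?thesis by (auto simp: top.extremum)
next
  case False
  then have ne: "F \<noteq> {}" and fin: "hausdorff_outer m A < top"
    by (auto simp: less_top)
  let ?H = "hausdorff_outer m"
  define S where "S n = {x \<in> A - F. 1 / real (Suc n) \<le> infdist x F}" for n
  define R where "R k = {x \<in> A - F. 1 / real (Suc (Suc k)) \<le> infdist x F \<and>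
                                     infdist x F < 1 / real (Suc k)}" for k
  have S_sep: "?H (A \<inter> F) + ?H (S n) \<le> ?H A" for n
  proof -
    have "?H (A \<inter> F) + ?H (S n) \<le> ?H ((A \<inter> F) \<union> S n)"
    proof (rule hausdorff_outer_separated)
      fix x y assume "x \<in> A \<inter> F" "y \<in> S n"
      then show "1 / real (Suc n) \<le> dist x y"
        using infdist_le[of x F y] by (auto simp: S_def dist_commute)
    qed simp
    also have "\<dots> \<le> ?H A" by (intro hausdorff_outer_mono) (auto simp: S_def)
    finally show ?thesis .
  qed
  have R_sep: "\<exists>r>0. \<forall>j. j + 2 \<le> k \<longrightarrow> (\<forall>x\<in>R k. \<forall>y\<in>R j. r \<le> dist x y)" for k
  proof (cases "k = 0")
    case True
    then show ?thesis by (intro exI[of _ 1]) auto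
  next
    case False
    show ?thesis
    proof (intro exI[of _ "1 / real k - 1 / real (Suc k)"] conjI allI impI ballI)
      show "0 < 1 / real k - 1 / real (Suc k)" using False by (simp add: frac_less2)
      fix j x y assume j: "j + 2 \<le> k" and x: "x \<in> R k" and y: "y \<in> R j"
      have "1 / real k \<le> 1 / real (Suc (Suc j))" using j by (intro frac_le) auto
      also have "\<dots> \<le> infdist y F" using y by (simp add: R_def)
      also have "\<dots> \<le> infdist x F + dist x y"
        using infdist_triangle[of y F x] by (simp add: dist_commute)
      finally show "1 / real k - 1 / real (Suc k) \<le> dist x y"
        using x by (simp add: R_def)
    qed
  qed
  have sum_fin: "(\<Sum>k. ?H (R (2 * k + c))) \<le> ?H A" for c
  proof (rule suminf_le_const)
    show "summable (\<lambda>k. ?H (R (2 * k + c)))" by simp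
    fix n
    have "(\<Sum>k<n. ?H (R (2 * k + c))) \<le> ?H (\<Union>k<n. R (2 * k + c))"
    proof (rule hausdorff_outer_separated_sum)
      fix k
      obtain r where r: "r > 0" "\<forall>j. j + 2 \<le> 2 * k + c \<longrightarrow> (\<forall>x\<in>R (2 * k + c). \<forall>y\<in>R j. r \<le> dist x y)"
        using R_sep by blast
      then show "\<exists>r>0. \<forall>j<k. \<forall>x\<in>R (2 * k + c). \<forall>y\<in>R (2 * j + c). r \<le> dist x y"
      proof (intro exI[of _ r] conjI allI impI)
        fix j assume "j < k"
        then have "(2 * j + c) + 2 \<le> 2 * k + c" by simp
        with r(2) show "\<forall>x\<in>R (2 * k + c). \<forall>y\<in>R (2 * j + c). r \<le> dist x y" by blast
      qed (use r(1) in simp)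
    qed
    also have "\<dots> \<le> ?H A" by (intro hausdorff_outer_mono) (auto simp: R_def)
    finally show "(\<Sum>k<n. ?H (R (2 * k + c))) \<le> ?H A" .
  qed
  define T where "T c n = (\<Sum>k. ?H (R (2 * (k + n) + c)))" for c n
  have tail: "?H (A - F) \<le> ?H (S (2 * n)) + (T 0 n + T 1 n)" for n
  proof -
    have "A - F \<subseteq> S (2 * n) \<union> ((\<Union>k. R (2 * (k + n) + 0)) \<union> (\<Union>k. R (2 * (k + n) + 1)))"
    proof
      fix x assume x: "x \<in> A - F"
      show "x \<in> S (2 * n) \<union> ((\<Union>k. R (2 * (k + n) + 0)) \<union> (\<Union>k. R (2 * (k + n) + 1)))"
      proof (cases "1 / real (Suc (2 * n)) \<le> infdist x F")
        case True
        then show ?thesis using x by (simp add: S_def)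
      next
        case far: False
        let ?P = "\<lambda>k. 1 / real (Suc (Suc k)) \<le> infdist x F"
        have "infdist x F > 0" using infdist_pos_not_in_closed[OF F ne] x by blast
        then obtain N where "1 / real (Suc N) < infdist x F"
          using nat_approx_posE by blast
        moreover have "1 / real (Suc (Suc N)) \<le> 1 / real (Suc N)" by (intro frac_le) auto
        ultimately have "?P N" by linarith
        define k where "k = (LEAST k. ?P k)"
        have Pk: "?P k" unfolding k_def using \<open>?P N\<close> by (rule LeastI)
        have kn: "2 * n \<le> k"
        proof (rule ccontr)
          assume "\<not> 2 * n \<le> k"
          then have "1 / real (Suc (2 * n)) \<le> 1 / real (Suc (Suc k))" by (intro frac_le) auto
          with Pk far show False by linarith
        qed
        have "infdist x F < 1 / real (Suc k)"
        proof (cases k)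
          case 0
          then show ?thesis using kn far by auto
        next
          case (Suc j)
          then have "\<not> ?P j" using not_less_Least[of j ?P] by (simp add: k_def)
          then show ?thesis using Suc by simp
        qed
        then have xR: "x \<in> R k" using x Pk by (simp add: R_def)
        have "k = 2 * ((k div 2 - n) + n) + 0 \<or> k = 2 * ((k div 2 - n) + n) + 1"
          using kn by presburger
        then show ?thesis using xR by (metis UnCI UN_I UNIV_I)
      qed
    qed
    then have "?H (A - F) \<le>
        ?H (S (2 * n) \<union> ((\<Union>k. R (2 * (k + n) + 0)) \<union> (\<Union>k. R (2 * (k + n) + 1))))"
      by (rule hausdorff_outer_mono)
    also have "\<dots> \<le> ?H (S (2 * n)) + (?H (\<Union>k. R (2 * (k + n) + 0)) + ?H (\<Union>k. R (2 * (k + n) + 1)))"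
      by (meson add_left_mono hausdorff_outer_subadditive order_trans)
    also have "\<dots> \<le> ?H (S (2 * n)) + (T 0 n + T 1 n)"
      unfolding T_def by (intro add_mono hausdorff_outer_countably_subadditive order_refl)
    finally show ?thesis .
  qed
  have T_lim: "T c \<longlonglongrightarrow> 0" for c
  proof -
    let ?f = "\<lambda>k. ?H (R (2 * k + c))"
    have total: "suminf ?f < top" using sum_fin[of c] fin by (rule le_less_trans)
    have split: "suminf ?f = T c n + (\<Sum>k<n. ?f k)" for n
      using suminf_offset[of ?f n] by (simp add: T_def)
    have "(\<Sum>k<n. ?f k) < top" for n
      using total split[of n] by (metis ennreal_add_eq_top less_top)
    then have "T c n = suminf ?f - (\<Sum>k<n. ?f k)" for n
      using split[of n] by (simp add: less_top)
    then have "T c = (\<lambda>n. suminf ?f - (\<Sum>k<n. ?f k))" by (intro ext)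
    moreover have "(\<lambda>n. suminf ?f - (\<Sum>k<n. ?f k)) \<longlonglongrightarrow> suminf ?f - suminf ?f"
      using total by (intro tendsto_diff_ennreal summable_LIMSEQ tendsto_const) auto
    ultimately show ?thesis using total by (simp add: less_top)
  qed
  have "(\<lambda>n. ?H A + (T 0 n + T 1 n)) \<longlonglongrightarrow> ?H A + (0 + 0)"
    by (intro tendsto_add tendsto_const T_lim)
  moreover have "?H (A \<inter> F) + ?H (A - F) \<le> ?H A + (T 0 n + T 1 n)" for n
  proof -
    have "?H (A \<inter> F) + ?H (A - F) \<le> (?H (A \<inter> F) + ?H (S (2 * n))) + (T 0 n + T 1 n)"
      using add_left_mono[OF tail[of n], of "?H (A \<inter> F)"] by (simp add: add.assoc)
    also have "\<dots> \<le> ?H A + (T 0 n + T 1 n)" by (intro add_right_mono S_sep)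
    finally show ?thesis .
  qed
  ultimately show ?thesis
    by (intro LIMSEQ_le_const[of _ "?H A"]) auto
qed

lemma sets_borel_subset_lambda_system:
  "sets borel \<subseteq> lambda_system UNIV (Pow UNIV) (hausdorff_outer m :: 'a::metric_space set \<Rightarrow> ennreal)"
proof -
  let ?L = "lambda_system UNIV (Pow UNIV) (hausdorff_outer m :: 'a set \<Rightarrow> ennreal)"
  have sig: "sigma_algebra UNIV ?L"
    using sigma_algebra.caratheodory_lemma[OF sigma_algebra_Pow outer_measure_space_hausdorff[of m]]
    by (auto simp: measure_space_def)
  have "F \<in> ?L" if "closed F" for F :: "'a set"
  proof -
    have "hausdorff_outer m (x \<inter> F) + hausdorff_outer m (x - F) = hausdorff_outer m x" for x
    proof (rule antisym)
      have "hausdorff_outer m ((x \<inter> F) \<union> (x - F)) \<le> hausdorff_outer m (x \<inter> F) + hausdorff_outer m (x - F)"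
        by (rule hausdorff_outer_subadditive)
      then show "hausdorff_outer m x \<le> hausdorff_outer m (x \<inter> F) + hausdorff_outer m (x - F)"
        by (simp add: Int_Diff_Un)
    qed (rule hausdorff_outer_closed_split[OF that])
    then show ?thesis
      unfolding algebra.lambda_system_eq[OF algebra_Pow] by simp
  qed
  then have "sigma_sets UNIV (Collect closed) \<subseteq> ?L"
    by (intro sigma_algebra.sigma_sets_subset[OF sig]) auto
  then show ?thesis
    by (simp add: borel_eq_closed)
qed

theorem emeasure_hausdorff:
  assumes "A \<in> sets borel"
  shows "emeasure (hausdorff m) A = hausdorff_outer m A"
proof -
  have "measure_space UNIV (sets borel) (hausdorff_outer m :: 'a set \<Rightarrow> ennreal)"
    using measure_down[OF sigma_algebra.caratheodory_lemma[OF sigma_algebra_Pow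
        outer_measure_space_hausdorff] _ sets_borel_subset_lambda_system]
      sets.sigma_algebra_axioms[of borel] by simp
  then show ?thesis
    unfolding hausdorff_def using assms
    by (intro emeasure_measure_of_sigma) (auto simp: measure_space_def)
qed

section \<open>Rectifiability\<close>

text \<open>\<open>\<real>\<^sup>m\<close> is the carrier of the library's \<^const>\<open>Euclidean_space\<close>, i.e. the
  sequences vanishing from index \<open>m\<close> on, with the Euclidean distance \<^const>\<open>L2_set\<close> of the
  coordinate differences.\<close>

definition lipschitz_map :: "nat \<Rightarrow> ((nat \<Rightarrow> real) \<Rightarrow> 'a::metric_space) \<Rightarrow> bool" where
  "lipschitz_map m f \<longleftrightarrow>
     (\<exists>L. \<forall>x\<in>topspace (Euclidean_space m). \<forall>y\<in>topspace (Euclidean_space m).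
        dist (f x) (f y) \<le> L * L2_set (\<lambda>k. x k - y k) {..<m})"

definition rectifiable :: "nat \<Rightarrow> 'a::metric_space set \<Rightarrow> bool" where
  "rectifiable m A \<longleftrightarrow>
     (\<exists>f :: nat \<Rightarrow> (nat \<Rightarrow> real) \<Rightarrow> 'a. (\<forall>i. lipschitz_map m (f i)) \<and>
        hausdorff_outer m (A - (\<Union>i. f i ` topspace (Euclidean_space m))) = 0)"

definition purely_unrectifiable :: "nat \<Rightarrow> 'a::metric_space set \<Rightarrow> bool" where
  "purely_unrectifiable m B \<longleftrightarrow> (\<forall>A. rectifiable m A \<longrightarrow> hausdorff_outer m (B \<inter> A) = 0)"

section \<open>Measures of given dimension\<close>

definition measure_support :: "'a::metric_space measure \<Rightarrow> 'a set" where
  "measure_support \<mu> = {x. \<forall>r>0. 0 < emeasure \<mu> (ball x r)}"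

definition has_growth :: "nat \<Rightarrow> 'a::metric_space measure \<Rightarrow> bool" where
  "has_growth m \<mu> \<longleftrightarrow> (\<exists>C>0. \<forall>x. \<forall>r>0. emeasure \<mu> (ball x r) \<le> ennreal (C * r ^ m))"

definition dimensional_measure :: "nat \<Rightarrow> 'a::metric_space measure \<Rightarrow> bool" where
  "dimensional_measure m \<mu> \<longleftrightarrow>
     sets \<mu> = sets borel \<and> hausdorff_outer m (measure_support \<mu>) < \<infinity> \<and> has_growth m \<mu>"

section \<open>Kernels and potentials\<close>

definition holder_continuous_on :: "'a::metric_space set \<Rightarrow> ('a \<Rightarrow> 'b::metric_space) \<Rightarrow> bool" where
  "holder_continuous_on S f \<longleftrightarrow>
     (\<exists>\<alpha> C. 0 < \<alpha> \<and> \<alpha> \<le> 1 \<and> (\<forall>x\<in>S. \<forall>y\<in>S. dist (f x) (f y) \<le> C * dist x y powr \<alpha>))"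

text \<open>Only the values of \<open>\<Omega>\<close> on the unit sphere matter: for \<open>m > 0\<close> the kernel is
  \<open>0\<close> at the origin, by \<open>x / 0 = 0\<close>.\<close>

definition homogeneous_kernel :: "nat \<Rightarrow> ('a::real_normed_vector \<Rightarrow> real) \<Rightarrow> 'a \<Rightarrow> real" where
  "homogeneous_kernel m \<Omega> z = \<Omega> (z /\<^sub>R norm z) / norm z ^ m"

definition potential ::
    "nat \<Rightarrow> ('a::real_normed_vector \<Rightarrow> real) \<Rightarrow> 'a measure \<Rightarrow> 'a \<Rightarrow> real" where
  "potential m \<Omega> \<mu> x = (LINT y|\<mu>. homogeneous_kernel m \<Omega> (x - y))"

definition truncated_potential ::
    "nat \<Rightarrow> ('a::real_normed_vector \<Rightarrow> real) \<Rightarrow> 'a measure \<Rightarrow> real \<Rightarrow> 'a \<Rightarrow> real" where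
  "truncated_potential m \<Omega> \<mu> \<epsilon> x =
     (LINT y:{y. \<epsilon> < norm (x - y)}|\<mu>. homogeneous_kernel m \<Omega> (x - y))"

definition essentially_bounded :: "'a measure \<Rightarrow> ('a \<Rightarrow> real) \<Rightarrow> bool" where
  "essentially_bounded M f \<longleftrightarrow> f \<in> borel_measurable M \<and> (\<exists>C. AE x in M. \<bar>f x\<bar> \<le> C)"

definition sphere_integral :: "(real ^ 'n \<Rightarrow> real) \<Rightarrow> real" where
  "sphere_integral f = (LINT \<xi>:sphere 0 1|hausdorff (CARD('n) - 1). f \<xi>)"

end

theory Submission
  imports Defs
begin

text \<open>
  Averaging the kernel over a ball makes it explicit.  For \<open>norm u \<le> 1\<close> the potential of Lebesgue
  measure on the unit ball at \<open>u\<close> is \<open>d\<close> times the integral of \<open>\<Omega> \<xi> * (u \<bullet> \<xi>)\<^sup>2\<close> over directions: in polar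
  coordinates at \<open>u\<close> each direction contributes half its squared chord length, the squared chords
  in the directions \<open>\<xi>\<close> and \<open>-\<xi>\<close> add up to \<open>4 * (u \<bullet> \<xi>)\<^sup>2 + 2 * (1 - (norm u)\<^sup>2)\<close>, and \<open>\<Omega>\<close> is even with
  mean zero.  So this potential is a quadratic form in \<open>u\<close>, which vanishes iff all second moments do.

  The measure is the law of \<open>\<Sum>k. r k *\<^sub>R \<omega> k\<close> with independent \<open>\<omega> k\<close>, uniform on the centres of a fine
  cubic grid filling the unit ball up to a small volume: a ball of radius \<open>r k\<close> is replaced by
  \<open>card (A k)\<close> balls of the much smaller radius \<open>r (Suc k)\<close> preserving total \<open>m\<close>-dimensional content,
  \<open>m = d - 2\<close>.  By Hoelder continuity a generation looks like Lebesgue measure on its ball up to a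
  summable error, so the potential is a sum of values of the quadratic form at the normalised
  positions of the point in its successive balls, plus a bounded term.  If the form is nonzero,
  points placed in a region of constant sign at every generation make the sum diverge.

  Balls of one generation are much smaller than the gaps between them, so a Lipschitz image of
  \<open>\<real>\<^sup>m\<close> meets only a negligible part of the limit set.  If \<open>\<Omega> e \<noteq> 0\<close>, almost every point is infinitely often
  near \<open>e / 2\<close> in the normalised ball; truncating there at radius slightly below \<open>3 / 2\<close> isolates a cap
  seen only in directions close to \<open>e\<close>, and hence moves the truncated integral by a fixed amount.
\<close>

section \<open>Polar coordinates\<close>

text \<open>\<open>E\<close> and \<mu> must serve every \<Omega> and every Hoelder exponent at once,
  so no constant of the construction may depend on \<Omega>. The accuracy of generation
  \<open>k\<close> is fixed in advance as \<open>\<delta> k = \<delta>0 * (1 / 2) ^ k\<close>;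
  replacing sums by integrals there costs a multiple of \<open>\<delta> k powr \<alpha>\<close>,
  which is summable for each \<alpha> > 0. The codimension 2 enters twice. The kernel
  \<open>1 / t ^ m\<close> against the polar density \<open>t ^ (m + 1)\<close> leaves
  \<open>t\<close>, whose integral along a chord is half its square. And preserving content forces
  radii that become as small as desired relative to the mesh of a fine grid; this ratio is what
  makes Lipschitz images negligible. The directional integrals of the statement are taken in
  Hausdorff measure, while polar coordinates deliver the image of Lebesgue measure on the ball under
  \<open>sgn\<close>. The two are shown proportional by comparing masses of balls centred on the
  sphere, which are equal by rotation invariance; no parametrisation of the sphere enters.\<close>

lemma borel_measurable_sgn_vec [measurable]:
  "(sgn :: 'a::euclidean_space \<Rightarrow> 'a) \<in> borel_measurable borel"
  unfolding sgn_div_norm by measurable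

lemma cball_sets_borel [measurable]: "cball (a::'a::metric_space) r \<in> sets borel"
  by simp

lemma pred_in_atMost [measurable (raw)]:
  fixes f g :: "_ \<Rightarrow> real"
  assumes [measurable]: "f \<in> borel_measurable M" "g \<in> borel_measurable M"
  shows "Measurable.pred M (\<lambda>x. f x \<in> {..g x})"
  unfolding atMost_iff by measurable

lemma lborel_pair_sigma_finite:
  "pair_sigma_finite (lborel :: 'a::euclidean_space measure) (lborel :: 'b::euclidean_space measure)"
  by (simp add: pair_sigma_finite_def lborel.sigma_finite_measure_axioms)

lemma nn_integral_lborel_affine:
  fixes f :: "'a::euclidean_space \<Rightarrow> ennreal"
  assumes [measurable]: "f \<in> borel_measurable borel" and "c \<noteq> 0"
  shows "(\<integral>\<^sup>+x. f x \<partial>lborel) = ennreal (\<bar>c\<bar> ^ DIM('a)) * (\<integral>\<^sup>+x. f (t + c *\<^sub>R x) \<partial>lborel)"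
  by (subst lborel_affine[OF assms(2), of t])
     (simp add: nn_integral_density nn_integral_distr nn_integral_cmult)

text \<open>Normalises polar coordinates: with \<open>n = d\<close> and \<open>a = norm y\<close>
  this integral times \<open>norm y ^ d\<close> is 1.\<close>

lemma nn_integral_tail_power:
  fixes a :: real and n :: nat
  assumes "a > 0" "n > 0"
  shows "(\<integral>\<^sup>+s. ennreal (real n / s ^ Suc n) * indicator {a..} s \<partial>lborel) = ennreal (1 / a ^ n)"
proof -
  have "(\<integral>\<^sup>+s. ennreal (real n / s ^ Suc n) * indicator {a..} s \<partial>lborel) = ennreal (0 - (- (1 / a ^ n)))"
  proof (rule nn_integral_FTC_atLeast)
    show "((\<lambda>s::real. - (1 / s ^ n)) \<longlongrightarrow> 0) at_top"
    proof -
      have "((\<lambda>s::real. 1 / s ^ n) \<longlongrightarrow> 0) at_top"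
        using \<open>n > 0\<close> by (intro tendsto_divide_0[OF tendsto_const] filterlim_at_top_imp_at_infinity
            filterlim_pow_at_top filterlim_ident)
      from tendsto_minus[OF this] show ?thesis by simp
    qed
    fix x :: real assume x: "a \<le> x"
    then have "x > 0" using assms by simp
    show "((\<lambda>s::real. - (1 / s ^ n)) has_real_derivative real n / x ^ Suc n) (at x)"
      using \<open>x > 0\<close> \<open>n > 0\<close>
      by (auto intro!: derivative_eq_intros simp: power_Suc[symmetric] field_simps power_add[symmetric]
          simp del: power_Suc)
    show "0 \<le> real n / x ^ Suc n" using \<open>x > 0\<close> by simp
  qed simp_all
  then show ?thesis by simp
qed

(* Polar coordinates without a surface measure: the direction is sampled by the cone
   measure z |-> sgn z on the unit ball; Fubini after the substitution t = s * norm z. *)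
lemma nn_integral_polar:
  fixes F :: "'a::euclidean_space \<Rightarrow> ennreal"
  assumes [measurable]: "F \<in> borel_measurable borel"
  defines "d \<equiv> DIM('a)"
  shows "(\<integral>\<^sup>+z. F z \<partial>lborel) =
    (\<integral>\<^sup>+z. indicator (cball 0 1) z *
       (\<integral>\<^sup>+t. indicator {0<..} t * ennreal (real d * t ^ (d - 1)) * F (t *\<^sub>R sgn z) \<partial>lborel) \<partial>lborel)"
proof -
  have d: "d > 0" by (simp add: d_def)
  have nz: "AE z in lborel. z \<noteq> (0::'a)" by (rule AE_lborel_singleton)
  define w where "w s = indicator {0<..} s * ennreal (real d * s ^ (d - 1))" for s :: real
  have [measurable]: "w \<in> borel_measurable borel" unfolding w_def by measurable
  have inner: "(\<integral>\<^sup>+t. w t * F (t *\<^sub>R sgn z) \<partial>lborel)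
       = (\<integral>\<^sup>+s. w s * ennreal (norm z ^ d) * F (s *\<^sub>R z) \<partial>lborel)" if "z \<noteq> 0" for z :: 'a
  proof -
    have "(\<integral>\<^sup>+t. w t * F (t *\<^sub>R sgn z) \<partial>lborel)
        = ennreal \<bar>norm z\<bar> * (\<integral>\<^sup>+s. w (0 + norm z * s) * F ((0 + norm z * s) *\<^sub>R sgn z) \<partial>lborel)"
      by (rule nn_integral_real_affine) (use that in \<open>simp_all\<close>)
    also have "\<dots> = (\<integral>\<^sup>+s. ennreal (norm z) * (w (norm z * s) * F (s *\<^sub>R z)) \<partial>lborel)"
      by (subst nn_integral_cmult[symmetric]) (use that in \<open>simp_all add: sgn_div_norm ac_simps\<close>)
    also have "\<dots> = (\<integral>\<^sup>+s. w s * ennreal (norm z ^ d) * F (s *\<^sub>R z) \<partial>lborel)"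
    proof (intro nn_integral_cong)
      fix s :: real
      have "ennreal (norm z) * w (norm z * s) = w s * ennreal (norm z ^ d)"
      proof (cases "s > 0")
        case True
        have "norm z * (real d * (norm z * s) ^ (d - 1)) = real d * s ^ (d - 1) * norm z ^ d"
          using d by (cases d) (simp_all add: power_mult_distrib)
        then show ?thesis using True that
          by (simp add: w_def ennreal_mult'[symmetric])
      next
        case False
        then have "\<not> 0 < norm z * s" by (simp add: zero_less_mult_iff)
        then show ?thesis using False by (simp add: w_def)
      qed
      then show "ennreal (norm z) * (w (norm z * s) * F (s *\<^sub>R z)) = w s * ennreal (norm z ^ d) * F (s *\<^sub>R z)"
        by (metis mult.assoc)
    qed
    finally show ?thesis .
  qed
  \<comment> \<open>The substitution \<open>y = s *\<^sub>R z\<close> turns the cone condition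
    \<open>norm z \<le> 1\<close> into \<open>norm y \<le> s\<close>; after the second use of Fubini
    \<open>s\<close> runs over \<open>{norm y..}\<close> and contributes total weight 1.\<close>
  have scale: "(\<integral>\<^sup>+z. indicator (cball 0 1) z * (ennreal (norm z ^ d) * F (s *\<^sub>R z)) \<partial>lborel)
      = ennreal (1 / s ^ d) * (\<integral>\<^sup>+y. indicator {..s} (norm y) * ennreal (norm y ^ d / s ^ d) * F y \<partial>lborel)"
    if s: "s > 0" for s
  proof -
    define H where "H y = indicator {..s} (norm y) * ennreal (norm y ^ d / s ^ d) * F y" for y :: 'a
    have [measurable]: "H \<in> borel_measurable borel" unfolding H_def by measurable
    have "(\<integral>\<^sup>+y. H y \<partial>lborel) = ennreal (s ^ d) * (\<integral>\<^sup>+z. H (0 + s *\<^sub>R z) \<partial>lborel)"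
      using nn_integral_lborel_affine[of H s 0] s by (simp add: d_def)
    also have "(\<integral>\<^sup>+z. H (0 + s *\<^sub>R z) \<partial>lborel)
        = (\<integral>\<^sup>+z. indicator (cball 0 1) z * (ennreal (norm z ^ d) * F (s *\<^sub>R z)) \<partial>lborel)"
      using s by (intro nn_integral_cong) (auto simp: H_def indicator_def power_mult_distrib)
    finally have *: "(\<integral>\<^sup>+y. H y \<partial>lborel) = ennreal (s ^ d) * \<dots>" .
    show ?thesis unfolding H_def[symmetric] * using s
      by (simp add: mult.assoc[symmetric] ennreal_mult'[symmetric])
  qed
  have "(\<integral>\<^sup>+z. indicator (cball 0 1) z * (\<integral>\<^sup>+t. w t * F (t *\<^sub>R sgn z) \<partial>lborel) \<partial>lborel)
      = (\<integral>\<^sup>+z. indicator (cball 0 1) z * (\<integral>\<^sup>+s. w s * ennreal (norm z ^ d) * F (s *\<^sub>R z) \<partial>lborel) \<partial>lborel)"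
    by (rule nn_integral_cong_AE) (use nz in eventually_elim, simp add: inner)
  also have "\<dots> = (\<integral>\<^sup>+z. (\<integral>\<^sup>+s. indicator (cball 0 1) z * (w s * ennreal (norm z ^ d) * F (s *\<^sub>R z)) \<partial>lborel) \<partial>(lborel::'a measure))"
    by (intro nn_integral_cong nn_integral_cmult[symmetric]) measurable
  also have "\<dots> = (\<integral>\<^sup>+s. (\<integral>\<^sup>+z. indicator (cball 0 1) z * (w s * ennreal (norm z ^ d) * F (s *\<^sub>R z)) \<partial>(lborel::'a measure)) \<partial>lborel)"
    by (rule pair_sigma_finite.Fubini'[OF lborel_pair_sigma_finite]) measurable
  also have "\<dots> = (\<integral>\<^sup>+s. (\<integral>\<^sup>+y. w s * ennreal (1 / s ^ d) * (indicator {..s} (norm y) * ennreal (norm y ^ d / s ^ d) * F y) \<partial>(lborel::'a measure)) \<partial>lborel)"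
  proof (rule nn_integral_cong)
    fix s :: real
    show "(\<integral>\<^sup>+z. indicator (cball 0 1) z * (w s * ennreal (norm z ^ d) * F (s *\<^sub>R z)) \<partial>(lborel::'a measure))
      = (\<integral>\<^sup>+y. w s * ennreal (1 / s ^ d) * (indicator {..s} (norm y) * ennreal (norm y ^ d / s ^ d) * F y) \<partial>lborel)"
    proof (cases "s > 0")
      case True
      have "(\<integral>\<^sup>+z. indicator (cball 0 1) z * (w s * ennreal (norm z ^ d) * F (s *\<^sub>R z)) \<partial>(lborel::'a measure))
          = w s * (\<integral>\<^sup>+z. indicator (cball 0 1) z * (ennreal (norm z ^ d) * F (s *\<^sub>R z)) \<partial>(lborel::'a measure))"
        by (subst nn_integral_cmult[symmetric]) (simp_all add: ac_simps)
      then show ?thesis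
        unfolding scale[OF True] by (subst nn_integral_cmult) (simp_all add: ac_simps)
    qed (simp add: w_def)
  qed
  also have "\<dots> = (\<integral>\<^sup>+y. (\<integral>\<^sup>+s. w s * ennreal (1 / s ^ d) * (indicator {..s} (norm y) * ennreal (norm y ^ d / s ^ d) * F y) \<partial>lborel) \<partial>(lborel::'a measure))"
    by (rule pair_sigma_finite.Fubini'[OF lborel_pair_sigma_finite]) measurable
  also have "\<dots> = (\<integral>\<^sup>+y. F y \<partial>lborel)"
  proof (rule nn_integral_cong_AE, use nz in eventually_elim)
    fix y :: 'a assume y: "y \<noteq> 0"
    have "(\<integral>\<^sup>+s. w s * ennreal (1 / s ^ d) * (indicator {..s} (norm y) * ennreal (norm y ^ d / s ^ d) * F y) \<partial>lborel)
       = (\<integral>\<^sup>+s. (ennreal (norm y ^ d) * F y) * (ennreal (real d / s ^ Suc d) * indicator {norm y..} s) \<partial>lborel)"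
    proof (intro nn_integral_cong)
      fix s :: real
      show "w s * ennreal (1 / s ^ d) * (indicator {..s} (norm y) * ennreal (norm y ^ d / s ^ d) * F y)
        = (ennreal (norm y ^ d) * F y) * (ennreal (real d / s ^ Suc d) * indicator {norm y..} s)"
      proof (cases "norm y \<le> s")
        case True
        moreover have "norm y > 0" using y by simp
        ultimately have s: "s > 0" by linarith
        have "s ^ d = s * s ^ (d - 1)" using d by (cases d) simp_all
        then have e: "real d * s ^ (d - 1) * (1 / s ^ d) * (norm y ^ d / s ^ d) = norm y ^ d * (real d / s ^ Suc d)"
          using s by (simp add: field_simps)
        have "w s * ennreal (1 / s ^ d) * ennreal (norm y ^ d / s ^ d)
            = ennreal (real d * s ^ (d - 1) * (1 / s ^ d) * (norm y ^ d / s ^ d))"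
          unfolding w_def using s by (subst ennreal_mult, simp, simp)+ simp
        also have "\<dots> = ennreal (norm y ^ d) * ennreal (real d / s ^ Suc d)"
          unfolding e using s by (intro ennreal_mult) simp_all
        finally have "w s * ennreal (1 / s ^ d) * ennreal (norm y ^ d / s ^ d)
            = ennreal (norm y ^ d) * ennreal (real d / s ^ Suc d)" .
        then show ?thesis using True by (simp add: mult.assoc[symmetric]) (simp add: mult.assoc mult.commute[of "F y"])
      qed simp
    qed
    also have "\<dots> = ennreal (norm y ^ d) * F y * ennreal (1 / norm y ^ d)"
      using y d by (subst nn_integral_cmult) (simp_all add: nn_integral_tail_power del: power_Suc)
    also have "\<dots> = F y * (ennreal (norm y ^ d) * ennreal (1 / norm y ^ d))" by (simp add: ac_simps)
    also have "\<dots> = F y" using y by (simp add: ennreal_mult'[symmetric])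
    finally show "(\<integral>\<^sup>+s. w s * ennreal (1 / s ^ d) * (indicator {..s} (norm y) * ennreal (norm y ^ d / s ^ d) * F y) \<partial>lborel) = F y" .
  qed
  finally show ?thesis by (simp add: w_def mult.assoc)
qed

lemma nn_integral_interval_const:
  "0 \<le> r \<Longrightarrow> 0 \<le> c \<Longrightarrow> (\<integral>\<^sup>+t. ennreal c * indicator {0..r} t \<partial>(lborel::real measure)) = ennreal (c * r)"
  by (subst nn_integral_cmult_indicator) (simp_all add: ennreal_mult)

lemma nn_integral_interval_linear:
  assumes "0 \<le> r" "0 \<le> c"
  shows "(\<integral>\<^sup>+t. ennreal (c * t) * indicator {0..r} t \<partial>(lborel::real measure)) = ennreal (c * r\<^sup>2 / 2)"
proof -
  have "(\<integral>\<^sup>+t. ennreal (c * t) * indicator {0..r} t \<partial>(lborel::real measure)) = ennreal (c * r\<^sup>2 / 2 - c * 0\<^sup>2 / 2)"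
    by (rule nn_integral_FTC_Icc) (use assms in \<open>auto intro!: derivative_eq_intros\<close>)
  then show ?thesis by simp
qed

text \<open>In dimension \<open>m + 2\<close> the radial integrand is linear for the exponent
  \<open>m\<close> of the kernel and constant for \<open>m + 1\<close>, the exponent that will
  control differences of the kernel. Both singularities are integrable.\<close>

lemma nn_integral_inverse_power_cball:
  assumes "R \<ge> 0" and d: "DIM('a::euclidean_space) = Suc (Suc m)"
  shows "(\<integral>\<^sup>+z. ennreal (1 / norm (z::'a) ^ m) * indicator (cball 0 R) z \<partial>lborel)
      = ennreal (real DIM('a) * R\<^sup>2 / 2) * emeasure lborel (cball (0::'a) 1)"
    and "(\<integral>\<^sup>+z. ennreal (1 / norm (z::'a) ^ Suc m) * indicator (cball 0 R) z \<partial>lborel)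
      = ennreal (real DIM('a) * R) * emeasure lborel (cball (0::'a) 1)"
proof -
  have nz: "AE z in lborel. z \<noteq> (0::'a)" by (rule AE_lborel_singleton)
  have eq: "(\<integral>\<^sup>+z. ennreal (1 / norm (z::'a) ^ p) * indicator (cball 0 R) z \<partial>lborel)
     = (\<integral>\<^sup>+t. ennreal (real DIM('a) * (t ^ Suc m / t ^ p)) * indicator {0..R} t \<partial>lborel) * emeasure lborel (cball (0::'a) 1)" for p
  proof -
    have "(\<integral>\<^sup>+z. ennreal (1 / norm (z::'a) ^ p) * indicator (cball 0 R) z \<partial>lborel) =
      (\<integral>\<^sup>+z. indicator (cball 0 1) z * (\<integral>\<^sup>+t. indicator {0<..} t * ennreal (real DIM('a) * t ^ (DIM('a) - 1)) *
         (ennreal (1 / norm (t *\<^sub>R sgn z::'a) ^ p) * indicator (cball 0 R) (t *\<^sub>R sgn z)) \<partial>lborel) \<partial>lborel)"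
      by (rule nn_integral_polar) measurable
    also have "\<dots> = (\<integral>\<^sup>+z. (\<integral>\<^sup>+t. ennreal (real DIM('a) * (t ^ Suc m / t ^ p)) * indicator {0..R} t \<partial>lborel) * indicator (cball (0::'a) 1) z \<partial>lborel)"
    proof (rule nn_integral_cong_AE, use nz in eventually_elim)
      fix z :: 'a assume z: "z \<noteq> 0"
      have "(\<integral>\<^sup>+t. indicator {0<..} t * ennreal (real DIM('a) * t ^ (DIM('a) - 1)) *
         (ennreal (1 / norm (t *\<^sub>R sgn z::'a) ^ p) * indicator (cball 0 R) (t *\<^sub>R sgn z)) \<partial>lborel)
        = (\<integral>\<^sup>+t. ennreal (real DIM('a) * (t ^ Suc m / t ^ p)) * indicator {0..R} t \<partial>lborel)"
      proof (rule nn_integral_cong_AE, use AE_lborel_singleton[of 0] in eventually_elim)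
        fix t :: real assume "t \<noteq> 0"
        then show "indicator {0<..} t * ennreal (real DIM('a) * t ^ (DIM('a) - 1)) *
         (ennreal (1 / norm (t *\<^sub>R sgn z::'a) ^ p) * indicator (cball 0 R) (t *\<^sub>R sgn z))
         = ennreal (real DIM('a) * (t ^ Suc m / t ^ p)) * indicator {0..R} t"
          using z by (auto simp: indicator_def norm_sgn d ennreal_mult'[symmetric])
      qed
      then show "indicator (cball 0 1) z * (\<integral>\<^sup>+t. indicator {0<..} t * ennreal (real DIM('a) * t ^ (DIM('a) - 1)) *
         (ennreal (1 / norm (t *\<^sub>R sgn z::'a) ^ p) * indicator (cball 0 R) (t *\<^sub>R sgn z)) \<partial>lborel)
         = (\<integral>\<^sup>+t. ennreal (real DIM('a) * (t ^ Suc m / t ^ p)) * indicator {0..R} t \<partial>lborel) * indicator (cball (0::'a) 1) z"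
        by (simp add: mult.commute)
    qed
    also have "\<dots> = (\<integral>\<^sup>+t. ennreal (real DIM('a) * (t ^ Suc m / t ^ p)) * indicator {0..R} t \<partial>lborel) * emeasure lborel (cball (0::'a) 1)"
      by (rule nn_integral_cmult_indicator) simp
    finally show ?thesis .
  qed
  have "(\<integral>\<^sup>+t. ennreal (real DIM('a) * (t ^ Suc m / t ^ m)) * indicator {0..R} t \<partial>lborel)
     = (\<integral>\<^sup>+t. ennreal (real DIM('a) * t) * indicator {0..R} t \<partial>lborel)"
    by (rule nn_integral_cong_AE, use AE_lborel_singleton[of 0] in eventually_elim) simp
  then show "(\<integral>\<^sup>+z. ennreal (1 / norm (z::'a) ^ m) * indicator (cball 0 R) z \<partial>lborel)
      = ennreal (real DIM('a) * R\<^sup>2 / 2) * emeasure lborel (cball (0::'a) 1)"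
    unfolding eq using assms by (simp add: nn_integral_interval_linear)
  have "(\<integral>\<^sup>+t. ennreal (real DIM('a) * (t ^ Suc m / t ^ Suc m)) * indicator {0..R} t \<partial>lborel)
     = (\<integral>\<^sup>+t. ennreal (real DIM('a)) * indicator {0..R} t \<partial>lborel)"
    by (rule nn_integral_cong_AE, use AE_lborel_singleton[of 0] in eventually_elim) simp
  then show "(\<integral>\<^sup>+z. ennreal (1 / norm (z::'a) ^ Suc m) * indicator (cball 0 R) z \<partial>lborel)
      = ennreal (real DIM('a) * R) * emeasure lborel (cball (0::'a) 1)"
    unfolding eq using assms by (simp only: nn_integral_interval_const)
qed


section \<open>Chords of the unit ball and the potential of its Lebesgue measure\<close>

definition chord :: "'a::real_inner \<Rightarrow> 'a \<Rightarrow> real" where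
  "chord u \<xi> = u \<bullet> \<xi> + sqrt ((u \<bullet> \<xi>)\<^sup>2 + 1 - (norm u)\<^sup>2)"

lemma chord_nonneg:
  assumes "norm u \<le> 1" shows "0 \<le> chord u \<xi>"
proof -
  have "\<bar>u \<bullet> \<xi>\<bar> \<le> sqrt ((u \<bullet> \<xi>)\<^sup>2 + 1 - (norm u)\<^sup>2)"
    using assms by (intro real_le_rsqrt) (simp add: abs_square_le_1)
  then show ?thesis by (simp add: chord_def)
qed

text \<open>Completing the square in \<open>t\<close> gives two roots, of which
  \<open>chord u \<xi>\<close> is the larger. As \<open>norm u \<le> 1\<close>, the smaller one is
  at most 0 and imposes nothing on \<open>t \<ge> 0\<close>.\<close>

lemma in_unit_ball_iff_chord:
  fixes u \<xi> :: "'a::real_inner"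
  assumes u: "norm u \<le> 1" and \<xi>: "norm \<xi> = 1" and t: "t \<ge> 0"
  shows "norm (u - t *\<^sub>R \<xi>) \<le> 1 \<longleftrightarrow> t \<le> chord u \<xi>"
proof -
  let ?D = "(u \<bullet> \<xi>)\<^sup>2 + 1 - (norm u)\<^sup>2"
  have uu: "(norm u)\<^sup>2 \<le> 1" using u by (simp add: abs_square_le_1)
  then have D: "?D \<ge> 0" by (smt (verit) zero_le_power2)
  have xx: "\<xi> \<bullet> \<xi> = 1" using \<xi> by (simp add: norm_eq_1)
  have "(norm (u - t *\<^sub>R \<xi>))\<^sup>2 = (norm u)\<^sup>2 - 2 * t * (u \<bullet> \<xi>) + t\<^sup>2"
    unfolding power2_norm_eq_inner using xx
    by (simp add: inner_diff_left inner_diff_right inner_commute power2_eq_square)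
  also have "\<dots> = (t - u \<bullet> \<xi>)\<^sup>2 - ?D + 1" by (simp add: power2_eq_square algebra_simps)
  finally have e: "(norm (u - t *\<^sub>R \<xi>))\<^sup>2 = (t - u \<bullet> \<xi>)\<^sup>2 - ?D + 1" .
  have "norm (u - t *\<^sub>R \<xi>) \<le> 1 \<longleftrightarrow> (norm (u - t *\<^sub>R \<xi>))\<^sup>2 \<le> 1"
    by (simp add: abs_square_le_1)
  also have "\<dots> \<longleftrightarrow> (t - u \<bullet> \<xi>)\<^sup>2 \<le> ?D" unfolding e by linarith
  also have "\<dots> \<longleftrightarrow> \<bar>t - u \<bullet> \<xi>\<bar> \<le> sqrt ?D"
    using D by (metis abs_ge_zero power2_abs real_le_rsqrt real_sqrt_abs real_sqrt_le_iff)
  also have "\<dots> \<longleftrightarrow> t \<le> chord u \<xi>"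
  proof -
    have "\<bar>u \<bullet> \<xi>\<bar> \<le> sqrt ?D"
      using uu by (intro real_le_rsqrt) simp
    then show ?thesis using t unfolding chord_def by linarith
  qed
  finally show ?thesis .
qed

text \<open>Opposite directions have opposite \<open>u \<bullet> \<xi>\<close> and the same square
  root, so the cross terms cancel and a polynomial in \<open>u\<close> remains.\<close>

lemma chord_square_sum:
  assumes "norm u \<le> 1"
  shows "(chord u \<xi>)\<^sup>2 + (chord u (- \<xi>))\<^sup>2 = 4 * (u \<bullet> \<xi>)\<^sup>2 + 2 * (1 - (norm u)\<^sup>2)"
proof -
  let ?D = "(u \<bullet> \<xi>)\<^sup>2 + 1 - (norm u)\<^sup>2"
  have "(norm u)\<^sup>2 \<le> 1" using assms by (simp add: abs_square_le_1)
  then have "0 \<le> ?D" by (smt (verit) zero_le_power2)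
  then have "(sqrt ?D)\<^sup>2 = ?D" by simp
  then show ?thesis
    by (simp add: chord_def power2_eq_square algebra_simps)
qed

lemma borel_measurable_chord [measurable]:
  "(\<lambda>z. chord u (sgn (z::'a::euclidean_space))) \<in> borel_measurable borel"
  unfolding chord_def by measurable

text \<open>In polar coordinates at \<open>u\<close> the factor
  \<open>t ^ (m + 1) / t ^ m = t\<close> is integrated up to the chord. Nonnegativity admits
  Tonelli; signed \<Omega> will follow by adding a constant.\<close>

lemma nn_integral_kernel_cball:
  fixes u :: "'a::euclidean_space" and \<Omega> :: "'a \<Rightarrow> real"
  assumes d: "DIM('a) = Suc (Suc m)" and u: "norm u \<le> 1"
    and [measurable]: "(\<lambda>z. \<Omega> (sgn z)) \<in> borel_measurable borel"
    and pos: "\<And>z. 0 \<le> \<Omega> (sgn z)"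
  shows "(\<integral>\<^sup>+w. ennreal (\<Omega> (sgn (u - w)) / norm (u - w) ^ m) * indicator (cball 0 1) w \<partial>lborel)
    = (\<integral>\<^sup>+z. ennreal (real DIM('a) / 2 * \<Omega> (sgn z) * (chord u (sgn z))\<^sup>2) * indicator (cball 0 1) z \<partial>lborel)"
proof -
  define F where "F z = ennreal (\<Omega> (sgn z) / norm z ^ m) * indicator (cball 0 1) (u - z)" for z
  have [measurable]: "F \<in> borel_measurable borel" unfolding F_def by measurable
  have "(\<integral>\<^sup>+w. ennreal (\<Omega> (sgn (u - w)) / norm (u - w) ^ m) * indicator (cball 0 1) w \<partial>lborel)
     = (\<integral>\<^sup>+z. ennreal (\<Omega> (sgn (u - (u + (-1) *\<^sub>R z))) / norm (u - (u + (-1) *\<^sub>R z)) ^ m) * indicator (cball 0 1) (u + (-1) *\<^sub>R z) \<partial>lborel)"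
    by (subst nn_integral_lborel_affine[where c = "-1" and t = u]) simp_all
  also have "\<dots> = (\<integral>\<^sup>+z. F z \<partial>lborel)" by (simp add: F_def)
  also have "\<dots> = (\<integral>\<^sup>+z. indicator (cball 0 1) z *
       (\<integral>\<^sup>+t. indicator {0<..} t * ennreal (real DIM('a) * t ^ (DIM('a) - 1)) * F (t *\<^sub>R sgn z) \<partial>lborel) \<partial>lborel)"
    by (rule nn_integral_polar) measurable
  also have "\<dots> = (\<integral>\<^sup>+z. ennreal (real DIM('a) / 2 * \<Omega> (sgn z) * (chord u (sgn z))\<^sup>2) * indicator (cball 0 1) z \<partial>lborel)"
  proof (rule nn_integral_cong_AE, use AE_lborel_singleton[of 0] in eventually_elim)
    fix z :: 'a assume z: "z \<noteq> 0"
    have nz: "norm (sgn z) = 1" using z by (simp add: norm_sgn)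
    have "(\<integral>\<^sup>+t. indicator {0<..} t * ennreal (real DIM('a) * t ^ (DIM('a) - 1)) * F (t *\<^sub>R sgn z) \<partial>lborel)
      = (\<integral>\<^sup>+t. ennreal (real DIM('a) * \<Omega> (sgn z) * t) * indicator {0..chord u (sgn z)} t \<partial>lborel)"
    proof (rule nn_integral_cong_AE, use AE_lborel_singleton[of 0] in eventually_elim)
      fix t :: real assume t: "t \<noteq> 0"
      show "indicator {0<..} t * ennreal (real DIM('a) * t ^ (DIM('a) - 1)) * F (t *\<^sub>R sgn z)
         = ennreal (real DIM('a) * \<Omega> (sgn z) * t) * indicator {0..chord u (sgn z)} t"
      proof (cases "t > 0")
        case True
        have sg: "sgn (t *\<^sub>R sgn z) = sgn z" using True nz by (simp add: sgn_div_norm[of "t *\<^sub>R sgn z"])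
        have i: "(indicator (cball 0 1) (u - t *\<^sub>R sgn z) :: ennreal) = indicator {0..chord u (sgn z)} t"
          using in_unit_ball_iff_chord[OF u nz, of t] True by (auto simp: indicator_def)
        have "ennreal (real DIM('a) * t ^ (DIM('a) - 1)) * ennreal (\<Omega> (sgn z) / t ^ m) = ennreal (real DIM('a) * \<Omega> (sgn z) * t)"
          using True pos d by (subst ennreal_mult[symmetric]) simp_all
        then show ?thesis using True nz
          by (simp add: F_def sg i mult.assoc[symmetric])
      qed (use t in simp)
    qed
    also have "\<dots> = ennreal (real DIM('a) * \<Omega> (sgn z) * (chord u (sgn z))\<^sup>2 / 2)"
      by (rule nn_integral_interval_linear) (use pos chord_nonneg[OF u] in simp_all)
    finally show "indicator (cball 0 1) z *
       (\<integral>\<^sup>+t. indicator {0<..} t * ennreal (real DIM('a) * t ^ (DIM('a) - 1)) * F (t *\<^sub>R sgn z) \<partial>lborel)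
       = ennreal (real DIM('a) / 2 * \<Omega> (sgn z) * (chord u (sgn z))\<^sup>2) * indicator (cball 0 1) z"
      by (simp add: mult.commute)
  qed
  finally show ?thesis .
qed

lemma integrable_bounded_cball:
  fixes f :: "'a::euclidean_space \<Rightarrow> real"
  assumes [measurable]: "f \<in> borel_measurable borel" and "\<And>z. \<bar>f z\<bar> \<le> B"
  shows "set_integrable lborel (cball a r) f"
  unfolding set_integrable_def
proof (rule integrableI_bounded_set_indicator[where B = B])
  show "emeasure lborel (cball a r) < \<infinity>" using emeasure_bounded_finite[OF bounded_cball] by simp
  show "AE x \<in> cball a r in lborel. norm (f x) \<le> B" using assms(2) by simp
qed simp_all

lemma chord_square_le:
  assumes "norm u \<le> 1"
  shows "(chord u (sgn z))\<^sup>2 \<le> 6"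
proof -
  have "\<bar>u \<bullet> sgn z\<bar> \<le> norm u * norm (sgn z)" by (rule Cauchy_Schwarz_ineq2)
  also have "\<dots> \<le> 1" using assms by (simp add: norm_sgn)
  finally have "(u \<bullet> sgn z)\<^sup>2 \<le> 1" by (simp add: abs_square_le_1)
  \<comment> \<open>Each square is at most the sum of the two opposite ones, hence at most
    \<open>4 + 2\<close>.\<close>
  then show ?thesis
    using chord_square_sum[OF assms, of "sgn z"] by (smt (verit) zero_le_power2)
qed

lemma has_integral_kernel_cball:
  fixes u :: "'a::euclidean_space" and \<Omega> :: "'a \<Rightarrow> real"
  assumes d: "DIM('a) = Suc (Suc m)" and u: "norm u \<le> 1"
    and meas[measurable]: "(\<lambda>z. \<Omega> (sgn z)) \<in> borel_measurable borel"
    and bd: "\<And>z. \<bar>\<Omega> (sgn z)\<bar> \<le> M"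
  shows "has_bochner_integral lborel (\<lambda>w. indicator (cball 0 1) w *\<^sub>R (\<Omega> (sgn (u - w)) / norm (u - w) ^ m))
    (LINT z:cball 0 1|lborel. real DIM('a) / 2 * \<Omega> (sgn z) * (chord u (sgn z))\<^sup>2)"
proof -
  have M: "M \<ge> 0" using bd[of 0] by linarith
  \<comment> \<open>Applied to \<open>\<Omega> + M\<close> and to the constant \<open>M\<close>,
    both between 0 and \<open>2 * M\<close>; their difference gives \<Omega>.\<close>
  have *: "has_bochner_integral lborel (\<lambda>w. indicator (cball 0 1) w *\<^sub>R (\<Phi> (sgn (u - w)) / norm (u - w) ^ m))
    (LINT z:cball 0 1|lborel. real DIM('a) / 2 * \<Phi> (sgn z) * (chord u (sgn z))\<^sup>2)
     \<and> set_integrable lborel (cball 0 1) (\<lambda>z. real DIM('a) / 2 * \<Phi> (sgn z) * (chord u (sgn z))\<^sup>2)"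
    if [measurable]: "(\<lambda>z. \<Phi> (sgn z)) \<in> borel_measurable borel"
    and pos: "\<And>z. 0 \<le> \<Phi> (sgn z)" and bd: "\<And>z. \<Phi> (sgn z) \<le> 2 * M" for \<Phi> :: "'a \<Rightarrow> real"
  proof
    show int: "set_integrable lborel (cball 0 1) (\<lambda>z. real DIM('a) / 2 * \<Phi> (sgn z) * (chord u (sgn z))\<^sup>2)"
    proof (rule integrable_bounded_cball)
      fix z
      have "real DIM('a) / 2 * \<Phi> (sgn z) * (chord u (sgn z))\<^sup>2 \<le> real DIM('a) / 2 * (2 * M) * 6"
        using chord_square_le[OF u] bd pos M by (intro mult_mono) auto
      then show "\<bar>real DIM('a) / 2 * \<Phi> (sgn z) * (chord u (sgn z))\<^sup>2\<bar> \<le> real DIM('a) / 2 * (2 * M) * 6"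
        using pos by simp
    qed measurable
    show "has_bochner_integral lborel (\<lambda>w. indicator (cball 0 1) w *\<^sub>R (\<Phi> (sgn (u - w)) / norm (u - w) ^ m))
      (LINT z:cball 0 1|lborel. real DIM('a) / 2 * \<Phi> (sgn z) * (chord u (sgn z))\<^sup>2)"
    proof (rule has_bochner_integral_nn_integral)
      have [measurable]: "(\<lambda>w. \<Phi> (sgn (u - w))) \<in> borel_measurable borel"
        by (rule measurable_compose[of "\<lambda>w. u - w" borel borel "\<lambda>z. \<Phi> (sgn z)"]) measurable
      show "(\<lambda>w. indicator (cball 0 1) w *\<^sub>R (\<Phi> (sgn (u - w)) / norm (u - w) ^ m)) \<in> borel_measurable lborel"
        by measurable
      show "AE w in lborel. 0 \<le> indicator (cball 0 1) w *\<^sub>R (\<Phi> (sgn (u - w)) / norm (u - w) ^ m)"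
        using pos by simp
      show "0 \<le> (LINT z:cball 0 1|lborel. real DIM('a) / 2 * \<Phi> (sgn z) * (chord u (sgn z))\<^sup>2)"
        unfolding set_lebesgue_integral_def using pos by (intro integral_nonneg_AE) simp
      have "(\<integral>\<^sup>+w. ennreal (indicator (cball 0 1) w *\<^sub>R (\<Phi> (sgn (u - w)) / norm (u - w) ^ m)) \<partial>lborel)
        = (\<integral>\<^sup>+w. ennreal (\<Phi> (sgn (u - w)) / norm (u - w) ^ m) * indicator (cball 0 1) w \<partial>lborel)"
        by (intro nn_integral_cong) (simp add: indicator_def)
      also have "\<dots> = (\<integral>\<^sup>+z. ennreal (real DIM('a) / 2 * \<Phi> (sgn z) * (chord u (sgn z))\<^sup>2) * indicator (cball 0 1) z \<partial>lborel)"
        by (rule nn_integral_kernel_cball[OF d u]) (use pos in simp_all)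
      also have "\<dots> = (\<integral>\<^sup>+z. ennreal (indicator (cball 0 1) z *\<^sub>R (real DIM('a) / 2 * \<Phi> (sgn z) * (chord u (sgn z))\<^sup>2)) \<partial>lborel)"
        by (intro nn_integral_cong) (simp add: indicator_def)
      also have "\<dots> = ennreal (LINT z:cball 0 1|lborel. real DIM('a) / 2 * \<Phi> (sgn z) * (chord u (sgn z))\<^sup>2)"
        unfolding set_lebesgue_integral_def
        by (rule nn_integral_eq_integral) (use int pos in \<open>simp_all add: set_integrable_def\<close>)
      finally show "(\<integral>\<^sup>+w. ennreal (indicator (cball 0 1) w *\<^sub>R (\<Phi> (sgn (u - w)) / norm (u - w) ^ m)) \<partial>lborel)
        = ennreal (LINT z:cball 0 1|lborel. real DIM('a) / 2 * \<Phi> (sgn z) * (chord u (sgn z))\<^sup>2)" .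
    qed
  qed
  have 1: "has_bochner_integral lborel (\<lambda>w. indicator (cball 0 1) w *\<^sub>R ((\<Omega> (sgn (u - w)) + M) / norm (u - w) ^ m))
    (LINT z:cball 0 1|lborel. real DIM('a) / 2 * (\<Omega> (sgn z) + M) * (chord u (sgn z))\<^sup>2)
     \<and> set_integrable lborel (cball 0 1) (\<lambda>z. real DIM('a) / 2 * (\<Omega> (sgn z) + M) * (chord u (sgn z))\<^sup>2)"
    by (rule *) (use bd in \<open>simp_all add: abs_le_iff, smt (verit) bd\<close>)
  have 2: "has_bochner_integral lborel (\<lambda>w. indicator (cball 0 1) w *\<^sub>R (M / norm (u - w) ^ m))
    (LINT z:cball 0 1|lborel. real DIM('a) / 2 * M * (chord u (sgn z))\<^sup>2)
     \<and> set_integrable lborel (cball 0 1) (\<lambda>z. real DIM('a) / 2 * M * (chord u (sgn z))\<^sup>2)"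
    by (rule *) (use M in simp_all)
  have eq: "(LINT z:cball 0 1|lborel. real DIM('a) / 2 * (\<Omega> (sgn z) + M) * (chord u (sgn z))\<^sup>2)
     - (LINT z:cball 0 1|lborel. real DIM('a) / 2 * M * (chord u (sgn z))\<^sup>2)
     = (LINT z:cball 0 1|lborel. real DIM('a) / 2 * \<Omega> (sgn z) * (chord u (sgn z))\<^sup>2)"
  proof -
    have "(\<lambda>z. real DIM('a) / 2 * \<Omega> (sgn z) * (chord u (sgn z))\<^sup>2)
       = (\<lambda>z. real DIM('a) / 2 * (\<Omega> (sgn z) + M) * (chord u (sgn z))\<^sup>2 - real DIM('a) / 2 * M * (chord u (sgn z))\<^sup>2)"
      by (simp add: fun_eq_iff algebra_simps)
    then show ?thesis
      by (simp only: set_integral_diff(2)[OF 1[THEN conjunct2] 2[THEN conjunct2]])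
  qed
  show ?thesis
    using has_bochner_integral_diff[OF 1[THEN conjunct1] 2[THEN conjunct1]] unfolding eq
    by (rule back_subst[of "\<lambda>f. has_bochner_integral lborel f _"]) (simp add: fun_eq_iff field_simps add_divide_distrib)
qed

lemma set_integral_cball_uminus:
  fixes f :: "'a::euclidean_space \<Rightarrow> real"
  assumes [measurable]: "f \<in> borel_measurable borel"
  shows "(LINT z:cball 0 r|lborel. f (- z)) = (LINT z:cball 0 r|lborel. f z)"
proof -
  have "distr lborel borel uminus = (lborel :: 'a measure)"
    by (subst lborel_affine[of "-1" 0]) (auto simp: density_1 one_ennreal_def[symmetric])
  then have "(LINT z:cball 0 r|lborel. f z) = (LINT z:cball 0 r|(distr lborel borel uminus). f z)"
    by simp
  also have "\<dots> = (LINT z:cball 0 r|lborel. f (- z))"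
    unfolding set_lebesgue_integral_def by (subst integral_distr) (simp_all add: indicator_def)
  finally show ?thesis by simp
qed

lemma integral_kernel_cball_even:
  fixes u :: "'a::euclidean_space" and \<Omega> :: "'a \<Rightarrow> real"
  assumes d: "DIM('a) = Suc (Suc m)" and u: "norm u \<le> 1"
    and meas[measurable]: "(\<lambda>z. \<Omega> (sgn z)) \<in> borel_measurable borel"
    and bd: "\<And>z. \<bar>\<Omega> (sgn z)\<bar> \<le> M"
    and even: "\<And>z. \<Omega> (- sgn z) = \<Omega> (sgn z)"
    and mean: "(LINT z:cball 0 1|lborel. \<Omega> (sgn z)) = 0"
  shows "set_integrable lborel (cball 0 1) (\<lambda>w. \<Omega> (sgn (u - w)) / norm (u - w) ^ m)"
    and "(LINT w:cball 0 1|lborel. \<Omega> (sgn (u - w)) / norm (u - w) ^ m)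
     = real DIM('a) * (LINT z:cball 0 1|lborel. \<Omega> (sgn z) * (u \<bullet> sgn z)\<^sup>2)"
proof -
  note h = has_integral_kernel_cball[OF d u meas bd]
  show "set_integrable lborel (cball 0 1) (\<lambda>w. \<Omega> (sgn (u - w)) / norm (u - w) ^ m)"
    using h unfolding set_integrable_def by (rule integrable.intros)
  let ?f = "\<lambda>z. real DIM('a) / 2 * \<Omega> (sgn z) * (chord u (sgn z))\<^sup>2"
  let ?g = "\<lambda>z. real DIM('a) / 2 * \<Omega> (sgn z) * (chord u (- sgn z))\<^sup>2"
  have M: "M \<ge> 0" using bd[of 0] by linarith
  have ibd: "\<bar>u \<bullet> sgn z\<bar> \<le> 1" for z
  proof -
    have "\<bar>u \<bullet> sgn z\<bar> \<le> norm u * norm (sgn z)" by (rule Cauchy_Schwarz_ineq2)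
    also have "\<dots> \<le> 1" using u by (simp add: norm_sgn)
    finally show ?thesis .
  qed
  have int: "set_integrable lborel (cball 0 1) (\<lambda>z. \<Omega> (sgn z))"
    by (rule integrable_bounded_cball) (use bd in simp_all)
  have int2: "set_integrable lborel (cball 0 1) (\<lambda>z. \<Omega> (sgn z) * (u \<bullet> sgn z)\<^sup>2)"
  proof (rule integrable_bounded_cball)
    fix z
    have "(u \<bullet> sgn z)\<^sup>2 \<le> 1" using ibd[of z] by (simp add: abs_square_le_1)
    then have "\<bar>\<Omega> (sgn z)\<bar> * (u \<bullet> sgn z)\<^sup>2 \<le> M * 1"
      using bd[of z] M by (intro mult_mono) simp_all
    then show "\<bar>\<Omega> (sgn z) * (u \<bullet> sgn z)\<^sup>2\<bar> \<le> M" by (simp add: abs_mult)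
  qed measurable
  have fint: "set_integrable lborel (cball 0 1) ?f"
  proof (rule integrable_bounded_cball)
    fix z
    have "real DIM('a) / 2 * \<bar>\<Omega> (sgn z)\<bar> * (chord u (sgn z))\<^sup>2 \<le> real DIM('a) / 2 * M * 6"
      using chord_square_le[OF u, of z] bd[of z] M by (intro mult_mono) auto
    then show "\<bar>?f z\<bar> \<le> real DIM('a) / 2 * M * 6" by (simp add: abs_mult)
  qed measurable
  have sm: "sgn (- z) = - sgn z" for z :: 'a by (simp add: sgn_div_norm)
  have gint: "set_integrable lborel (cball 0 1) ?g"
  proof (rule integrable_bounded_cball)
    fix z
    have "real DIM('a) / 2 * \<bar>\<Omega> (sgn z)\<bar> * (chord u (sgn (-z)))\<^sup>2 \<le> real DIM('a) / 2 * M * 6"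
      using chord_square_le[OF u, of "-z"] bd[of z] M by (intro mult_mono) auto
    then show "\<bar>?g z\<bar> \<le> real DIM('a) / 2 * M * 6" by (simp add: abs_mult sm)
  next
    show "?g \<in> borel_measurable borel" unfolding chord_def by measurable
  qed
  \<comment> \<open>Reflection of the ball replaces each chord by the opposite one, since \<Omega>
    is even; the mean of both versions is free of square roots.\<close>
  have fg: "(LINT z:cball 0 1|lborel. ?f z) = (LINT z:cball 0 1|lborel. ?g z)"
    using set_integral_cball_uminus[of ?f 1] by (simp add: sm even)
  have "2 * (LINT z:cball 0 1|lborel. ?f z) = (LINT z:cball 0 1|lborel. ?f z + ?g z)"
    using fg by (subst set_integral_add(2)[OF fint gint]) simp
  also have "\<dots> = (LINT z:cball 0 1|lborel. 2 * real DIM('a) * (\<Omega> (sgn z) * (u \<bullet> sgn z)\<^sup>2)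
       + real DIM('a) * (1 - (norm u)\<^sup>2) * \<Omega> (sgn z))"
  proof -
    have "?f z + ?g z = 2 * real DIM('a) * (\<Omega> (sgn z) * (u \<bullet> sgn z)\<^sup>2)
       + real DIM('a) * (1 - (norm u)\<^sup>2) * \<Omega> (sgn z)" for z
    proof -
      have "?f z + ?g z = real DIM('a) / 2 * \<Omega> (sgn z) * ((chord u (sgn z))\<^sup>2 + (chord u (- sgn z))\<^sup>2)"
        by (simp add: algebra_simps)
      then show ?thesis unfolding chord_square_sum[OF u] by (simp add: field_simps)
    qed
    then show ?thesis by simp
  qed
  also have "\<dots> = 2 * real DIM('a) * (LINT z:cball 0 1|lborel. \<Omega> (sgn z) * (u \<bullet> sgn z)\<^sup>2)"
    using int int2 mean by (subst set_integral_add(2)) simp_all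
  finally show "(LINT w:cball 0 1|lborel. \<Omega> (sgn (u - w)) / norm (u - w) ^ m)
     = real DIM('a) * (LINT z:cball 0 1|lborel. \<Omega> (sgn z) * (u \<bullet> sgn z)\<^sup>2)"
    using has_bochner_integral_integral_eq[OF h] by (simp add: set_lebesgue_integral_def)
qed

section \<open>Hausdorff measure on the sphere\<close>

lemma ball_sets_borel [measurable]: "ball (a::'a::metric_space) r \<in> sets borel"
  by simp

lemma sphere_sets_borel [measurable]: "sphere (a::'a::metric_space) r \<in> sets borel"
proof -
  have "sphere a r = cball a r - ball a r" by auto
  then show ?thesis by simp
qed

section \<open>Finite coverings and isometries\<close>

lemma hausdorff_pre_finite_cover:
  assumes I: "finite I" and cov: "A \<subseteq> (\<Union>i\<in>I. U i)" and "\<delta> \<ge> 0"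
    and U: "\<And>i. i \<in> I \<Longrightarrow> bounded (U i) \<and> diameter (U i) \<le> \<delta>"
  shows "hausdorff_pre m \<delta> A \<le> (\<Sum>i\<in>I. hausdorff_gauge m (U i))"
proof -
  obtain e where e: "bij_betw e {..<card I} I"
    using ex_bij_betw_nat_finite[OF I] by (auto simp: atLeast0LessThan)
  \<comment> \<open>Coverings are sequences, so a finite one is padded with empty sets; their gauge
    is 0 even for \<open>m = 0\<close>.\<close>
  define V where "V n = (if n < card I then U (e n) else {})" for n
  have eI: "e n \<in> I" if "n < card I" for n using e that by (auto simp: bij_betw_def)
  have "V \<in> hausdorff_covers \<delta> A"
    unfolding hausdorff_covers_def mem_Collect_eq
  proof (intro conjI allI subsetI)
    fix x assume "x \<in> A"
    then obtain i where i: "i \<in> I" "x \<in> U i" using cov by blast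
    then obtain n where "n < card I" "e n = i" using e by (metis bij_betw_iff_bijections lessThan_iff)
    then show "x \<in> (\<Union>n. V n)" using i by (auto simp: V_def)
  next
    fix n show "bounded (V n)" "diameter (V n) \<le> \<delta>"
      using U[OF eI, of n] \<open>\<delta> \<ge> 0\<close> by (auto simp: V_def)
  qed
  then have "hausdorff_pre m \<delta> A \<le> (\<Sum>n. hausdorff_gauge m (V n))"
    unfolding hausdorff_pre_def by (rule INF_lower)
  also have "\<dots> = (\<Sum>n<card I. hausdorff_gauge m (V n))"
    by (rule suminf_finite) (auto simp: V_def)
  also have "\<dots> = (\<Sum>n<card I. hausdorff_gauge m (U (e n)))" by (simp add: V_def)
  also have "\<dots> = (\<Sum>i\<in>I. hausdorff_gauge m (U i))" by (rule sum.reindex_bij_betw[OF e])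
  finally show ?thesis .
qed

lemma hausdorff_pre_finite_cballs:
  fixes P :: "'a::real_normed_vector set"
  assumes P: "finite P" and cov: "A \<subseteq> (\<Union>p\<in>P. cball p r)" and r: "r \<ge> 0"
  shows "hausdorff_pre m (2 * r) A \<le> ennreal (real (card P) * (unit_ball_vol (real m) * r ^ m))"
proof -
  have dm: "diameter (cball p r) \<le> 2 * r" for p :: 'a
  proof (rule diameter_le)
    fix x y assume "x \<in> cball p r" "y \<in> cball p r"
    then show "norm (x - y) \<le> 2 * r"
      using dist_triangle2[of x y p] by (simp add: dist_norm norm_minus_commute)
  qed (use r in simp)
  have "hausdorff_pre m (2 * r) A \<le> (\<Sum>p\<in>P. hausdorff_gauge m (cball p r))"
    by (rule hausdorff_pre_finite_cover[OF P cov]) (use r dm in auto)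
  also have "\<dots> \<le> (\<Sum>p\<in>P. ennreal (unit_ball_vol (real m) * r ^ m))"
  proof (rule sum_mono)
    fix p :: 'a
    have "(diameter (cball p r) / 2) ^ m \<le> r ^ m"
      using dm[of p] diameter_ge_0[OF bounded_cball, of p r] by (intro power_mono) auto
    then show "hausdorff_gauge m (cball p r) \<le> ennreal (unit_ball_vol (real m) * r ^ m)"
      unfolding hausdorff_gauge_def by (auto intro!: ennreal_leI mult_left_mono)
  qed
  also have "\<dots> = ennreal (real (card P) * (unit_ball_vol (real m) * r ^ m))"
    using r by (simp add: ennreal_mult ennreal_of_nat_eq_real_of_nat)
  finally show ?thesis .
qed

lemma hausdorff_outer_isometry_le:
  fixes T :: "'a::metric_space \<Rightarrow> 'b::metric_space"
  assumes T: "\<And>x y. dist (T x) (T y) = dist x y"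
  shows "hausdorff_outer m (T ` A) \<le> hausdorff_outer m A"
proof -
  have diam: "diameter (T ` U) = diameter U" for U
  proof -
    have "(\<lambda>(x, y). dist x y) ` (T ` U \<times> T ` U) = (\<lambda>(x, y). dist x y) ` (U \<times> U)"
      using T by (force simp: image_iff)
    then show ?thesis by (simp add: diameter_def)
  qed
  have bdd: "bounded (T ` U)" if "bounded U" for U
    using that unfolding bounded_def by (auto simp: T) (metis T)
  have "hausdorff_pre m \<delta> (T ` A) \<le> hausdorff_pre m \<delta> A" for \<delta>
    unfolding hausdorff_pre_def[of m \<delta> A]
  proof (rule INF_greatest)
    fix U assume U: "U \<in> hausdorff_covers \<delta> A"
    then have "(\<lambda>i. T ` U i) \<in> hausdorff_covers \<delta> (T ` A)"
      unfolding hausdorff_covers_def by (auto simp: diam bdd) blast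
    then have "hausdorff_pre m \<delta> (T ` A) \<le> (\<Sum>i. hausdorff_gauge m (T ` U i))"
      unfolding hausdorff_pre_def by (rule INF_lower)
    also have "\<dots> = (\<Sum>i. hausdorff_gauge m (U i))"
      by (intro suminf_cong) (auto simp: hausdorff_gauge_def diam)
    finally show "hausdorff_pre m \<delta> (T ` A) \<le> (\<Sum>i. hausdorff_gauge m (U i))" .
  qed
  then show ?thesis unfolding hausdorff_outer_def by (intro SUP_mono) blast
qed

lemma hausdorff_outer_isometry:
  fixes T :: "'a::metric_space \<Rightarrow> 'b::metric_space"
  assumes T: "\<And>x y. dist (T x) (T y) = dist x y" and "bij T"
  shows "hausdorff_outer m (T ` A) = hausdorff_outer m A"
proof (rule antisym[OF hausdorff_outer_isometry_le[OF T]])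
  have "dist (inv T x) (inv T y) = dist x y" for x y
    by (metis T assms(2) bij_inv_eq_iff)
  from hausdorff_outer_isometry_le[OF this, of m "T ` A"]
  show "hausdorff_outer m A \<le> hausdorff_outer m (T ` A)"
    using \<open>bij T\<close> by (simp add: bij_is_inj image_inv_f_f)
qed

(* Uniqueness of translation-invariant measures, normalised by the invariant unit ball. *)
lemma lborel_distr_orthogonal:
  fixes T :: "'a::euclidean_space \<Rightarrow> 'a"
  assumes T: "orthogonal_transformation T"
  shows "distr lborel borel T = lborel"
proof -
  have lin: "linear T" using T by (simp add: orthogonal_transformation_def)
  have surj: "surj T" by (rule orthogonal_transformation_surj[OF T])
  have Tm [measurable]: "T \<in> borel_measurable borel"
    using linear_continuous_on[OF linear_conv_bounded_linear[THEN iffD1, OF lin]]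
    by (intro borel_measurable_continuous_onI) simp
  let ?M = "distr lborel borel T"
  have ball: "emeasure ?M (ball 0 r) = emeasure lborel (ball (0::'a) r)" for r
  proof -
    have "T -` ball 0 r = ball 0 r"
      using orthogonal_transformation_norm[OF T] by (auto simp: dist_norm)
    then show ?thesis by (subst emeasure_distr) simp_all
  qed
  interpret M: sigma_finite_measure ?M
  proof
    show "\<exists>A. countable A \<and> A \<subseteq> sets ?M \<and> \<Union> A = space ?M \<and> (\<forall>a\<in>A. emeasure ?M a \<noteq> \<infinity>)"
    proof (intro exI[of _ "range (\<lambda>n::nat. ball 0 (real n))"] conjI ballI)
      show "\<Union> (range (\<lambda>n::nat. ball 0 (real n))) = space ?M"
        by (auto intro: reals_Archimedean2)
      fix a :: "'a set" assume "a \<in> range (\<lambda>n::nat. ball 0 (real n))"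
      then show "emeasure ?M a \<noteq> \<infinity>"
        using ball emeasure_bounded_finite[OF bounded_ball, of "0::'a"] by (auto simp: less_top)
    qed auto
  qed
  have pair: "pair_sigma_finite (lborel :: 'a measure) ?M"
    by (simp add: pair_sigma_finite_def lborel.sigma_finite_measure_axioms M.sigma_finite_measure_axioms)
  have pair': "pair_sigma_finite ?M (lborel :: 'a measure)"
    by (simp add: pair_sigma_finite_def lborel.sigma_finite_measure_axioms M.sigma_finite_measure_axioms)
  have trans_l: "(\<integral>\<^sup>+x. f (x - a) \<partial>lborel) = (\<integral>\<^sup>+x. f x \<partial>lborel)"
    if [measurable]: "f \<in> borel_measurable borel" for f and a :: 'a
    using nn_integral_lborel_affine[of f 1 "- a"] by (simp add: algebra_simps)
  have refl_l: "(\<integral>\<^sup>+x. f (a - x) \<partial>lborel) = (\<integral>\<^sup>+x. f x \<partial>lborel)"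
    if [measurable]: "f \<in> borel_measurable borel" for f and a :: 'a
    using nn_integral_lborel_affine[of f "-1" "a"] by (simp add: algebra_simps)
  have trans_M: "(\<integral>\<^sup>+x. f (x - a) \<partial>?M) = (\<integral>\<^sup>+x. f x \<partial>?M)"
    if [measurable]: "f \<in> borel_measurable borel" for f and a :: 'a
  proof -
    obtain b where b: "a = T b" using surj by blast
    have "(\<integral>\<^sup>+x. f (x - a) \<partial>?M) = (\<integral>\<^sup>+x. f (T (x - b)) \<partial>lborel)"
      by (subst nn_integral_distr) (simp_all add: b linear_diff[OF lin])
    also have "\<dots> = (\<integral>\<^sup>+x. f (T x) \<partial>lborel)" by (rule trans_l) simp
    also have "\<dots> = (\<integral>\<^sup>+x. f x \<partial>?M)" by (subst nn_integral_distr) simp_all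
    finally show ?thesis .
  qed
  let ?B = "ball (0::'a) 1"
  have "emeasure ?M A = emeasure lborel A" if A [measurable]: "A \<in> sets borel" for A
  proof -
    \<comment> \<open>The indicator of \<open>x - y \<in> A\<close> and \<open>y \<in> ?B\<close> is
      integrated over both measures in either order. One order gives the left side, by translation
      invariance of \<open>?M\<close>; the reflection \<open>w = x - y\<close> and the other order
      give \<open>?M\<close> of \<open>?B\<close> times \<open>lborel\<close> of
      \<open>A\<close>.\<close>
    have "emeasure ?M A * emeasure lborel ?B = (\<integral>\<^sup>+y. emeasure ?M A * indicator ?B y \<partial>lborel)"
      by (simp add: nn_integral_cmult_indicator)
    also have "\<dots> = (\<integral>\<^sup>+y. (\<integral>\<^sup>+x. indicator A (x - y) * indicator ?B y \<partial>?M) \<partial>lborel)"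
    proof (rule nn_integral_cong)
      fix y
      have "(\<integral>\<^sup>+x. indicator A (x - y) * indicator ?B y \<partial>?M) = (\<integral>\<^sup>+x. indicator A (x - y) \<partial>?M) * indicator ?B y"
        by (rule nn_integral_multc) simp
      then show "emeasure ?M A * indicator ?B y = (\<integral>\<^sup>+x. indicator A (x - y) * indicator ?B y \<partial>?M)"
        by (simp add: trans_M[of "indicator A"])
    qed
    also have "\<dots> = (\<integral>\<^sup>+x. (\<integral>\<^sup>+y. indicator A (x - y) * indicator ?B y \<partial>lborel) \<partial>?M)"
      by (rule pair_sigma_finite.Fubini'[OF pair']) measurable
    also have "\<dots> = (\<integral>\<^sup>+x. (\<integral>\<^sup>+w. indicator A w * indicator ?B (x - w) \<partial>lborel) \<partial>?M)"
    proof (rule nn_integral_cong)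
      fix x
      show "(\<integral>\<^sup>+y. indicator A (x - y) * indicator ?B y \<partial>lborel) = (\<integral>\<^sup>+w. indicator A w * indicator ?B (x - w) \<partial>lborel)"
        using refl_l[of "\<lambda>w. indicator A w * indicator ?B (x - w)" x] by simp
    qed
    also have "\<dots> = (\<integral>\<^sup>+w. (\<integral>\<^sup>+x. indicator A w * indicator ?B (x - w) \<partial>?M) \<partial>lborel)"
      by (rule pair_sigma_finite.Fubini'[OF pair]) measurable
    also have "\<dots> = (\<integral>\<^sup>+w. emeasure ?M ?B * indicator A w \<partial>lborel)"
    proof (rule nn_integral_cong)
      fix w
      have "(\<integral>\<^sup>+x. indicator A w * indicator ?B (x - w) \<partial>?M) = indicator A w * (\<integral>\<^sup>+x. indicator ?B (x - w) \<partial>?M)"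
        by (rule nn_integral_cmult) simp
      then show "(\<integral>\<^sup>+x. indicator A w * indicator ?B (x - w) \<partial>?M) = emeasure ?M ?B * indicator A w"
        by (simp add: trans_M[of "indicator ?B"] mult.commute)
    qed
    also have "\<dots> = emeasure lborel ?B * emeasure lborel A"
      by (simp add: nn_integral_cmult_indicator ball)
    finally have "emeasure lborel ?B * emeasure ?M A = emeasure lborel ?B * emeasure lborel A"
      by (simp add: mult.commute)
    moreover have "emeasure lborel ?B \<noteq> 0" "emeasure lborel ?B \<noteq> top"
      using emeasure_bounded_finite[OF bounded_ball, of "0::'a" 1]
      by (auto simp: emeasure_ball unit_ball_vol_pos ennreal_eq_0_iff not_le)
    ultimately show ?thesis by (simp add: ennreal_mult_cancel_left)
  qed
  then show ?thesis by (intro measure_eqI) simp_all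
qed

text \<open>Stands in for surface measure: rotation invariant, with the volume of the unit ball as
  total mass on the sphere, because \<open>sgn z\<close> is a unit vector except at 0.\<close>

definition cone_measure :: "'a::euclidean_space measure" where
  "cone_measure = distr (density lborel (indicator (cball 0 1))) borel sgn"

lemma sets_cone_measure [simp, measurable_cong]: "sets cone_measure = sets borel"
  and space_cone_measure [simp]: "space cone_measure = UNIV"
  by (simp_all add: cone_measure_def)

lemma integral_cone_measure:
  fixes f :: "'a::euclidean_space \<Rightarrow> real"
  assumes [measurable]: "f \<in> borel_measurable borel"
  shows "(LINT \<xi>|cone_measure. f \<xi>) = (LINT z:cball 0 1|lborel. f (sgn z))"
proof -
  have e: "(indicator (cball 0 1) :: 'a \<Rightarrow> ennreal) = (\<lambda>z. ennreal (indicator (cball 0 1) z))"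
    by (auto simp: indicator_def)
  show ?thesis
    unfolding cone_measure_def set_lebesgue_integral_def
    by (subst integral_distr) (simp_all add: e integral_density)
qed

lemma emeasure_cone_measure:
  assumes [measurable]: "A \<in> sets borel"
  shows "emeasure cone_measure A = emeasure lborel (cball 0 1 \<inter> sgn -` (A :: 'a::euclidean_space set))"
proof -
  have m: "sgn -` A \<in> sets borel" using measurable_sets[OF borel_measurable_sgn_vec assms] by simp
  then show ?thesis
    unfolding cone_measure_def
    by (subst emeasure_distr) (simp_all add: emeasure_density indicator_inter_arith[symmetric] Int_commute)
qed

lemma finite_cone_measure: "emeasure (cone_measure :: 'a::euclidean_space measure) UNIV < \<infinity>"
  by (subst emeasure_cone_measure) (use emeasure_bounded_finite[OF bounded_cball, of "0::'a" 1] in auto)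

text \<open>Let \<open>a\<close> be the volume of the cone over the cap. By scaling, the outer part
  of the cone of thickness \<open>\<delta>\<close> has volume at least \<open>\<delta> * a\<close>,
  and it lies in the ball of radius \<open>2 * \<delta>\<close> around \<open>\<xi>\<close>.
  Comparing volumes and cancelling one factor \<open>\<delta>\<close> leaves the power
  \<open>k\<close>.\<close>

lemma emeasure_cone_measure_le:
  fixes \<xi> :: "'a::euclidean_space"
  assumes d: "DIM('a) = Suc k" and \<delta>: "0 < \<delta>" "\<delta> \<le> 1"
  shows "emeasure cone_measure (cball \<xi> \<delta>) \<le> ennreal (unit_ball_vol (real DIM('a)) * 2 ^ DIM('a) * \<delta> ^ k)"
proof -
  define A where "A = cball \<xi> \<delta>"
  define T where "T s = cball 0 s \<inter> sgn -` A" for s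
  have sA [measurable]: "sgn -` A \<in> sets borel"
    using measurable_sets[OF borel_measurable_sgn_vec, of A] by (simp add: A_def)
  have Tm [measurable]: "T s \<in> sets borel" for s unfolding T_def by measurable
  have fin: "emeasure lborel (T s) < \<infinity>" for s
    using emeasure_bounded_finite[OF bounded_subset[OF bounded_cball, of "T s" "0::'a" s]] by (auto simp: T_def)
  have sc: "emeasure lborel (T s) = ennreal (s ^ DIM('a)) * emeasure lborel (T 1)" if s: "s > 0" for s
  proof -
    have "emeasure lborel (T s) = (\<integral>\<^sup>+z. indicator (T s) z \<partial>lborel)" by simp
    also have "\<dots> = ennreal (\<bar>s\<bar> ^ DIM('a)) * (\<integral>\<^sup>+z. indicator (T s) (0 + s *\<^sub>R z) \<partial>lborel)"
      by (rule nn_integral_lborel_affine) (use s in simp_all)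
    also have "(\<integral>\<^sup>+z. indicator (T s) (0 + s *\<^sub>R z) \<partial>lborel) = (\<integral>\<^sup>+z. indicator (T 1) z \<partial>(lborel::'a measure))"
      using s by (intro nn_integral_cong) (auto simp: T_def indicator_def sgn_scaleR)
    finally show ?thesis using s by simp
  qed
  define a where "a = measure lborel (T 1)"
  have a: "emeasure lborel (T s) = ennreal (s ^ DIM('a) * a)" if "s > 0" for s
    using sc[OF that] fin[of 1] that by (simp add: a_def emeasure_eq_ennreal_measure less_top ennreal_mult)
  have sub: "T 1 - T (1 - \<delta>) \<subseteq> cball \<xi> (2 * \<delta>)"
  proof
    fix z assume z: "z \<in> T 1 - T (1 - \<delta>)"
    then have 1: "norm z \<le> 1" "dist \<xi> (sgn z) \<le> \<delta>" "1 - \<delta> < norm z"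
      by (auto simp: T_def A_def)
    have "dist (sgn z) z \<le> \<delta>"
    proof (cases "z = 0")
      case False
      have "sgn z - z = (1 - norm z) *\<^sub>R sgn z"
        using False by (simp add: sgn_div_norm scaleR_diff_left left_diff_distrib)
      then have "norm (sgn z - z) = 1 - norm z" using 1 False by (simp add: norm_sgn)
      then show ?thesis using 1 by (simp add: dist_norm)
    qed (use \<delta> in simp)
    then show "z \<in> cball \<xi> (2 * \<delta>)" using 1 dist_triangle[of \<xi> z "sgn z"] by simp
  qed
  have a0: "a \<ge> 0" by (simp add: a_def)
  have mT: "measure lborel (T s) = s ^ DIM('a) * a" if "s > 0" for s
    using a[OF that] a0 that by (simp add: measure_def)
  have "\<delta> * a \<le> measure lborel (T 1 - T (1 - \<delta>))"
  \<comment> \<open>The scaling law holds for positive factors only; for \<open>\<delta> = 1\<close>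
    the inner cone \<open>T 0\<close> is at most the origin.\<close>
  proof (cases "\<delta> = 1")
    case True
    have "measure lborel (T 1 - T 0) \<ge> measure lborel (T 1) - measure lborel (T 0)"
      using fin by (intro measure_diff_le_measure_setdiff) (auto simp: fmeasurable_def)
    moreover have "measure lborel (T 0) = 0"
    proof -
      have "measure lborel (T 0) \<le> measure lborel {0::'a}"
        by (rule measure_mono_fmeasurable) (auto simp: T_def fmeasurable_def)
      moreover have "measure lborel {0::'a} = 0" by (simp add: measure_def)
      ultimately show ?thesis using measure_nonneg[of lborel "T 0"] by linarith
    qed
    ultimately show ?thesis using True by (simp add: a_def)
  next
    case False
    have "measure lborel (T 1 - T (1 - \<delta>)) \<ge> measure lborel (T 1) - measure lborel (T (1 - \<delta>))"
      using fin by (intro measure_diff_le_measure_setdiff) (auto simp: fmeasurable_def)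
    moreover have "(1 - \<delta>) ^ DIM('a) * a \<le> (1 - \<delta>) * a"
      using \<delta> a0 power_decreasing[of 1 "DIM('a)" "1 - \<delta>"] by (intro mult_right_mono) auto
    ultimately show ?thesis using False \<delta> by (simp add: mT algebra_simps)
  qed
  also have "\<dots> \<le> measure lborel (cball \<xi> (2 * \<delta>))"
    by (rule measure_mono_fmeasurable[OF sub])
      (use emeasure_bounded_finite[OF bounded_cball] in \<open>auto simp: fmeasurable_def\<close>)
  also have "\<dots> = unit_ball_vol (real DIM('a)) * (2 * \<delta>) ^ DIM('a)"
    using \<delta> by (simp add: content_cball)
  also have "\<dots> = \<delta> * (unit_ball_vol (real DIM('a)) * 2 ^ DIM('a) * \<delta> ^ k)"
    by (simp add: d power_mult_distrib)
  finally have "a \<le> unit_ball_vol (real DIM('a)) * 2 ^ DIM('a) * \<delta> ^ k" using \<delta> by simp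
  moreover have "emeasure cone_measure (cball \<xi> \<delta>) = ennreal a"
    using a[of 1] by (simp add: emeasure_cone_measure T_def A_def)
  ultimately show ?thesis by (simp add: ennreal_leI)
qed

lemma emeasure_cone_measure_sphere:
  "emeasure cone_measure (sphere (0::'a::euclidean_space) 1) = ennreal (unit_ball_vol (real DIM('a)))"
proof -
  have "emeasure cone_measure (sphere (0::'a) 1) = emeasure lborel (cball (0::'a) 1 \<inter> sgn -` sphere 0 1)"
    by (rule emeasure_cone_measure) simp
  also have "cball (0::'a) 1 \<inter> sgn -` sphere 0 1 = cball 0 1 - {0}"
    by (auto simp: norm_sgn)
  also have "emeasure lborel (cball (0::'a) 1 - {0}) = emeasure lborel (cball (0::'a) 1)"
    by (rule emeasure_Diff_null_set) auto
  also have "\<dots> = ennreal (unit_ball_vol (real DIM('a)))"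
    by (simp add: emeasure_cball)
  finally show ?thesis .
qed

text \<open>Covering sets may be single points, of diameter 0. Their bound is the limit of those for
  positive radii, and is 0 because \<open>k \<ge> 1\<close>.\<close>

lemma emeasure_cone_measure_le':
  fixes \<xi> :: "'a::euclidean_space"
  assumes d: "DIM('a) = Suc k" and k: "k \<ge> 1" and \<delta>: "0 \<le> \<delta>" "\<delta> \<le> 1"
  shows "emeasure cone_measure (cball \<xi> \<delta>) \<le> ennreal (unit_ball_vol (real DIM('a)) * 2 ^ DIM('a) * \<delta> ^ k)"
proof (cases "\<delta> = 0")
  case True
  let ?C = "unit_ball_vol (real DIM('a)) * 2 ^ DIM('a)"
  have C: "?C > 0" by (simp add: unit_ball_vol_pos)
  have "emeasure cone_measure (cball \<xi> 0) \<le> 0 + ennreal e" if e: "e > 0" for e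
  proof -
    define t where "t = min 1 (e / ?C)"
    have t: "0 < t" "t \<le> 1" "?C * t \<le> e"
      using e C by (auto simp: t_def min_def field_simps)
    have "emeasure cone_measure (cball \<xi> 0) \<le> emeasure cone_measure (cball \<xi> t)"
      using t by (intro emeasure_mono) auto
    also have "\<dots> \<le> ennreal (?C * t ^ k)"
      by (rule emeasure_cone_measure_le[OF d]) (use t in auto)
    also have "\<dots> \<le> ennreal e"
    proof (rule ennreal_leI)
      have "t ^ k \<le> t" using t k power_decreasing[of 1 k t] by simp
      then have "?C * t ^ k \<le> ?C * t" using C by (intro mult_left_mono) auto
      then show "?C * t ^ k \<le> e" using t(3) by linarith
    qed
    finally show ?thesis by simp
  qed
  then have "emeasure cone_measure (cball \<xi> 0) \<le> 0"
    by (rule ennreal_le_epsilon)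
  then show ?thesis using True by simp
qed (use emeasure_cone_measure_le[OF d] \<delta> in simp)

text \<open>Mass distribution principle: a covering set that meets the sphere lies in a ball whose
  cone measure is at most a constant times the gauge of the set, so the total gauge of a covering is
  bounded below.\<close>

lemma hausdorff_outer_sphere_pos:
  assumes d: "DIM('a::euclidean_space) = Suc k" and k: "k \<ge> 1"
  shows "hausdorff_outer k (sphere (0::'a) 1) > 0"
proof -
  let ?S = "sphere (0::'a) 1"
  define C where "C = unit_ball_vol (real DIM('a)) * 2 ^ DIM('a)"
  define v where "v = unit_ball_vol (real k)"
  have v: "v > 0" and C: "C > 0" by (simp_all add: v_def C_def unit_ball_vol_pos)
  \<comment> \<open>The ratio of the bound \<open>C * t ^ k\<close> for a ball of radius
    \<open>t\<close> to the gauge \<open>v * (t / 2) ^ k\<close> of a set of diameter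
    \<open>t\<close>.\<close>
  define D where "D = C * 2 ^ k / v"
  have D: "D > 0" using v C by (simp add: D_def)
  have "ennreal (unit_ball_vol (real DIM('a)) / D) \<le> hausdorff_pre k 1 ?S"
    unfolding hausdorff_pre_def
  proof (rule INF_greatest)
    fix U assume U: "U \<in> hausdorff_covers 1 ?S"
    define V where "V i = (if U i \<inter> ?S = {} then {} else cball (SOME \<xi>. \<xi> \<in> U i \<inter> ?S) (diameter (U i)))" for i
    have Ub: "bounded (U i)" "diameter (U i) \<le> 1" for i
      using U by (auto simp: hausdorff_covers_def)
    have VU: "\<xi> \<in> V i" if "\<xi> \<in> U i \<inter> ?S" for \<xi> i
    proof -
      have "(SOME \<xi>. \<xi> \<in> U i \<inter> ?S) \<in> U i \<inter> ?S" using that by (rule someI)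
      then have "dist (SOME \<xi>. \<xi> \<in> U i \<inter> ?S) \<xi> \<le> diameter (U i)"
        using that Ub by (intro diameter_bounded_bound) auto
      then show ?thesis using that by (auto simp: V_def)
    qed
    have "ennreal (unit_ball_vol (real DIM('a))) = emeasure cone_measure ?S"
      by (simp add: emeasure_cone_measure_sphere)
    also have "\<dots> \<le> emeasure cone_measure (\<Union>i. V i)"
    proof (rule emeasure_mono)
      show "?S \<subseteq> (\<Union>i. V i)" using U VU unfolding hausdorff_covers_def by blast
      show "(\<Union>i. V i) \<in> sets cone_measure" by (auto simp: V_def)
    qed
    also have "\<dots> \<le> (\<Sum>i. emeasure cone_measure (V i))"
      by (rule emeasure_subadditive_countably) (auto simp: V_def)
    also have "\<dots> \<le> (\<Sum>i. ennreal D * hausdorff_gauge k (U i))"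
    proof (intro suminf_le)
      fix i
      show "emeasure cone_measure (V i) \<le> ennreal D * hausdorff_gauge k (U i)"
      proof (cases "U i \<inter> ?S = {}")
        case False
        have "emeasure cone_measure (V i) \<le> ennreal (C * diameter (U i) ^ k)"
          unfolding V_def C_def using False Ub diameter_ge_0[OF Ub(1)]
          by (auto intro!: emeasure_cone_measure_le'[OF d k])
        also have "C * diameter (U i) ^ k = D * (v * (diameter (U i) / 2) ^ k)"
          using v by (simp add: D_def power_divide)
        also have "ennreal \<dots> = ennreal D * hausdorff_gauge k (U i)"
          using False D by (auto simp: hausdorff_gauge_def v_def ennreal_mult')
        finally show ?thesis .
      qed (simp add: V_def)
    qed simp_all
    also have "\<dots> = ennreal D * (\<Sum>i. hausdorff_gauge k (U i))" by simp
    finally have le: "ennreal (unit_ball_vol (real DIM('a))) \<le> ennreal D * (\<Sum>i. hausdorff_gauge k (U i))" .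
    have "ennreal (unit_ball_vol (real DIM('a)) / D) = ennreal (1 / D) * ennreal (unit_ball_vol (real DIM('a)))"
      using D by (subst ennreal_mult[symmetric]) auto
    also have "\<dots> \<le> ennreal (1 / D) * (ennreal D * (\<Sum>i. hausdorff_gauge k (U i)))"
      by (intro mult_left_mono le) simp
    also have "\<dots> = (\<Sum>i. hausdorff_gauge k (U i))"
      using D by (simp add: mult.assoc[symmetric] ennreal_mult'[symmetric])
    finally show "ennreal (unit_ball_vol (real DIM('a)) / D) \<le> (\<Sum>i. hausdorff_gauge k (U i))" .
  qed
  also have "\<dots> \<le> hausdorff_outer k ?S" by (rule hausdorff_pre_le_outer) simp
  finally have "ennreal (unit_ball_vol (real DIM('a)) / D) \<le> hausdorff_outer k ?S" .
  moreover have "0 < ennreal (unit_ball_vol (real DIM('a)) / D)"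
    using D by (simp add: unit_ball_vol_pos)
  ultimately show ?thesis by (rule less_le_trans[rotated])
qed

text \<open>The disjoint balls of radius \<open>x\<close> around the points fit into the shell
  between the radii \<open>1 - x\<close> and \<open>1 + x\<close>, whose volume is of order
  \<open>x\<close>.\<close>

lemma card_separated_sphere_le:
  fixes P :: "'a::euclidean_space set"
  assumes P: "finite P" "P \<subseteq> sphere 0 1" and x: "0 < x" "x \<le> 1"
    and sep: "\<And>p q. p \<in> P \<Longrightarrow> q \<in> P \<Longrightarrow> p \<noteq> q \<Longrightarrow> 2 * x \<le> dist p q"
    and d: "DIM('a) = Suc k"
  shows "real (card P) * x ^ k \<le> 2 ^ DIM('a) * real DIM('a)"
proof -
  let ?w = "unit_ball_vol (real DIM('a))"
  let ?d = "DIM('a)"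
  have w: "?w > 0" by (simp add: unit_ball_vol_pos)
  have fm: "cball (0::'a) r \<in> fmeasurable lborel" "ball p r \<in> fmeasurable lborel" for r and p :: 'a
    using emeasure_bounded_finite[OF bounded_cball, of "0::'a" r] emeasure_bounded_finite[OF bounded_ball, of p r]
    by (auto simp: fmeasurable_def)
  have "real (card P) * (?w * x ^ ?d) = (\<Sum>p\<in>P. measure lborel (ball p x))"
    using x by (simp add: content_ball)
  also have "\<dots> = measure lborel (\<Union>p\<in>P. ball p x)"
  proof (rule measure_UNION'[symmetric, OF P(1)])
    show "pairwise (\<lambda>p q. disjnt (ball p x) (ball q x)) P"
    proof (intro pairwiseI)
      fix p q assume "p \<in> P" "q \<in> P" "p \<noteq> q"
      from sep[OF this] show "disjnt (ball p x) (ball q x)"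
        unfolding disjnt_def by (auto) (smt (verit) dist_triangle2 dist_commute)
    qed
  qed (use fm in auto)
  also have "\<dots> \<le> measure lborel (cball (0::'a) (1 + x) - cball 0 (1 - x))"
  proof (rule measure_mono_fmeasurable)
    show "(\<Union>p\<in>P. ball p x) \<subseteq> cball 0 (1 + x) - cball 0 (1 - x)"
    proof
      fix z assume "z \<in> (\<Union>p\<in>P. ball p x)"
      then obtain p where p: "norm p = 1" "dist p z < x" using P by auto
      then show "z \<in> cball 0 (1 + x) - cball 0 (1 - x)"
        using norm_triangle_ineq2[of p z] norm_triangle_ineq2[of z p]
        by (auto simp: dist_norm norm_minus_commute)
    qed
  qed (use fm P in auto)
  also have "\<dots> = measure lborel (cball (0::'a) (1 + x)) - measure lborel (cball (0::'a) (1 - x))"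
    by (rule measurable_measure_Diff) (use fm x in auto)
  also have "\<dots> = ?w * ((1 + x) ^ ?d - (1 - x) ^ ?d)"
    using x by (simp add: content_cball algebra_simps)
  also have "\<dots> \<le> ?w * (2 ^ ?d * real ?d * x)"
  proof (rule mult_left_mono)
    \<comment> \<open>Halving brings both bases down to at most 1, as \<open>norm_power_diff\<close>
      requires.\<close>
    have "norm (((1 + x) / 2) ^ ?d - ((1 - x) / 2) ^ ?d) \<le> real ?d * norm ((1 + x) / 2 - (1 - x) / 2)"
      by (rule norm_power_diff) (use x in auto)
    then have "((1 + x) / 2) ^ ?d - ((1 - x) / 2) ^ ?d \<le> real ?d * x"
      using x by (simp add: field_simps)
    then have "2 ^ ?d * (((1 + x) / 2) ^ ?d - ((1 - x) / 2) ^ ?d) \<le> 2 ^ ?d * (real ?d * x)"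
      by (intro mult_left_mono) auto
    then show "(1 + x) ^ ?d - (1 - x) ^ ?d \<le> 2 ^ ?d * real ?d * x"
      by (simp add: power_divide right_diff_distrib)
  qed (use w in simp)
  finally have "?w * x * (real (card P) * x ^ k) \<le> ?w * x * (2 ^ ?d * real ?d)"
    by (simp add: d ac_simps)
  then show ?thesis using w x by simp
qed

text \<open>A \<open>2 * x\<close>-separated subset of maximal cardinality is also a
  \<open>2 * x\<close>-net. The packing estimate bounds its size, and the balls of radius
  \<open>2 * x\<close> around it cover the sphere.\<close>

lemma hausdorff_outer_sphere_finite:
  assumes d: "DIM('a::euclidean_space) = Suc k"
  shows "hausdorff_outer k (sphere (0::'a) 1) < \<infinity>"
proof -
  let ?S = "sphere (0::'a) 1"
  define B where "B = 2 ^ DIM('a) * real DIM('a)"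
  define v where "v = unit_ball_vol (real k)"
  have main: "hausdorff_pre k (4 * x) ?S \<le> ennreal (B * (v * 2 ^ k))" if x: "0 < x" "x \<le> 1" for x
  proof -
    define Q where "Q P \<longleftrightarrow> finite P \<and> P \<subseteq> ?S \<and> (\<forall>p\<in>P. \<forall>q\<in>P. p \<noteq> q \<longrightarrow> 2 * x \<le> dist p q)" for P
    have bd: "real (card P) * x ^ k \<le> B" if "Q P" for P
      unfolding B_def by (rule card_separated_sphere_le[OF _ _ x _ d]) (use that in \<open>auto simp: Q_def\<close>)
    have "\<exists>P. Q P \<and> (\<forall>P'. Q P' \<longrightarrow> card P' \<le> card P)"
    proof (rule Lattices_Big.ex_has_greatest_nat[of Q "{}" card "Suc (nat \<lceil>B / x ^ k\<rceil>)"])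
      show "Q {}" by (simp add: Q_def)
      show "\<forall>P. Q P \<longrightarrow> card P < Suc (nat \<lceil>B / x ^ k\<rceil>)"
      proof (intro allI impI)
        fix P assume "Q P"
        then have "real (card P) \<le> B / x ^ k" using bd x by (simp add: pos_le_divide_eq)
        then show "card P < Suc (nat \<lceil>B / x ^ k\<rceil>)" by linarith
      qed
    qed
    then obtain P where P: "Q P" and max: "\<And>P'. Q P' \<Longrightarrow> card P' \<le> card P" by blast
    have "?S \<subseteq> (\<Union>p\<in>P. cball p (2 * x))"
    proof
      fix z assume z: "z \<in> ?S"
      show "z \<in> (\<Union>p\<in>P. cball p (2 * x))"
      proof (rule ccontr)
        assume n: "z \<notin> (\<Union>p\<in>P. cball p (2 * x))"
        then have "Q (insert z P)"
          using P z unfolding Q_def by (auto simp: dist_commute not_le less_imp_le)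
        moreover have "z \<notin> P" using n x by force
        ultimately show False using max[of "insert z P"] P by (simp add: Q_def)
      qed
    qed
    then have "hausdorff_pre k (2 * (2 * x)) ?S \<le> ennreal (real (card P) * (unit_ball_vol (real k) * (2 * x) ^ k))"
      using P x by (intro hausdorff_pre_finite_cballs) (auto simp: Q_def)
    also have "\<dots> \<le> ennreal (B * (v * 2 ^ k))"
    proof (rule ennreal_leI)
      have "real (card P) * x ^ k * (v * 2 ^ k) \<le> B * (v * 2 ^ k)"
        using bd[OF P] by (intro mult_right_mono) (auto simp: v_def)
      then show "real (card P) * (unit_ball_vol (real k) * (2 * x) ^ k) \<le> B * (v * 2 ^ k)"
        by (simp add: v_def power_mult_distrib ac_simps)
    qed
    finally show ?thesis by simp
  qed
  have "hausdorff_pre k \<delta> ?S \<le> ennreal (B * (v * 2 ^ k))" if "\<delta> > 0" for \<delta>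
  proof -
    have "hausdorff_pre k \<delta> ?S \<le> hausdorff_pre k (4 * min 1 (\<delta> / 4)) ?S"
      by (rule hausdorff_pre_mono) auto
    also have "\<dots> \<le> ennreal (B * (v * 2 ^ k))" by (rule main) (use that in auto)
    finally show ?thesis .
  qed
  then have "hausdorff_outer k ?S \<le> ennreal (B * (v * 2 ^ k))"
    unfolding hausdorff_outer_def by (intro SUP_least) auto
  also have "\<dots> < \<infinity>" by simp
  finally show ?thesis .
qed

lemma norm_sgn_diff_le:
  fixes x y :: "'a::real_normed_vector"
  assumes y: "y \<noteq> 0"
  shows "norm (sgn x - sgn y) \<le> 2 * norm (x - y) / norm y"
proof -
  \<comment> \<open>Each summand on the right has norm at most \<open>norm (x - y)\<close>, whence
    the factor 2.\<close>
  have "norm y *\<^sub>R (sgn x - sgn y) = (norm y - norm x) *\<^sub>R sgn x + (x - y)"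
    using y by (cases "x = 0") (simp_all add: sgn_div_norm algebra_simps)
  then have "norm y * norm (sgn x - sgn y) = norm ((norm y - norm x) *\<^sub>R sgn x + (x - y))"
    by (metis abs_norm_cancel norm_scaleR)
  also have "\<dots> \<le> norm ((norm y - norm x) *\<^sub>R sgn x) + norm (x - y)" by (rule norm_triangle_ineq)
  also have "norm ((norm y - norm x) *\<^sub>R sgn x) \<le> \<bar>norm y - norm x\<bar>"
    by (simp add: norm_sgn)
  also have "\<bar>norm y - norm x\<bar> \<le> norm (x - y)"
    by (metis norm_minus_commute norm_triangle_ineq3)
  finally show ?thesis using y by (simp add: field_simps)
qed

(* Two measures for which balls of equal radius centred on the sphere have equal mass are
   proportional: integrate f y - f x over the pairs at distance less than r. *)
lemma uniform_measures_compare: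
  fixes \<sigma> \<nu> :: "'a::euclidean_space measure" and f :: "'a \<Rightarrow> real"
  assumes fin: "finite_measure \<sigma>" "finite_measure \<nu>"
    and sets: "sets \<sigma> = sets borel" "sets \<nu> = sets borel"
    and conc: "AE x in \<sigma>. x \<in> S" "AE x in \<nu>. x \<in> S"
    and f [measurable]: "f \<in> borel_measurable borel" and fb: "\<And>x. \<bar>f x\<bar> \<le> B" and f0: "\<And>x. x \<notin> S \<Longrightarrow> f x = 0"
    and g: "\<And>x. x \<in> S \<Longrightarrow> measure \<sigma> (ball x r) = g" and h: "\<And>x. x \<in> S \<Longrightarrow> measure \<nu> (ball x r) = h"
    and \<epsilon>: "\<And>x y. x \<in> S \<Longrightarrow> y \<in> S \<Longrightarrow> dist x y < r \<Longrightarrow> \<bar>f x - f y\<bar> \<le> \<epsilon>" and \<epsilon>0: "\<epsilon> \<ge> 0"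
  shows "\<bar>g * (LINT x|\<nu>. f x) - h * (LINT x|\<sigma>. f x)\<bar> \<le> \<epsilon> * (g * measure \<nu> UNIV)"
proof -
  interpret S: finite_measure \<sigma> by fact
  interpret N: finite_measure \<nu> by fact
  note [measurable_cong] = sets
  have sp: "space \<sigma> = UNIV" "space \<nu> = UNIV" using sets by (simp_all add: sets_eq_imp_space_eq)
  interpret pair_sigma_finite \<sigma> \<nu> ..
  interpret P: finite_measure "\<sigma> \<Otimes>\<^sub>M \<nu>"
    by (rule finite_measure_pair_measure) fact+
  define i where "i x y = (if dist x y < r then 1 else 0 :: real)" for x y :: 'a
  have im [measurable]: "(\<lambda>p. i (fst p) (snd p)) \<in> borel_measurable (\<sigma> \<Otimes>\<^sub>M \<nu>)"
    unfolding i_def by measurable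
  have B: "B \<ge> 0" using fb[of 0] by linarith
  have int: "integrable (\<sigma> \<Otimes>\<^sub>M \<nu>) (\<lambda>p. i (fst p) (snd p))"
    by (rule P.integrable_const_bound[of _ 1]) (auto simp: i_def)
  have int1: "integrable (\<sigma> \<Otimes>\<^sub>M \<nu>) (\<lambda>p. i (fst p) (snd p) * f (snd p))"
    by (rule P.integrable_const_bound[of _ B]) (auto simp: i_def fb B)
  have int2: "integrable (\<sigma> \<Otimes>\<^sub>M \<nu>) (\<lambda>p. i (fst p) (snd p) * f (fst p))"
    by (rule P.integrable_const_bound[of _ B]) (auto simp: i_def fb B)
  have i1: "(LINT x|\<sigma>. i x y) = measure \<sigma> (ball y r)" for y
  proof -
    have "(LINT x|\<sigma>. i x y) = (LINT x|\<sigma>. indicator (ball y r) x)"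
      by (intro Bochner_Integration.integral_cong) (auto simp: i_def indicator_def dist_commute)
    then show ?thesis by (simp add: sets)
  qed
  have i2: "(LINT y|\<nu>. i x y) = measure \<nu> (ball x r)" for x
  proof -
    have "(LINT y|\<nu>. i x y) = (LINT y|\<nu>. indicator (ball x r) y)"
      by (intro Bochner_Integration.integral_cong) (auto simp: i_def indicator_def)
    then show ?thesis by (simp add: sets)
  qed
  \<comment> \<open>Integrating out the variable that does not occur in \<open>f\<close> leaves the
    mass of a ball centred at the other one; where that centre is off \<open>S\<close>,
    \<open>f\<close> vanishes.\<close>
  have X1: "(LINT p|(\<sigma> \<Otimes>\<^sub>M \<nu>). i (fst p) (snd p) * f (snd p)) = g * (LINT x|\<nu>. f x)"
  proof -
    have "(LINT p|(\<sigma> \<Otimes>\<^sub>M \<nu>). i (fst p) (snd p) * f (snd p)) = (LINT y|\<nu>. (LINT x|\<sigma>. i x y * f y))"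
      using integral_snd[of "\<lambda>x y. i x y * f y"] int1 by (simp add: case_prod_unfold)
    also have "\<dots> = (LINT y|\<nu>. g * f y)"
    proof (intro Bochner_Integration.integral_cong refl)
      fix y show "(LINT x|\<sigma>. i x y * f y) = g * f y"
        using i1[of y] g[of y] f0[of y] by (cases "y \<in> S") simp_all
    qed
    finally show ?thesis by simp
  qed
  have X2: "(LINT p|(\<sigma> \<Otimes>\<^sub>M \<nu>). i (fst p) (snd p) * f (fst p)) = h * (LINT x|\<sigma>. f x)"
  proof -
    have "(LINT p|(\<sigma> \<Otimes>\<^sub>M \<nu>). i (fst p) (snd p) * f (fst p)) = (LINT x|\<sigma>. (LINT y|\<nu>. i x y * f x))"
      using integral_fst[of "\<lambda>x y. i x y * f x"] int2 by (simp add: case_prod_unfold)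
    also have "\<dots> = (LINT x|\<sigma>. h * f x)"
    proof (intro Bochner_Integration.integral_cong refl)
      fix x show "(LINT y|\<nu>. i x y * f x) = h * f x"
        using i2[of x] h[of x] f0[of x] by (cases "x \<in> S") simp_all
    qed
    finally show ?thesis by simp
  qed
  have X3: "(LINT p|(\<sigma> \<Otimes>\<^sub>M \<nu>). i (fst p) (snd p)) = g * measure \<nu> UNIV"
  proof -
    have "(LINT p|(\<sigma> \<Otimes>\<^sub>M \<nu>). i (fst p) (snd p)) = (LINT y|\<nu>. (LINT x|\<sigma>. i x y))"
      using integral_snd[of "\<lambda>x y. i x y"] int by (simp add: case_prod_unfold)
    also have "\<dots> = (LINT y|\<nu>. g)"
    proof (rule integral_cong_AE)
      show "(\<lambda>y. LINT x|\<sigma>. i x y) \<in> borel_measurable \<nu>" unfolding i_def by measurable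
      show "AE y in \<nu>. (LINT x|\<sigma>. i x y) = g"
        unfolding i1 using conc(2) by eventually_elim (rule g)
    qed simp
    finally show ?thesis by (simp add: sp)
  qed
  have aeS: "AE p in \<sigma> \<Otimes>\<^sub>M \<nu>. fst p \<in> S" "AE p in \<sigma> \<Otimes>\<^sub>M \<nu>. snd p \<in> S"
  proof -
    from conc(1) obtain N1 where N1: "{x \<in> space \<sigma>. x \<notin> S} \<subseteq> N1" "emeasure \<sigma> N1 = 0" "N1 \<in> sets \<sigma>" by (rule AE_E)
    from conc(2) obtain N2 where N2: "{x \<in> space \<nu>. x \<notin> S} \<subseteq> N2" "emeasure \<nu> N2 = 0" "N2 \<in> sets \<nu>" by (rule AE_E)
    show "AE p in \<sigma> \<Otimes>\<^sub>M \<nu>. fst p \<in> S"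
      by (rule AE_I[of _ _ "N1 \<times> UNIV"])
        (use N1 sp sets in \<open>auto simp: N.emeasure_pair_measure_Times space_pair_measure\<close>)
    show "AE p in \<sigma> \<Otimes>\<^sub>M \<nu>. snd p \<in> S"
      by (rule AE_I[of _ _ "UNIV \<times> N2"])
        (use N2 sp sets in \<open>auto simp: N.emeasure_pair_measure_Times space_pair_measure\<close>)
  qed
  have "\<bar>g * (LINT x|\<nu>. f x) - h * (LINT x|\<sigma>. f x)\<bar>
     = norm (LINT p|(\<sigma> \<Otimes>\<^sub>M \<nu>). i (fst p) (snd p) * f (snd p) - i (fst p) (snd p) * f (fst p))"
    using int1 int2 by (simp add: X1 X2)
  also have "\<dots> \<le> (LINT p|(\<sigma> \<Otimes>\<^sub>M \<nu>). \<epsilon> * i (fst p) (snd p))"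
  proof (rule order_trans[OF integral_norm_bound integral_mono_AE])
    show "integrable (\<sigma> \<Otimes>\<^sub>M \<nu>) (\<lambda>p. \<epsilon> * i (fst p) (snd p))" using int by simp
    show "integrable (\<sigma> \<Otimes>\<^sub>M \<nu>) (\<lambda>p. norm (i (fst p) (snd p) * f (snd p) - i (fst p) (snd p) * f (fst p)))"
      using int1 int2 by simp
    show "AE p in \<sigma> \<Otimes>\<^sub>M \<nu>. norm (i (fst p) (snd p) * f (snd p) - i (fst p) (snd p) * f (fst p)) \<le> \<epsilon> * i (fst p) (snd p)"
      using aeS
    proof eventually_elim
      case (elim p)
      then show ?case using \<epsilon>[of "fst p" "snd p"] by (auto simp: i_def abs_minus_commute)
    qed
  qed
  also have "\<dots> = \<epsilon> * (g * measure \<nu> UNIV)" by (simp add: X3)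
  finally show ?thesis .
qed

lemma measure_cone_ball_pos:
  fixes \<xi> :: "'a::euclidean_space"
  assumes \<xi>: "norm \<xi> = 1" and r: "r > 0"
  shows "measure cone_measure (ball \<xi> r) > 0"
proof -
  \<comment> \<open>On the ball of radius \<open>t\<close> around \<open>\<xi> /\<^sub>R 2\<close>
    the direction differs from \<open>\<xi>\<close> by less than \<open>4 * t\<close>, by
    \<open>norm_sgn_diff_le\<close>; the bound \<open>1/4\<close> keeps that ball inside the unit
    ball.\<close>
  define t where "t = min (1/4) (r / 8)"
  have t: "0 < t" "t \<le> 1/4" "4 * t < r" using r by (auto simp: t_def min_def)
  have sub: "ball (\<xi> /\<^sub>R 2) t \<subseteq> cball 0 1 \<inter> sgn -` ball \<xi> r"
  proof
    fix z assume "z \<in> ball (\<xi> /\<^sub>R 2) t"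
    then have z: "norm (z - \<xi> /\<^sub>R 2) < t" by (simp add: dist_norm norm_minus_commute)
    have "norm z \<le> norm (\<xi> /\<^sub>R 2) + norm (z - \<xi> /\<^sub>R 2)" by (metis add.commute diff_add_cancel norm_triangle_ineq)
    then have 1: "norm z \<le> 1" using z t \<xi> by simp
    have "\<xi> \<noteq> 0" using \<xi> by auto
    have "sgn (\<xi> /\<^sub>R 2) = \<xi>" using \<xi> by (simp add: sgn_div_norm)
    then have "norm (sgn z - \<xi>) \<le> 2 * norm (z - \<xi> /\<^sub>R 2) / norm (\<xi> /\<^sub>R 2)"
      using norm_sgn_diff_le[of "\<xi> /\<^sub>R 2" z] \<xi> \<open>\<xi> \<noteq> 0\<close> by simp
    also have "\<dots> = 4 * norm (z - \<xi> /\<^sub>R 2)" using \<xi> by simp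
    also have "\<dots> < r" using z t by linarith
    finally show "z \<in> cball 0 1 \<inter> sgn -` ball \<xi> r" using 1 by (simp add: dist_norm norm_minus_commute)
  qed
  have "0 < emeasure lborel (ball (\<xi> /\<^sub>R 2) t)"
    using t by (simp add: emeasure_ball unit_ball_vol_pos)
  also have "\<dots> \<le> emeasure lborel (cball 0 1 \<inter> sgn -` ball \<xi> r)"
    using measurable_sets[OF borel_measurable_sgn_vec, of "ball \<xi> r"] by (intro emeasure_mono[OF sub]) auto
  also have "\<dots> = emeasure cone_measure (ball \<xi> r)" by (simp add: emeasure_cone_measure)
  finally have "0 < emeasure cone_measure (ball \<xi> r)" .
  moreover have "emeasure cone_measure (ball \<xi> r) < \<infinity>"
    using finite_cone_measure emeasure_mono[of "ball \<xi> r" UNIV cone_measure] by (auto intro: le_less_trans)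
  ultimately show ?thesis by (simp add: measure_def enn2real_positive_iff)
qed

lemma orthogonal_transformation_sgn:
  assumes "orthogonal_transformation T"
  shows "sgn (T z) = T (sgn z)"
  using assms by (simp add: sgn_div_norm orthogonal_transformation_norm orthogonal_transformation_linear
      linear_scale)

text \<open>An orthogonal map carries \<open>\<xi>\<close> to \<open>\<xi>'\<close>, commutes with
  \<open>sgn\<close> and preserves both Lebesgue measure and the unit ball.\<close>

lemma measure_cone_ball_eq:
  fixes \<xi> \<xi>' :: "real ^ 'n"
  assumes "norm \<xi> = 1" "norm \<xi>' = 1"
  shows "measure cone_measure (ball \<xi> r) = measure cone_measure (ball \<xi>' r)"
proof -
  obtain T where T: "orthogonal_transformation T" "T \<xi> = \<xi>'"
    using orthogonal_transformation_exists[of \<xi> \<xi>'] assms by auto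
  have Tm [measurable]: "T \<in> borel_measurable borel"
    using linear_continuous_on[OF linear_conv_bounded_linear[THEN iffD1, OF orthogonal_transformation_linear[OF T(1)]]]
    by (intro borel_measurable_continuous_onI) simp
  have iso: "dist (T x) (T y) = dist x y" for x y
    using T(1) by (simp add: orthogonal_transformation_isometry)
  have sb [measurable]: "sgn -` ball \<zeta> r \<in> sets borel" for \<zeta> :: "real ^ 'n"
    using measurable_sets[OF borel_measurable_sgn_vec, of "ball \<zeta> r"] by simp
  have "emeasure lborel (cball 0 1 \<inter> sgn -` ball \<xi>' r) = emeasure (distr lborel borel T) (cball 0 1 \<inter> sgn -` ball \<xi>' r)"
    by (simp add: lborel_distr_orthogonal[OF T(1)])
  also have "\<dots> = emeasure lborel (T -` (cball 0 1 \<inter> sgn -` ball \<xi>' r))"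
    by (subst emeasure_distr) simp_all
  also have "T -` (cball 0 1 \<inter> sgn -` ball \<xi>' r) = cball 0 1 \<inter> sgn -` ball \<xi> r"
    using iso by (auto simp: T(2)[symmetric] orthogonal_transformation_sgn[OF T(1)] orthogonal_transformation_norm[OF T(1)])
  finally show ?thesis by (simp add: emeasure_cone_measure measure_def)
qed

lemma hausdorff_sphere_ball_eq:
  fixes \<xi> \<xi>' :: "real ^ 'n"
  assumes "norm \<xi> = 1" "norm \<xi>' = 1"
  shows "hausdorff_outer k (ball \<xi> r \<inter> sphere 0 1) = hausdorff_outer k (ball \<xi>' r \<inter> sphere 0 1)"
proof -
  obtain T where T: "orthogonal_transformation T" "T \<xi> = \<xi>'"
    using orthogonal_transformation_exists[of \<xi> \<xi>'] assms by auto
  have iso: "dist (T x) (T y) = dist x y" for x y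
    using T(1) by (simp add: orthogonal_transformation_isometry)
  have "T ` (ball \<xi> r \<inter> sphere 0 1) = T ` ball \<xi> r \<inter> T ` sphere 0 1"
    by (rule image_Int[OF orthogonal_transformation_inj[OF T(1)]])
  also have "T ` ball \<xi> r = ball \<xi>' r"
    using image_orthogonal_transformation_ball[OF T(1)] T(2) by simp
  also have "T ` sphere 0 1 = sphere 0 1"
  proof -
    have "T ` sphere 0 1 = T ` (cball 0 1 - ball 0 1)" by (rule arg_cong[where f = "image T"]) auto
    also have "\<dots> = T ` cball 0 1 - T ` ball 0 1"
      by (rule image_set_diff[OF orthogonal_transformation_inj[OF T(1)]])
    also have "\<dots> = sphere 0 1"
      using T(1) by (auto simp: image_orthogonal_transformation_ball image_orthogonal_transformation_cball
          orthogonal_transformation_isometry)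
    finally show ?thesis .
  qed
  finally have "T ` (ball \<xi> r \<inter> sphere 0 1) = ball \<xi>' r \<inter> sphere 0 1" .
  then show ?thesis
    using hausdorff_outer_isometry[OF iso orthogonal_transformation_bij[OF T(1)], of k "ball \<xi> r \<inter> sphere 0 1"] by simp
qed

text \<open>Nothing is known about \<open>f\<close> off the sphere, and \<open>sgn\<close> leaves
  the sphere only at 0; so the origin is split off.\<close>

lemma borel_measurable_comp_sgn:
  fixes f :: "'a::euclidean_space \<Rightarrow> real"
  assumes "continuous_on (sphere 0 1) f"
  shows "(\<lambda>z. f (sgn z)) \<in> borel_measurable borel"
proof -
  have [measurable]: "(\<lambda>x. indicator (sphere 0 1) x *\<^sub>R f x) \<in> borel_measurable borel"
    by (rule borel_measurable_continuous_on_indicator) (use assms in auto)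
  have "(\<lambda>z. indicator {0} z * f 0 + (\<lambda>x. indicator (sphere 0 1) x *\<^sub>R f x) (sgn z)) \<in> borel_measurable borel"
    by measurable
  moreover have "(\<lambda>z. indicator {0} z * f 0 + (\<lambda>x. indicator (sphere 0 1) x *\<^sub>R f x) (sgn z)) = (\<lambda>z. f (sgn z))"
    by (auto simp: fun_eq_iff norm_sgn indicator_def)
  ultimately show ?thesis by simp
qed

text \<open>Let \<open>g r\<close> and \<open>h r\<close> be the masses that the two measures give
  to balls of radius \<open>r\<close> centred on the sphere. By
  \<open>uniform_measures_compare\<close>, \<open>g r\<close> times one integral and
  \<open>h r\<close> times the other differ by a small multiple of \<open>g r\<close>. The constant
  function has no oscillation and determines \<open>h r / g r\<close> exactly, the same for all
  \<open>r > 0\<close>; division by \<open>g r\<close> leaves an arbitrarily small error.\<close>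

theorem sphere_integral_eq_cone:
  assumes n: "CARD('n::finite) \<ge> 2"
  obtains c where "c > 0" and "\<And>f :: real ^ 'n \<Rightarrow> real. continuous_on (sphere 0 1) f \<Longrightarrow>
    sphere_integral f = c * (LINT z:cball 0 1|lborel. f (sgn z))"
proof -
  define k where "k = CARD('n) - 1"
  have d: "DIM(real ^ 'n) = Suc k" and k: "k \<ge> 1" using n by (simp_all add: k_def)
  let ?S = "sphere (0 :: real ^ 'n) 1"
  define \<nu> where "\<nu> = density (hausdorff k :: (real ^ 'n) measure) (indicator ?S)"
  define \<sigma> where "\<sigma> = (cone_measure :: (real ^ 'n) measure)"
  have sets [measurable_cong]: "sets \<sigma> = sets borel" "sets \<nu> = sets borel" by (simp_all add: \<sigma>_def \<nu>_def)
  have sp: "space \<sigma> = UNIV" "space \<nu> = UNIV" by (simp_all add: \<sigma>_def \<nu>_def)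
  have em: "emeasure \<nu> A = hausdorff_outer k (A \<inter> ?S)" if [measurable]: "A \<in> sets borel" for A
    unfolding \<nu>_def by (subst emeasure_density)
      (simp_all add: indicator_inter_arith[symmetric] emeasure_hausdorff Int_commute)
  have fin: "finite_measure \<sigma>" "finite_measure \<nu>"
    by (rule finite_measureI; use finite_cone_measure[where 'a = "real ^ 'n"] hausdorff_outer_sphere_finite[OF d] in \<open>simp add: \<sigma>_def sp less_top\<close>)
       (rule finite_measureI; use hausdorff_outer_sphere_finite[OF d] in \<open>simp add: em sp less_top\<close>)
  have conc: "AE x in \<sigma>. x \<in> ?S" "AE x in \<nu>. x \<in> ?S"
  proof -
    show "AE x in \<sigma>. x \<in> ?S"
    proof -
      have "AE z in lborel. 0 < (indicator (cball (0 :: real ^ 'n) 1) z :: ennreal) \<longrightarrow> sgn z \<in> ?S"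
        using AE_lborel_singleton[of "0 :: real ^ 'n"] by eventually_elim (simp add: norm_sgn)
      then have "AE z in density lborel (indicator (cball (0 :: real ^ 'n) 1)). sgn z \<in> ?S"
        by (subst AE_density) simp_all
      then show ?thesis
        unfolding \<sigma>_def cone_measure_def by (subst AE_distr_iff) simp_all
    qed
    show "AE x in \<nu>. x \<in> ?S" unfolding \<nu>_def
      by (subst AE_density) (auto intro!: AE_I2 simp: indicator_def split: if_splits)
  qed
  obtain p :: "real ^ 'n" where p: "norm p = 1" using vector_choose_size[of 1] by auto
  define g where "g r = measure \<sigma> (ball p r)" for r
  define h where "h r = measure \<nu> (ball p r)" for r
  have g: "measure \<sigma> (ball x r) = g r" if "x \<in> ?S" for x r
    unfolding g_def \<sigma>_def using measure_cone_ball_eq[of x p r] that p by simp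
  have h: "measure \<nu> (ball x r) = h r" if "x \<in> ?S" for x r
    unfolding h_def measure_def using hausdorff_sphere_ball_eq[of x p k r] that p by (simp add: em)
  have gpos: "g r > 0" if "r > 0" for r
    unfolding g_def \<sigma>_def by (rule measure_cone_ball_pos[OF p that])
  have N: "measure \<nu> UNIV > 0"
    using hausdorff_outer_sphere_pos[OF d k] hausdorff_outer_sphere_finite[OF d]
    by (simp add: measure_def em enn2real_positive_iff)
  have intN: "(LINT x|\<nu>. indicator ?S x * f x) = sphere_integral f" if "continuous_on ?S f" for f
  proof -
    have "(\<lambda>x. indicator ?S x *\<^sub>R f x) \<in> borel_measurable borel"
      by (rule borel_measurable_continuous_on_indicator) (use that in auto)
    then have [measurable]: "(\<lambda>x. indicator ?S x * f x) \<in> borel_measurable borel" by simp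
    have e: "(indicator ?S :: real ^ 'n \<Rightarrow> ennreal) = (\<lambda>x. ennreal (indicator ?S x))"
      by (auto simp: indicator_def)
    have "(LINT x|\<nu>. indicator ?S x *\<^sub>R f x) = (LINT x|hausdorff k. indicator ?S x *\<^sub>R (indicator ?S x *\<^sub>R f x))"
      unfolding \<nu>_def e by (subst integral_density) simp_all
    also have "\<dots> = sphere_integral f"
      unfolding sphere_integral_def set_lebesgue_integral_def k_def
      by (intro Bochner_Integration.integral_cong) (auto simp: indicator_def)
    finally show ?thesis by simp
  qed
  have intS: "(LINT x|\<sigma>. indicator ?S x * f x) = (LINT z:cball 0 1|lborel. f (sgn z))" if "continuous_on ?S f" for f :: "real ^ 'n \<Rightarrow> real"
  proof -
    have "(\<lambda>x. indicator ?S x *\<^sub>R f x) \<in> borel_measurable borel"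
      by (rule borel_measurable_continuous_on_indicator) (use that in auto)
    then have [measurable]: "(\<lambda>x. indicator ?S x * f x) \<in> borel_measurable borel" by simp
    have "(LINT x|\<sigma>. indicator ?S x *\<^sub>R f x) = (LINT z:cball 0 1|lborel. indicator ?S (sgn z) *\<^sub>R f (sgn z))"
      unfolding \<sigma>_def by (rule integral_cone_measure) simp
    also have "\<dots> = (LINT z:cball 0 1|lborel. f (sgn z))"
    proof -
      note borel_measurable_comp_sgn[OF that, measurable]
      show ?thesis
        unfolding set_lebesgue_integral_def
      proof (rule integral_cong_AE)
        show "AE z in lborel. indicator (cball 0 1) z *\<^sub>R (indicator ?S (sgn z) *\<^sub>R f (sgn z)) = indicator (cball 0 1) z *\<^sub>R f (sgn z)"
          using AE_lborel_singleton[of "0 :: real ^ 'n"] by eventually_elim (simp add: norm_sgn)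
      qed measurable
    qed
    finally show ?thesis by simp
  qed
  have key: "\<bar>g r * sphere_integral f - h r * (LINT z:cball 0 1|lborel. f (sgn z))\<bar> \<le> \<epsilon> * (g r * measure \<nu> UNIV)"
    if f: "continuous_on ?S f" and \<epsilon>: "\<And>x y. x \<in> ?S \<Longrightarrow> y \<in> ?S \<Longrightarrow> dist x y < r \<Longrightarrow> \<bar>f x - f y\<bar> \<le> \<epsilon>" "\<epsilon> \<ge> 0" for f r \<epsilon>
  proof -
    have "bounded (f ` ?S)" by (intro compact_imp_bounded compact_continuous_image f compact_sphere)
    then obtain B where "B > 0" and B0: "\<forall>y\<in>f ` ?S. norm y \<le> B" unfolding bounded_pos by blast
    have B: "\<bar>f x\<bar> \<le> B" if "x \<in> ?S" for x using B0 imageI[OF that, of f] by fastforce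
    have "(\<lambda>x. indicator ?S x *\<^sub>R f x) \<in> borel_measurable borel"
      by (rule borel_measurable_continuous_on_indicator) (use f in auto)
    then have m: "(\<lambda>x. indicator ?S x * f x) \<in> borel_measurable borel" by simp
    have "\<bar>g r * (LINT x|\<nu>. indicator ?S x * f x) - h r * (LINT x|\<sigma>. indicator ?S x * f x)\<bar> \<le> \<epsilon> * (g r * measure \<nu> UNIV)"
    proof (rule uniform_measures_compare[OF fin sets conc m])
      show "\<bar>indicator ?S x * f x\<bar> \<le> B" for x using B[of x] \<open>B > 0\<close> by (cases "x \<in> ?S") simp_all
    qed (use g h \<epsilon> in auto)
    then show ?thesis by (simp only: intN[OF f] intS[OF f])
  qed
  define a where "a = (LINT z:cball 0 1|lborel. (\<lambda>_. 1 :: real) (sgn (z :: real ^ 'n)))"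
  have a: "a > 0"
  proof -
    have "a = measure lborel (cball (0 :: real ^ 'n) 1)"
      by (simp add: a_def set_lebesgue_integral_def)
    then show ?thesis by (simp add: content_cball unit_ball_vol_pos)
  qed
  have one: "g r * measure \<nu> UNIV = h r * a" for r
  proof -
    have "sphere_integral (\<lambda>_ :: real ^ 'n. 1) = measure \<nu> UNIV"
    proof -
      have "sphere_integral (\<lambda>_ :: real ^ 'n. 1) = (LINT x|\<nu>. indicator ?S x * 1)"
        by (rule intN[symmetric]) simp
      also have "\<dots> = (LINT x|\<nu>. 1)"
        by (intro integral_cong_AE) (use conc(2) in auto)
      finally show ?thesis by (simp add: sp)
    qed
    then show ?thesis using key[of "\<lambda>_. 1" r 0] by (simp add: a_def)
  qed
  show thesis
  proof
    show "measure \<nu> UNIV / a > 0" using N a by simp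
    fix f :: "real ^ 'n \<Rightarrow> real" assume f: "continuous_on ?S f"
    let ?I = "LINT z:cball 0 1|lborel. f (sgn z)"
    have uc: "uniformly_continuous_on ?S f" by (rule compact_uniformly_continuous[OF f]) simp
    have "\<bar>sphere_integral f - measure \<nu> UNIV / a * ?I\<bar> \<le> 0 + e" if e: "e > 0" for e
    proof -
      define \<epsilon> where "\<epsilon> = e / measure \<nu> UNIV"
      have \<epsilon>: "\<epsilon> > 0" "\<epsilon> * measure \<nu> UNIV = e" using e N by (auto simp: \<epsilon>_def)
      obtain r where r: "r > 0" "\<And>x y. x \<in> ?S \<Longrightarrow> y \<in> ?S \<Longrightarrow> dist x y < r \<Longrightarrow> dist (f x) (f y) < \<epsilon>"
        using uc \<epsilon>(1) unfolding uniformly_continuous_on_def by (metis dist_commute)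
      have gr: "g r > 0" by (rule gpos[OF r(1)])
      have "\<bar>g r * sphere_integral f - h r * ?I\<bar> \<le> \<epsilon> * (g r * measure \<nu> UNIV)"
        by (rule key[OF f]) (use r(2) \<epsilon>(1) in \<open>auto simp: dist_real_def less_imp_le\<close>)
      also have "h r = g r * (measure \<nu> UNIV / a)" using one[of r] a by (simp add: field_simps)
      finally have *: "\<bar>g r * sphere_integral f - g r * (measure \<nu> UNIV / a) * ?I\<bar> \<le> \<epsilon> * (g r * measure \<nu> UNIV)" .
      have "\<bar>g r * (sphere_integral f - measure \<nu> UNIV / a * ?I)\<bar> \<le> g r * e"
      proof -
        have "\<epsilon> * (g r * measure \<nu> UNIV) = g r * e" by (simp add: \<epsilon>(2)[symmetric])
        with * show ?thesis by (simp only: right_diff_distrib mult.assoc)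
      qed
      then have "g r * \<bar>sphere_integral f - measure \<nu> UNIV / a * ?I\<bar> \<le> g r * e"
        using gr by (simp add: abs_mult)
      then show ?thesis using gr by simp
    qed
    then have "\<bar>sphere_integral f - measure \<nu> UNIV / a * ?I\<bar> \<le> 0" by (rule field_le_epsilon)
    then show "sphere_integral f = measure \<nu> UNIV / a * ?I" by simp
  qed
qed

section \<open>Kernel estimates on grids\<close>

lemma has_bochner_integral_inverse_power:
  fixes u :: "'a::euclidean_space"
  assumes d: "DIM('a) = Suc (Suc m)" and R: "R \<ge> 0"
  shows "has_bochner_integral lborel (\<lambda>w. indicator (cball u R) w *\<^sub>R (1 / norm (u - w) ^ m))
      (real DIM('a) * R\<^sup>2 / 2 * unit_ball_vol (real DIM('a)))"
    and "has_bochner_integral lborel (\<lambda>w. indicator (cball u R) w *\<^sub>R (1 / norm (u - w) ^ Suc m))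
      (real DIM('a) * R * unit_ball_vol (real DIM('a)))"
proof -
  have trans: "(\<integral>\<^sup>+w. ennreal (indicator (cball u R) w *\<^sub>R (1 / norm (u - w) ^ p)) \<partial>lborel)
     = (\<integral>\<^sup>+z. ennreal (1 / norm (z::'a) ^ p) * indicator (cball 0 R) z \<partial>lborel)" for p
  proof -
    have "(\<integral>\<^sup>+w. ennreal (indicator (cball u R) w *\<^sub>R (1 / norm (u - w) ^ p)) \<partial>lborel)
      = (\<integral>\<^sup>+z. ennreal (indicator (cball u R) (u + 1 *\<^sub>R z) *\<^sub>R (1 / norm (u - (u + 1 *\<^sub>R z)) ^ p)) \<partial>lborel)"
      by (subst nn_integral_lborel_affine[of _ 1 u]) simp_all
    also have "\<dots> = (\<integral>\<^sup>+z. ennreal (1 / norm (z::'a) ^ p) * indicator (cball 0 R) z \<partial>lborel)"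
      by (intro nn_integral_cong) (simp add: indicator_def dist_norm)
    finally show ?thesis .
  qed
  have v: "emeasure lborel (cball (0::'a) 1) = ennreal (unit_ball_vol (real DIM('a)))"
    by (simp add: emeasure_cball)
  show "has_bochner_integral lborel (\<lambda>w. indicator (cball u R) w *\<^sub>R (1 / norm (u - w) ^ m))
      (real DIM('a) * R\<^sup>2 / 2 * unit_ball_vol (real DIM('a)))"
    by (rule has_bochner_integral_nn_integral)
       (use R in \<open>simp_all only: trans nn_integral_inverse_power_cball(1)[OF R d] v, simp_all add: ennreal_mult'[symmetric] unit_ball_vol_nonneg\<close>)
  show "has_bochner_integral lborel (\<lambda>w. indicator (cball u R) w *\<^sub>R (1 / norm (u - w) ^ Suc m))
      (real DIM('a) * R * unit_ball_vol (real DIM('a)))"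
    by (rule has_bochner_integral_nn_integral)
       (use R in \<open>simp_all only: trans nn_integral_inverse_power_cball(2)[OF R d] v, simp_all add: ennreal_mult'[symmetric] unit_ball_vol_nonneg\<close>)
qed

lemma inverse_power_set_integral:
  fixes u :: "'a::euclidean_space"
  assumes d: "DIM('a) = Suc (Suc m)" and R: "R \<ge> 0" and S: "S \<in> sets borel" "S \<subseteq> cball u R"
  shows "set_integrable lborel S (\<lambda>w. 1 / norm (u - w) ^ m)"
    and "(LINT w:S|lborel. 1 / norm (u - w) ^ m) \<le> real DIM('a) * R\<^sup>2 / 2 * unit_ball_vol (real DIM('a))"
    and "set_integrable lborel S (\<lambda>w. 1 / norm (u - w) ^ Suc m)"
    and "(LINT w:S|lborel. 1 / norm (u - w) ^ Suc m) \<le> real DIM('a) * R * unit_ball_vol (real DIM('a))"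
proof -
  have gen: "set_integrable lborel S f \<and> (LINT w:S|lborel. f w) \<le> c"
    if h: "has_bochner_integral lborel (\<lambda>w. indicator (cball u R) w *\<^sub>R f w) c" and pos: "\<And>w. f w \<ge> 0" for f :: "'a \<Rightarrow> real" and c
  proof
    have int: "set_integrable lborel (cball u R) f" unfolding set_integrable_def using h by (rule integrable.intros)
    show "set_integrable lborel S f"
      by (rule set_integrable_subset[OF int]) (use S in auto)
    have "(LINT w:S|lborel. f w) \<le> (LINT w:cball u R|lborel. f w)"
      unfolding set_lebesgue_integral_def using int \<open>set_integrable lborel S f\<close> S pos
      by (intro integral_mono) (auto simp: set_integrable_def indicator_def)
    also have "\<dots> = c" using has_bochner_integral_integral_eq[OF h] by (simp add: set_lebesgue_integral_def)
    finally show "(LINT w:S|lborel. f w) \<le> c" .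
  qed
  note 1 = gen[OF has_bochner_integral_inverse_power(1)[OF d R]]
    and 2 = gen[OF has_bochner_integral_inverse_power(2)[OF d R]]
  show "set_integrable lborel S (\<lambda>w. 1 / norm (u - w) ^ m)"
    "(LINT w:S|lborel. 1 / norm (u - w) ^ m) \<le> real DIM('a) * R\<^sup>2 / 2 * unit_ball_vol (real DIM('a))"
    using 1 by auto
  show "set_integrable lborel S (\<lambda>w. 1 / norm (u - w) ^ Suc m)"
    "(LINT w:S|lborel. 1 / norm (u - w) ^ Suc m) \<le> real DIM('a) * R * unit_ball_vol (real DIM('a))"
    using 2 by auto
qed

section \<open>Size and regularity of the kernel\<close>

lemma homogeneous_kernel_sgn: "homogeneous_kernel m \<Omega> z = \<Omega> (sgn z) / norm z ^ m"
  by (simp add: homogeneous_kernel_def sgn_div_norm)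

lemma homogeneous_kernel_scale:
  assumes "r > 0"
  shows "homogeneous_kernel m \<Omega> (r *\<^sub>R z) = homogeneous_kernel m \<Omega> z / r ^ m"
  using assms by (simp add: homogeneous_kernel_sgn sgn_scaleR power_mult_distrib)

lemma homogeneous_kernel_bound:
  assumes M: "\<And>\<xi>. norm \<xi> = 1 \<Longrightarrow> \<bar>\<Omega> \<xi>\<bar> \<le> M" and m: "m \<ge> 1"
  shows "\<bar>homogeneous_kernel m \<Omega> z\<bar> \<le> M / norm z ^ m"
proof (cases "z = 0")
  \<comment> \<open>For \<open>m \<ge> 1\<close> both sides are 0, by division by 0.\<close>
  case True then show ?thesis using m by (simp add: homogeneous_kernel_sgn power_0_left)
next
  case False
  then have "\<bar>\<Omega> (sgn z)\<bar> \<le> M" using M by (simp add: norm_sgn)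
  then show ?thesis by (simp add: homogeneous_kernel_sgn divide_right_mono)
qed

lemma power_diff_one_le:
  fixes t :: real
  assumes "0 \<le> t" "t \<le> R" "1 \<le> R"
  shows "\<bar>t ^ m - 1\<bar> \<le> real m * R ^ m * \<bar>t - 1\<bar>"
proof -
  have "norm ((t / R) ^ m - (1 / R) ^ m) \<le> real m * norm (t / R - 1 / R)"
    by (rule norm_power_diff) (use assms in auto)
  then have "\<bar>t ^ m - 1\<bar> / R ^ m \<le> real m * (\<bar>t - 1\<bar> / R)"
    using assms by (simp add: power_divide diff_divide_distrib[symmetric])
  also have "\<dots> \<le> real m * \<bar>t - 1\<bar>"
    using assms mult_left_mono[of 1 R "\<bar>t - 1\<bar>"] by (intro mult_left_mono) (auto simp: divide_le_eq)
  finally show ?thesis using assms by (simp add: field_simps)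
qed

text \<open>The difference splits into a change of direction, controlled by the Hoelder condition
  because \<open>sgn\<close> is Lipschitz away from 0, and a change of modulus through
  \<open>t = norm z' / norm z\<close>, which is Lipschitz in the relative distance \<open>s\<close>.
  The constants \<open>R\<close> and \<open>L\<close> say that the two moduli are
  comparable.\<close>

lemma homogeneous_kernel_holder:
  fixes z z' :: "'a::real_normed_vector"
  assumes M: "\<And>\<xi>. norm \<xi> = 1 \<Longrightarrow> \<bar>\<Omega> \<xi>\<bar> \<le> M"
    and H: "\<And>\<xi> \<eta>. norm \<xi> = 1 \<Longrightarrow> norm \<eta> = 1 \<Longrightarrow> \<bar>\<Omega> \<xi> - \<Omega> \<eta>\<bar> \<le> C * norm (\<xi> - \<eta>) powr \<alpha>"
    and \<alpha>: "0 < \<alpha>" "\<alpha> \<le> 1" and C: "C \<ge> 0" and z: "z \<noteq> 0" "z' \<noteq> 0"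
    and R: "norm z' \<le> R * norm z" "1 \<le> R" and L: "norm (z - z') \<le> L * norm z'" "1 \<le> L"
  shows "\<bar>homogeneous_kernel m \<Omega> z - homogeneous_kernel m \<Omega> z'\<bar>
    \<le> (2 * C + M * real m * R ^ Suc m * L) * (norm (z - z') / norm z') powr \<alpha> / norm z' ^ m"
proof -
  define s where "s = norm (z - z') / norm z'"
  define t where "t = norm z' / norm z"
  have nz: "norm z > 0" "norm z' > 0" using z by auto
  have s: "0 \<le> s" "s \<le> L" using L nz by (auto simp: s_def pos_divide_le_eq)
  have t: "0 \<le> t" "t \<le> R" using R nz by (auto simp: t_def pos_divide_le_eq)
  have M0: "M \<ge> 0" using M[of "sgn z"] z by (simp add: norm_sgn)
  have K: "homogeneous_kernel m \<Omega> z - homogeneous_kernel m \<Omega> z'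
     = (\<Omega> (sgn z) * (t ^ m - 1) + (\<Omega> (sgn z) - \<Omega> (sgn z'))) / norm z' ^ m"
    using nz by (simp add: homogeneous_kernel_sgn t_def field_simps power_divide)
  \<comment> \<open>A term linear in \<open>s\<close> is absorbed into
    \<open>s powr \<alpha>\<close>, since \<open>s powr (1 - \<alpha>)\<close> is bounded for
    \<open>s \<le> L\<close>.\<close>
  have sL: "s \<le> L * s powr \<alpha>"
  proof (cases "s = 0")
    case False
    have "s powr (1 - \<alpha>) \<le> L powr (1 - \<alpha>)" using s \<alpha> by (intro powr_mono2) auto
    also have "L powr (1 - \<alpha>) \<le> L powr 1" using L \<alpha> by (intro powr_mono) auto
    finally have "s powr (1 - \<alpha>) \<le> L" using L by simp
    then have "s powr (1 - \<alpha>) * s powr \<alpha> \<le> L * s powr \<alpha>" by (rule mult_right_mono) simp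
    then show ?thesis using False s by (simp add: powr_add[symmetric])
  qed (use L in simp)
  have "\<bar>t - 1\<bar> \<le> s * R"
  proof -
    have "t - 1 = (norm z' - norm z) / norm z" using nz by (simp add: t_def field_simps)
    then have "\<bar>t - 1\<bar> = \<bar>norm z - norm z'\<bar> / norm z" using nz by (simp add: abs_minus_commute)
    also have "\<dots> \<le> norm (z - z') / norm z"
      using nz by (intro divide_right_mono norm_triangle_ineq3) auto
    also have "\<dots> = s * t" using nz by (simp add: s_def t_def)
    also have "\<dots> \<le> s * R" using s t by (intro mult_left_mono) auto
    finally show ?thesis .
  qed
  then have "\<bar>t - 1\<bar> \<le> L * s powr \<alpha> * R" using mult_right_mono[OF sL, of R] R by linarith
  have "\<bar>\<Omega> (sgn z) * (t ^ m - 1)\<bar> \<le> M * (real m * R ^ m * \<bar>t - 1\<bar>)"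
    unfolding abs_mult using M[of "sgn z"] z power_diff_one_le[OF t R(2)] M0
    by (intro mult_mono) (auto simp: norm_sgn)
  also have "\<dots> \<le> M * (real m * R ^ m * (L * s powr \<alpha> * R))"
    using M0 R \<open>\<bar>t - 1\<bar> \<le> L * s powr \<alpha> * R\<close> by (intro mult_left_mono) auto
  finally have 1: "\<bar>\<Omega> (sgn z) * (t ^ m - 1)\<bar> \<le> M * real m * R ^ Suc m * L * s powr \<alpha>" by (simp add: ac_simps)
  have "\<bar>\<Omega> (sgn z) - \<Omega> (sgn z')\<bar> \<le> C * norm (sgn z - sgn z') powr \<alpha>"
    by (rule H) (use z in \<open>auto simp: norm_sgn\<close>)
  also have "\<dots> \<le> C * (2 * s) powr \<alpha>"
    using norm_sgn_diff_le[OF z(2), of z] \<alpha> C by (intro mult_left_mono powr_mono2) (auto simp: s_def)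
  also have "\<dots> \<le> C * (2 * s powr \<alpha>)"
  proof (intro mult_left_mono C)
    have "(2::real) powr \<alpha> \<le> 2 powr 1" using \<alpha> by (intro powr_mono) auto
    then show "(2 * s) powr \<alpha> \<le> 2 * s powr \<alpha>" using s by (simp add: powr_mult mult_right_mono)
  qed
  finally have 2: "\<bar>\<Omega> (sgn z) - \<Omega> (sgn z')\<bar> \<le> 2 * C * s powr \<alpha>" by simp
  have "\<bar>\<Omega> (sgn z) * (t ^ m - 1) + (\<Omega> (sgn z) - \<Omega> (sgn z'))\<bar> \<le> (2 * C + M * real m * R ^ Suc m * L) * s powr \<alpha>"
    using abs_triangle_ineq[of "\<Omega> (sgn z) * (t ^ m - 1)" "\<Omega> (sgn z) - \<Omega> (sgn z')"] 1 2
    unfolding distrib_right by linarith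
  then show ?thesis unfolding K using nz by (simp add: s_def[symmetric] divide_right_mono)
qed

section \<open>Cubes and grids in the unit ball\<close>

definition cube :: "'a::euclidean_space \<Rightarrow> real \<Rightarrow> 'a set" where
  "cube a h = {w. \<forall>i\<in>Basis. a \<bullet> i - h / 2 \<le> w \<bullet> i \<and> w \<bullet> i < a \<bullet> i + h / 2}"

lemma cube_sets_borel [measurable]: "cube a h \<in> sets borel"
proof -
  have "cube a h = (\<Inter>i\<in>Basis. {w. a \<bullet> i - h / 2 \<le> w \<bullet> i} \<inter> {w. w \<bullet> i < a \<bullet> i + h / 2})"
    by (auto simp: cube_def)
  moreover have "{w. a \<bullet> i - h / 2 \<le> w \<bullet> i} \<inter> {w. w \<bullet> i < a \<bullet> i + h / 2} \<in> sets borel" for i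
    by measurable
  ultimately show ?thesis by (auto intro!: sets.finite_INT)
qed

lemma cube_subset_cball: "h \<ge> 0 \<Longrightarrow> cube (a::'a::euclidean_space) h \<subseteq> cball a (real DIM('a) * h / 2)"
proof
  fix w assume h: "h \<ge> 0" and w: "w \<in> cube a h"
  have "norm (w - a) \<le> (\<Sum>i\<in>Basis. \<bar>(w - a) \<bullet> i\<bar>)" by (rule norm_le_l1)
  also have "\<dots> \<le> (\<Sum>i\<in>(Basis::'a set). h / 2)"
  proof (rule sum_mono)
    fix i :: 'a assume "i \<in> Basis"
    then have "a \<bullet> i - h / 2 \<le> w \<bullet> i" "w \<bullet> i < a \<bullet> i + h / 2" using w by (auto simp: cube_def)
    then show "\<bar>(w - a) \<bullet> i\<bar> \<le> h / 2" unfolding inner_diff_left by linarith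
  qed
  finally show "w \<in> cball a (real DIM('a) * h / 2)" by (simp add: dist_norm norm_minus_commute)
qed

lemma not_in_cube_dist:
  assumes "w \<notin> cube (a::'a::euclidean_space) h"
  shows "h / 2 \<le> dist w a"
proof -
  obtain i where "i \<in> Basis" "\<not> (a \<bullet> i - h / 2 \<le> w \<bullet> i \<and> w \<bullet> i < a \<bullet> i + h / 2)"
    using assms unfolding cube_def by blast
  then have i: "i \<in> Basis" "h / 2 \<le> \<bar>(w - a) \<bullet> i\<bar>"
    unfolding inner_diff_left by linarith+
  then show ?thesis using Basis_le_norm[OF i(1), of "w - a"] by (simp add: dist_norm)
qed

lemma measure_cube:
  assumes h: "h > 0"
  shows "cube (a::'a::euclidean_space) h \<in> fmeasurable lborel" "measure lborel (cube a h) = h ^ DIM('a)"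
proof -
  define p q where "p = a - (\<Sum>i\<in>Basis. (h / 2) *\<^sub>R i)" and "q = a + (\<Sum>i\<in>Basis. (h / 2) *\<^sub>R i)"
  have pi: "p \<bullet> i = a \<bullet> i - h / 2" "q \<bullet> i = a \<bullet> i + h / 2" if "i \<in> Basis" for i
    using that by (simp_all add: p_def q_def inner_diff_left inner_add_left inner_sum_left inner_Basis if_distrib sum.delta cong: if_cong)
  have sub: "box p q \<subseteq> cube a h" "cube a h \<subseteq> cbox p q"
    using pi by (auto simp: cube_def mem_box less_imp_le)
  show f: "cube a h \<in> fmeasurable lborel"
    by (rule fmeasurableI2[OF _ sub(2)])
       (use emeasure_bounded_finite[OF bounded_cbox, of p q] in \<open>auto simp: fmeasurable_def\<close>)
  have c: "measure lborel (box p q) = h ^ DIM('a)" "measure lborel (cbox p q) = h ^ DIM('a)"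
    using h pi by (simp_all add: measure_lborel_box measure_lborel_cbox inner_diff_left)
  have "measure lborel (box p q) \<le> measure lborel (cube a h)"
    by (rule measure_mono_fmeasurable[OF sub(1) _ f]) simp
  moreover have "measure lborel (cube a h) \<le> measure lborel (cbox p q)"
    by (rule measure_mono_fmeasurable[OF sub(2)])
       (use emeasure_bounded_finite[OF bounded_cbox, of p q] in \<open>auto simp: fmeasurable_def\<close>)
  ultimately show "measure lborel (cube a h) = h ^ DIM('a)" using c by simp
qed

text \<open>The mesh \<open>h\<close> may be far smaller than the accuracy \<open>\<delta>\<close>.
  The uncovered volume is measured against \<open>\<delta> ^ DIM('a)\<close> because integrating
  \<open>1 / norm (u - w) ^ m\<close> over such a set then costs only order
  \<open>\<delta>\<^sup>2\<close>: within \<open>\<delta>\<close> of \<open>u\<close> by direct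
  integration, farther away by the volume times \<open>1 / \<delta> ^ m\<close>.\<close>

definition is_grid :: "'a::euclidean_space set \<Rightarrow> real \<Rightarrow> real \<Rightarrow> bool" where
  "is_grid A h \<delta> \<longleftrightarrow> finite A \<and> A \<noteq> {} \<and> 0 < h \<and> h \<le> \<delta> \<and> (\<forall>a\<in>A. cube a h \<subseteq> cball 0 1) \<and>
     (\<forall>a\<in>A. \<forall>b\<in>A. a \<noteq> b \<longrightarrow> cube a h \<inter> cube b h = {} \<and> h \<le> dist a b) \<and>
     measure lborel (cball 0 1 - (\<Union>a\<in>A. cube a h)) \<le> \<delta> ^ DIM('a)"

lemma is_grid_measure_Union:
  assumes A: "is_grid (A::'a::euclidean_space set) h \<delta>" and B: "B \<subseteq> A"
  shows "measure lborel (\<Union>a\<in>B. cube a h) = real (card B) * h ^ DIM('a)"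
proof -
  have h: "h > 0" and fB: "finite B" using A B by (auto simp: is_grid_def intro: finite_subset)
  have "disjnt (cube a h) (cube b h)" if "a \<in> B" "b \<in> B" "a \<noteq> b" for a b
    using A B that unfolding is_grid_def disjnt_def by blast
  then have "measure lborel (\<Union>a\<in>B. cube a h) = (\<Sum>a\<in>B. measure lborel (cube a h))"
    by (intro measure_UNION'[OF fB] measure_cube(1)[OF h]) (auto simp: pairwise_def)
  then show ?thesis by (simp add: measure_cube(2)[OF h])
qed

lemma cball_fmeasurable [simp, intro]: "cball (a::'a::euclidean_space) r \<in> fmeasurable lborel"
  using emeasure_bounded_finite[OF bounded_cball, of a r] by (auto simp: fmeasurable_def)

lemma is_grid_card:
  assumes A: "is_grid (A::'a::euclidean_space set) h \<delta>"
  shows "real (card A) * h ^ DIM('a) \<le> unit_ball_vol (real DIM('a))"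
    and "unit_ball_vol (real DIM('a)) - \<delta> ^ DIM('a) \<le> real (card A) * h ^ DIM('a)"
proof -
  let ?U = "\<Union>a\<in>A. cube a h"
  have fin: "finite A" and sub: "?U \<subseteq> cball 0 1" using A by (auto simp: is_grid_def)
  have Um: "?U \<in> sets borel" using fin by auto
  have Uf: "?U \<in> fmeasurable lborel" by (rule fmeasurableI2[OF cball_fmeasurable sub]) (use Um in simp)
  have U: "measure lborel ?U = real (card A) * h ^ DIM('a)" by (rule is_grid_measure_Union[OF A order_refl])
  have c: "measure lborel (cball (0::'a) 1) = unit_ball_vol (real DIM('a))" by (simp add: content_cball)
  show "real (card A) * h ^ DIM('a) \<le> unit_ball_vol (real DIM('a))"
    using measure_mono_fmeasurable[OF sub _ cball_fmeasurable] Um by (simp add: U c)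
  have "measure lborel (cball 0 1 - ?U) = measure lborel (cball (0::'a) 1) - measure lborel ?U"
    by (rule measurable_measure_Diff) (use Um sub in auto)
  then show "unit_ball_vol (real DIM('a)) - \<delta> ^ DIM('a) \<le> real (card A) * h ^ DIM('a)"
    using A by (simp add: U c is_grid_def)
qed

lemma is_gridD:
  fixes A :: "'a::euclidean_space set"
  assumes "is_grid A h \<delta>"
  shows "finite A" "A \<noteq> {}" "0 < h" "h \<le> \<delta>" "0 < \<delta>" "\<And>a. a \<in> A \<Longrightarrow> cube a h \<subseteq> cball 0 1"
    "\<And>a b. a \<in> A \<Longrightarrow> b \<in> A \<Longrightarrow> a \<noteq> b \<Longrightarrow> cube a h \<inter> cube b h = {}"
    "\<And>a b. a \<in> A \<Longrightarrow> b \<in> A \<Longrightarrow> a \<noteq> b \<Longrightarrow> h \<le> dist a b"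
    "measure lborel (cball 0 1 - (\<Union>a\<in>A. cube a h)) \<le> \<delta> ^ DIM('a)"
  using assms unfolding is_grid_def by auto

lemma center_in_cube: "h > 0 \<Longrightarrow> a \<in> cube a h"
  by (auto simp: cube_def)

lemma inverse_power_set_integral_le:
  fixes u :: "'a::euclidean_space"
  assumes d: "DIM('a) = Suc (Suc m)" and \<delta>: "\<delta> > 0" and S: "S \<in> sets borel" "S \<subseteq> cball u R" "R \<ge> 0"
  shows "(LINT w:S|lborel. 1 / norm (u - w) ^ m)
    \<le> real DIM('a) * \<delta>\<^sup>2 / 2 * unit_ball_vol (real DIM('a)) + measure lborel S / \<delta> ^ m"
proof -
  have Sf: "S \<in> fmeasurable lborel" by (rule fmeasurableI2[OF cball_fmeasurable S(2)]) (use S in simp)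
  have m1: "S \<inter> cball u \<delta> \<in> sets borel" using S by simp
  have i1: "set_integrable lborel (S \<inter> cball u \<delta>) (\<lambda>w. 1 / norm (u - w) ^ m)"
    by (rule inverse_power_set_integral(1)[OF d S(3) m1]) (use S in auto)
  have i0: "set_integrable lborel S (\<lambda>w. 1 / norm (u - w) ^ m)"
    by (rule inverse_power_set_integral(1)[OF d S(3) S(1,2)])
  have i2: "integrable lborel (\<lambda>w. indicator S w * (1 / \<delta> ^ m))"
    using Sf S by (intro integrable_mult_left) (auto simp: fmeasurable_def integrable_indicator_iff)
  have "(LINT w:S|lborel. 1 / norm (u - w) ^ m)
    \<le> (LINT w|lborel. indicator (S \<inter> cball u \<delta>) w *\<^sub>R (1 / norm (u - w) ^ m) + indicator S w * (1 / \<delta> ^ m))"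
    unfolding set_lebesgue_integral_def
  proof (rule integral_mono)
    fix w
    show "indicator S w *\<^sub>R (1 / norm (u - w) ^ m)
       \<le> indicator (S \<inter> cball u \<delta>) w *\<^sub>R (1 / norm (u - w) ^ m) + indicator S w * (1 / \<delta> ^ m)"
    proof (cases "w \<in> S \<and> w \<notin> cball u \<delta>")
      case True
      then have "1 / norm (u - w) ^ m \<le> 1 / \<delta> ^ m"
        using \<delta> by (intro divide_left_mono power_mono mult_pos_pos zero_less_power) (auto simp: dist_norm)
      then show ?thesis using True by (simp add: indicator_def)
    qed (use \<delta> in \<open>auto simp: indicator_def\<close>)
  qed (use i0 i1 i2 in \<open>auto simp: set_integrable_def\<close>)
  also have "\<dots> = (LINT w:S \<inter> cball u \<delta>|lborel. 1 / norm (u - w) ^ m) + measure lborel S / \<delta> ^ m"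
    unfolding set_lebesgue_integral_def using i1 i2 S
    by (subst Bochner_Integration.integral_add) (auto simp: set_integrable_def)
  also have "(LINT w:S \<inter> cball u \<delta>|lborel. 1 / norm (u - w) ^ m) \<le> real DIM('a) * \<delta>\<^sup>2 / 2 * unit_ball_vol (real DIM('a))"
    by (rule inverse_power_set_integral(2)[OF d _ m1]) (use \<delta> in auto)
  finally show ?thesis by simp
qed

lemma grid_union_integral:
  fixes f :: "'a::euclidean_space \<Rightarrow> real"
  assumes A: "is_grid A h \<delta>" and B: "B \<subseteq> A" and int: "\<And>b. b \<in> B \<Longrightarrow> set_integrable lborel (cube b h) f"
  shows "(LINT w:(\<Union>b\<in>B. cube b h)|lborel. f w) = (\<Sum>b\<in>B. LINT w:cube b h|lborel. f w)"
proof (rule set_integral_finite_Union)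
  show "finite B" using B is_gridD(1)[OF A] by (rule finite_subset)
  show "disjoint_family_on (\<lambda>b. cube b h) B"
    using is_gridD(7)[OF A] B unfolding disjoint_family_on_def by blast
qed (use int in auto)

text \<open>For every \<open>w\<close> in the cell \<open>norm (u - w)\<close> is at most a multiple
  of \<open>norm (u - v)\<close>, even if \<open>u\<close> itself lies near a corner of the cell. So
  the value at \<open>v\<close> is dominated by the average over the cell.\<close>

lemma far_cell_inverse_power:
  fixes u v b :: "'a::euclidean_space"
  assumes d: "DIM('a) = Suc (Suc m)" and h: "h > 0" and far: "h / 2 \<le> dist u b" and v: "dist v b \<le> h / 8"
  shows "h ^ DIM('a) / norm (u - v) ^ m \<le> (4 * real DIM('a)) ^ m * (LINT w:cube b h|lborel. 1 / norm (u - w) ^ m)"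
proof -
  let ?D = "real DIM('a)"
  have D: "?D \<ge> 2" using d by simp
  \<comment> \<open>\<open>3 / 4\<close>, since \<open>dist v b \<le> h / 8\<close> is at most a
    quarter of \<open>dist u b\<close>.\<close>
  have uv: "norm (u - v) \<ge> 3 / 4 * dist u b"
    using far v dist_triangle[of u b v] by (simp add: dist_norm norm_minus_commute)
  have pos: "norm (u - v) > 0" using uv far h by linarith
  have sub: "cube b h \<subseteq> cball u (dist u b + ?D * h / 2)"
  proof
    fix w assume "w \<in> cube b h"
    then have "dist b w \<le> ?D * h / 2" using cube_subset_cball[of h b] h by auto
    then show "w \<in> cball u (dist u b + ?D * h / 2)" using dist_triangle[of u w b] by simp
  qed
  have int: "set_integrable lborel (cube b h) (\<lambda>w. 1 / norm (u - w) ^ m)"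
    by (rule inverse_power_set_integral(1)[OF d _ _ sub]) (use h in auto)
  have pw: "1 / norm (u - v) ^ m \<le> (4 * ?D) ^ m * (1 / norm (u - w) ^ m)" if "w \<in> cube b h" "w \<noteq> u" for w
  proof -
    have "norm (u - w) \<le> dist u b + ?D * h / 2" using sub that by (auto simp: dist_norm)
    also have "?D * h / 2 \<le> ?D * dist u b" using far D by (simp add: mult_left_mono)
    also have "dist u b + ?D * dist u b \<le> (3 * ?D) * dist u b"
      using D mult_right_mono[of 1 "2 * ?D" "dist u b"] by (simp add: algebra_simps)
    also have "\<dots> = (4 * ?D) * (3 / 4 * dist u b)" by simp
    also have "\<dots> \<le> (4 * ?D) * norm (u - v)" using uv by (intro mult_left_mono) auto
    finally have "norm (u - w) ^ m \<le> ((4 * ?D) * norm (u - v)) ^ m" by (intro power_mono) auto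
    then show ?thesis using pos that by (simp add: power_mult_distrib field_simps)
  qed
  have "h ^ DIM('a) / norm (u - v) ^ m = (LINT w:cube b h|lborel. 1 / norm (u - v) ^ m)"
    using measure_cube(2)[OF h, of b] measure_cube(1)[OF h, of b]
    by (simp add: set_lebesgue_integral_def)
  also have "\<dots> \<le> (LINT w:cube b h|lborel. (4 * ?D) ^ m * (1 / norm (u - w) ^ m))"
    unfolding set_lebesgue_integral_def
  proof (rule integral_mono_AE)
    show "integrable lborel (\<lambda>w. indicator (cube b h) w *\<^sub>R (1 / norm (u - v) ^ m))"
      using measure_cube(1)[OF h, of b] by (simp add: fmeasurable_def integrable_indicator_iff)
    show "integrable lborel (\<lambda>w. indicator (cube b h) w *\<^sub>R ((4 * ?D) ^ m * (1 / norm (u - w) ^ m)))"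
      using integrable_mult_right[OF int[unfolded set_integrable_def], of "(4 * ?D) ^ m"] by (simp add: ac_simps)
    show "AE w in lborel. indicator (cube b h) w *\<^sub>R (1 / norm (u - v) ^ m) \<le> indicator (cube b h) w *\<^sub>R ((4 * ?D) ^ m * (1 / norm (u - w) ^ m))"
      using AE_lborel_singleton[of u] by eventually_elim (use pw in \<open>auto simp: indicator_def\<close>)
  qed
  also have "\<dots> = (4 * ?D) ^ m * (LINT w:cube b h|lborel. 1 / norm (u - w) ^ m)"
    by (rule set_integral_mult_right)
  finally show ?thesis .
qed

text \<open>The far cells are dominated by one integral over the ball of radius 3 around
  \<open>u\<close>. Centres are \<open>h\<close> apart, so at most one of them is nearer than
  \<open>h / 2\<close> to \<open>u\<close>, and \<open>B\<close> is paid at most once.\<close>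

lemma last_level_sum:
  fixes u :: "'a::euclidean_space" and \<kappa> :: "'a \<Rightarrow> real"
  assumes d: "DIM('a) = Suc (Suc m)" and A: "is_grid A h \<delta>" and u: "norm u \<le> 2" and B: "B \<ge> 0"
    and far: "\<And>b. b \<in> A \<Longrightarrow> h / 2 \<le> dist u b \<Longrightarrow> \<kappa> b * h ^ DIM('a) \<le> c * (LINT w:cube b h|lborel. 1 / norm (u - w) ^ m)"
    and near: "\<And>b. b \<in> A \<Longrightarrow> dist u b < h / 2 \<Longrightarrow> \<kappa> b * h ^ DIM('a) \<le> B" and c: "c \<ge> 0"
  shows "(\<Sum>b\<in>A. \<kappa> b * h ^ DIM('a)) \<le> c * (real DIM('a) * 9 / 2 * unit_ball_vol (real DIM('a))) + B"
proof -
  define F where "F = {b\<in>A. h / 2 \<le> dist u b}"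
  define N where "N = {b\<in>A. dist u b < h / 2}"
  note G = is_gridD[OF A]
  have AF: "A = F \<union> N" "F \<inter> N = {}" by (auto simp: F_def N_def)
  have fin: "finite F" "finite N" using G(1) by (auto simp: F_def N_def)
  have inc: "cball 0 1 \<subseteq> cball u 3"
  proof
    fix w :: 'a assume "w \<in> cball 0 1"
    then show "w \<in> cball u 3" using u norm_triangle_ineq4[of u w] by (simp add: dist_norm)
  qed
  have sub: "(\<Union>b\<in>F. cube b h) \<subseteq> cball u 3" using G(6) inc unfolding F_def by blast
  have Um: "(\<Union>b\<in>F. cube b h) \<in> sets borel" using fin by auto
  have "(\<Sum>b\<in>F. \<kappa> b * h ^ DIM('a)) \<le> (\<Sum>b\<in>F. c * (LINT w:cube b h|lborel. 1 / norm (u - w) ^ m))"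
    by (intro sum_mono far) (auto simp: F_def)
  also have "\<dots> = c * (LINT w:(\<Union>b\<in>F. cube b h)|lborel. 1 / norm (u - w) ^ m)"
  proof (subst grid_union_integral[OF A])
    fix b assume b: "b \<in> F"
    have "cube b h \<subseteq> cball u 3" using sub b by blast
    then show "set_integrable lborel (cube b h) (\<lambda>w. 1 / norm (u - w) ^ m)"
      by (intro inverse_power_set_integral(1)[OF d, of 3]) auto
  qed (auto simp: F_def sum_distrib_left)
  also have "\<dots> \<le> c * (real DIM('a) * 3\<^sup>2 / 2 * unit_ball_vol (real DIM('a)))"
    by (intro mult_left_mono c inverse_power_set_integral(2)[OF d _ Um sub]) auto
  finally have 1: "(\<Sum>b\<in>F. \<kappa> b * h ^ DIM('a)) \<le> c * (real DIM('a) * 9 / 2 * unit_ball_vol (real DIM('a)))" by simp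
  have "card N \<le> 1"
  proof (rule card_le_Suc0_iff_eq[OF fin(2), THEN iffD2, simplified One_nat_def[symmetric]], intro ballI)
    fix b b' assume "b \<in> N" "b' \<in> N"
    then have "dist b b' < h" using dist_triangle_half_r[of u b h b'] by (auto simp: N_def)
    then show "b = b'" using G(8)[of b b'] \<open>b \<in> N\<close> \<open>b' \<in> N\<close> by (force simp: N_def)
  qed
  have "(\<Sum>b\<in>N. \<kappa> b * h ^ DIM('a)) \<le> real (card N) * B"
    by (rule sum_bounded_above) (use near in \<open>auto simp: N_def\<close>)
  also have "\<dots> \<le> 1 * B" using \<open>card N \<le> 1\<close> B by (intro mult_right_mono) auto
  finally have 2: "(\<Sum>b\<in>N. \<kappa> b * h ^ DIM('a)) \<le> B" by simp
  have "(\<Sum>b\<in>A. \<kappa> b * h ^ DIM('a)) = (\<Sum>b\<in>F. \<kappa> b * h ^ DIM('a)) + (\<Sum>b\<in>N. \<kappa> b * h ^ DIM('a))"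
    unfolding AF(1) by (rule sum.union_disjoint[OF fin AF(2)])
  then show ?thesis using 1 2 by linarith
qed

section \<open>Cell averages of a Hoelder kernel\<close>

locale hoelder_kernel =
  fixes \<Omega> :: "'a::euclidean_space \<Rightarrow> real" and m :: nat and \<alpha> C M :: real
  assumes d: "DIM('a) = Suc (Suc m)" and m: "m \<ge> 1"
    and M: "\<And>\<xi>. norm \<xi> = 1 \<Longrightarrow> \<bar>\<Omega> \<xi>\<bar> \<le> M"
    and H: "\<And>\<xi> \<eta>. norm \<xi> = 1 \<Longrightarrow> norm \<eta> = 1 \<Longrightarrow> \<bar>\<Omega> \<xi> - \<Omega> \<eta>\<bar> \<le> C * norm (\<xi> - \<eta>) powr \<alpha>"
    and \<alpha>: "0 < \<alpha>" "\<alpha> \<le> 1" and C: "C \<ge> 0"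
    and meas: "(\<lambda>z. \<Omega> (sgn z)) \<in> borel_measurable borel"
begin

abbreviation "K \<equiv> homogeneous_kernel m \<Omega>"

text \<open>The first factor is the constant of \<open>homogeneous_kernel_holder\<close> for
  \<open>R = 4 * d\<close> and \<open>L = 6 * d\<close>, with \<open>d\<close> the dimension. The
  factor \<open>2 * d\<close> comes from replacing \<open>(d * h / y) powr \<alpha>\<close> by
  \<open>d * h powr \<alpha> * (2 / y)\<close> for \<open>0 < y \<le> 2\<close>.\<close>

definition C1 :: real where "C1 = (2 * C + M * real m * (4 * real DIM('a)) ^ Suc m * (6 * real DIM('a))) * (2 * real DIM('a))"
text \<open>The first summand accounts for the cells that are compared with their averages, the
  second for the part of the ball outside these cells.\<close>

definition C2 :: real where "C2 = C1 * (real DIM('a) * 2 * unit_ball_vol (real DIM('a))) + M * (real DIM('a) / 2 * unit_ball_vol (real DIM('a)) + 2)"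

lemma D3: "real DIM('a) \<ge> 3" using d m by simp

lemma M0: "M \<ge> 0"
proof -
  obtain p :: 'a where "norm p = 1" using vector_choose_size[of 1] by auto
  from M[OF this] show ?thesis by linarith
qed

lemma C1_nonneg: "C1 \<ge> 0" using C M0 D3 by (simp add: C1_def)

lemma K_measurable [measurable]: "K \<in> borel_measurable borel"
proof -
  note meas[measurable]
  show ?thesis unfolding homogeneous_kernel_sgn[abs_def] by measurable
qed

lemma K_bound: "\<bar>K z\<bar> \<le> M / norm z ^ m"
  by (rule homogeneous_kernel_bound[OF M m])

lemma K_set_integral:
  assumes S: "S \<in> sets borel" "S \<subseteq> cball u R" "R \<ge> 0"
  shows "set_integrable lborel S (\<lambda>w. K (u - w))"
    and "\<bar>LINT w:S|lborel. K (u - w)\<bar> \<le> M * (LINT w:S|lborel. 1 / norm (u - w) ^ m)"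
proof -
  have int: "set_integrable lborel S (\<lambda>w. M * (1 / norm (u - w) ^ m))"
    by (intro set_integrable_mult_right inverse_power_set_integral(1)[OF d S(3) S(1,2)])
  have le: "norm (indicator S w *\<^sub>R K (u - w)) \<le> indicator S w *\<^sub>R (M * (1 / norm (u - w) ^ m))" for w
    using K_bound[of "u - w"] by (simp add: indicator_def)
  show i: "set_integrable lborel S (\<lambda>w. K (u - w))"
    unfolding set_integrable_def
    by (rule Bochner_Integration.integrable_bound[OF int[unfolded set_integrable_def]])
       (use S in \<open>simp, intro AE_I2 order_trans[OF le order_trans[OF abs_ge_self eq_refl[OF real_norm_def[symmetric]]]]\<close>)
  have "\<bar>LINT w:S|lborel. K (u - w)\<bar> \<le> (LINT w|lborel. norm (indicator S w *\<^sub>R K (u - w)))"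
    unfolding set_lebesgue_integral_def real_norm_def[symmetric] by (rule integral_norm_bound)
  also have "\<dots> \<le> (LINT w:S|lborel. M * (1 / norm (u - w) ^ m))"
    unfolding set_lebesgue_integral_def
    by (rule integral_mono) (use i int le in \<open>auto simp: set_integrable_def simp del: real_norm_def norm_scaleR\<close>)
  also have "\<dots> = M * (LINT w:S|lborel. 1 / norm (u - w) ^ m)" by (rule set_integral_mult_right)
  finally show "\<bar>LINT w:S|lborel. K (u - w)\<bar> \<le> M * (LINT w:S|lborel. 1 / norm (u - w) ^ m)" .
qed

text \<open>As \<open>w\<close> lies outside the cube of \<open>a\<close>, it is at least
  \<open>h / 2\<close> from \<open>a\<close> and hence \<open>3 / 8 * h\<close> from
  \<open>u\<close>; displacements of order \<open>h\<close> are thus bounded relative to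
  \<open>norm (u - w)\<close>. The singularity is recorded with exponent \<open>m + 1\<close> for
  every \<alpha>, which is still integrable in dimension \<open>m + 2\<close>.\<close>

lemma cell_pointwise:
  assumes A: "is_grid A h \<delta>" and ab: "a \<in> A" "b \<in> A" "a \<noteq> b" and u: "norm u \<le> 1" "dist u a \<le> h / 8"
    and v: "dist v b \<le> h / 8" and w: "w \<in> cube b h"
  shows "\<bar>K (u - v) - K (u - w)\<bar> \<le> C1 * h powr \<alpha> / norm (u - w) ^ Suc m"
proof -
  note G = is_gridD[OF A]
  note h = G(3)
  let ?z = "u - v" and ?y = "u - w"
  have "w \<notin> cube a h" using G(7)[OF ab] w by blast
  then have "h / 2 \<le> dist w a" by (rule not_in_cube_dist)
  then have y: "norm ?y \<ge> 3 / 8 * h" using u(2) dist_triangle[of w a u] by (simp add: dist_norm norm_minus_commute)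
  have z: "norm ?z \<ge> 3 / 4 * h"
    using G(8)[OF ab] u(2) v dist_triangle[of a b u] dist_triangle[of u b v]
    by (simp add: dist_norm norm_minus_commute)
  have wb: "dist b w \<le> real DIM('a) * h / 2" using cube_subset_cball[of h b] h w by auto
  have "norm (?z - ?y) = dist v w" by (simp add: dist_norm norm_minus_commute)
  also have "\<dots> \<le> h / 8 + real DIM('a) * h / 2" using wb v dist_triangle[of v w b] by simp
  also have "\<dots> \<le> real DIM('a) * h" using D3 h mult_right_mono[OF D3, of h] by linarith
  finally have zy: "norm (?z - ?y) \<le> real DIM('a) * h" .
  have nz: "norm ?z > 0" "norm ?y > 0" using y z h by linarith+
  have y2: "norm ?y \<le> 2"
    using u(1) G(6)[OF ab(2)] w norm_triangle_ineq4[of u w] by auto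
  have R: "norm ?y \<le> (4 * real DIM('a)) * norm ?z"
  proof -
    have "norm ?y \<le> norm ?z + real DIM('a) * h"
      using zy norm_triangle_ineq3[of ?y ?z] by (simp add: norm_minus_commute abs_le_iff)
    also have "real DIM('a) * h \<le> real DIM('a) * (4 / 3 * norm ?z)" using z D3 by (intro mult_left_mono) auto
    also have "norm ?z + \<dots> \<le> (4 * real DIM('a)) * norm ?z"
    proof -
      have "1 * norm ?z \<le> real DIM('a) * norm ?z" using D3 by (intro mult_right_mono) auto
      then show ?thesis using norm_ge_zero[of ?z]
        by (simp only: mult.assoc mult.left_commute[of "real DIM('a)"])
    qed
    finally show ?thesis by simp
  qed
  have L: "norm (?z - ?y) \<le> (6 * real DIM('a)) * norm ?y"
  proof -
    have "real DIM('a) * h \<le> real DIM('a) * (8 / 3 * norm ?y)" using y D3 by (intro mult_left_mono) auto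
    also have "\<dots> \<le> (6 * real DIM('a)) * norm ?y" using D3 by (simp add: mult_right_mono)
    finally show ?thesis using zy by linarith
  qed
  let ?c = "2 * C + M * real m * (4 * real DIM('a)) ^ Suc m * (6 * real DIM('a))"
  have c0: "?c \<ge> 0" using C M0 D3 by simp
  have "\<bar>K ?z - K ?y\<bar> \<le> ?c * (norm (?z - ?y) / norm ?y) powr \<alpha> / norm ?y ^ m"
    by (rule homogeneous_kernel_holder[OF M H \<alpha> C _ _ R _ L]) (use nz D3 in auto)
  also have "\<dots> \<le> ?c * (real DIM('a) * h powr \<alpha> * (2 / norm ?y)) / norm ?y ^ m"
  proof (intro divide_right_mono mult_left_mono c0)
    have "(norm (?z - ?y) / norm ?y) powr \<alpha> \<le> (real DIM('a) * h / norm ?y) powr \<alpha>"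
      using zy \<alpha> nz by (intro powr_mono2 divide_right_mono) auto
    also have "\<dots> = real DIM('a) powr \<alpha> * h powr \<alpha> / norm ?y powr \<alpha>"
      using nz h D3 by (simp add: powr_mult powr_divide)
    also have "\<dots> \<le> real DIM('a) * h powr \<alpha> * (2 / norm ?y)"
    proof -
      have 1: "real DIM('a) powr \<alpha> \<le> real DIM('a)" using powr_mono[of \<alpha> 1 "real DIM('a)"] \<alpha> D3 by simp
      \<comment> \<open>Because \<open>norm ?y \<le> 2\<close>, the exponent \<alpha> in the
        denominator may be raised to 1 at the cost of a factor 2.\<close>
      have "norm ?y = norm ?y powr \<alpha> * norm ?y powr (1 - \<alpha>)"
        using nz by (simp add: powr_add[symmetric])
      also have "\<dots> \<le> norm ?y powr \<alpha> * 2"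
      proof (rule mult_left_mono)
        have "norm ?y powr (1 - \<alpha>) \<le> 2 powr (1 - \<alpha>)" using y2 \<alpha> by (intro powr_mono2) auto
        also have "\<dots> \<le> 2 powr 1" using \<alpha> by (intro powr_mono) auto
        finally show "norm ?y powr (1 - \<alpha>) \<le> 2" by simp
      qed simp
      finally have 2: "1 / norm ?y powr \<alpha> \<le> 2 / norm ?y" using nz by (simp add: field_simps)
      have "real DIM('a) powr \<alpha> * h powr \<alpha> * (1 / norm ?y powr \<alpha>) \<le> real DIM('a) * h powr \<alpha> * (2 / norm ?y)"
        using 1 2 D3 by (intro mult_mono) auto
      then show ?thesis by simp
    qed
    finally show "(norm (?z - ?y) / norm ?y) powr \<alpha> \<le> real DIM('a) * h powr \<alpha> * (2 / norm ?y)" .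
  qed simp
  also have "\<dots> = C1 * h powr \<alpha> / norm ?y ^ Suc m"
    by (simp add: C1_def)
  finally show ?thesis .
qed

lemma cell_average:
  assumes A: "is_grid A h \<delta>" and ab: "a \<in> A" "b \<in> A" "a \<noteq> b" and u: "norm u \<le> 1" "dist u a \<le> h / 8"
    and v: "dist v b \<le> h / 8"
  shows "\<bar>K (u - v) * h ^ DIM('a) - (LINT w:cube b h|lborel. K (u - w))\<bar>
     \<le> C1 * h powr \<alpha> * (LINT w:cube b h|lborel. 1 / norm (u - w) ^ Suc m)"
proof -
  note G = is_gridD[OF A]
  note h = G(3)
  have sub: "cube b h \<subseteq> cball u 2"
  proof
    fix w assume "w \<in> cube b h"
    then have "norm w \<le> 1" using G(6)[OF ab(2)] by auto
    then show "w \<in> cball u 2" using u norm_triangle_ineq4[of u w] by (simp add: dist_norm)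
  qed
  have int1: "set_integrable lborel (cube b h) (\<lambda>w. K (u - v))"
    using measure_cube(1)[OF h, of b] by (simp add: set_integrable_def fmeasurable_def integrable_indicator_iff)
  have int2: "set_integrable lborel (cube b h) (\<lambda>w. K (u - w))"
    by (rule K_set_integral(1)[OF _ sub]) auto
  have int3: "set_integrable lborel (cube b h) (\<lambda>w. C1 * h powr \<alpha> * (1 / norm (u - w) ^ Suc m))"
    by (intro set_integrable_mult_right inverse_power_set_integral(3)[OF d _ _ sub]) auto
  have "(LINT w:cube b h|lborel. K (u - v)) = K (u - v) * h ^ DIM('a)"
    using measure_cube(2)[OF h, of b] measure_cube(1)[OF h, of b]
    by (simp add: set_lebesgue_integral_def)
  then have "\<bar>K (u - v) * h ^ DIM('a) - (LINT w:cube b h|lborel. K (u - w))\<bar>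
     = \<bar>LINT w:cube b h|lborel. K (u - v) - K (u - w)\<bar>"
    by (simp only: set_integral_diff(2)[OF int1 int2])
  also have "\<dots> \<le> (LINT w|lborel. norm (indicator (cube b h) w *\<^sub>R (K (u - v) - K (u - w))))"
    unfolding set_lebesgue_integral_def real_norm_def[symmetric] by (rule integral_norm_bound)
  also have "\<dots> \<le> (LINT w:cube b h|lborel. C1 * h powr \<alpha> * (1 / norm (u - w) ^ Suc m))"
    unfolding set_lebesgue_integral_def
  proof (rule integral_mono)
    show "integrable lborel (\<lambda>w. norm (indicator (cube b h) w *\<^sub>R (K (u - v) - K (u - w))))"
      using set_integral_diff(1)[OF int1 int2] unfolding set_integrable_def by (rule integrable_norm)
    show "norm (indicator (cube b h) w *\<^sub>R (K (u - v) - K (u - w)))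
        \<le> indicator (cube b h) w *\<^sub>R (C1 * h powr \<alpha> * (1 / norm (u - w) ^ Suc m))" for w
      using cell_pointwise[OF A ab u v, of w] by (auto simp: indicator_def)
  qed (use int3 in \<open>auto simp: set_integrable_def\<close>)
  also have "\<dots> = C1 * h powr \<alpha> * (LINT w:cube b h|lborel. 1 / norm (u - w) ^ Suc m)"
    by (rule set_integral_mult_right)
  finally show ?thesis .
qed

text \<open>The numbers \<open>\<kappa> b\<close> stand for the kernel averaged over the part of the
  measure in cell \<open>b\<close>. The sum omits the cell of \<open>u\<close>; this cell and the
  uncovered part of the ball have volume at most \<open>2 * \<delta> ^ DIM('a)\<close> together, so
  their share of the integral is of order \<open>\<delta>\<^sup>2\<close>.\<close>

lemma level_sum:
  assumes A: "is_grid A h \<delta>" and \<delta>: "\<delta> \<le> 1" and a: "a \<in> A" and u: "norm u \<le> 1"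
    and \<kappa>: "\<And>b. b \<in> A - {a} \<Longrightarrow> \<bar>\<kappa> b * h ^ DIM('a) - (LINT w:cube b h|lborel. K (u - w))\<bar>
       \<le> C1 * h powr \<alpha> * (LINT w:cube b h|lborel. 1 / norm (u - w) ^ Suc m)"
  shows "\<bar>(\<Sum>b\<in>A - {a}. \<kappa> b * h ^ DIM('a)) - (LINT w:cball 0 1|lborel. K (u - w))\<bar> \<le> C2 * \<delta> powr \<alpha>"
proof -
  note G = is_gridD[OF A]
  define B where "B = A - {a}"
  define U where "U = (\<Union>b\<in>B. cube b h)"
  define R where "R = cball 0 1 - U"
  have BA: "B \<subseteq> A" by (auto simp: B_def)
  have fB: "finite B" using G(1) by (simp add: B_def)
  have Um [measurable]: "U \<in> sets borel" using fB by (auto simp: U_def)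
  have Rm [measurable]: "R \<in> sets borel" by (simp add: R_def)
  have inc: "cball 0 1 \<subseteq> cball u 2"
  proof
    fix w :: 'a assume "w \<in> cball 0 1"
    then show "w \<in> cball u 2" using u norm_triangle_ineq4[of u w] by (simp add: dist_norm)
  qed
  have U1: "U \<subseteq> cball 0 1" using G(6) BA by (auto simp: U_def)
  have sU: "U \<subseteq> cball u 2" and sR: "R \<subseteq> cball u 2" using U1 inc by (auto simp: R_def)
  have sb: "cube b h \<subseteq> cball u 2" if "b \<in> B" for b using sU that by (auto simp: U_def)
  have iU: "set_integrable lborel U (\<lambda>w. K (u - w))" by (rule K_set_integral(1)[OF Um sU]) simp
  have iR: "set_integrable lborel R (\<lambda>w. K (u - w))" by (rule K_set_integral(1)[OF Rm sR]) simp
  have split: "(LINT w:cball 0 1|lborel. K (u - w)) = (LINT w:U|lborel. K (u - w)) + (LINT w:R|lborel. K (u - w))"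
  proof -
    have "cball 0 1 = U \<union> R" "U \<inter> R = {}" using U1 by (auto simp: R_def)
    then show ?thesis using set_integral_Un[OF _ iU iR] by simp
  qed
  have UK: "(LINT w:U|lborel. K (u - w)) = (\<Sum>b\<in>B. LINT w:cube b h|lborel. K (u - w))"
    unfolding U_def by (rule grid_union_integral[OF A BA]) (rule K_set_integral(1)[OF _ sb], auto)
  have UI: "(LINT w:U|lborel. 1 / norm (u - w) ^ Suc m) = (\<Sum>b\<in>B. LINT w:cube b h|lborel. 1 / norm (u - w) ^ Suc m)"
    unfolding U_def by (rule grid_union_integral[OF A BA]) (rule inverse_power_set_integral(3)[OF d _ _ sb], auto)
  have "\<bar>(\<Sum>b\<in>B. \<kappa> b * h ^ DIM('a)) - (LINT w:U|lborel. K (u - w))\<bar>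
     \<le> (\<Sum>b\<in>B. \<bar>\<kappa> b * h ^ DIM('a) - (LINT w:cube b h|lborel. K (u - w))\<bar>)"
    unfolding UK by (simp only: sum_subtractf[symmetric] sum_abs)
  also have "\<dots> \<le> (\<Sum>b\<in>B. C1 * h powr \<alpha> * (LINT w:cube b h|lborel. 1 / norm (u - w) ^ Suc m))"
    by (intro sum_mono \<kappa>) (simp add: B_def)
  also have "\<dots> = C1 * h powr \<alpha> * (LINT w:U|lborel. 1 / norm (u - w) ^ Suc m)"
    by (simp only: UI sum_distrib_left)
  also have "\<dots> \<le> C1 * \<delta> powr \<alpha> * (real DIM('a) * 2 * unit_ball_vol (real DIM('a)))"
    using inverse_power_set_integral(4)[OF d _ Um sU] C1_nonneg G(3,4) \<alpha>
    by (intro mult_mono powr_mono2) (auto simp: set_lebesgue_integral_def intro!: integral_nonneg_AE)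
  finally have 1: "\<bar>(\<Sum>b\<in>B. \<kappa> b * h ^ DIM('a)) - (LINT w:U|lborel. K (u - w))\<bar> \<le> C1 * (real DIM('a) * 2 * unit_ball_vol (real DIM('a))) * \<delta> powr \<alpha>"
    by (simp only: ac_simps)
  have mR: "measure lborel R \<le> 2 * \<delta> ^ DIM('a)"
  proof -
    let ?m = "cball 0 1 - (\<Union>b\<in>A. cube b h)"
    have f1: "?m \<in> fmeasurable lborel" by (rule fmeasurable_Diff) (use G(1) in auto)
    have "cube a h \<subseteq> R" using G(6)[OF a] G(7)[OF a] unfolding R_def U_def B_def by blast
    then have "R = ?m \<union> cube a h" using a unfolding R_def U_def B_def by blast
    then have "measure lborel R \<le> measure lborel ?m + measure lborel (cube a h)"
      using measure_Un_le[of ?m lborel "cube a h"] fmeasurableD[OF f1] by simp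
    also have "measure lborel (cube a h) \<le> \<delta> ^ DIM('a)"
      using measure_cube(2)[OF G(3), of a] G(3,4) by (simp add: power_mono)
    finally show ?thesis using G(9) by simp
  qed
  have "\<bar>LINT w:R|lborel. K (u - w)\<bar> \<le> M * (LINT w:R|lborel. 1 / norm (u - w) ^ m)"
    by (rule K_set_integral(2)[OF Rm sR]) simp
  also have "\<dots> \<le> M * (real DIM('a) * \<delta>\<^sup>2 / 2 * unit_ball_vol (real DIM('a)) + measure lborel R / \<delta> ^ m)"
    by (intro mult_left_mono M0 inverse_power_set_integral_le[OF d G(5) Rm sR]) simp
  also have "\<dots> \<le> M * (real DIM('a) * \<delta>\<^sup>2 / 2 * unit_ball_vol (real DIM('a)) + 2 * \<delta> ^ DIM('a) / \<delta> ^ m)"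
    using mR G(5) M0 by (intro mult_left_mono add_left_mono divide_right_mono) auto
  also have "\<dots> = M * (real DIM('a) / 2 * unit_ball_vol (real DIM('a)) + 2) * \<delta>\<^sup>2"
    using G(5) by (simp add: d power2_eq_square field_simps)
  also have "\<dots> \<le> M * (real DIM('a) / 2 * unit_ball_vol (real DIM('a)) + 2) * \<delta> powr \<alpha>"
  proof (rule mult_left_mono)
    have "\<delta>\<^sup>2 = \<delta> powr 2" using G(5) by (simp add: powr_numeral)
    also have "\<dots> \<le> \<delta> powr \<alpha>" using G(5) \<delta> \<alpha> by (intro powr_mono') auto
    finally show "\<delta>\<^sup>2 \<le> \<delta> powr \<alpha>" .
  qed (use M0 in \<open>simp add: unit_ball_vol_nonneg\<close>)
  finally have 2: "\<bar>LINT w:R|lborel. K (u - w)\<bar> \<le> M * (real DIM('a) / 2 * unit_ball_vol (real DIM('a)) + 2) * \<delta> powr \<alpha>" .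
  show ?thesis
    unfolding B_def[symmetric] split C2_def distrib_right using 1 2 by linarith
qed

end

section \<open>Existence of fine grids\<close>

text \<open>A lattice cube has diameter at most \<open>d * h\<close>, with \<open>d\<close> the
  dimension, so the cubes contained in the unit ball miss at most a shell of that thickness.\<close>

lemma lattice_grid_exists:
  assumes \<delta>: "0 < \<delta>" and e: "0 < e"
  obtains A :: "'a::euclidean_space set" and h where "is_grid A h \<delta>" "h \<le> e"
proof -
  let ?D = "real DIM('a)" and ?v = "unit_ball_vol (real DIM('a))"
  have v: "?v > 0" by (simp add: unit_ball_vol_pos)
  have D: "?D \<ge> 1" by (simp add: DIM_positive Suc_leI)
  \<comment> \<open>The last bound makes the volume of the missed shell, at most
    \<open>?v * (?D * (?D * h))\<close>, at most \<open>\<delta> ^ DIM('a)\<close>; the bound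
    \<open>1 / (2 * ?D)\<close> ensures that the cube containing the origin fits into the
    ball.\<close>
  define h where "h = min (min \<delta> e) (min (1 / (2 * ?D)) (\<delta> ^ DIM('a) / (?D * ?D * ?v)))"
  have h: "h > 0" "h \<le> \<delta>" "h \<le> e" "?D * h \<le> 1 / 2" "?D * ?D * ?v * h \<le> \<delta> ^ DIM('a)"
  proof -
    show "h > 0" using \<delta> e v by (auto simp: h_def)
    show "h \<le> \<delta>" "h \<le> e" by (auto simp: h_def)
    have "h \<le> 1 / (2 * ?D)" "h \<le> \<delta> ^ DIM('a) / (?D * ?D * ?v)" by (auto simp: h_def)
    then show "?D * h \<le> 1 / 2" "?D * ?D * ?v * h \<le> \<delta> ^ DIM('a)"
      using D v by (simp_all add: field_simps)
  qed
  define L where "L = {a :: 'a. \<forall>i\<in>Basis. a \<bullet> i / h \<in> \<int>}"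
  define A where "A = {a \<in> L. cube a h \<subseteq> cball 0 1}"
  have sep: "cube a h \<inter> cube b h = {} \<and> h \<le> dist a b" if ab: "a \<in> L" "b \<in> L" "a \<noteq> b" for a b
  proof -
    obtain i where i: "i \<in> Basis" "a \<bullet> i \<noteq> b \<bullet> i" using \<open>a \<noteq> b\<close> euclidean_eqI by blast
    have "a \<bullet> i / h - b \<bullet> i / h \<in> \<int>" using ab i by (auto simp: L_def)
    moreover have "a \<bullet> i / h - b \<bullet> i / h \<noteq> 0" using i h by simp
    ultimately have "1 \<le> \<bar>a \<bullet> i / h - b \<bullet> i / h\<bar>" by (rule Ints_nonzero_abs_ge1)
    then have "1 \<le> \<bar>a \<bullet> i - b \<bullet> i\<bar> / h" using h by (simp add: diff_divide_distrib[symmetric])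
    then have g: "h \<le> \<bar>a \<bullet> i - b \<bullet> i\<bar>" using h by (simp add: pos_le_divide_eq)
    also have "\<dots> \<le> dist a b" using Basis_le_norm[OF i(1), of "a - b"] by (simp add: dist_norm inner_diff_left)
    finally have "h \<le> dist a b" .
    moreover have "cube a h \<inter> cube b h = {}"
    proof (rule ccontr)
      assume "cube a h \<inter> cube b h \<noteq> {}"
      then obtain w where "w \<in> cube a h" "w \<in> cube b h" by blast
      then have "a \<bullet> i - h / 2 \<le> w \<bullet> i" "w \<bullet> i < a \<bullet> i + h / 2" "b \<bullet> i - h / 2 \<le> w \<bullet> i" "w \<bullet> i < b \<bullet> i + h / 2"
        using i(1) by (auto simp: cube_def)
      then show False using g by linarith
    qed
    ultimately show ?thesis by blast
  qed
  \<comment> \<open>Rounds each coordinate to a nearest lattice value; the cubes are half-open, so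
    ties are decided as \<open>floor\<close> decides them.\<close>
  have cover: "\<exists>a\<in>L. w \<in> cube a h" for w :: 'a
  proof
    define a where "a = (\<Sum>i\<in>Basis. (h * real_of_int \<lfloor>w \<bullet> i / h + 1 / 2\<rfloor>) *\<^sub>R i)"
    have ai: "a \<bullet> i = h * real_of_int \<lfloor>w \<bullet> i / h + 1 / 2\<rfloor>" if "i \<in> Basis" for i
      using that by (simp add: a_def inner_sum_left inner_Basis if_distrib sum.delta cong: if_cong)
    show "a \<in> L" using h by (simp add: L_def ai)
    show "w \<in> cube a h"
      unfolding cube_def mem_Collect_eq
    proof
      fix i :: 'a assume i: "i \<in> Basis"
      define t where "t = w \<bullet> i / h + 1 / 2"
      have "real_of_int \<lfloor>t\<rfloor> \<le> t" "t < real_of_int \<lfloor>t\<rfloor> + 1" by linarith+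
      then have "h * real_of_int \<lfloor>t\<rfloor> \<le> h * t" "h * t < h * (real_of_int \<lfloor>t\<rfloor> + 1)"
        using h by (auto intro: mult_left_mono mult_strict_left_mono)
      moreover have "h * t = w \<bullet> i + h / 2" using h by (simp add: t_def field_simps)
      ultimately show "a \<bullet> i - h / 2 \<le> w \<bullet> i \<and> w \<bullet> i < a \<bullet> i + h / 2"
        using ai[OF i] unfolding t_def[symmetric] by (simp add: distrib_left)
    qed
  qed
  have fin: "finite A"
  proof -
    let ?K = "\<lceil>1 / h\<rceil>"
    have "A \<subseteq> (\<lambda>f. \<Sum>i\<in>Basis. (h * real_of_int (f i)) *\<^sub>R i) ` (Basis \<rightarrow>\<^sub>E {- ?K..?K})"
    proof
      fix a assume a: "a \<in> A"
      then have "\<forall>i\<in>Basis. \<exists>z. a \<bullet> i / h = real_of_int z" by (auto simp: A_def L_def Ints_def)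
      then obtain f where f: "\<And>i. i \<in> Basis \<Longrightarrow> a \<bullet> i / h = real_of_int (f i)" by metis
      have "norm a \<le> 1" using a center_in_cube[OF h(1), of a] by (auto simp: A_def)
      have "restrict f Basis \<in> Basis \<rightarrow>\<^sub>E {- ?K..?K}"
      proof (rule restrict_PiE_iff[THEN iffD2], rule ballI)
        fix i :: 'a assume i: "i \<in> Basis"
        have "\<bar>a \<bullet> i\<bar> \<le> 1" using Basis_le_norm[OF i, of a] \<open>norm a \<le> 1\<close> by linarith
        then have "\<bar>a \<bullet> i / h\<bar> \<le> 1 / h" using h by (simp add: abs_divide divide_right_mono)
        then have "\<bar>real_of_int (f i)\<bar> \<le> 1 / h" using f[OF i] by simp
        then show "f i \<in> {- ?K..?K}" by (simp add: abs_le_iff) linarith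
      qed
      moreover have "a = (\<Sum>i\<in>Basis. (h * real_of_int (restrict f Basis i)) *\<^sub>R i)"
      proof -
        have "a = (\<Sum>i\<in>Basis. (a \<bullet> i) *\<^sub>R i)" by (simp add: euclidean_representation)
        also have "\<dots> = (\<Sum>i\<in>Basis. (h * real_of_int (restrict f Basis i)) *\<^sub>R i)"
          using h by (intro sum.cong) (auto simp: f[symmetric])
        finally show ?thesis .
      qed
      ultimately show "a \<in> (\<lambda>f. \<Sum>i\<in>Basis. (h * real_of_int (f i)) *\<^sub>R i) ` (Basis \<rightarrow>\<^sub>E {- ?K..?K})" by blast
    qed
    then show ?thesis by (rule finite_subset) (auto intro!: finite_imageI finite_PiE)
  qed
  have inner: "\<exists>a\<in>A. w \<in> cube a h" if w: "norm w \<le> 1 - ?D * h" for w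
  proof -
    obtain a where a: "a \<in> L" "w \<in> cube a h" using cover by blast
    have "cube a h \<subseteq> cball 0 1"
    proof
      fix x assume "x \<in> cube a h"
      then have "dist a x \<le> ?D * h / 2" "dist a w \<le> ?D * h / 2"
        using cube_subset_cball[of h a] h a by auto
      then have "dist w x \<le> ?D * h" using dist_triangle3[of w x a] by linarith
      then have "norm x \<le> norm w + ?D * h"
        using norm_triangle_sub[of x w] by (simp add: dist_norm norm_minus_commute)
      then show "x \<in> cball 0 1" using w by simp
    qed
    then show ?thesis using a by (auto simp: A_def)
  qed
  have "A \<noteq> {}" using inner[of 0] h by auto
  moreover have "measure lborel (cball 0 1 - (\<Union>a\<in>A. cube a h)) \<le> \<delta> ^ DIM('a)"
  proof -
    have "measure lborel (cball 0 1 - (\<Union>a\<in>A. cube a h)) \<le> measure lborel (cball 0 1 - cball (0::'a) (1 - ?D * h))"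
    proof (rule measure_mono_fmeasurable)
      show "cball 0 1 - (\<Union>a\<in>A. cube a h) \<subseteq> cball 0 1 - cball (0::'a) (1 - ?D * h)"
        using inner by fastforce
      show "cball 0 1 - (\<Union>a\<in>A. cube a h) \<in> sets lborel"
        using sets.finite_UN[OF fin, of "\<lambda>a. cube a h" borel] by auto
    qed (auto intro!: fmeasurable_Diff)
    also have "\<dots> = measure lborel (cball (0::'a) 1) - measure lborel (cball (0::'a) (1 - ?D * h))"
    proof (rule measurable_measure_Diff)
      have "0 \<le> ?D * h" using h D by simp
      then show "cball 0 (1 - ?D * h) \<subseteq> cball (0::'a) 1" by auto
    qed auto
    also have "\<dots> = ?v * (1 ^ DIM('a) - (1 - ?D * h) ^ DIM('a))"
      using h by (simp add: content_cball algebra_simps)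
    also have "\<dots> \<le> ?v * (?D * (?D * h))"
    proof (rule mult_left_mono)
      have "norm (1 ^ DIM('a) - (1 - ?D * h) ^ DIM('a)) \<le> ?D * norm (1 - (1 - ?D * h))"
        by (rule norm_power_diff) (use h D in \<open>auto simp: abs_le_iff\<close>)
      then show "1 ^ DIM('a) - (1 - ?D * h) ^ DIM('a) \<le> ?D * (?D * h)" using h by simp
    qed (use v in simp)
    also have "\<dots> \<le> \<delta> ^ DIM('a)" using h(5) by (simp add: ac_simps)
    finally show ?thesis .
  qed
  ultimately have "is_grid A h \<delta>"
    using fin h sep unfolding is_grid_def by (auto simp: A_def)
  then show thesis using that h(3) by blast
qed

text \<open>A nearly full grid has at least order \<open>1 / h ^ (m + 2)\<close> points, so
  \<open>q ^ m = 1 / card A\<close> is at most of order \<open>h ^ 2 * h ^ m\<close>. The surplus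
  factor \<open>h ^ 2\<close> is the codimension; it makes \<open>q / h\<close> small for a fine
  mesh.\<close>

lemma sparse_grid_exists:
  assumes d: "DIM('a::euclidean_space) = Suc (Suc m)" and m: "m \<ge> 1"
    and \<delta>: "0 < \<delta>" "\<delta> ^ DIM('a) \<le> unit_ball_vol (real DIM('a)) / 2"
  obtains A :: "'a::euclidean_space set" and h q where "is_grid A h \<delta>" "q > 0" "q ^ m * real (card A) = 1" "q \<le> \<delta> * h"
proof -
  let ?v = "unit_ball_vol (real DIM('a))"
  have v: "?v > 0" by (simp add: unit_ball_vol_pos)
  \<comment> \<open>With \<open>h \<le> e \<le> 1\<close> the product \<open>h * h\<close> is at
    most \<open>e\<close>, hence small enough for
    \<open>2 / ?v * (h * h) \<le> \<delta> ^ m\<close>.\<close>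
  define e where "e = min 1 (\<delta> ^ m * ?v / 2)"
  have e: "e > 0" "e \<le> 1" "e \<le> \<delta> ^ m * ?v / 2" using \<delta> v by (auto simp: e_def)
  obtain A :: "'a set" and h where A: "is_grid A h \<delta>" and he: "h \<le> e"
    using lattice_grid_exists[OF \<delta>(1) e(1)] by blast
  note G = is_gridD[OF A]
  have N: "real (card A) > 0" using G(1,2) by (simp add: card_gt_0_iff)
  define q where "q = root m (1 / real (card A))"
  have q: "q > 0" using N m by (simp add: q_def)
  have qm: "q ^ m = 1 / real (card A)" unfolding q_def using N m by (intro real_root_pow_pos2) auto
  have "q ^ m \<le> (\<delta> * h) ^ m"
  proof -
    have "?v / 2 \<le> real (card A) * h ^ DIM('a)" using is_grid_card(2)[OF A] \<delta>(2) by linarith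
    then have "1 / real (card A) \<le> 2 / ?v * h ^ DIM('a)" using N v by (simp add: field_simps)
    also have "\<dots> = 2 / ?v * (h * h) * h ^ m" by (simp add: d)
    also have "\<dots> \<le> \<delta> ^ m * h ^ m"
    proof (rule mult_right_mono)
      have "h * h \<le> h * 1" using he e G(3) by (intro mult_left_mono) auto
      then have "h * h \<le> \<delta> ^ m * ?v / 2" using he e by linarith
      then show "2 / ?v * (h * h) \<le> \<delta> ^ m" using v by (simp add: field_simps)
    qed (use G(3) in simp)
    finally show ?thesis by (simp add: qm power_mult_distrib)
  qed
  then have "q \<le> \<delta> * h"
    using power_strict_mono[of "\<delta> * h" q m] \<delta> G(3) m by (cases "q \<le> \<delta> * h") auto
  then show thesis using that[OF A q] qm N by simp
qed

section \<open>The Cantor measure\<close>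

text \<open>The bound \<open>1 / 128\<close> makes the balls of each generation so much smaller than
  the gaps between them that the factors 2, 4 and 60 in the separation arguments do no harm. By
  \<open>\<delta>0_vol\<close> every grid fills at least half of the unit ball.\<close>

locale cantor =
  fixes m :: nat and A :: "nat \<Rightarrow> 'a::euclidean_space set" and h q \<delta> :: "nat \<Rightarrow> real" and \<delta>0 :: real
  assumes d: "DIM('a) = Suc (Suc m)" and m: "m \<ge> 1"
    and grid: "\<And>k. is_grid (A k) (h k) (\<delta> k)"
    and q_pos: "\<And>k. q k > 0" and q_card: "\<And>k. q k ^ m * real (card (A k)) = 1"
    and q_le: "\<And>k. q k \<le> \<delta> k * h k"
    and \<delta>: "\<And>k. \<delta> k = \<delta>0 * (1 / 2) ^ k" and \<delta>0: "0 < \<delta>0" "\<delta>0 \<le> 1 / 128"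
    and \<delta>0_vol: "\<delta>0 ^ DIM('a) \<le> unit_ball_vol (real DIM('a)) / 2"
begin

section \<open>Radii, centres and the limit set\<close>

definition r :: "nat \<Rightarrow> real" where "r n = (\<Prod>k<n. q k)"
definition center :: "(nat \<Rightarrow> 'a) \<Rightarrow> nat \<Rightarrow> 'a" where "center \<omega> n = (\<Sum>k<n. r k *\<^sub>R \<omega> k)"
definition point :: "(nat \<Rightarrow> 'a) \<Rightarrow> 'a" where "point \<omega> = (\<Sum>k. r k *\<^sub>R \<omega> k)"
definition paths :: "(nat \<Rightarrow> 'a) set" where "paths = {\<omega>. \<forall>k. \<omega> k \<in> A k}"
definition centers :: "nat \<Rightarrow> 'a set" where "centers n = (\<lambda>\<omega>. center \<omega> n) ` paths"
text \<open>A limit point stays within \<open>4 / 3 * r n\<close> of its centre of generation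
  \<open>n\<close>. The radius \<open>2 * r n\<close> leaves a margin: a point outside
  \<open>F n\<close> is at least \<open>2 / 3 * r n\<close> away from all limit points.\<close>

definition F :: "nat \<Rightarrow> 'a set" where "F n = (\<Union>c\<in>centers n. cball c (2 * r n))"
definition E :: "'a set" where "E = (\<Inter>n. F n)"

lemmas G = is_gridD[OF grid]

lemma \<delta>_pos: "\<delta> k > 0" and \<delta>_le: "\<delta> k \<le> 1 / 128"
proof -
  show "\<delta> k > 0" using \<delta>0 by (simp add: \<delta>)
  have "\<delta>0 * (1 / 2) ^ k \<le> \<delta>0 * 1" using \<delta>0 by (intro mult_left_mono power_le_one) auto
  then show "\<delta> k \<le> 1 / 128" using \<delta>0(2) unfolding \<delta> by linarith
qed

lemma h_pos: "h k > 0" and h_le: "h k \<le> 1 / 128"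
  using G(3,4)[of k] \<delta>_le[of k] by auto

lemma q_le_h: "q k \<le> h k / 128"
proof -
  have "q k \<le> \<delta> k * h k" by (rule q_le)
  also have "\<dots> \<le> 1 / 128 * h k" using \<delta>_le h_pos less_imp_le by (intro mult_right_mono) auto
  finally show ?thesis by simp
qed

lemma q_small: "q k \<le> 1 / 4" using q_le_h[of k] h_le[of k] by simp

lemma card_A_pos: "card (A k) > 0" using G(1,2)[of k] by (simp add: card_gt_0_iff)

lemma r_0 [simp]: "r 0 = 1" and r_Suc: "r (Suc n) = r n * q n"
  by (simp_all add: r_def)

lemma r_pos [simp]: "r n > 0" unfolding r_def by (intro prod_pos) (simp add: q_pos)

lemma r_neq_0 [simp]: "r n \<noteq> 0" using r_pos[of n] by linarith

lemma r_nonneg [simp]: "r n \<ge> 0" using r_pos[of n] by (rule less_imp_le)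

lemma r_Suc_le: "r (Suc n) \<le> r n * h n / 128"
  unfolding r_Suc using mult_left_mono[OF q_le_h, of "r n" n] by simp

lemma r_Suc_le4: "r (Suc n) \<le> r n / 4"
  unfolding r_Suc using mult_left_mono[OF q_small, of "r n" n] by simp

lemma r_add_le: "r (n + k) \<le> r n * (1 / 4) ^ k"
proof (induction k)
  case (Suc k)
  then show ?case using r_Suc_le4[of "n + k"] by simp
qed simp

lemma r_antimono: "n \<le> k \<Longrightarrow> r k \<le> r n"
proof -
  assume "n \<le> k"
  then have "r k \<le> r n * (1 / 4) ^ (k - n)" using r_add_le[of n "k - n"] by simp
  also have "\<dots> \<le> r n * 1" by (intro mult_left_mono power_le_one) auto
  finally show ?thesis by simp
qed

lemma r_le_power: "r k \<le> (1 / 4) ^ k" using r_add_le[of 0 k] by simp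

lemma r_tendsto_0: "r \<longlonglongrightarrow> 0"
proof (rule tendsto_sandwich[of "\<lambda>_. 0" r sequentially "\<lambda>k. (1 / 4) ^ k"])
  show "(\<lambda>k. (1 / 4 :: real) ^ k) \<longlonglongrightarrow> 0" by (rule LIMSEQ_realpow_zero) auto
qed (auto simp: r_le_power)

lemma norm_A_le: "a \<in> A k \<Longrightarrow> norm a \<le> 1"
  using G(6)[of a k] center_in_cube[OF h_pos, of a k] by auto

lemma paths_norm_le: "\<omega> \<in> paths \<Longrightarrow> norm (\<omega> k) \<le> 1"
  by (auto simp: paths_def intro: norm_A_le)

lemma path_summable: "\<omega> \<in> paths \<Longrightarrow> summable (\<lambda>k. r k *\<^sub>R \<omega> k)"
proof (rule summable_comparison_test'[of "\<lambda>k. (1 / 4) ^ k" 0])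
  assume w: "\<omega> \<in> paths"
  fix k :: nat
  have "norm (r k *\<^sub>R \<omega> k) = r k * norm (\<omega> k)" by simp
  also have "\<dots> \<le> (1 / 4) ^ k * 1"
    using paths_norm_le[OF w, of k] r_le_power[of k] by (intro mult_mono) auto
  finally show "norm (r k *\<^sub>R \<omega> k) \<le> (1 / 4) ^ k" by simp
qed simp

lemma point_center_dist:
  assumes w: "\<omega> \<in> paths"
  shows "dist (point \<omega>) (center \<omega> n) \<le> 4 / 3 * r n"
proof -
  have s: "summable (\<lambda>k. r k *\<^sub>R \<omega> k)" by (rule path_summable[OF w])
  have "point \<omega> = (\<Sum>k. r (k + n) *\<^sub>R \<omega> (k + n)) + center \<omega> n"
    unfolding point_def center_def by (rule suminf_split_initial_segment[OF s])
  then have e: "point \<omega> - center \<omega> n = (\<Sum>k. r (k + n) *\<^sub>R \<omega> (k + n))" by simp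
  have "norm (\<Sum>k. r (k + n) *\<^sub>R \<omega> (k + n)) \<le> (\<Sum>k. r n * (1 / 4) ^ k)"
  proof (rule norm_suminf_le)
    fix k
    have "norm (r (k + n) *\<^sub>R \<omega> (k + n)) = r (k + n) * norm (\<omega> (k + n))" by simp
    also have "\<dots> \<le> (r n * (1 / 4) ^ k) * 1"
      using paths_norm_le[OF w, of "k + n"] r_add_le[of n k] by (intro mult_mono) (auto simp: add.commute)
    finally show "norm (r (k + n) *\<^sub>R \<omega> (k + n)) \<le> r n * (1 / 4) ^ k" by simp
  qed (simp add: summable_geometric summable_mult)
  also have "\<dots> = r n * (1 / (1 - 1 / 4))"
    by (subst suminf_mult) (simp_all add: suminf_geometric summable_geometric)
  finally show ?thesis by (simp add: dist_norm e)
qed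

lemma center_Suc: "center \<omega> (Suc n) = center \<omega> n + r n *\<^sub>R \<omega> n"
  by (simp add: center_def)

lemma center_cong: "(\<And>k. k < n \<Longrightarrow> \<omega> k = \<omega>' k) \<Longrightarrow> center \<omega> n = center \<omega>' n"
  by (simp add: center_def)

section \<open>Nesting and separation of the balls\<close>

lemma nested_step:
  assumes w: "\<omega> \<in> paths" and x: "dist x (center \<omega> (Suc n)) \<le> 2 * r (Suc n)"
  shows "dist x (center \<omega> n) \<le> r n + 2 * r (Suc n)"
proof -
  have "dist (center \<omega> (Suc n)) (center \<omega> n) = r n * norm (\<omega> n)" by (simp add: center_Suc dist_norm)
  also have "\<dots> \<le> r n * 1" using paths_norm_le[OF w] by (intro mult_left_mono) auto
  finally show ?thesis using x dist_triangle[of x "center \<omega> n" "center \<omega> (Suc n)"] by simp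
qed

lemma nested:
  assumes w: "\<omega> \<in> paths" and x: "dist x (center \<omega> n) \<le> 2 * r n" and k: "k \<le> n"
  shows "dist x (center \<omega> k) \<le> 2 * r k"
  using k x
proof (induction rule: inc_induct)
  case (step j)
  then show ?case using nested_step[OF w, of x j] r_Suc_le4[of j] r_pos[of j] by linarith
qed

lemma path_upd: "\<eta> \<in> paths \<Longrightarrow> b \<in> A k \<Longrightarrow> \<eta>(k := b) \<in> paths"
  by (auto simp: paths_def)

lemma paths_nonempty: "paths \<noteq> {}"
proof -
  have "(\<lambda>k. SOME a. a \<in> A k) \<in> paths" using G(2) by (auto simp: paths_def some_in_eq)
  then show ?thesis by blast
qed

text \<open>At the first step where the paths differ the new centres are at least
  \<open>r k * h k\<close> apart, and \<open>r (Suc k)\<close> is at most \<open>1 / 128\<close> of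
  that; passing to \<open>x\<close> and \<open>y\<close> loses only \<open>4 * r (Suc k)\<close>.
  The two conclusions measure the distance against the gap and against the radius.\<close>

lemma separation:
  assumes w: "\<omega> \<in> paths" "\<omega>' \<in> paths" and agree: "\<And>i. i < k \<Longrightarrow> \<omega> i = \<omega>' i" and ne: "\<omega> k \<noteq> \<omega>' k"
    and x: "dist x (center \<omega> (Suc k)) \<le> 2 * r (Suc k)" and y: "dist y (center \<omega>' (Suc k)) \<le> 2 * r (Suc k)"
  shows "r k * h k / 2 \<le> dist x y" and "60 * r (Suc k) \<le> dist x y"
proof -
  have "r k * h k \<le> r k * dist (\<omega> k) (\<omega>' k)"
    using G(8)[of "\<omega> k" k "\<omega>' k"] w ne by (intro mult_left_mono) (auto simp: paths_def)
  also have "\<dots> = dist (center \<omega> (Suc k)) (center \<omega>' (Suc k))"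
    using center_cong[of k \<omega> \<omega>', OF agree] by (simp add: center_Suc dist_norm scaleR_diff_right[symmetric])
  also have "\<dots> \<le> dist (center \<omega> (Suc k)) x + dist x y + dist y (center \<omega>' (Suc k))"
    using dist_triangle[of "center \<omega> (Suc k)" "center \<omega>' (Suc k)" x] dist_triangle[of x "center \<omega>' (Suc k)" y] by linarith
  finally have "r k * h k - 4 * r (Suc k) \<le> dist x y" using x y by (simp add: dist_commute)
  then show "r k * h k / 2 \<le> dist x y" "60 * r (Suc k) \<le> dist x y"
    using r_Suc_le[of k] r_pos[of "Suc k"] by linarith+
qed

lemma first_difference:
  fixes \<omega> \<omega>' :: "nat \<Rightarrow> 'a" and n :: nat
  assumes "\<not> (\<forall>i<n. \<omega> i = \<omega>' i)"
  obtains k where "k < n" "\<forall>i<k. \<omega> i = \<omega>' i" "\<omega> k \<noteq> \<omega>' k"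
proof -
  define k where "k = (LEAST i. \<omega> i \<noteq> \<omega>' i)"
  obtain i where "i < n" "\<omega> i \<noteq> \<omega>' i" using assms by blast
  then have "k \<le> i" "\<omega> k \<noteq> \<omega>' k"
    unfolding k_def using Least_le[of "\<lambda>i. \<omega> i \<noteq> \<omega>' i" i] LeastI[of "\<lambda>i. \<omega> i \<noteq> \<omega>' i" i] by auto
  moreover have "\<omega> j = \<omega>' j" if "j < k" for j using not_less_Least[of j "\<lambda>i. \<omega> i \<noteq> \<omega>' i"] that by (auto simp: k_def)
  ultimately show thesis using \<open>i < n\<close> by (intro that[of k]) auto
qed

lemma same_center:
  assumes w: "\<omega> \<in> paths" "\<omega>' \<in> paths" and x: "dist x (center \<omega> n) \<le> 2 * r n" and y: "dist y (center \<omega>' n) \<le> 2 * r n"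
    and close: "dist x y < 60 * r n"
  shows "\<forall>i<n. \<omega> i = \<omega>' i"
proof (rule ccontr)
  assume "\<not> ?thesis"
  then obtain k where k: "k < n" "\<forall>i<k. \<omega> i = \<omega>' i" "\<omega> k \<noteq> \<omega>' k" by (rule first_difference)
  have "60 * r (Suc k) \<le> dist x y"
    using k by (intro separation(2)[OF w k(2)[rule_format] k(3)] nested[OF w(1) x] nested[OF w(2) y]) auto
  moreover have "r n \<le> r (Suc k)" using k by (intro r_antimono) simp
  ultimately show False using close by linarith
qed

text \<open>The gap between sub-balls is of order \<open>r n * h n\<close>, far above their radius.
  The radius-based \<open>same_center\<close> would lose the ratio \<open>q n / h n\<close>, on
  which pure unrectifiability rests.\<close>

lemma same_center_Suc:
  assumes w: "\<omega> \<in> paths" "\<omega>' \<in> paths" and x: "dist x (center \<omega> (Suc n)) \<le> 2 * r (Suc n)"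
    and y: "dist y (center \<omega>' (Suc n)) \<le> 2 * r (Suc n)" and close: "dist x y < r n * h n / 2"
  shows "\<forall>i<Suc n. \<omega> i = \<omega>' i"
proof (rule ccontr)
  assume "\<not> ?thesis"
  then obtain k where k: "k < Suc n" "\<forall>i<k. \<omega> i = \<omega>' i" "\<omega> k \<noteq> \<omega>' k" by (rule first_difference)
  have s: "r k * h k / 2 \<le> dist x y" "60 * r (Suc k) \<le> dist x y"
    using k by (intro separation[OF w k(2)[rule_format] k(3)] nested[OF w(1) x] nested[OF w(2) y]; simp)+
  show False
  \<comment> \<open>If the paths part before step \<open>n\<close>, the radius-based bound gives at
    least \<open>60 * r n\<close>, which already exceeds the assumed distance.\<close>
  proof (cases "k = n")
    case False
    then have "r n \<le> r (Suc k)" using k by (intro r_antimono) simp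
    moreover have "r n * h n \<le> r n * 1" using h_le[of n] by (intro mult_left_mono) auto
    ultimately show False using s close r_pos[of n] by linarith
  qed (use s close in simp)
qed

text \<open>A centre depends on finitely many steps of an infinite path; in this form the centres
  can be counted.\<close>

lemma centers_eq: "centers n = (\<lambda>f. \<Sum>k<n. r k *\<^sub>R f k) ` (PiE {..<n} A)"
proof
  show "centers n \<subseteq> (\<lambda>f. \<Sum>k<n. r k *\<^sub>R f k) ` (PiE {..<n} A)"
  proof
    fix c assume "c \<in> centers n"
    then obtain \<omega> where w: "\<omega> \<in> paths" "c = center \<omega> n" by (auto simp: centers_def)
    have "restrict \<omega> {..<n} \<in> PiE {..<n} A" using w by (auto simp: paths_def)
    moreover have "c = (\<Sum>k<n. r k *\<^sub>R restrict \<omega> {..<n} k)" using w by (simp add: center_def)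
    ultimately show "c \<in> (\<lambda>f. \<Sum>k<n. r k *\<^sub>R f k) ` (PiE {..<n} A)" by blast
  qed
  show "(\<lambda>f. \<Sum>k<n. r k *\<^sub>R f k) ` (PiE {..<n} A) \<subseteq> centers n"
  proof clarify
    fix f assume f: "f \<in> PiE {..<n} A"
    obtain \<eta> where \<eta>: "\<eta> \<in> paths" using paths_nonempty by blast
    define \<omega> where "\<omega> k = (if k < n then f k else \<eta> k)" for k
    have "\<omega> \<in> paths" using f \<eta> by (auto simp: paths_def \<omega>_def)
    moreover have "(\<Sum>k<n. r k *\<^sub>R f k) = center \<omega> n" by (simp add: center_def \<omega>_def)
    ultimately show "(\<Sum>k<n. r k *\<^sub>R f k) \<in> centers n" by (simp add: centers_def)
  qed
qed

lemma r_power_card: "r n ^ m * (\<Prod>k<n. real (card (A k))) = 1"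
  unfolding r_def prod_power_distrib by (simp add: prod.distrib[symmetric] q_card)

lemma finite_centers: "finite (centers n)" and card_centers: "real (card (centers n)) * r n ^ m \<le> 1"
proof -
  have fin: "finite (PiE {..<n} A)" using G(1) by (intro finite_PiE) auto
  then show "finite (centers n)" by (simp add: centers_eq)
  have "card (centers n) \<le> card (PiE {..<n} A)" unfolding centers_eq using fin by (rule card_image_le)
  also have "\<dots> = (\<Prod>k<n. card (A k))" by (simp add: card_PiE)
  finally have "real (card (centers n)) \<le> (\<Prod>k<n. real (card (A k)))" by (metis of_nat_le_iff of_nat_prod)
  then have "real (card (centers n)) * r n ^ m \<le> (\<Prod>k<n. real (card (A k))) * r n ^ m"
    by (intro mult_right_mono) auto
  then show "real (card (centers n)) * r n ^ m \<le> 1" using r_power_card[of n] by (simp add: mult.commute)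
qed

lemma F_iff: "x \<in> F n \<longleftrightarrow> (\<exists>\<omega>\<in>paths. dist x (center \<omega> n) \<le> 2 * r n)"
  by (auto simp: F_def centers_def dist_commute)

lemma closed_F: "closed (F n)" unfolding F_def by (intro closed_UN finite_centers) auto

lemma closed_E: "closed E" unfolding E_def by (intro closed_INT ballI closed_F)

lemma point_in_F: "\<omega> \<in> paths \<Longrightarrow> point \<omega> \<in> F n"
  unfolding F_iff using point_center_dist[of \<omega> n] r_pos[of n] by (intro bexI[of _ \<omega>]) linarith+

lemma point_in_E: "\<omega> \<in> paths \<Longrightarrow> point \<omega> \<in> E"
  by (simp add: E_def point_in_F)

text \<open>The generation at which \<open>x\<close> is first lost is where the expansion of the
  potential at \<open>x\<close> will stop.\<close>

lemma not_E_cases: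
  assumes "x \<notin> E"
  obtains "x \<notin> F 0" | n where "x \<in> F n" "x \<notin> F (Suc n)"
proof (cases "x \<in> F 0")
  case True
  define k where "k = (LEAST k. x \<notin> F k)"
  obtain j where "x \<notin> F j" using assms by (auto simp: E_def)
  then have k: "x \<notin> F k" unfolding k_def by (rule LeastI)
  then obtain n where n: "k = Suc n" using True by (cases k) auto
  have "x \<in> F n" using not_less_Least[of n "\<lambda>k. x \<notin> F k"] n by (auto simp: k_def)
  then show thesis using that(2) k n by simp
qed (use that in blast)

text \<open>In the coordinates of the ball of generation \<open>k\<close>, a point near the path
  lies in the cube around the step \<open>\<omega> k\<close>. This supplies the position of
  \<open>u\<close> demanded by the cell estimates and keeps \<open>u\<close> in the unit ball, where
  the quadratic formula is valid.\<close>

lemma center_local: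
  assumes w: "\<omega> \<in> paths" and k: "k < n" and x: "dist x (center \<omega> n) \<le> 2 * r n"
  defines "u \<equiv> (x - center \<omega> k) /\<^sub>R r k"
  shows "dist u (\<omega> k) \<le> 2 * q k" and "dist u (\<omega> k) \<le> h k / 8" and "norm u \<le> 1"
proof -
  have "dist x (center \<omega> (Suc k)) \<le> 2 * r (Suc k)" by (rule nested[OF w x]) (use k in simp)
  moreover have "x - center \<omega> (Suc k) = r k *\<^sub>R (u - \<omega> k)"
    using r_pos[of k] by (simp add: center_Suc u_def scaleR_diff_right)
  ultimately have "r k * dist u (\<omega> k) \<le> r k * (2 * q k)" by (simp add: dist_norm r_Suc)
  then show 1: "dist u (\<omega> k) \<le> 2 * q k" using mult_le_cancel_left_pos[OF r_pos] by blast
  then show 2: "dist u (\<omega> k) \<le> h k / 8" using q_le_h[of k] h_pos[of k] by linarith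
  have "u \<in> cube (\<omega> k) (h k)"
    using not_in_cube_dist[of u "\<omega> k" "h k"] 2 h_pos[of k] by force
  then show "norm u \<le> 1" using G(6)[of "\<omega> k" k] w by (auto simp: paths_def)
qed

lemma point_local:
  fixes k :: nat
  assumes w: "\<omega> \<in> paths"
  defines "v \<equiv> (point \<omega> - center \<omega> k) /\<^sub>R r k"
  shows "dist v (\<omega> k) \<le> 4 / 3 * q k" and "dist v (\<omega> k) \<le> h k / 8"
proof -
  have "dist (point \<omega>) (center \<omega> (Suc k)) \<le> 4 / 3 * r (Suc k)" by (rule point_center_dist[OF w])
  moreover have "point \<omega> - center \<omega> (Suc k) = r k *\<^sub>R (v - \<omega> k)"
    using r_pos[of k] by (simp add: center_Suc v_def scaleR_diff_right)
  ultimately have "r k * dist v (\<omega> k) \<le> r k * (4 / 3 * q k)" by (simp add: dist_norm r_Suc)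
  then show 1: "dist v (\<omega> k) \<le> 4 / 3 * q k" using mult_le_cancel_left_pos[OF r_pos] by blast
  then show "dist v (\<omega> k) \<le> h k / 8" using q_le_h[of k] h_pos[of k] by linarith
qed

section \<open>The law of a random path\<close>

definition step :: "nat \<Rightarrow> 'a measure" where "step k = measure_pmf (pmf_of_set (A k))"
definition P :: "(nat \<Rightarrow> 'a) measure" where "P = PiM UNIV step"
definition \<mu> :: "'a measure" where "\<mu> = distr P borel point"
definition cyl :: "nat \<Rightarrow> (nat \<Rightarrow> 'a) \<Rightarrow> (nat \<Rightarrow> 'a) set" where "cyl n \<eta> = {\<omega>. \<forall>k<n. \<omega> k = \<eta> k}"

lemma sets_step [simp]: "sets (step k) = UNIV" and space_step [simp]: "space (step k) = UNIV"
  by (simp_all add: step_def)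

lemma prob_space_step: "prob_space (step k)"
  unfolding step_def by (rule prob_space_measure_pmf)

lemma space_P [simp]: "space P = UNIV"
  by (simp add: P_def space_PiM PiE_UNIV_domain)

sublocale P: prob_space P
  unfolding P_def by (rule prob_space_PiM) (rule prob_space_step)

lemma component_measurable [measurable]: "(\<lambda>\<omega>. \<omega> k) \<in> P \<rightarrow>\<^sub>M borel"
proof -
  have "(\<lambda>\<omega>. \<omega> k) \<in> P \<rightarrow>\<^sub>M step k" unfolding P_def by (rule measurable_component_singleton) simp
  moreover have "step k \<rightarrow>\<^sub>M borel = (UNIV :: ('a \<Rightarrow> 'a) set)" by (auto simp: measurable_def)
  ultimately show ?thesis using measurable_comp[of "\<lambda>\<omega>. \<omega> k" P "step k" id borel] by (auto simp: comp_def)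
qed

lemma point_measurable [measurable]: "point \<in> P \<rightarrow>\<^sub>M borel"
  unfolding point_def by measurable

lemma sets_\<mu> [simp, measurable_cong]: "sets \<mu> = sets borel" and space_\<mu> [simp]: "space \<mu> = UNIV"
  by (simp_all add: \<mu>_def)

lemma prob_space_\<mu>: "prob_space \<mu>"
  unfolding \<mu>_def by (rule P.prob_space_distr) simp

lemma AE_paths: "AE \<omega> in P. \<omega> \<in> paths"
proof -
  have "AE \<omega> in P. \<omega> k \<in> A k" for k
    unfolding P_def
  proof (rule AE_PiM_component)
    show "AE x in step k. x \<in> A k"
      unfolding step_def using G(1,2)[of k] by (simp add: AE_measure_pmf_iff)
  qed (use prob_space_step in auto)
  then show ?thesis by (simp add: paths_def AE_all_countable)
qed

lemma measure_step: "measure (step k) B = real (card (A k \<inter> B)) / real (card (A k))"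
  unfolding step_def using G(1,2)[of k] by (simp add: measure_pmf_of_set)

lemma P_rectangle:
  assumes J: "finite J"
  shows "{\<omega>. \<forall>k\<in>J. \<omega> k \<in> B k} \<in> sets P"
    and "measure P {\<omega>. \<forall>k\<in>J. \<omega> k \<in> B k} = (\<Prod>k\<in>J. real (card (A k \<inter> B k)) / real (card (A k)))"
proof -
  have e: "{\<omega>. \<forall>k\<in>J. \<omega> k \<in> B k} = prod_emb UNIV step J (PiE J B)"
    by (auto simp: prod_emb_def PiE_UNIV_domain)
  show "{\<omega>. \<forall>k\<in>J. \<omega> k \<in> B k} \<in> sets P"
    unfolding e P_def using J by (intro sets_PiM_I) auto
  show "measure P {\<omega>. \<forall>k\<in>J. \<omega> k \<in> B k} = (\<Prod>k\<in>J. real (card (A k \<inter> B k)) / real (card (A k)))"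
  proof -
    interpret S: prob_space "step k" for k by (rule prob_space_step)
    have "emeasure P {\<omega>. \<forall>k\<in>J. \<omega> k \<in> B k} = (\<Prod>k\<in>J. emeasure (step k) (B k))"
      unfolding e P_def using J by (intro emeasure_PiM_emb) (auto intro: prob_space_step)
    also have "\<dots> = ennreal (\<Prod>k\<in>J. measure (step k) (B k))"
      by (simp add: S.emeasure_eq_measure prod_ennreal)
    finally have "measure P {\<omega>. \<forall>k\<in>J. \<omega> k \<in> B k} = (\<Prod>k\<in>J. measure (step k) (B k))"
      by (simp add: measure_def[of P] prod_nonneg)
    then show ?thesis by (simp add: measure_step)
  qed
qed

lemma cyl_eq: "cyl n \<eta> = {\<omega>. \<forall>k\<in>{..<n}. \<omega> k \<in> {\<eta> k}}"
  by (auto simp: cyl_def)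

lemma cyl_sets [measurable]: "cyl n \<eta> \<in> sets P"
  unfolding cyl_eq by (rule P_rectangle(1)) simp

lemma measure_cyl:
  assumes "\<eta> \<in> paths"
  shows "measure P (cyl n \<eta>) = r n ^ m"
proof -
  have "measure P (cyl n \<eta>) = (\<Prod>k<n. real (card (A k \<inter> {\<eta> k})) / real (card (A k)))"
    unfolding cyl_eq by (rule P_rectangle(2)) simp
  also have "\<dots> = (\<Prod>k<n. 1 / real (card (A k)))"
    using assms by (intro prod.cong) (auto simp: paths_def)
  also have "\<dots> = (\<Prod>k<n. q k ^ m)"
  proof (rule prod.cong)
    fix k show "1 / real (card (A k)) = q k ^ m" using q_card[of k] card_A_pos[of k] by (simp add: field_simps)
  qed simp
  also have "\<dots> = r n ^ m" by (simp add: r_def prod_power_distrib)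
  finally show ?thesis .
qed

lemma cyl_refine:
  "\<omega> \<in> paths \<Longrightarrow> \<omega> \<in> cyl n \<eta> \<Longrightarrow> \<omega> \<in> cyl (Suc n) (\<eta>(n := \<omega> n))"
  by (auto simp: cyl_def less_Suc_eq)

text \<open>Up to the null set of sequences outside \<open>paths\<close>, a cylinder is the disjoint
  union of those that fix one more step.\<close>

lemma cyl_integral_split:
  fixes f :: "(nat \<Rightarrow> 'a) \<Rightarrow> real"
  assumes f: "integrable P f"
  shows "(LINT \<omega>:cyl n \<eta>|P. f \<omega>) = (\<Sum>b\<in>A n. LINT \<omega>:cyl (Suc n) (\<eta>(n := b))|P. f \<omega>)"
proof -
  have si: "set_integrable P S f" if "S \<in> sets P" for S
    using integrable_mult_indicator[OF that f] by (simp add: set_integrable_def)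
  have "(\<Sum>b\<in>A n. LINT \<omega>:cyl (Suc n) (\<eta>(n := b))|P. f \<omega>) = (LINT \<omega>:(\<Union>b\<in>A n. cyl (Suc n) (\<eta>(n := b)))|P. f \<omega>)"
  proof (rule set_integral_finite_Union[symmetric])
    show "disjoint_family_on (\<lambda>b. cyl (Suc n) (\<eta>(n := b))) (A n)"
      by (auto simp: disjoint_family_on_def cyl_def)
  qed (use G(1) si in auto)
  also have "\<dots> = (LINT \<omega>:cyl n \<eta>|P. f \<omega>)"
  proof (rule set_integral_cong_set)
    have "f \<in> borel_measurable P" using f by auto
    then show "set_borel_measurable P (\<Union>b\<in>A n. cyl (Suc n) (\<eta>(n := b))) f" "set_borel_measurable P (cyl n \<eta>) f"
      using G(1) unfolding set_borel_measurable_def by (auto intro!: borel_measurable_indicator sets.finite_UN borel_measurable_times)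
    show "AE \<omega> in P. (\<omega> \<in> cyl n \<eta>) = (\<omega> \<in> (\<Union>b\<in>A n. cyl (Suc n) (\<eta>(n := b))))"
      using AE_paths
    proof eventually_elim
      case (elim \<omega>)
      have "\<omega> n \<in> A n" using elim by (simp add: paths_def)
      moreover have "\<omega> \<in> cyl n \<eta>" if "\<omega> \<in> cyl (Suc n) (\<eta>(n := b))" for b
        using that by (fastforce simp: cyl_def)
      ultimately show ?case using cyl_refine[OF elim, of n \<eta>] by auto
    qed
  qed
  finally show ?thesis by simp
qed

lemma cyl_integral_bound:
  fixes f :: "(nat \<Rightarrow> 'a) \<Rightarrow> real"
  assumes f: "integrable P f" and \<eta>: "\<eta> \<in> paths"
    and b: "\<And>\<omega>. \<omega> \<in> paths \<Longrightarrow> \<omega> \<in> cyl n \<eta> \<Longrightarrow> \<bar>f \<omega> - c\<bar> \<le> e"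
  shows "\<bar>(LINT \<omega>:cyl n \<eta>|P. f \<omega>) - r n ^ m * c\<bar> \<le> r n ^ m * e"
proof -
  have si: "set_integrable P (cyl n \<eta>) f"
    using integrable_mult_indicator[OF cyl_sets f] by (simp add: set_integrable_def)
  have sc: "set_integrable P (cyl n \<eta>) (\<lambda>_. c)" for c :: real
    by (simp add: set_integrable_def integrable_indicator_iff P.emeasure_eq_measure)
  have ic: "(LINT \<omega>:cyl n \<eta>|P. c) = r n ^ m * c" for c :: real
    using measure_cyl[OF \<eta>, of n] by (simp add: set_lebesgue_integral_def P.emeasure_eq_measure)
  have "\<bar>(LINT \<omega>:cyl n \<eta>|P. f \<omega>) - r n ^ m * c\<bar> = \<bar>LINT \<omega>:cyl n \<eta>|P. f \<omega> - c\<bar>"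
    by (simp only: set_integral_diff(2)[OF si sc] ic)
  also have "\<dots> \<le> (LINT \<omega>|P. norm (indicator (cyl n \<eta>) \<omega> *\<^sub>R (f \<omega> - c)))"
    unfolding set_lebesgue_integral_def real_norm_def[symmetric] by (rule integral_norm_bound)
  also have "\<dots> \<le> (LINT \<omega>:cyl n \<eta>|P. e)"
    unfolding set_lebesgue_integral_def
  proof (rule integral_mono_AE)
    show "integrable P (\<lambda>\<omega>. norm (indicator (cyl n \<eta>) \<omega> *\<^sub>R (f \<omega> - c)))"
      using set_integral_diff(1)[OF si sc] unfolding set_integrable_def by (rule integrable_norm)
    show "integrable P (\<lambda>\<omega>. indicator (cyl n \<eta>) \<omega> *\<^sub>R e)" using sc[of e] by (simp add: set_integrable_def)
    show "AE \<omega> in P. norm (indicator (cyl n \<eta>) \<omega> *\<^sub>R (f \<omega> - c)) \<le> indicator (cyl n \<eta>) \<omega> *\<^sub>R e"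
      using AE_paths by eventually_elim (use b in \<open>auto simp: indicator_def\<close>)
  qed
  finally show ?thesis by (simp add: ic)
qed

end

section \<open>Growth and pure unrectifiability\<close>

text \<open>The disjoint cubes around the counted centres all lie in the ball enlarged by the size
  of a cube; volumes are compared.\<close>

lemma grid_count:
  fixes A :: "'a::euclidean_space set"
  assumes A: "is_grid A h \<delta>" and B: "B \<subseteq> A" and t: "t \<ge> 0" and near: "\<And>b. b \<in> B \<Longrightarrow> dist u b \<le> t"
  shows "real (card B) * h ^ DIM('a) \<le> unit_ball_vol (real DIM('a)) * (t + real DIM('a) * h / 2) ^ DIM('a)"
proof -
  note G = is_gridD[OF A]
  have fB: "finite B" using G(1) B by (rule finite_subset[rotated])
  have h: "h > 0" by (rule G(3))
  have "real (card B) * h ^ DIM('a) = measure lborel (\<Union>b\<in>B. cube b h)"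
    by (rule is_grid_measure_Union[OF A B, symmetric])
  also have "\<dots> \<le> measure lborel (cball u (t + real DIM('a) * h / 2))"
  proof (rule measure_mono_fmeasurable)
    show "(\<Union>b\<in>B. cube b h) \<subseteq> cball u (t + real DIM('a) * h / 2)"
    proof
      fix w assume "w \<in> (\<Union>b\<in>B. cube b h)"
      then obtain b where b: "b \<in> B" "w \<in> cube b h" by blast
      then have "dist b w \<le> real DIM('a) * h / 2" using cube_subset_cball[of h b] h by auto
      then show "w \<in> cball u (t + real DIM('a) * h / 2)"
        using near[OF b(1)] dist_triangle[of u w b] by simp
    qed
    show "(\<Union>b\<in>B. cube b h) \<in> sets lborel" using sets.finite_UN[OF fB, of "\<lambda>b. cube b h" borel] by auto
  qed simp
  also have "\<dots> = unit_ball_vol (real DIM('a)) * (t + real DIM('a) * h / 2) ^ DIM('a)"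
    using t h by (simp add: content_cball)
  finally show ?thesis .
qed

context cantor
begin

section \<open>Support and growth of the measure\<close>

lemma emeasure_\<mu>_ball: "emeasure \<mu> (ball x \<rho>) = emeasure P (point -` ball x \<rho>)"
  unfolding \<mu>_def by (subst emeasure_distr) simp_all

lemma point_vimage_sets [measurable]: "point -` ball x \<rho> \<in> sets P"
  using measurable_sets[OF point_measurable, of "ball x \<rho>"] by simp

lemma measure_support_\<mu>: "measure_support \<mu> = E"
proof
  show "measure_support \<mu> \<subseteq> E"
  proof
    fix x assume x: "x \<in> measure_support \<mu>"
    show "x \<in> E"
    proof (rule ccontr)
      assume "x \<notin> E"
      then have "open (- E)" "x \<in> - E" using closed_E by auto
      then obtain \<rho> where \<rho>: "\<rho> > 0" "ball x \<rho> \<subseteq> - E" using open_contains_ball by blast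
      have "emeasure P (point -` ball x \<rho>) \<le> emeasure P {}"
      proof (rule emeasure_mono_AE)
        show "AE \<omega> in P. \<omega> \<in> point -` ball x \<rho> \<longrightarrow> \<omega> \<in> {}"
          using AE_paths by eventually_elim (use \<rho> point_in_E in blast)
      qed simp
      then show False using x \<rho>(1) by (auto simp: measure_support_def emeasure_\<mu>_ball dest!: spec[of _ \<rho>])
    qed
  qed
  show "E \<subseteq> measure_support \<mu>"
  proof
    fix x assume x: "x \<in> E"
    have "0 < emeasure \<mu> (ball x \<rho>)" if \<rho>: "\<rho> > 0" for \<rho>
    proof -
      have "\<rho> / 4 > 0" using \<rho> by simp
      then obtain n where "r n < \<rho> / 4"
        using order_tendstoD(2)[OF r_tendsto_0] unfolding eventually_sequentially by blast
      \<comment> \<open>The factor 4 exceeds \<open>2 + 4 / 3\<close>: in units of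
        \<open>r n\<close> these bound the distances of \<open>x\<close> and of the points of the
        cylinder from the common centre.\<close>
      then have n: "4 * r n < \<rho>" by simp
      have "x \<in> F n" using x by (auto simp: E_def)
      then obtain \<eta> where \<eta>: "\<eta> \<in> paths" "dist x (center \<eta> n) \<le> 2 * r n" by (auto simp: F_iff)
      have "0 < ennreal (r n ^ m)" by simp
      also have "\<dots> = emeasure P (cyl n \<eta>)" by (simp add: P.emeasure_eq_measure measure_cyl[OF \<eta>(1)])
      also have "\<dots> \<le> emeasure P (point -` ball x \<rho>)"
      proof (rule emeasure_mono_AE)
        show "AE \<omega> in P. \<omega> \<in> cyl n \<eta> \<longrightarrow> \<omega> \<in> point -` ball x \<rho>"
          using AE_paths
        proof eventually_elim
          case (elim \<omega>)
          show ?case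
          proof
            assume "\<omega> \<in> cyl n \<eta>"
            then have ce: "center \<omega> n = center \<eta> n" by (intro center_cong) (auto simp: cyl_def)
            have "dist x (point \<omega>) < \<rho>"
              using point_center_dist[OF elim, of n, unfolded ce] \<eta>(2) n dist_triangle2[of x "point \<omega>" "center \<eta> n"] r_pos[of n]
              by linarith
            then show "\<omega> \<in> point -` ball x \<rho>" by simp
          qed
        qed
      qed measurable
      finally show ?thesis by (simp add: emeasure_\<mu>_ball)
    qed
    then show "x \<in> measure_support \<mu>" by (simp add: measure_support_def)
  qed
qed

lemma inverse_card_le: "1 / real (card (A k)) \<le> 2 / unit_ball_vol (real DIM('a)) * h k ^ DIM('a)"
proof -
  let ?v = "unit_ball_vol (real DIM('a))"
  have v: "?v > 0" by (simp add: unit_ball_vol_pos)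
  have "\<delta> k ^ DIM('a) \<le> \<delta>0 ^ DIM('a)"
    using \<delta>_pos[of k] \<delta>0 by (intro power_mono) (auto simp: \<delta> mult_left_le power_le_one)
  then have "?v / 2 \<le> real (card (A k)) * h k ^ DIM('a)"
    using is_grid_card(2)[OF grid[of k]] \<delta>0_vol by linarith
  then show ?thesis using v card_A_pos[of k] by (simp add: field_simps)
qed

text \<open>For \<open>r (Suc n) \<le> \<rho> < r n\<close> the ball sees only one ball of
  generation \<open>n\<close>, and with \<open>s = \<rho> / r n\<close> a volume comparison counts
  the sub-balls it sees. If \<open>h n \<le> s\<close>, there are at most order
  \<open>(s / h n) ^ d\<close>, where \<open>d = m + 2\<close>, of total mass at most order
  \<open>s ^ d * r n ^ m\<close>, which is at most \<open>\<rho> ^ m\<close> because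
  \<open>s < 1\<close>. If \<open>s < h n\<close>, their number is bounded and each has mass
  \<open>r (Suc n) ^ m \<le> \<rho> ^ m\<close>.\<close>

lemma has_growth_\<mu>: "has_growth m \<mu>"
proof -
  let ?v = "unit_ball_vol (real DIM('a))" and ?d = "DIM('a)"
  have v: "?v > 0" by (simp add: unit_ball_vol_pos)
  \<comment> \<open>In both cases the radius in \<open>grid_count\<close> is at most
    \<open>1 + real ?d\<close> times the larger of \<open>s\<close> and \<open>h n\<close>.\<close>
  define c where "c = (1 + real ?d) ^ ?d"
  have c: "c \<ge> 0" by (simp add: c_def)
  define C where "C = 1 + (2 + ?v) * c"
  have C: "C \<ge> 1" "2 * c \<le> C" "?v * c \<le> C" using c v by (simp_all add: C_def algebra_simps)
  have "emeasure \<mu> (ball x \<rho>) \<le> ennreal (C * \<rho> ^ m)" if \<rho>: "\<rho> > 0" for x \<rho>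
  proof (cases "\<rho> \<ge> 1")
    case True
    interpret M: prob_space \<mu> by (rule prob_space_\<mu>)
    have "emeasure \<mu> (ball x \<rho>) \<le> 1" by (rule M.emeasure_le_1)
    also have "1 \<le> ennreal (C * \<rho> ^ m)"
      using mult_mono[of 1 C 1 "\<rho> ^ m"] C True by simp
    finally show ?thesis .
  next
    case False
    show ?thesis
    proof (cases "\<exists>\<eta>\<in>paths. point \<eta> \<in> ball x \<rho>")
      case no: False
      have "emeasure P (point -` ball x \<rho>) \<le> emeasure P {}"
        by (rule emeasure_mono_AE) (use AE_paths in \<open>eventually_elim, use no in auto\<close>)
      then show ?thesis by (simp add: emeasure_\<mu>_ball)
    next
      case True
      then obtain \<eta> where \<eta>: "\<eta> \<in> paths" "dist x (point \<eta>) < \<rho>" by auto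
      define k where "k = (LEAST k. r k \<le> \<rho>)"
      obtain j where "r j < \<rho>" using order_tendstoD(2)[OF r_tendsto_0 \<rho>] unfolding eventually_sequentially by blast
      then have "r k \<le> \<rho>" unfolding k_def by (intro LeastI[of "\<lambda>k. r k \<le> \<rho>" j]) simp
      have "k \<noteq> 0"
      proof
        assume "k = 0"
        then show False using \<open>r k \<le> \<rho>\<close> False by simp
      qed
      then obtain n where n: "k = Suc n" by (cases k) auto
      have rn: "r (Suc n) \<le> \<rho>" "\<rho> < r n"
        using \<open>r k \<le> \<rho>\<close> not_less_Least[of n "\<lambda>k. r k \<le> \<rho>"] n by (auto simp: k_def)
      define u where "u = (x - center \<eta> n) /\<^sub>R r n"
      define s where "s = \<rho> / r n"
      have s: "0 < s" "s < 1" using rn \<rho> by (auto simp: s_def)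
      have \<rho>s: "\<rho> = s * r n" by (simp add: s_def)
      define B where "B = {b \<in> A n. dist u b \<le> s + h n / 8}"
      have fB: "finite B" "B \<subseteq> A n" using G(1)[of n] by (auto simp: B_def)
      have "emeasure P (point -` ball x \<rho>) \<le> emeasure P (\<Union>b\<in>B. cyl (Suc n) (\<eta>(n := b)))"
      proof (rule emeasure_mono_AE)
        show "AE \<omega> in P. \<omega> \<in> point -` ball x \<rho> \<longrightarrow> \<omega> \<in> (\<Union>b\<in>B. cyl (Suc n) (\<eta>(n := b)))"
          using AE_paths
        proof eventually_elim
          case (elim \<omega>)
          show ?case
          proof
            assume "\<omega> \<in> point -` ball x \<rho>"
            then have x: "dist x (point \<omega>) < \<rho>" by simp
            have "dist (point \<omega>) (point \<eta>) < 60 * r n"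
              using dist_triangle3[of "point \<omega>" "point \<eta>" x] x \<eta>(2) rn(2) r_pos[of n] by linarith
            moreover have "dist (point \<zeta>) (center \<zeta> n) \<le> 2 * r n" if "\<zeta> \<in> paths" for \<zeta>
              using point_center_dist[OF that, of n] r_pos[of n] by linarith
            ultimately have agree: "\<forall>i<n. \<omega> i = \<eta> i" using elim \<eta>(1) by (intro same_center[OF elim \<eta>(1)]) blast+
            then have cyl: "\<omega> \<in> cyl (Suc n) (\<eta>(n := \<omega> n))" by (auto simp: cyl_def less_Suc_eq)
            have ce: "center \<omega> n = center \<eta> n" by (rule center_cong) (use agree in auto)
            define v where "v = (point \<omega> - center \<eta> n) /\<^sub>R r n"
            have "dist v (\<omega> n) \<le> h n / 8" using point_local(2)[OF elim, of n] by (simp add: v_def ce)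
            moreover have "dist u v \<le> s"
            proof -
              have "u - v = (x - point \<omega>) /\<^sub>R r n" by (simp add: u_def v_def scaleR_diff_right[symmetric])
              then have "dist u v = dist x (point \<omega>) / r n" by (simp add: dist_norm divide_inverse mult.commute)
              then show ?thesis using x by (simp add: s_def divide_right_mono)
            qed
            ultimately have "dist u (\<omega> n) \<le> s + h n / 8" using dist_triangle[of u "\<omega> n" v] by linarith
            then have "\<omega> n \<in> B" using elim by (simp add: B_def paths_def)
            then show "\<omega> \<in> (\<Union>b\<in>B. cyl (Suc n) (\<eta>(n := b)))" using cyl by blast
          qed
        qed
      qed (use fB in auto)
      also have "\<dots> \<le> (\<Sum>b\<in>B. emeasure P (cyl (Suc n) (\<eta>(n := b))))"
        by (rule emeasure_subadditive_finite) (use fB in auto)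
      also have "\<dots> = (\<Sum>b\<in>B. ennreal (r (Suc n) ^ m))"
        using fB(2) by (intro sum.cong refl) (auto simp: P.emeasure_eq_measure measure_cyl path_upd[OF \<eta>(1)])
      also have "\<dots> = ennreal (real (card B) * r (Suc n) ^ m)"
        by (simp add: ennreal_mult ennreal_of_nat_eq_real_of_nat)
      also have "\<dots> \<le> ennreal (C * \<rho> ^ m)"
      proof (rule ennreal_leI)
        have hp: "h n > 0" by (rule h_pos)
        have cnt: "real (card B) * h n ^ ?d \<le> ?v * (s + h n / 8 + real ?d * h n / 2) ^ ?d"
          by (rule grid_count[OF grid fB(2)]) (use s hp in \<open>auto simp: B_def\<close>)
        have d3: "real ?d \<ge> 3" using d m by simp
        show "real (card B) * r (Suc n) ^ m \<le> C * \<rho> ^ m"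
        proof (cases "h n \<le> s")
          case True
          have "s + h n / 8 + real ?d * h n / 2 \<le> (1 + real ?d) * s"
          proof -
            have "real ?d * h n \<le> real ?d * s" "3 * s \<le> real ?d * s"
              using True d3 s by (auto intro!: mult_left_mono mult_right_mono)
            then show ?thesis using True s unfolding distrib_right by linarith
          qed
          then have "(s + h n / 8 + real ?d * h n / 2) ^ ?d \<le> c * s ^ ?d"
            unfolding c_def power_mult_distrib[symmetric] using s hp by (intro power_mono) auto
          then have "real (card B) * h n ^ ?d \<le> ?v * (c * s ^ ?d)"
            using cnt v by (meson mult_left_mono less_imp_le order_trans)
          then have *: "real (card B) * (2 / ?v * h n ^ ?d) \<le> 2 * c * s ^ ?d"
            using v by (simp add: field_simps)
          have "real (card B) * r (Suc n) ^ m = real (card B) * (1 / real (card (A n))) * r n ^ m"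
            using q_card[of n] card_A_pos[of n] by (simp add: r_Suc power_mult_distrib field_simps)
          also have "\<dots> \<le> real (card B) * (2 / ?v * h n ^ ?d) * r n ^ m"
            using inverse_card_le[of n] by (intro mult_right_mono mult_left_mono) auto
          also have "\<dots> \<le> (2 * c * s ^ ?d) * r n ^ m" by (intro mult_right_mono *) auto
          also have "\<dots> \<le> (2 * c * s ^ m) * r n ^ m"
            using s c d by (intro mult_right_mono mult_left_mono power_decreasing) auto
          also have "\<dots> = 2 * c * \<rho> ^ m" by (simp add: \<rho>s power_mult_distrib)
          also have "\<dots> \<le> C * \<rho> ^ m" using C \<rho> by (intro mult_right_mono) auto
          finally show ?thesis .
        next
          case False
          have "s + h n / 8 + real ?d * h n / 2 \<le> (1 + real ?d) * h n"
          proof -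
            have "3 * h n \<le> real ?d * h n" using d3 hp by (intro mult_right_mono) auto
            then show ?thesis using False hp unfolding distrib_right by linarith
          qed
          then have "(s + h n / 8 + real ?d * h n / 2) ^ ?d \<le> c * h n ^ ?d"
            unfolding c_def power_mult_distrib[symmetric] using s hp by (intro power_mono) auto
          then have "real (card B) * h n ^ ?d \<le> ?v * (c * h n ^ ?d)"
            using cnt v by (meson mult_left_mono less_imp_le order_trans)
          then have "real (card B) \<le> ?v * c" using hp by simp
          then have "real (card B) * r (Suc n) ^ m \<le> (?v * c) * \<rho> ^ m"
            using rn(1) c v by (intro mult_mono power_mono) auto
          also have "\<dots> \<le> C * \<rho> ^ m" using C \<rho> by (intro mult_right_mono) auto
          finally show ?thesis .
        qed
      qed
      finally show ?thesis by (simp add: emeasure_\<mu>_ball)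
    qed
  qed
  then show ?thesis unfolding has_growth_def using C by (intro exI[of _ C]) auto
qed

section \<open>Hausdorff measure of the limit set and its rectifiable parts\<close>

lemma hausdorff_outer_le_of_pre:
  assumes b: "\<And>n. hausdorff_pre m (4 * r (Suc n)) S \<le> ennreal (b n)" and lim: "b \<longlonglongrightarrow> l" and l: "l \<ge> 0"
  shows "hausdorff_outer m S \<le> ennreal l"
  unfolding hausdorff_outer_def
proof (rule SUP_least)
  fix \<epsilon> :: real assume "\<epsilon> \<in> {0<..}"
  then have \<epsilon>: "\<epsilon> / 4 > 0" by simp
  have "eventually (\<lambda>n. hausdorff_pre m \<epsilon> S \<le> ennreal (b n)) sequentially"
    using order_tendstoD(2)[OF LIMSEQ_Suc[OF r_tendsto_0] \<epsilon>]
  proof eventually_elim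
    case (elim n)
    then have "hausdorff_pre m \<epsilon> S \<le> hausdorff_pre m (4 * r (Suc n)) S" by (intro hausdorff_pre_mono) auto
    then show ?case using b[of n] by simp
  qed
  moreover have "(\<lambda>n. ennreal (b n)) \<longlonglongrightarrow> ennreal l" using lim by (rule tendsto_ennrealI)
  ultimately show "hausdorff_pre m \<epsilon> S \<le> ennreal l"
    using tendsto_lowerbound[of "\<lambda>n. ennreal (b n)" "ennreal l" sequentially] by auto
qed

lemma hausdorff_outer_E: "hausdorff_outer m E < \<infinity>"
proof -
  have "hausdorff_pre m (4 * r (Suc n)) E \<le> ennreal (unit_ball_vol (real m) * 2 ^ m)" for n
  proof -
    have "hausdorff_pre m (2 * (2 * r (Suc n))) E
        \<le> ennreal (real (card (centers (Suc n))) * (unit_ball_vol (real m) * (2 * r (Suc n)) ^ m))"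
      by (rule hausdorff_pre_finite_cballs[OF finite_centers]) (auto simp: E_def F_def)
    also have "\<dots> \<le> ennreal (unit_ball_vol (real m) * 2 ^ m)"
    proof (rule ennreal_leI)
      have "(unit_ball_vol (real m) * 2 ^ m) * (real (card (centers (Suc n))) * r (Suc n) ^ m)
          \<le> (unit_ball_vol (real m) * 2 ^ m) * 1"
        by (intro mult_left_mono card_centers) auto
      then show "real (card (centers (Suc n))) * (unit_ball_vol (real m) * (2 * r (Suc n)) ^ m)
          \<le> unit_ball_vol (real m) * 2 ^ m"
        by (simp add: power_mult_distrib ac_simps)
    qed
    finally show ?thesis by simp
  qed
  then have "hausdorff_outer m E \<le> ennreal (unit_ball_vol (real m) * 2 ^ m)"
    by (rule hausdorff_outer_le_of_pre) auto
  also have "\<dots> < \<infinity>" by simp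
  finally show ?thesis .
qed

lemma dimensional_measure_\<mu>: "dimensional_measure m \<mu>"
  unfolding dimensional_measure_def measure_support_\<mu> using hausdorff_outer_E has_growth_\<mu> by simp

(* A Lipschitz image of a cube of side comparable to the separation of the balls of one
   generation meets E inside a single, much smaller, ball of that generation. *)
lemma lipschitz_image_null:
  assumes f: "lipschitz_map m f"
  shows "hausdorff_outer m (E \<inter> f ` {x \<in> topspace (Euclidean_space m). \<forall>i<m. \<bar>x i\<bar> \<le> real M}) = 0"
proof -
  let ?S = "{x \<in> topspace (Euclidean_space m). \<forall>i<m. \<bar>x i\<bar> \<le> real M}"
  obtain L0 where L0: "\<And>x y. x \<in> topspace (Euclidean_space m) \<Longrightarrow> y \<in> topspace (Euclidean_space m) \<Longrightarrow>
      dist (f x) (f y) \<le> L0 * L2_set (\<lambda>k. x k - y k) {..<m}"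
    using f unfolding lipschitz_map_def by blast
  define L where "L = max 1 L0"
  have L: "L \<ge> 1" "L0 \<le> L" by (auto simp: L_def)
  have Lip: "dist (f x) (f y) \<le> L * (\<Sum>k<m. \<bar>x k - y k\<bar>)" if "x \<in> ?S" "y \<in> ?S" for x y
  proof -
    have "dist (f x) (f y) \<le> L0 * L2_set (\<lambda>k. x k - y k) {..<m}" using that by (intro L0) auto
    also have "\<dots> \<le> L * L2_set (\<lambda>k. x k - y k) {..<m}" using L by (intro mult_right_mono) auto
    also have "\<dots> \<le> L * (\<Sum>k<m. \<bar>x k - y k\<bar>)"
      using L by (intro mult_left_mono L2_set_le_sum_abs) auto
    finally show ?thesis .
  qed
  define c where "c = 8 * L * real m * (2 * real M + 3)"
  have pre: "hausdorff_pre m (4 * r (Suc n)) (E \<inter> f ` ?S) \<le> ennreal (unit_ball_vol (real m) * (c * \<delta> n) ^ m)" for n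
  proof -
    \<comment> \<open>Points of one cell then have images at most \<open>r n * h n / 4\<close>
      apart, below the threshold \<open>r n * h n / 2\<close> of
      \<open>same_center_Suc\<close>.\<close>
    define g where "g = r n * h n / (4 * L * real m)"
    have m1: "real m \<ge> 1" using m by simp
    have g: "g > 0" using h_pos[of n] L m1 by (simp add: g_def)
    have Lg: "L * (real m * g) = r n * h n / 4" using L m1 by (simp add: g_def)
    have "g \<le> 1"
    proof -
      have "r n * h n \<le> 1 * 1" using r_antimono[of 0 n] h_le[of n] h_pos[of n] by (intro mult_mono) auto
      moreover have "1 \<le> L * real m" using mult_mono[of 1 L 1 "real m"] L m1 by simp
      ultimately show ?thesis using L m1 by (simp add: g_def)
    qed
    define K where "K = \<lceil>real M / g\<rceil>"
    have "real M / g \<ge> 0" using g by simp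
    then have K0: "K \<ge> 0" unfolding K_def by linarith
    define cell where "cell x = (\<lambda>k\<in>{..<m}. \<lfloor>x k / g\<rfloor>)" for x :: "nat \<Rightarrow> real"
    define Z where "Z = cell ` {x \<in> ?S. f x \<in> E}"
    have Zsub: "Z \<subseteq> PiE {..<m} (\<lambda>_. {- K..K})"
    proof
      fix z assume "z \<in> Z"
      then obtain x where x: "z = cell x" "x \<in> ?S" by (auto simp: Z_def)
      show "z \<in> PiE {..<m} (\<lambda>_. {- K..K})"
        unfolding x(1) cell_def
      proof (rule restrict_PiE_iff[THEN iffD2], rule ballI)
        fix k assume "k \<in> {..<m}"
        then have "\<bar>x k\<bar> \<le> real M" using x(2) by auto
        then have "\<bar>x k / g\<bar> \<le> real M / g" using g by (simp add: abs_divide divide_right_mono)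
        moreover have "real M / g \<le> real_of_int K" by (simp add: K_def)
        ultimately have "- real_of_int K \<le> x k / g" "x k / g \<le> real_of_int K" by linarith+
        then show "\<lfloor>x k / g\<rfloor> \<in> {- K..K}" by (simp add: le_floor_iff floor_le_iff)
      qed
    qed
    have finZ: "finite Z" by (rule finite_subset[OF Zsub]) (auto intro!: finite_PiE)
    have "card Z \<le> card (PiE {..<m} (\<lambda>_. {- K..K}))" by (rule card_mono[OF _ Zsub]) (auto intro!: finite_PiE)
    also have "\<dots> = nat (2 * K + 1) ^ m" by (simp add: card_PiE)
    finally have "real (card Z) \<le> real (nat (2 * K + 1)) ^ m" by (metis of_nat_le_iff of_nat_power)
    also have "\<dots> \<le> ((2 * real M + 3) / g) ^ m"
    proof (rule power_mono)
      have "real_of_int K \<le> real M / g + 1" unfolding K_def by linarith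
      then have "2 * real_of_int K + 1 \<le> (2 * real M) / g + 3" by simp
      also have "\<dots> \<le> (2 * real M) / g + 3 / g" using g \<open>g \<le> 1\<close> by (simp add: pos_le_divide_eq)
      finally show "real (nat (2 * K + 1)) \<le> (2 * real M + 3) / g" using K0 by (simp add: add_divide_distrib)
    qed simp
    finally have cZ: "real (card Z) \<le> ((2 * real M + 3) / g) ^ m" .
    have "\<exists>p. \<forall>x\<in>?S. f x \<in> E \<longrightarrow> cell x = z \<longrightarrow> f x \<in> cball p (2 * r (Suc n))" for z
    proof (cases "z \<in> Z")
      case True
      then obtain x0 where x0: "x0 \<in> ?S" "f x0 \<in> E" "cell x0 = z" by (auto simp: Z_def)
      then have "f x0 \<in> F (Suc n)" by (auto simp: E_def)
      then obtain \<eta> where \<eta>: "\<eta> \<in> paths" "dist (f x0) (center \<eta> (Suc n)) \<le> 2 * r (Suc n)" by (auto simp: F_iff)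
      show ?thesis
      proof (intro exI[of _ "center \<eta> (Suc n)"] ballI impI)
        fix x assume x: "x \<in> ?S" "f x \<in> E" "cell x = z"
        then have "f x \<in> F (Suc n)" by (auto simp: E_def)
        then obtain \<omega> where \<omega>: "\<omega> \<in> paths" "dist (f x) (center \<omega> (Suc n)) \<le> 2 * r (Suc n)" by (auto simp: F_iff)
        have "\<bar>x k - x0 k\<bar> \<le> g" if k: "k < m" for k
        proof -
          have "\<lfloor>x k / g\<rfloor> = \<lfloor>x0 k / g\<rfloor>"
          proof -
            have "cell x k = cell x0 k" using x(3) x0(3) by simp
            then show ?thesis using k by (simp add: cell_def)
          qed
          then have "\<bar>x k / g - x0 k / g\<bar> \<le> 1" by linarith
          then have "\<bar>x k - x0 k\<bar> / g \<le> 1" using g by (simp add: diff_divide_distrib[symmetric])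
          then show ?thesis using g by (simp add: pos_divide_le_eq)
        qed
        then have "(\<Sum>k<m. \<bar>x k - x0 k\<bar>) \<le> (\<Sum>k<m. g)" by (intro sum_mono) auto
        then have "dist (f x) (f x0) \<le> L * (real m * g)"
          using Lip[OF x(1) x0(1)] L by (simp add: order_trans[OF _ mult_left_mono])
        then have "dist (f x) (f x0) < r n * h n / 2"
          unfolding Lg using mult_pos_pos[OF r_pos h_pos, of n n] by linarith
        then have "\<forall>i<Suc n. \<omega> i = \<eta> i" by (intro same_center_Suc[OF \<omega>(1) \<eta>(1) \<omega>(2) \<eta>(2)])
        then have "center \<omega> (Suc n) = center \<eta> (Suc n)" by (intro center_cong) auto
        then show "f x \<in> cball (center \<eta> (Suc n)) (2 * r (Suc n))" using \<omega>(2) by (simp add: dist_commute)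
      qed
    qed (auto simp: Z_def)
    then have "\<forall>z. \<exists>p. \<forall>x\<in>?S. f x \<in> E \<longrightarrow> cell x = z \<longrightarrow> f x \<in> cball p (2 * r (Suc n))" by (rule allI)
    from choice[OF this] obtain p
      where p: "\<forall>z. \<forall>x\<in>?S. f x \<in> E \<longrightarrow> cell x = z \<longrightarrow> f x \<in> cball (p z) (2 * r (Suc n))" by (rule exE)
    have "hausdorff_pre m (2 * (2 * r (Suc n))) (E \<inter> f ` ?S)
       \<le> ennreal (real (card (p ` Z)) * (unit_ball_vol (real m) * (2 * r (Suc n)) ^ m))"
    proof (rule hausdorff_pre_finite_cballs)
      show "E \<inter> f ` ?S \<subseteq> (\<Union>z\<in>p ` Z. cball z (2 * r (Suc n)))"
      proof
        fix y assume "y \<in> E \<inter> f ` ?S"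
        then obtain x where x: "y = f x" "x \<in> ?S" "f x \<in> E" by blast
        then have "cell x \<in> Z" by (auto simp: Z_def)
        moreover have "y \<in> cball (p (cell x)) (2 * r (Suc n))" using p[rule_format, OF x(2,3) refl] x(1) by simp
        ultimately show "y \<in> (\<Union>z\<in>p ` Z. cball z (2 * r (Suc n)))" by blast
      qed
    qed (use finZ in auto)
    also have "\<dots> \<le> ennreal (unit_ball_vol (real m) * (c * \<delta> n) ^ m)"
    proof (rule ennreal_leI)
      have "real (card (p ` Z)) \<le> ((2 * real M + 3) / g) ^ m"
        using cZ card_image_le[OF finZ, of p] by linarith
      then have "real (card (p ` Z)) * (unit_ball_vol (real m) * (2 * r (Suc n)) ^ m)
         \<le> ((2 * real M + 3) / g) ^ m * (unit_ball_vol (real m) * (2 * r (Suc n)) ^ m)"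
        by (intro mult_right_mono) auto
      also have "\<dots> = unit_ball_vol (real m) * ((2 * real M + 3) / g * (2 * r (Suc n))) ^ m"
        by (simp only: power_mult_distrib ac_simps)
      also have "\<dots> \<le> unit_ball_vol (real m) * (c * \<delta> n) ^ m"
      proof (intro mult_left_mono power_mono)
        \<comment> \<open>The number of cells grows like \<open>1 / g ^ m\<close>, so only the ratio
          \<open>q n / h n\<close> of radius to gap survives, and it is at most
          \<open>\<delta> n\<close>.\<close>
        have "(2 * real M + 3) / g * (2 * r (Suc n)) = c * (q n / h n)"
          using L m1 h_pos[of n] by (simp add: g_def c_def r_Suc field_simps)
        also have "\<dots> \<le> c * \<delta> n"
          using q_le[of n] h_pos[of n] L by (intro mult_left_mono) (auto simp: c_def pos_divide_le_eq)
        finally show "(2 * real M + 3) / g * (2 * r (Suc n)) \<le> c * \<delta> n" .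
      qed (use g in auto)
      finally show "real (card (p ` Z)) * (unit_ball_vol (real m) * (2 * r (Suc n)) ^ m)
        \<le> unit_ball_vol (real m) * (c * \<delta> n) ^ m" .
    qed
    finally show ?thesis by simp
  qed
  have "\<delta> \<longlonglongrightarrow> \<delta>0 * 0"
    unfolding \<delta>[abs_def] by (intro tendsto_mult tendsto_const LIMSEQ_realpow_zero) auto
  then have "(\<lambda>n. unit_ball_vol (real m) * (c * \<delta> n) ^ m) \<longlonglongrightarrow> unit_ball_vol (real m) * (c * (\<delta>0 * 0)) ^ m"
    by (intro tendsto_intros)
  then have "(\<lambda>n. unit_ball_vol (real m) * (c * \<delta> n) ^ m) \<longlonglongrightarrow> 0" using m by (simp add: power_0_left)
  from hausdorff_outer_le_of_pre[OF pre this] show ?thesis by simp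
qed

text \<open>Countable subadditivity reduces a rectifiable set to a null set and Lipschitz images of
  the bounded pieces \<open>S M\<close>.\<close>

lemma purely_unrectifiable_E: "purely_unrectifiable m E"
  unfolding purely_unrectifiable_def
proof (intro allI impI)
  fix B :: "'a set" assume "rectifiable m B"
  then obtain f :: "nat \<Rightarrow> (nat \<Rightarrow> real) \<Rightarrow> 'a" where f: "\<And>i. lipschitz_map m (f i)"
    and B: "hausdorff_outer m (B - (\<Union>i. f i ` topspace (Euclidean_space m))) = 0"
    unfolding rectifiable_def by blast
  define S where "S M = {x \<in> topspace (Euclidean_space m). \<forall>i<m. \<bar>x i\<bar> \<le> real M}" for M :: nat
  have top: "topspace (Euclidean_space m) = (\<Union>M. S M)"
  proof
    show "topspace (Euclidean_space m) \<subseteq> (\<Union>M. S M)"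
    proof
      fix x assume x: "x \<in> topspace (Euclidean_space m)"
      obtain M :: nat where "(\<Sum>i<m. \<bar>x i\<bar>) \<le> real M" using real_arch_simple by blast
      then have "\<bar>x i\<bar> \<le> real M" if "i < m" for i
        using member_le_sum[of i "{..<m}" "\<lambda>i. \<bar>x i\<bar>"] that by simp
      then show "x \<in> (\<Union>M. S M)" using x by (auto simp: S_def)
    qed
  qed (auto simp: S_def)
  have null: "hausdorff_outer m (\<Union>j. X j) = 0" if "\<And>j. hausdorff_outer m (X j) = 0" for X :: "nat \<Rightarrow> 'a set"
    using hausdorff_outer_countably_subadditive[of m X] that by simp
  define R where "R = B - (\<Union>i. f i ` topspace (Euclidean_space m))"
  define V where "V = (\<Union>i. \<Union>M. E \<inter> f i ` S M)"
  have V0: "hausdorff_outer m V = 0"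
    unfolding V_def S_def by (intro null lipschitz_image_null f)
  have T: "f i ` topspace (Euclidean_space m) = (\<Union>M. f i ` S M)" for i by (simp only: top image_UN)
  have "E \<inter> B \<subseteq> R \<union> V" unfolding R_def V_def T by auto
  then have "hausdorff_outer m (E \<inter> B) \<le> hausdorff_outer m (R \<union> V)" by (rule hausdorff_outer_mono)
  also have "\<dots> \<le> hausdorff_outer m R + hausdorff_outer m V" by (rule hausdorff_outer_subadditive)
  also have "\<dots> = 0" using B V0 by (simp add: R_def)
  finally show "hausdorff_outer m (E \<inter> B) = 0" by simp
qed

end

section \<open>Boundedness of the potential\<close>

text \<open>The ball of radius \<open>\<tau> / 2\<close> around \<open>p\<close> is covered by the
  cubes with centre in \<open>ball p \<tau>\<close> and by the part missed by the grid, which has at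
  most half the volume of that ball. The cubes must fill the other half.\<close>

lemma grid_fraction:
  fixes A :: "'a::euclidean_space set"
  assumes A: "is_grid A h \<delta>" and p: "norm p + \<tau> \<le> 1" and \<tau>: "\<tau> > 0"
    and h: "real DIM('a) * h < \<tau>" and \<delta>: "\<delta> ^ DIM('a) \<le> unit_ball_vol (real DIM('a)) * (\<tau> / 2) ^ DIM('a) / 2"
  shows "(\<tau> / 2) ^ DIM('a) / 2 \<le> real (card (A \<inter> ball p \<tau>)) / real (card A)"
proof -
  let ?v = "unit_ball_vol (real DIM('a))"
  note G = is_gridD[OF A]
  have v: "?v > 0" by (simp add: unit_ball_vol_pos)
  define B where "B = A \<inter> ball p \<tau>"
  have fB: "finite B" "B \<subseteq> A" using G(1) by (auto simp: B_def)
  let ?U = "\<Union>b\<in>B. cube b h" and ?m = "cball 0 1 - (\<Union>a\<in>A. cube a h)"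
  have Um: "?U \<in> sets borel" using sets.finite_UN[OF fB(1), of "\<lambda>b. cube b h" borel] by auto
  have Vm: "(\<Union>a\<in>A. cube a h) \<in> sets borel" using sets.finite_UN[OF G(1), of "\<lambda>b. cube b h" borel] by auto
  have mf: "?m \<in> fmeasurable lborel" by (rule fmeasurable_Diff) (use Vm in auto)
  have "?U \<subseteq> cball 0 1" using G(6) fB(2) by blast
  then have Uf: "?U \<in> fmeasurable lborel" by (rule fmeasurableI2[OF cball_fmeasurable]) (use Um in simp)
  have sub: "cball p (\<tau> / 2) \<subseteq> ?U \<union> ?m"
  proof
    fix w assume w: "w \<in> cball p (\<tau> / 2)"
    then have "norm w \<le> norm p + \<tau> / 2" using norm_triangle_sub[of w p] by (simp add: dist_norm norm_minus_commute)
    then have w1: "w \<in> cball 0 1" using p \<tau> by simp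
    show "w \<in> ?U \<union> ?m"
    proof (cases "\<exists>a\<in>A. w \<in> cube a h")
      case True
      then obtain a where a: "a \<in> A" "w \<in> cube a h" by blast
      have "dist a w \<le> real DIM('a) * h / 2" using cube_subset_cball[of h a] G(3) a(2) by auto
      then have "dist p a < \<tau>" using w h dist_triangle[of p a w] by (simp add: dist_commute)
      then show ?thesis using a by (auto simp: B_def)
    qed (use w1 in auto)
  qed
  have "?v * (\<tau> / 2) ^ DIM('a) = measure lborel (cball p (\<tau> / 2))" using \<tau> by (simp add: content_cball)
  also have "\<dots> \<le> measure lborel (?U \<union> ?m)"
    by (rule measure_mono_fmeasurable[OF sub]) (use Uf mf in auto)
  also have "\<dots> \<le> measure lborel ?U + measure lborel ?m"
    by (rule measure_Un_le) (use Um Vm in auto)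
  also have "\<dots> \<le> real (card B) * h ^ DIM('a) + \<delta> ^ DIM('a)"
    using G(9) is_grid_measure_Union[OF A fB(2)] by simp
  finally have "?v * (\<tau> / 2) ^ DIM('a) / 2 \<le> real (card B) * h ^ DIM('a)" using \<delta> by linarith
  moreover have "(\<tau> / 2) ^ DIM('a) / 2 * (real (card A) * h ^ DIM('a)) \<le> (\<tau> / 2) ^ DIM('a) / 2 * ?v"
    using is_grid_card(1)[OF A] \<tau> by (intro mult_left_mono) auto
  moreover have N: "real (card A) > 0" using G(1,2) by (simp add: card_gt_0_iff)
  ultimately have "((\<tau> / 2) ^ DIM('a) / 2 * real (card A)) * h ^ DIM('a) \<le> real (card B) * h ^ DIM('a)"
    by (simp add: mult.commute mult.left_commute)
  then have "(\<tau> / 2) ^ DIM('a) / 2 * real (card A) \<le> real (card B)" using G(3) by simp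
  then show ?thesis using N by (simp add: B_def pos_le_divide_eq)
qed

context cantor
begin

lemma \<delta>_tendsto_0: "\<delta> \<longlonglongrightarrow> 0"
proof -
  have "\<delta> \<longlonglongrightarrow> \<delta>0 * 0"
    unfolding \<delta>[abs_def] by (intro tendsto_mult tendsto_const LIMSEQ_realpow_zero) auto
  then show ?thesis by simp
qed

lemma eventually_grid_fraction:
  assumes p: "norm p + \<tau> \<le> 1" and \<tau>: "\<tau> > 0"
  shows "\<forall>\<^sub>F k in sequentially. (\<tau> / 2) ^ DIM('a) / 2 \<le> real (card (A k \<inter> ball p \<tau>)) / real (card (A k))"
proof -
  let ?c = "unit_ball_vol (real DIM('a)) * (\<tau> / 2) ^ DIM('a) / 2"
  have c: "?c > 0" using \<tau> by (simp add: unit_ball_vol_pos)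
  have "(\<lambda>k. \<delta> k ^ DIM('a)) \<longlonglongrightarrow> 0"
    using tendsto_power[OF \<delta>_tendsto_0, of "DIM('a)"] by (simp add: power_0_left)
  then have 1: "\<forall>\<^sub>F k in sequentially. \<delta> k ^ DIM('a) < ?c" using c by (rule order_tendstoD(2))
  have 2: "\<forall>\<^sub>F k in sequentially. \<delta> k < \<tau> / real DIM('a)"
    using \<tau> by (intro order_tendstoD(2)[OF \<delta>_tendsto_0]) auto
  from 1 2 show ?thesis
  proof eventually_elim
    case (elim k)
    have "real DIM('a) * h k \<le> real DIM('a) * \<delta> k" using G(4)[of k] by (intro mult_left_mono) auto
    also have "\<dots> < \<tau>" using elim(2) by (simp add: pos_less_divide_eq mult.commute)
    finally show ?case using elim(1) by (intro grid_fraction[OF grid p \<tau>]) auto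
  qed
qed

lemma grid_volume: "unit_ball_vol (real DIM('a)) / 2 \<le> real (card (A k)) * h k ^ DIM('a)"
proof -
  have "1 / real (card (A k)) \<le> 2 / unit_ball_vol (real DIM('a)) * h k ^ DIM('a)" by (rule inverse_card_le)
  then show ?thesis using card_A_pos[of k] unit_ball_vol_pos[of "real DIM('a)"] by (simp add: field_simps)
qed

end

section \<open>Expansion of the potential over the generations\<close>

locale cantor_kernel = cantor m A h q \<delta> \<delta>0 + hk: hoelder_kernel \<Omega> m \<alpha> C M
  for m and A :: "nat \<Rightarrow> 'a::euclidean_space set" and h q \<delta> \<delta>0 and \<Omega> :: "'a \<Rightarrow> real" and \<alpha> C M
begin

definition I :: "'a \<Rightarrow> real" where "I u = (LINT w:cball 0 1|lborel. homogeneous_kernel m \<Omega> (u - w))"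

definition Cerr :: real where
  "Cerr = 2 / unit_ball_vol (real DIM('a)) * hk.C2"

text \<open>The factor in front comes from the lower bound for
  \<open>card (A n) * h n ^ DIM('a)\<close>. The first summand bounds the far cells. The second
  bounds the nearest one, where the kernel is at most \<open>M * (3 / 2) ^ m / q n ^ m\<close> and
  \<open>1 / q n ^ m\<close> is cancelled by the relative mass \<open>1 / card (A n)\<close> of a
  sub-ball.\<close>

definition Clast :: real where
  "Clast = 2 / unit_ball_vol (real DIM('a)) * (M * (4 * real DIM('a)) ^ m * (real DIM('a) * 9 / 2 * unit_ball_vol (real DIM('a)))
     + M * (3 / 2) ^ m * unit_ball_vol (real DIM('a)))"

lemma potential_eq: "potential m \<Omega> \<mu> x = (LINT \<omega>|P. hk.K (x - point \<omega>))"
  unfolding potential_def \<mu>_def by (subst integral_distr) simp_all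

lemma kernel_measurable: "(\<lambda>\<omega>. hk.K (x - point \<omega>)) \<in> borel_measurable P"
  by measurable

lemma kernel_integrable_far:
  assumes "\<rho> > 0" "\<And>\<omega>. \<omega> \<in> paths \<Longrightarrow> \<rho> \<le> dist x (point \<omega>)"
  shows "integrable P (\<lambda>\<omega>. hk.K (x - point \<omega>))" and "\<bar>LINT \<omega>|P. hk.K (x - point \<omega>)\<bar> \<le> M / \<rho> ^ m"
proof -
  have AE: "AE \<omega> in P. norm (hk.K (x - point \<omega>)) \<le> M / \<rho> ^ m"
    using AE_paths
  proof eventually_elim
    case (elim \<omega>)
    have "\<bar>hk.K (x - point \<omega>)\<bar> \<le> M / norm (x - point \<omega>) ^ m" by (rule hk.K_bound)
    also have "\<dots> \<le> M / \<rho> ^ m"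
      using assms(1) assms(2)[OF elim] hk.M0
      by (intro divide_left_mono power_mono mult_pos_pos zero_less_power) (auto simp: dist_norm)
    finally show ?case by simp
  qed
  show int: "integrable P (\<lambda>\<omega>. hk.K (x - point \<omega>))"
    by (rule P.integrable_const_bound[OF AE kernel_measurable])
  have "\<bar>LINT \<omega>|P. hk.K (x - point \<omega>)\<bar> \<le> (LINT \<omega>|P. norm (hk.K (x - point \<omega>)))"
    unfolding real_norm_def[symmetric] by (rule integral_norm_bound)
  also have "\<dots> \<le> (LINT \<omega>|P. M / \<rho> ^ m)" by (rule integral_mono_AE) (use int AE in auto)
  finally show "\<bar>LINT \<omega>|P. hk.K (x - point \<omega>)\<bar> \<le> M / \<rho> ^ m" using P.prob_space by simp
qed

lemma kernel_integrable:
  assumes "x \<notin> E" shows "integrable P (\<lambda>\<omega>. hk.K (x - point \<omega>))"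
proof -
  have "open (- E)" "x \<in> - E" using assms closed_E by auto
  then obtain \<rho> where \<rho>: "\<rho> > 0" "ball x \<rho> \<subseteq> - E" using open_contains_ball by blast
  have "\<rho> \<le> dist x (point \<omega>)" if "\<omega> \<in> paths" for \<omega>
    using \<rho>(2) point_in_E[OF that] by (force simp: not_le[symmetric])
  then show ?thesis by (rule kernel_integrable_far(1)[OF \<rho>(1)])
qed

lemma cell_local:
  assumes \<eta>: "\<eta> \<in> paths" and \<omega>: "\<omega> \<in> paths" "\<omega> \<in> cyl (Suc k) (\<eta>(k := b))"
  defines "v \<equiv> (point \<omega> - center \<eta> k) /\<^sub>R r k"
  shows "dist v b \<le> 4 / 3 * q k" "dist v b \<le> h k / 8"
    and "hk.K (x - point \<omega>) = hk.K ((x - center \<eta> k) /\<^sub>R r k - v) / r k ^ m"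
proof -
  have wk: "\<omega> k = b" and ce: "center \<omega> k = center \<eta> k"
    using \<omega>(2) by (auto simp: cyl_def less_Suc_eq intro!: center_cong)
  show "dist v b \<le> 4 / 3 * q k" "dist v b \<le> h k / 8"
    using point_local[OF \<omega>(1), of k] by (simp_all add: v_def wk ce)
  have "x - point \<omega> = r k *\<^sub>R ((x - center \<eta> k) /\<^sub>R r k - v)"
    by (simp add: v_def scaleR_diff_right)
  then show "hk.K (x - point \<omega>) = hk.K ((x - center \<eta> k) /\<^sub>R r k - v) / r k ^ m"
    using homogeneous_kernel_scale[OF r_pos] by metis
qed

text \<open>The cylinder has mass \<open>r k ^ m / card (A k)\<close>, so \<open>card (A k)\<close>
  times its integral is the average of \<open>f * r k ^ m\<close>. A pointwise estimate for the
  rescaled kernel passes to this average.\<close>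

lemma cell_integral_bound:
  assumes f: "integrable P f" and \<eta>: "\<eta> \<in> paths" and b: "b \<in> A k"
    and bound: "\<And>\<omega>. \<omega> \<in> paths \<Longrightarrow> \<omega> \<in> cyl (Suc k) (\<eta>(k := b)) \<Longrightarrow> \<bar>f \<omega> * r k ^ m * h k ^ DIM('a) - J\<bar> \<le> e"
  shows "\<bar>real (card (A k)) * (LINT \<omega>:cyl (Suc k) (\<eta>(k := b))|P. f \<omega>) * h k ^ DIM('a) - J\<bar> \<le> e"
proof -
  let ?N = "real (card (A k))"
  let ?I = "LINT \<omega>:cyl (Suc k) (\<eta>(k := b))|P. f \<omega>"
  have N: "?N > 0" using card_A_pos[of k] by simp
  define s where "s = r k ^ m * h k ^ DIM('a)"
  have s: "s > 0" using h_pos[of k] by (simp add: s_def)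
  have "\<bar>f \<omega> - J / s\<bar> \<le> e / s" if "\<omega> \<in> paths" "\<omega> \<in> cyl (Suc k) (\<eta>(k := b))" for \<omega>
  proof -
    have "f \<omega> - J / s = (f \<omega> * r k ^ m * h k ^ DIM('a) - J) / s"
      using h_pos[of k] by (simp add: s_def diff_divide_distrib)
    then have "\<bar>f \<omega> - J / s\<bar> = \<bar>f \<omega> * r k ^ m * h k ^ DIM('a) - J\<bar> / s" using s by simp
    also have "\<dots> \<le> e / s" using bound[OF that] s by (intro divide_right_mono) auto
    finally show ?thesis .
  qed
  then have "\<bar>?I - r (Suc k) ^ m * (J / s)\<bar> \<le> r (Suc k) ^ m * (e / s)"
    by (rule cyl_integral_bound[OF f path_upd[OF \<eta> b]])
  moreover have "r (Suc k) ^ m = r k ^ m / ?N"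
    using q_card[of k] N by (simp add: r_Suc power_mult_distrib field_simps)
  ultimately have *: "\<bar>?I - r k ^ m / ?N * (J / s)\<bar> \<le> r k ^ m / ?N * (e / s)" by simp
  have t: "?N * h k ^ DIM('a) > 0" using N h_pos[of k] by simp
  have "?N * ?I * h k ^ DIM('a) - J = ?N * h k ^ DIM('a) * (?I - r k ^ m / ?N * (J / s))"
    using N h_pos[of k] by (simp add: s_def right_diff_distrib)
  then have "\<bar>?N * ?I * h k ^ DIM('a) - J\<bar> = ?N * h k ^ DIM('a) * \<bar>?I - r k ^ m / ?N * (J / s)\<bar>"
    using t h_pos[of k] by (simp add: abs_mult)
  also have "\<dots> \<le> ?N * h k ^ DIM('a) * (r k ^ m / ?N * (e / s))"
    using t by (intro mult_left_mono *) auto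
  also have "\<dots> = e" using N h_pos[of k] by (simp add: s_def)
  finally show ?thesis .
qed

text \<open>The difference of the two integrals is the contribution of the sub-balls that branch off
  the path at step \<open>k\<close>. Each has relative mass \<open>1 / card (A k)\<close>, where
  Lebesgue measure assigns \<open>h k ^ DIM('a)\<close> to its cube; hence the quotient under
  \<open>I\<close>.\<close>

lemma level_error:
  assumes \<eta>: "\<eta> \<in> paths" and x: "dist x (center \<eta> n) \<le> 2 * r n" and k: "k < n" and xE: "x \<notin> E"
  shows "\<bar>(LINT \<omega>:cyl k \<eta>|P. hk.K (x - point \<omega>)) - (LINT \<omega>:cyl (Suc k) \<eta>|P. hk.K (x - point \<omega>))
     - I ((x - center \<eta> k) /\<^sub>R r k) / (real (card (A k)) * h k ^ DIM('a))\<bar> \<le> Cerr * \<delta> k powr \<alpha>"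
proof -
  define u where "u = (x - center \<eta> k) /\<^sub>R r k"
  define f where "f \<omega> = hk.K (x - point \<omega>)" for \<omega>
  define Y where "Y b = (LINT \<omega>:cyl (Suc k) (\<eta>(k := b))|P. f \<omega>)" for b
  let ?N = "real (card (A k))"
  have N: "?N > 0" using card_A_pos[of k] by simp
  have v: "unit_ball_vol (real DIM('a)) > 0" by (simp add: unit_ball_vol_pos)
  have f: "integrable P f" unfolding f_def by (rule kernel_integrable[OF xE])
  have \<eta>k: "\<eta> k \<in> A k" using \<eta> by (simp add: paths_def)
  have u: "dist u (\<eta> k) \<le> h k / 8" "norm u \<le> 1"
    using center_local[OF \<eta> k x] by (simp_all add: u_def)
  have "\<bar>?N * Y b * h k ^ DIM('a) - (LINT w:cube b (h k)|lborel. hk.K (u - w))\<bar>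
     \<le> hk.C1 * h k powr \<alpha> * (LINT w:cube b (h k)|lborel. 1 / norm (u - w) ^ Suc m)" if b: "b \<in> A k - {\<eta> k}" for b
    unfolding Y_def
  proof (rule cell_integral_bound[OF f \<eta>])
    fix \<omega> assume \<omega>: "\<omega> \<in> paths" "\<omega> \<in> cyl (Suc k) (\<eta>(k := b))"
    define v where "v = (point \<omega> - center \<eta> k) /\<^sub>R r k"
    have v: "dist v b \<le> h k / 8" and fv: "f \<omega> = hk.K (u - v) / r k ^ m"
      using cell_local[OF \<eta> \<omega>] by (simp_all add: v_def u_def f_def)
    have "\<bar>hk.K (u - v) * h k ^ DIM('a) - (LINT w:cube b (h k)|lborel. hk.K (u - w))\<bar>
       \<le> hk.C1 * h k powr \<alpha> * (LINT w:cube b (h k)|lborel. 1 / norm (u - w) ^ Suc m)"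
      by (rule hk.cell_average[OF grid \<eta>k _ _ u(2,1) v]) (use b in auto)
    then show "\<bar>f \<omega> * r k ^ m * h k ^ DIM('a) - (LINT w:cube b (h k)|lborel. hk.K (u - w))\<bar>
       \<le> hk.C1 * h k powr \<alpha> * (LINT w:cube b (h k)|lborel. 1 / norm (u - w) ^ Suc m)"
      by (simp add: fv)
  qed (use b in auto)
  then have ls: "\<bar>(\<Sum>b\<in>A k - {\<eta> k}. ?N * Y b * h k ^ DIM('a)) - I u\<bar> \<le> hk.C2 * \<delta> k powr \<alpha>"
    unfolding I_def using \<delta>_le[of k] by (intro hk.level_sum[OF grid _ \<eta>k u(2)]) auto
  define S where "S = (\<Sum>b\<in>A k - {\<eta> k}. Y b)"
  have S: "(LINT \<omega>:cyl k \<eta>|P. f \<omega>) - (LINT \<omega>:cyl (Suc k) \<eta>|P. f \<omega>) = S"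
    using sum.remove[OF G(1) \<eta>k, of Y] by (simp add: cyl_integral_split[OF f, of k] S_def Y_def)
  define s where "s = ?N * h k ^ DIM('a)"
  have s: "s > 0" "unit_ball_vol (real DIM('a)) / 2 \<le> s" using N h_pos[of k] grid_volume[of k] by (simp_all add: s_def)
  have "(\<Sum>b\<in>A k - {\<eta> k}. ?N * Y b * h k ^ DIM('a)) = s * S"
    by (simp add: S_def s_def sum_distrib_left ac_simps)
  then have "\<bar>s * S - I u\<bar> \<le> hk.C2 * \<delta> k powr \<alpha>" using ls by simp
  moreover have "s * (S - I u / s) = s * S - I u" using s by (simp add: right_diff_distrib)
  ultimately have "s * \<bar>S - I u / s\<bar> \<le> hk.C2 * \<delta> k powr \<alpha>"
    using s by (metis abs_mult abs_of_pos)
  then have "unit_ball_vol (real DIM('a)) / 2 * \<bar>S - I u / s\<bar> \<le> hk.C2 * \<delta> k powr \<alpha>"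
    using mult_right_mono[OF s(2), of "\<bar>S - I u / s\<bar>"] by linarith
  then have "\<bar>S - I u / s\<bar> \<le> Cerr * \<delta> k powr \<alpha>"
    using v by (simp add: Cerr_def field_simps)
  then show ?thesis using S by (simp add: f_def u_def s_def)
qed

text \<open>Here absolute values suffice. Since \<open>x\<close> is outside all doubled sub-balls,
  its normalised position is at least \<open>2 / 3 * q n\<close> from the limit points, with
  \<open>2 / 3 = 2 - 4 / 3\<close>. This handles the at most one cell with centre within
  \<open>h n / 2\<close>; the others are compared with an integral.\<close>

lemma last_level_error:
  assumes \<eta>: "\<eta> \<in> paths" and x: "dist x (center \<eta> n) \<le> 2 * r n" and xF: "x \<notin> F (Suc n)"
  shows "\<bar>LINT \<omega>:cyl n \<eta>|P. hk.K (x - point \<omega>)\<bar> \<le> Clast"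
proof -
  define u where "u = (x - center \<eta> n) /\<^sub>R r n"
  define f where "f \<omega> = hk.K (x - point \<omega>)" for \<omega>
  define Y where "Y b = (LINT \<omega>:cyl (Suc n) (\<eta>(n := b))|P. f \<omega>)" for b
  let ?N = "real (card (A n))" and ?D = "real DIM('a)" and ?v = "unit_ball_vol (real DIM('a))"
  have N: "?N > 0" using card_A_pos[of n] by simp
  have v: "?v > 0" by (simp add: unit_ball_vol_pos)
  have xE: "x \<notin> E" using xF by (auto simp: E_def)
  have f: "integrable P f" unfolding f_def by (rule kernel_integrable[OF xE])
  have "norm u = dist x (center \<eta> n) / r n" by (simp add: u_def dist_norm divide_inverse mult.commute)
  then have u: "norm u \<le> 2" using x by (simp add: pos_divide_le_eq)
  have ub: "dist u b > 2 * q n" if b: "b \<in> A n" for b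
  proof -
    have "dist x (center (\<eta>(n := b)) (Suc n)) > 2 * r (Suc n)"
      using xF path_upd[OF \<eta> b] by (force simp: F_iff)
    moreover have "center (\<eta>(n := b)) n = center \<eta> n" by (rule center_cong) simp
    then have "x - center (\<eta>(n := b)) (Suc n) = r n *\<^sub>R (u - b)"
      by (simp add: center_Suc u_def scaleR_diff_right)
    ultimately have "r n * (2 * q n) < r n * dist u b" by (simp add: dist_norm r_Suc)
    then show ?thesis by (simp add: mult_less_cancel_left_pos)
  qed
  have hp: "h n > 0" by (rule h_pos)
  have far: "\<bar>?N * Y b * h n ^ DIM('a)\<bar> \<le> M * (4 * ?D) ^ m * (LINT w:cube b (h n)|lborel. 1 / norm (u - w) ^ m)"
    if b: "b \<in> A n" "h n / 2 \<le> dist u b" for b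
  proof -
    have "\<bar>?N * Y b * h n ^ DIM('a) - 0\<bar> \<le> M * (4 * ?D) ^ m * (LINT w:cube b (h n)|lborel. 1 / norm (u - w) ^ m)"
      unfolding Y_def
    proof (rule cell_integral_bound[OF f \<eta> b(1)])
      fix \<omega> assume \<omega>: "\<omega> \<in> paths" "\<omega> \<in> cyl (Suc n) (\<eta>(n := b))"
      define v where "v = (point \<omega> - center \<eta> n) /\<^sub>R r n"
      have v: "dist v b \<le> h n / 8" and fv: "f \<omega> = hk.K (u - v) / r n ^ m"
        using cell_local[OF \<eta> \<omega>] by (simp_all add: v_def u_def f_def)
      have "\<bar>f \<omega> * r n ^ m * h n ^ DIM('a) - 0\<bar> = \<bar>hk.K (u - v)\<bar> * h n ^ DIM('a)"
        using hp by (simp add: fv abs_mult)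
      also have "\<dots> \<le> M / norm (u - v) ^ m * h n ^ DIM('a)"
        using hp by (intro mult_right_mono hk.K_bound) auto
      also have "\<dots> = M * (h n ^ DIM('a) / norm (u - v) ^ m)" by simp
      also have "\<dots> \<le> M * ((4 * ?D) ^ m * (LINT w:cube b (h n)|lborel. 1 / norm (u - w) ^ m))"
        by (intro mult_left_mono hk.M0 far_cell_inverse_power[OF d hp b(2) v])
      finally show "\<bar>f \<omega> * r n ^ m * h n ^ DIM('a) - 0\<bar>
          \<le> M * (4 * ?D) ^ m * (LINT w:cube b (h n)|lborel. 1 / norm (u - w) ^ m)" by simp
    qed
    then show ?thesis by simp
  qed
  have near: "\<bar>?N * Y b * h n ^ DIM('a)\<bar> \<le> M * (3 / 2) ^ m * ?v" if b: "b \<in> A n" for b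
  proof -
    have "\<bar>?N * Y b * h n ^ DIM('a) - 0\<bar> \<le> M * (3 / 2) ^ m * ?v"
      unfolding Y_def
    proof (rule cell_integral_bound[OF f \<eta> b(1)])
      fix \<omega> assume \<omega>: "\<omega> \<in> paths" "\<omega> \<in> cyl (Suc n) (\<eta>(n := b))"
      define v where "v = (point \<omega> - center \<eta> n) /\<^sub>R r n"
      have v: "dist v b \<le> 4 / 3 * q n" and fv: "f \<omega> = hk.K (u - v) / r n ^ m"
        using cell_local[OF \<eta> \<omega>] by (simp_all add: v_def u_def f_def)
      have uv: "norm (u - v) \<ge> 2 / 3 * q n"
        using ub[OF b] v dist_triangle[of u b v] by (simp add: dist_norm)
      have "\<bar>f \<omega> * r n ^ m * h n ^ DIM('a) - 0\<bar> = \<bar>hk.K (u - v)\<bar> * h n ^ DIM('a)"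
        using hp by (simp add: fv abs_mult)
      also have "\<dots> \<le> M / norm (u - v) ^ m * h n ^ DIM('a)"
        using hp by (intro mult_right_mono hk.K_bound) auto
      also have "\<dots> \<le> M / (2 / 3 * q n) ^ m * h n ^ DIM('a)"
        using uv q_pos[of n] hp hk.M0
        by (intro mult_right_mono divide_left_mono power_mono mult_pos_pos zero_less_power) (auto intro: less_le_trans[OF _ uv])
      also have "\<dots> = M * (3 / 2) ^ m * (?N * h n ^ DIM('a))"
        using q_card[of n] q_pos[of n] N by (simp add: power_mult_distrib power_divide field_simps)
      also have "\<dots> \<le> M * (3 / 2) ^ m * ?v"
        using is_grid_card(1)[OF grid[of n]] hk.M0 by (intro mult_left_mono) auto
      finally show "\<bar>f \<omega> * r n ^ m * h n ^ DIM('a) - 0\<bar> \<le> M * (3 / 2) ^ m * ?v" .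
    qed
    then show ?thesis by simp
  qed
  have ls: "(\<Sum>b\<in>A n. (?N * \<bar>Y b\<bar>) * h n ^ DIM('a)) \<le> M * (4 * ?D) ^ m * (?D * 9 / 2 * ?v) + M * (3 / 2) ^ m * ?v"
  proof (rule last_level_sum[OF d grid u])
    fix b assume b: "b \<in> A n"
    have e: "(?N * \<bar>Y b\<bar>) * h n ^ DIM('a) = \<bar>?N * Y b * h n ^ DIM('a)\<bar>" using hp by (simp add: abs_mult)
    show "(?N * \<bar>Y b\<bar>) * h n ^ DIM('a) \<le> M * (4 * ?D) ^ m * (LINT w:cube b (h n)|lborel. 1 / norm (u - w) ^ m)"
      if "h n / 2 \<le> dist u b" unfolding e by (rule far[OF b that])
    show "(?N * \<bar>Y b\<bar>) * h n ^ DIM('a) \<le> M * (3 / 2) ^ m * ?v" unfolding e by (rule near[OF b])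
  qed (use hk.M0 v in auto)
  define s where "s = ?N * h n ^ DIM('a)"
  have s: "?v / 2 \<le> s" using grid_volume[of n] by (simp add: s_def)
  have "\<bar>LINT \<omega>:cyl n \<eta>|P. f \<omega>\<bar> = \<bar>\<Sum>b\<in>A n. Y b\<bar>" by (simp add: cyl_integral_split[OF f, of n] Y_def)
  also have "\<dots> \<le> (\<Sum>b\<in>A n. \<bar>Y b\<bar>)" by (rule sum_abs)
  finally have a: "\<bar>LINT \<omega>:cyl n \<eta>|P. f \<omega>\<bar> \<le> (\<Sum>b\<in>A n. \<bar>Y b\<bar>)" .
  have "s * (\<Sum>b\<in>A n. \<bar>Y b\<bar>) = (\<Sum>b\<in>A n. (?N * \<bar>Y b\<bar>) * h n ^ DIM('a))"
    by (simp add: s_def sum_distrib_left ac_simps)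
  moreover have "?v / 2 * (\<Sum>b\<in>A n. \<bar>Y b\<bar>) \<le> s * (\<Sum>b\<in>A n. \<bar>Y b\<bar>)"
    by (intro mult_right_mono s sum_nonneg) auto
  ultimately have "?v / 2 * (\<Sum>b\<in>A n. \<bar>Y b\<bar>) \<le> M * (4 * ?D) ^ m * (?D * 9 / 2 * ?v) + M * (3 / 2) ^ m * ?v"
    using ls by linarith
  then have "(\<Sum>b\<in>A n. \<bar>Y b\<bar>) \<le> Clast"
    using v unfolding Clast_def by (simp add: field_simps)
  then show ?thesis using a by (simp add: f_def)
qed

lemma Cerr_nonneg: "Cerr \<ge> 0"
  unfolding Cerr_def hk.C2_def using hk.C1_nonneg hk.M0 by (intro mult_nonneg_nonneg add_nonneg_nonneg divide_nonneg_nonneg) auto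

lemma sum_\<delta>_powr: "(\<Sum>k<n. \<delta> k powr \<alpha>) \<le> 1 / (1 - (1 / 2) powr \<alpha>)"
proof -
  define z where "z = (1 / 2 :: real) powr \<alpha>"
  have z: "0 < z" "z < 1" using powr_less_mono'[of "1 / 2" 0 \<alpha>] hk.\<alpha> by (auto simp: z_def)
  have "\<delta> k powr \<alpha> \<le> z ^ k" for k
  proof -
    have "\<delta> k powr \<alpha> \<le> ((1 / 2) ^ k) powr \<alpha>"
      using \<delta>0 hk.\<alpha> by (intro powr_mono2) (auto simp: \<delta> mult_le_cancel_right1)
    also have "\<dots> = z ^ k" by (simp add: z_def powr_powr powr_realpow[symmetric] mult.commute)
    finally show ?thesis .
  qed
  then have "(\<Sum>k<n. \<delta> k powr \<alpha>) \<le> (\<Sum>k<n. z ^ k)" by (intro sum_mono) auto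
  also have "\<dots> \<le> (\<Sum>k. z ^ k)" using z by (intro sum_le_suminf) auto
  also have "\<dots> = 1 / (1 - z)" using z by (intro suminf_geometric) auto
  finally show ?thesis by (simp add: z_def)
qed

definition R0 :: real where "R0 = Cerr * (1 / (1 - (1 / 2) powr \<alpha>)) + Clast"

text \<open>Telescopes over the cylinders from \<open>cyl 0 \<eta>\<close> to
  \<open>cyl n \<eta>\<close>: each difference is a value of \<open>I\<close> up to a summable
  error, and the innermost cylinder contributes a bounded amount.\<close>

lemma potential_expansion:
  assumes \<eta>: "\<eta> \<in> paths" and x: "dist x (center \<eta> n) \<le> 2 * r n" and xF: "x \<notin> F (Suc n)"
  shows "\<bar>potential m \<Omega> \<mu> x - (\<Sum>k<n. I ((x - center \<eta> k) /\<^sub>R r k) / (real (card (A k)) * h k ^ DIM('a)))\<bar> \<le> R0"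
proof -
  have xE: "x \<notin> E" using xF by (auto simp: E_def)
  define Y where "Y k = (LINT \<omega>:cyl k \<eta>|P. hk.K (x - point \<omega>))" for k
  define T where "T k = I ((x - center \<eta> k) /\<^sub>R r k) / (real (card (A k)) * h k ^ DIM('a))" for k
  have "cyl 0 \<eta> = UNIV" by (simp add: cyl_def)
  then have Y0: "potential m \<Omega> \<mu> x = Y 0" by (simp add: potential_eq Y_def set_lebesgue_integral_def)
  have "Y 0 - Y n = (\<Sum>k<n. Y k - Y (Suc k))" by (rule sum_lessThan_telescope'[symmetric])
  then have e: "Y 0 - (\<Sum>k<n. T k) = (\<Sum>k<n. Y k - Y (Suc k) - T k) + Y n" by (simp add: sum_subtractf)
  have "\<bar>\<Sum>k<n. Y k - Y (Suc k) - T k\<bar> \<le> (\<Sum>k<n. \<bar>Y k - Y (Suc k) - T k\<bar>)" by (rule sum_abs)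
  also have "\<dots> \<le> (\<Sum>k<n. Cerr * \<delta> k powr \<alpha>)"
    unfolding Y_def T_def by (intro sum_mono level_error[OF \<eta> x _ xE]) auto
  also have "\<dots> = Cerr * (\<Sum>k<n. \<delta> k powr \<alpha>)" by (simp add: sum_distrib_left)
  also have "\<dots> \<le> Cerr * (1 / (1 - (1 / 2) powr \<alpha>))" by (intro mult_left_mono sum_\<delta>_powr Cerr_nonneg)
  finally have 1: "\<bar>\<Sum>k<n. Y k - Y (Suc k) - T k\<bar> \<le> Cerr * (1 / (1 - (1 / 2) powr \<alpha>))" .
  have 2: "\<bar>Y n\<bar> \<le> Clast" unfolding Y_def by (rule last_level_error[OF \<eta> x xF])
  show ?thesis unfolding Y0 T_def[symmetric] e R0_def using 1 2 by linarith
qed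

lemma potential_far:
  assumes "x \<notin> F 0" shows "\<bar>potential m \<Omega> \<mu> x\<bar> \<le> M / (2 / 3) ^ m"
  unfolding potential_eq
proof (rule kernel_integrable_far(2))
  fix \<omega> assume \<omega>: "\<omega> \<in> paths"
  then have "norm x > 2" using assms by (force simp: F_iff center_def)
  moreover have "norm (point \<omega>) \<le> 4 / 3" using point_center_dist[OF \<omega>, of 0] by (simp add: center_def)
  ultimately show "2 / 3 \<le> dist x (point \<omega>)" using norm_triangle_ineq2[of x "point \<omega>"] by (simp add: dist_norm)
qed simp

lemma potential_measurable: "potential m \<Omega> \<mu> \<in> borel_measurable borel"
proof -
  interpret M: prob_space \<mu> by (rule prob_space_\<mu>)
  show ?thesis unfolding potential_def[abs_def] by measurable
qed

lemma potential_bounded: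
  assumes I0: "\<And>u. norm u \<le> 1 \<Longrightarrow> I u = 0"
  shows "essentially_bounded (lebesgue_on (- E)) (potential m \<Omega> \<mu>)"
  unfolding essentially_bounded_def
proof
  show "potential m \<Omega> \<mu> \<in> borel_measurable (lebesgue_on (- E))"
    using potential_measurable by (intro measurable_restrict_space1 measurable_completion) simp
  define B where "B = max R0 (M / (2 / 3) ^ m)"
  have "\<bar>potential m \<Omega> \<mu> x\<bar> \<le> B" if xE: "x \<in> - E" for x
  proof (rule not_E_cases[of x])
    show "x \<notin> E" using xE by simp
  next
    assume "x \<notin> F 0"
    from potential_far[OF this] show ?thesis by (simp add: B_def)
  next
    fix n assume x: "x \<in> F n" "x \<notin> F (Suc n)"
    then obtain \<eta> where \<eta>: "\<eta> \<in> paths" "dist x (center \<eta> n) \<le> 2 * r n" by (auto simp: F_iff)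
    have "(\<Sum>k<n. I ((x - center \<eta> k) /\<^sub>R r k) / (real (card (A k)) * h k ^ DIM('a))) = 0"
      using center_local(3)[OF \<eta>(1) _ \<eta>(2)] by (intro sum.neutral) (auto simp: I0)
    then show ?thesis using potential_expansion[OF \<eta> x(2)] by (simp add: B_def)
  qed
  then have "AE x in lebesgue_on (- E). \<bar>potential m \<Omega> \<mu> x\<bar> \<le> B" by (intro AE_I2) (simp add: space_restrict_space)
  then show "\<exists>B. AE x in lebesgue_on (- E). \<bar>potential m \<Omega> \<mu> x\<bar> \<le> B" by blast
qed

lemma I_bound:
  assumes "norm u \<le> 1"
  shows "\<bar>I u\<bar> \<le> M * (real DIM('a) * 2 * unit_ball_vol (real DIM('a)))"
proof -
  have sub: "cball 0 1 \<subseteq> cball u 2"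
  proof
    fix w :: 'a assume "w \<in> cball 0 1"
    then show "w \<in> cball u 2" using assms norm_triangle_ineq4[of u w] by (simp add: dist_norm)
  qed
  have "\<bar>I u\<bar> \<le> M * (LINT w:cball 0 1|lborel. 1 / norm (u - w) ^ m)"
    unfolding I_def by (rule hk.K_set_integral(2)[OF _ sub]) auto
  also have "\<dots> \<le> M * (real DIM('a) * 2\<^sup>2 / 2 * unit_ball_vol (real DIM('a)))"
    by (intro mult_left_mono hk.M0 inverse_power_set_integral(2)[OF d _ _ sub]) auto
  finally show ?thesis by simp
qed

text \<open>Along a path whose late steps all lie in \<open>ball p \<tau>\<close>, every generation
  from \<open>k0\<close> on contributes at least \<open>c\<close> divided by the volume of the unit
  ball, with sign \<sigma>, so the expansion grows linearly. It is evaluated on open shells, because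
  large values at single points would not contradict an almost everywhere bound.\<close>

lemma potential_unbounded:
  assumes p: "norm p + \<tau> \<le> 1" and \<tau>: "\<tau> > 0" and c: "c > 0" and \<sigma>: "\<bar>\<sigma>\<bar> = 1"
    and I: "\<And>u. u \<in> ball p (2 * \<tau>) \<Longrightarrow> norm u \<le> 1 \<Longrightarrow> c \<le> \<sigma> * I u"
  shows "\<not> essentially_bounded (lebesgue_on (- E)) (potential m \<Omega> \<mu>)"
proof
  let ?v = "unit_ball_vol (real DIM('a))"
  have v: "?v > 0" by (simp add: unit_ball_vol_pos)
  assume "essentially_bounded (lebesgue_on (- E)) (potential m \<Omega> \<mu>)"
  then obtain B where B: "AE x in lebesgue_on (- E). \<bar>potential m \<Omega> \<mu> x\<bar> \<le> B"
    unfolding essentially_bounded_def by blast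
  have "\<forall>\<^sub>F k in sequentially. \<delta> k < \<tau>" by (rule order_tendstoD(2)[OF \<delta>_tendsto_0 \<tau>])
  with eventually_grid_fraction[OF p \<tau>]
  have "\<forall>\<^sub>F k in sequentially. A k \<inter> ball p \<tau> \<noteq> {} \<and> \<delta> k < \<tau>"
  proof eventually_elim
    case (elim k)
    have "0 < (\<tau> / 2) ^ DIM('a) / 2" using \<tau> by simp
    then show ?case using elim by force
  qed
  then obtain k0 where k0: "\<And>k. k \<ge> k0 \<Longrightarrow> A k \<inter> ball p \<tau> \<noteq> {}" "\<And>k. k \<ge> k0 \<Longrightarrow> \<delta> k < \<tau>"
    unfolding eventually_sequentially by blast
  define \<eta> where "\<eta> k = (if k \<ge> k0 then SOME a. a \<in> A k \<inter> ball p \<tau> else SOME a. a \<in> A k)" for k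
  have \<eta>1: "\<eta> k \<in> A k \<inter> ball p \<tau>" if "k \<ge> k0" for k
    unfolding \<eta>_def using k0(1)[OF that] that by (simp only: if_True) (rule some_in_eq[THEN iffD2])
  have \<eta>2: "\<eta> k \<in> A k" for k
    using \<eta>1[of k] some_in_eq[of "A k"] G(2)[of k] by (cases "k \<ge> k0") (auto simp: \<eta>_def)
  have \<eta>: "\<eta> \<in> paths" using \<eta>2 by (simp add: paths_def)
  define Im where "Im = 2 / ?v * (M * (real DIM('a) * 2 * ?v))"
  \<comment> \<open>Between 2 and 4 radii a point has left the sub-ball on the path but is still far
    from all the others; so it is outside \<open>F (Suc n)\<close> and inside the doubled ball of
    generation \<open>n\<close>.\<close>
  define W where "W n = ball (center \<eta> (Suc n)) (4 * r (Suc n)) - cball (center \<eta> (Suc n)) (2 * r (Suc n))" for n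
  have key: "(real n - real k0) * (c / ?v) - real k0 * Im - R0 \<le> \<bar>potential m \<Omega> \<mu> y\<bar> \<and> y \<notin> E"
    if y: "y \<in> W n" and n: "n \<ge> k0" for y n
  proof -
    have y1: "dist y (center \<eta> (Suc n)) < 4 * r (Suc n)" "2 * r (Suc n) < dist y (center \<eta> (Suc n))"
      using y by (auto simp: W_def dist_commute)
    have yF: "y \<notin> F (Suc n)"
    proof
      assume "y \<in> F (Suc n)"
      then obtain \<omega> where \<omega>: "\<omega> \<in> paths" "dist y (center \<omega> (Suc n)) \<le> 2 * r (Suc n)" by (auto simp: F_iff)
      have "dist y (center \<eta> (Suc n)) < r n * h n / 2"
        using y1 r_Suc_le[of n] mult_pos_pos[OF r_pos h_pos, of n n] by linarith
      then have "\<forall>i<Suc n. \<omega> i = \<eta> i" by (intro same_center_Suc[OF \<omega>(1) \<eta> \<omega>(2)]) auto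
      then have "center \<omega> (Suc n) = center \<eta> (Suc n)" by (intro center_cong) auto
      then show False using \<omega>(2) y1 by simp
    qed
    have "dist (center \<eta> (Suc n)) (center \<eta> n) \<le> r n"
      using mult_left_mono[OF paths_norm_le[OF \<eta>, of n], of "r n"] by (simp add: center_Suc dist_norm)
    then have yn: "dist y (center \<eta> n) \<le> 2 * r n"
      using y1 r_Suc_le4[of n] dist_triangle[of y "center \<eta> n" "center \<eta> (Suc n)"] by linarith
    define T where "T k = I ((y - center \<eta> k) /\<^sub>R r k) / (real (card (A k)) * h k ^ DIM('a))" for k
    have T: "\<bar>potential m \<Omega> \<mu> y - (\<Sum>k<n. T k)\<bar> \<le> R0"
      unfolding T_def by (rule potential_expansion[OF \<eta> yn yF])
    have Tb: "\<sigma> * T k \<ge> (if k < k0 then - Im else c / ?v)" if k: "k < n" for k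
    proof -
      define u where "u = (y - center \<eta> k) /\<^sub>R r k"
      define s where "s = real (card (A k)) * h k ^ DIM('a)"
      have s: "?v / 2 \<le> s" "s \<le> ?v" using grid_volume[of k] is_grid_card(1)[OF grid[of k]] by (simp_all add: s_def)
      have s0: "s > 0" using s v by linarith
      have u: "dist u (\<eta> k) \<le> 2 * q k" "norm u \<le> 1" using center_local[OF \<eta> k yn] by (simp_all add: u_def)
      show ?thesis
      proof (cases "k < k0")
        case True
        have "\<bar>\<sigma> * T k\<bar> = \<bar>I u\<bar> / s" using s0 \<sigma> h_pos[of k] by (simp add: T_def u_def s_def abs_mult)
        also have "\<dots> \<le> (M * (real DIM('a) * 2 * ?v)) / s" using s0 by (intro divide_right_mono I_bound u) auto
        also have "\<dots> \<le> (M * (real DIM('a) * 2 * ?v)) / (?v / 2)"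
          by (intro divide_left_mono mult_pos_pos s0) (use s v hk.M0 in auto)
        also have "\<dots> = Im" by (simp add: Im_def)
        finally show ?thesis using True by (simp add: abs_le_iff)
      next
        case False
        have "2 * q k < \<tau>" using k0(2)[of k] False q_le_h[of k] G(4)[of k] h_pos[of k] by simp
        then have "dist p u < 2 * \<tau>"
          using \<eta>1[of k] False u(1) dist_triangle[of p u "\<eta> k"] by (simp add: dist_commute)
        then have "c \<le> \<sigma> * I u" using I[of u] u(2) by simp
        then have "c / ?v \<le> (\<sigma> * I u) / s" by (intro frac_le s0) (use s c in auto)
        then show ?thesis using False by (simp add: T_def u_def s_def)
      qed
    qed
    have "(real n - real k0) * (c / ?v) - real k0 * Im = (\<Sum>k<n. if k < k0 then - Im else c / ?v)"
    proof -
      have "(\<Sum>k<n. if k < k0 then - Im else c / ?v) = (\<Sum>k\<in>{..<n} \<inter> {k. k < k0}. - Im) + (\<Sum>k\<in>{..<n} \<inter> - {k. k < k0}. c / ?v)"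
        by (rule sum.If_cases) simp
      moreover have "{..<n} \<inter> {k. k < k0} = {..<k0}" "{..<n} \<inter> - {k. k < k0} = {k0..<n}" using n by auto
      ultimately show ?thesis using n by (simp add: of_nat_diff)
    qed
    also have "\<dots> \<le> (\<Sum>k<n. \<sigma> * T k)" by (intro sum_mono Tb) auto
    also have "\<dots> = \<sigma> * (\<Sum>k<n. T k)" by (simp add: sum_distrib_left)
    also have "\<dots> \<le> \<bar>\<Sum>k<n. T k\<bar>" using abs_ge_self[of "\<sigma> * (\<Sum>k<n. T k)"] \<sigma> by (simp add: abs_mult)
    finally show ?thesis using T yF by (auto simp: E_def)
  qed
  obtain j :: nat where j: "(B + real k0 * Im + R0) / (c / ?v) < real j" using reals_Archimedean2 by blast
  define n where "n = k0 + j"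
  have "B + real k0 * Im + R0 < real j * (c / ?v)" using j c v
    by (subst (asm) pos_divide_less_eq) simp_all
  then have big: "B < (real n - real k0) * (c / ?v) - real k0 * Im - R0" by (simp add: n_def)
  have "AE x in lebesgue. x \<in> - E \<longrightarrow> \<bar>potential m \<Omega> \<mu> x\<bar> \<le> B"
    using B closed_E by (subst (asm) AE_restrict_space_iff) (auto simp: borel_closed)
  then have "AE x in lebesgue. x \<notin> W n"
    by eventually_elim (use key[of _ n] big in \<open>force simp: n_def\<close>)
  moreover have op: "open (W n)" unfolding W_def by (intro open_Diff) auto
  moreover have "W n \<in> sets lebesgue" using op by auto
  ultimately have "negligible (W n)" by (simp add: negligible_iff_null_sets AE_iff_null_sets)
  moreover have "W n \<noteq> {}"
  proof -
    obtain e :: 'a where e: "norm e = 3 * r (Suc n)" using vector_choose_size[of "3 * r (Suc n)"] by auto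
    have "center \<eta> (Suc n) + e \<in> W n" using e r_pos[of "Suc n"] by (simp add: W_def dist_norm)
    then show ?thesis by blast
  qed
  ultimately show False using op open_not_negligible by blast
qed

end

section \<open>Failure of principal values\<close>

text \<open>The unit sphere and the sphere of radius \<open>3 / 2\<close> around
  \<open>e /\<^sub>R 2\<close> touch at \<open>- e\<close>. Hence a point \<open>v\<close> almost in
  the unit ball and almost \<open>3 / 2\<close> away from \<open>u\<close> is within order
  \<open>sqrt \<tau>\<close> of \<open>- e\<close>, the square root reflecting the tangency, and
  \<open>u - v\<close> is close to \<open>(3 / 2) *\<^sub>R e\<close>.\<close>

lemma sgn_near_pole:
  fixes e u v :: "'a::real_inner"
  assumes e: "norm e = 1" and \<tau>: "0 < \<tau>" "\<tau> \<le> 1 / 16" "12 * sqrt \<tau> \<le> \<rho>"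
    and u: "norm (u - e /\<^sub>R 2) < \<tau>" and v: "norm v \<le> 1 + \<tau>" and uv: "3 / 2 - 4 * \<tau> < norm (u - v)"
  shows "norm (sgn (u - v) - e) < \<rho>"
proof -
  have t2: "\<tau> * \<tau> \<le> \<tau>" using \<tau> mult_left_mono[of \<tau> 1 \<tau>] by simp
  have st: "\<tau> \<le> sqrt \<tau>" using \<tau> t2 by (intro real_le_rsqrt) (auto simp: power2_eq_square)
  have "norm (u - v) \<le> norm (u - e /\<^sub>R 2) + norm (v - e /\<^sub>R 2)"
    using norm_triangle_ineq4[of "u - e /\<^sub>R 2" "v - e /\<^sub>R 2"] by simp
  then have lo: "3 / 2 - 5 * \<tau> \<le> norm (v - e /\<^sub>R 2)" using u uv by linarith
  have "9 / 4 - 15 * \<tau> \<le> (3 / 2 - 5 * \<tau>)\<^sup>2" by (simp add: power2_eq_square algebra_simps)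
  also have "\<dots> \<le> (norm (v - e /\<^sub>R 2))\<^sup>2" using lo \<tau> by (intro power_mono) auto
  also have "\<dots> = (norm v)\<^sup>2 - v \<bullet> e + 1 / 4"
  proof -
    have "e \<bullet> e = 1" using e by (simp add: norm_eq_1)
    then show ?thesis unfolding power2_norm_eq_inner
      by (simp add: inner_diff_left inner_diff_right inner_commute[of e v] field_simps)
  qed
  finally have 1: "v \<bullet> e \<le> (norm v)\<^sup>2 - 2 + 15 * \<tau>" by simp
  have "(norm v)\<^sup>2 \<le> (1 + \<tau>)\<^sup>2" using v by (intro power_mono) auto
  also have "\<dots> \<le> 1 + 3 * \<tau>" using t2 by (simp add: power2_eq_square algebra_simps)
  finally have 2: "(norm v)\<^sup>2 \<le> 1 + 3 * \<tau>" .
  have "(norm (v + e))\<^sup>2 = (norm v)\<^sup>2 + 2 * (v \<bullet> e) + 1"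
  proof -
    have "e \<bullet> e = 1" using e by (simp add: norm_eq_1)
    then show ?thesis unfolding power2_norm_eq_inner
      by (simp add: inner_add_left inner_add_right inner_commute[of e v])
  qed
  then have "(norm (v + e))\<^sup>2 \<le> 49 * \<tau>" using 1 2 \<tau> by linarith
  then have "norm (v + e) \<le> sqrt (49 * \<tau>)" by (intro real_le_rsqrt)
  also have "\<dots> = 7 * sqrt \<tau>" by (simp add: real_sqrt_mult)
  finally have ve: "norm (v + e) \<le> 7 * sqrt \<tau>" .
  let ?p = "(3 / 2) *\<^sub>R e"
  have "u - v - ?p = (u - e /\<^sub>R 2) - (v + e)"
  proof -
    have "?p = e /\<^sub>R 2 + e"
      using scaleR_add_left[of "1/2" 1 e] by simp
    then show ?thesis by simp
  qed
  then have "norm (u - v - ?p) \<le> norm (u - e /\<^sub>R 2) + norm (v + e)" using norm_triangle_ineq4 by metis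
  then have w: "norm (u - v - ?p) < 8 * sqrt \<tau>" using u ve st by linarith
  have "e \<noteq> 0" using e by auto
  then have "norm (sgn (u - v) - sgn ?p) \<le> 2 * norm (u - v - ?p) / norm ?p" by (intro norm_sgn_diff_le) simp
  also have "sgn ?p = e" using e by (simp add: sgn_div_norm)
  also have "2 * norm (u - v - ?p) / norm ?p = 4 / 3 * norm (u - v - ?p)" using e by simp
  \<comment> \<open>The constant 12 is \<open>4 / 3 * 8\<close> rounded up.\<close>
  also have "\<dots> < 12 * sqrt \<tau>" using w \<tau> real_sqrt_gt_zero[of \<tau>] by linarith
  finally show ?thesis using \<tau> by simp
qed

text \<open>In late generations each step hits the ball with probability at least a fixed
  \<open>f > 0\<close>, independently of the others, so \<open>j\<close> consecutive misses have
  probability at most \<open>(1 - f) ^ j\<close>.\<close>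

lemma (in cantor) AE_frequently:
  assumes p: "norm p + \<tau> \<le> 1" and \<tau>: "\<tau> > 0"
  shows "AE \<omega> in P. \<forall>N. \<exists>n\<ge>N. \<omega> n \<in> ball p \<tau>"
proof -
  define f where "f = (\<tau> / 2) ^ DIM('a) / 2"
  have f: "f > 0" using \<tau> by (simp add: f_def)
  obtain k0 where k0: "\<And>k. k \<ge> k0 \<Longrightarrow> f \<le> real (card (A k \<inter> ball p \<tau>)) / real (card (A k))"
    using eventually_grid_fraction[OF p \<tau>] unfolding eventually_sequentially f_def by blast
  have compl: "real (card (A k \<inter> - ball p \<tau>)) / real (card (A k)) \<le> 1 - f" if "k \<ge> k0" for k
  proof -
    have "card (A k) = card (A k \<inter> ball p \<tau>) + card (A k \<inter> - ball p \<tau>)"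
      using G(1)[of k] by (subst card_Un_disjoint[symmetric]) (auto intro!: arg_cong[where f = card])
    then have "real (card (A k)) = real (card (A k \<inter> ball p \<tau>)) + real (card (A k \<inter> - ball p \<tau>))" by simp
    then show ?thesis using k0[OF that] card_A_pos[of k] by (simp add: field_simps)
  qed
  have f1: "f \<le> 1"
  proof -
    have "0 \<le> real (card (A k0 \<inter> - ball p \<tau>)) / real (card (A k0))" by simp
    then show ?thesis using compl[of k0] by linarith
  qed
  have main: "AE \<omega> in P. \<exists>n\<ge>N. \<omega> n \<in> ball p \<tau>" if N: "N \<ge> k0" for N
  proof -
    define R where "R j = {\<omega>. \<forall>k\<in>{N..<N + j}. \<omega> k \<in> - ball p \<tau>}" for j
    have Rm: "R j \<in> sets P" for j unfolding R_def by (rule P_rectangle(1)) simp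
    have Rle: "measure P (R j) \<le> (1 - f) ^ j" for j
    proof -
      have "measure P (R j) = (\<Prod>k\<in>{N..<N + j}. real (card (A k \<inter> - ball p \<tau>)) / real (card (A k)))"
        unfolding R_def by (rule P_rectangle(2)) simp
      also have "\<dots> \<le> (\<Prod>k\<in>{N..<N + j}. 1 - f)"
        using N by (intro prod_mono) (auto intro!: compl)
      finally show ?thesis by simp
    qed
    have Im: "(\<Inter>j. R j) \<in> sets P" using Rm by auto
    have "measure P (\<Inter>j. R j) \<le> 0"
    proof (rule LIMSEQ_le_const[of "\<lambda>j. (1 - f) ^ j"])
      show "(\<lambda>j. (1 - f) ^ j) \<longlonglongrightarrow> 0" using f f1 by (intro LIMSEQ_realpow_zero) auto
      have "measure P (\<Inter>j. R j) \<le> (1 - f) ^ j" for j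
        using P.finite_measure_mono[of "\<Inter>j. R j" "R j"] Rm Rle[of j] by force
      then show "\<exists>n0. \<forall>j\<ge>n0. measure P (\<Inter>j. R j) \<le> (1 - f) ^ j" by blast
    qed
    then have "measure P (\<Inter>j. R j) = 0" by (simp add: measure_le_0_iff)
    then have "(\<Inter>j. R j) \<in> null_sets P" using Im by (simp add: null_sets_def P.emeasure_eq_measure)
    then have "AE \<omega> in P. \<omega> \<notin> (\<Inter>j. R j)" by (rule AE_not_in)
    then show ?thesis
    proof eventually_elim
      case (elim \<omega>)
      then show ?case by (auto simp: R_def)
    qed
  qed
  have "AE \<omega> in P. \<forall>N. \<exists>n\<ge>max N k0. \<omega> n \<in> ball p \<tau>"
    unfolding AE_all_countable by (intro allI main) simp
  then show ?thesis by eventually_elim (meson max.bounded_iff)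
qed

context cantor_kernel
begin

lemma truncated_potential_eq:
  "truncated_potential m \<Omega> \<mu> \<epsilon> x = (LINT \<omega>|P. indicator {\<omega>. \<epsilon> < norm (x - point \<omega>)} \<omega> * hk.K (x - point \<omega>))"
proof -
  have [measurable]: "{y. \<epsilon> < norm (x - y)} \<in> sets borel" by measurable
  show ?thesis
    unfolding truncated_potential_def set_lebesgue_integral_def \<mu>_def
    by (subst integral_distr) (auto intro!: Bochner_Integration.integral_cong simp: indicator_def)
qed

lemma truncated_integrable:
  assumes "\<epsilon> > 0"
  shows "integrable P (\<lambda>\<omega>. indicator {\<omega>. \<epsilon> < norm (x - point \<omega>)} \<omega> * hk.K (x - point \<omega>))"
proof (rule P.integrable_const_bound[of _ "M / \<epsilon> ^ m"])
  have "\<bar>indicator {\<omega>. \<epsilon> < norm (x - point \<omega>)} \<omega> * hk.K (x - point \<omega>)\<bar> \<le> M / \<epsilon> ^ m" for \<omega>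
  proof (cases "\<epsilon> < norm (x - point \<omega>)")
    case True
    have "\<bar>hk.K (x - point \<omega>)\<bar> \<le> M / norm (x - point \<omega>) ^ m" by (rule hk.K_bound)
    also have "\<dots> \<le> M / \<epsilon> ^ m"
      using True assms hk.M0 by (intro divide_left_mono power_mono mult_pos_pos zero_less_power) auto
    finally show ?thesis using True by simp
  qed (use hk.M0 assms in simp)
  then show "AE \<omega> in P. norm (indicator {\<omega>. \<epsilon> < norm (x - point \<omega>)} \<omega> * hk.K (x - point \<omega>)) \<le> M / \<epsilon> ^ m"
    by (intro AE_I2) simp
  have [measurable]: "{\<omega>. \<epsilon> < norm (x - point \<omega>)} \<in> sets P"
  proof -
    have "{\<omega> \<in> space P. \<epsilon> < norm (x - point \<omega>)} \<in> sets P" by measurable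
    then show ?thesis by simp
  qed
  show "(\<lambda>\<omega>. indicator {\<omega>. \<epsilon> < norm (x - point \<omega>)} \<omega> * hk.K (x - point \<omega>)) \<in> borel_measurable P"
    by measurable
qed

(* The annulus removed from the ball of generation n is a cap opposite to e; all its
   directions are close to e, where the kernel has a fixed sign. *)
lemma truncation_oscillation:
  assumes e: "norm e = 1" and \<tau>: "0 < \<tau>" "\<tau> \<le> 1 / 16" "12 * sqrt \<tau> \<le> \<rho>" and c: "c > 0"
    and pos: "\<And>\<xi>. norm \<xi> = 1 \<Longrightarrow> norm (\<xi> - e) < \<rho> \<Longrightarrow> c \<le> \<sigma> * \<Omega> \<xi>"
    and \<zeta>: "\<zeta> \<in> paths" and x: "dist x (center \<zeta> n + (r n / 2) *\<^sub>R e) < \<tau> * r n" and q: "4 / 3 * q n \<le> \<tau>"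
    and f: "f \<le> real (card (A n \<inter> ball (- ((1 - \<tau>) *\<^sub>R e)) \<tau>)) / real (card (A n))"
  shows "f * c / 4 ^ m \<le> \<sigma> * (truncated_potential m \<Omega> \<mu> ((3 / 2 - 4 * \<tau>) * r n) x - truncated_potential m \<Omega> \<mu> (4 * r n) x)"
proof -
  define \<epsilon> where "\<epsilon> = (3 / 2 - 4 * \<tau>) * r n"
  have \<epsilon>: "0 < \<epsilon>" "\<epsilon> \<le> 4 * r n" using \<tau> r_pos[of n] by (auto simp: \<epsilon>_def)
  define u where "u = (x - center \<zeta> n) /\<^sub>R r n"
  have xu: "x = center \<zeta> n + r n *\<^sub>R u" by (simp add: u_def)
  have u: "norm (u - e /\<^sub>R 2) < \<tau>"
  proof -
    have "x - (center \<zeta> n + (r n / 2) *\<^sub>R e) = r n *\<^sub>R (u - e /\<^sub>R 2)"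
      by (simp add: xu scaleR_diff_right)
    then have "r n * norm (u - e /\<^sub>R 2) < r n * \<tau>" using x by (simp add: dist_norm mult.commute)
    then show ?thesis by (simp add: mult_less_cancel_left_pos)
  qed
  have un: "norm u \<le> 1 / 2 + \<tau>" using u norm_triangle_sub[of u "e /\<^sub>R 2"] e by simp
  have xc: "dist x (center \<zeta> n) \<le> 2 * r n"
  proof -
    have "r n * norm u \<le> r n * 2" using un \<tau> by (intro mult_left_mono) auto
    then show ?thesis by (simp add: xu dist_norm mult.commute)
  qed
  \<comment> \<open>The radius \<open>4 * r n\<close> takes in all limit points of the ball of
    generation \<open>n\<close> containing \<open>x\<close>, while the other balls are at least
    \<open>60 * r n\<close> away. So \<open>g\<close> sees only the part of this one ball beyond
    \<epsilon>.\<close>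
  define g where "g \<omega> = (indicator {\<omega>. \<epsilon> < norm (x - point \<omega>)} \<omega> * hk.K (x - point \<omega>)
     - indicator {\<omega>. 4 * r n < norm (x - point \<omega>)} \<omega> * hk.K (x - point \<omega>))" for \<omega>
  have gint: "integrable P g" unfolding g_def using \<epsilon> r_pos[of n] by (intro Bochner_Integration.integrable_diff truncated_integrable) auto
  have gval: "(LINT \<omega>|P. g \<omega>) = truncated_potential m \<Omega> \<mu> \<epsilon> x - truncated_potential m \<Omega> \<mu> (4 * r n) x"
    unfolding g_def truncated_potential_eq using \<epsilon> r_pos[of n]
    by (intro Bochner_Integration.integral_diff truncated_integrable) auto
  \<comment> \<open>The ball of radius \<tau> around \<open>b0\<close> touches the unit sphere from
    inside at \<open>- e\<close>. The steps in it have relative mass at least \<open>f\<close>, and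
    the points following them lie beyond \<epsilon>.\<close>
  define b0 where "b0 = - ((1 - \<tau>) *\<^sub>R e)"
  define B where "B = A n \<inter> ball b0 \<tau>"
  define S where "S = (\<Union>b\<in>B. cyl (Suc n) (\<zeta>(n := b)))"
  have fB: "finite B" "B \<subseteq> A n" using G(1)[of n] by (auto simp: B_def)
  have Sm [measurable]: "S \<in> sets P" unfolding S_def using fB(1) by auto
  have mS: "f * r n ^ m \<le> measure P S"
  proof -
    have "measure P S = (\<Sum>b\<in>B. measure P (cyl (Suc n) (\<zeta>(n := b))))"
      unfolding S_def
    proof (rule P.finite_measure_finite_Union[OF fB(1)])
      show "disjoint_family_on (\<lambda>b. cyl (Suc n) (\<zeta>(n := b))) B"
        by (auto simp: disjoint_family_on_def cyl_def)
    qed auto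
    also have "\<dots> = (\<Sum>b\<in>B. r (Suc n) ^ m)"
      using fB(2) by (intro sum.cong refl measure_cyl path_upd[OF \<zeta>]) auto
    also have "\<dots> = real (card B) / real (card (A n)) * r n ^ m"
      using q_card[of n] card_A_pos[of n] by (simp add: r_Suc power_mult_distrib field_simps)
    also have "\<dots> \<ge> f * r n ^ m" using f by (intro mult_right_mono) (auto simp: B_def b0_def)
    finally show ?thesis by simp
  qed
  \<comment> \<open>The annulus may contain more than \<open>S\<close>; all of it is seen in
    directions close to \<open>e\<close>, so the surplus has the same sign and cannot cancel the
    contribution of \<open>S\<close>.\<close>
  have low: "c / (4 * r n) ^ m * indicator S \<omega> \<le> \<sigma> * g \<omega>" if \<omega>: "\<omega> \<in> paths" for \<omega>
  proof -
    define v where "v = (point \<omega> - center \<zeta> n) /\<^sub>R r n"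
    have xv: "x - point \<omega> = r n *\<^sub>R (u - v)" by (simp add: xu v_def scaleR_diff_right)
    have nx: "norm (x - point \<omega>) = norm (u - v) * r n" unfolding xv by (simp add: mult.commute)
    show ?thesis
    proof (cases "\<epsilon> < norm (x - point \<omega>) \<and> norm (x - point \<omega>) \<le> 4 * r n")
      case True
      have "dist x (point \<omega>) < 60 * r n" using True r_pos[of n] unfolding dist_norm by linarith
      moreover have "dist (point \<omega>) (center \<omega> n) \<le> 2 * r n"
        using point_center_dist[OF \<omega>, of n] r_pos[of n] by linarith
      ultimately have agree: "\<forall>i<n. \<zeta> i = \<omega> i" by (intro same_center[OF \<zeta> \<omega> xc]) auto
      have ce: "center \<zeta> n = center \<omega> n" by (rule center_cong) (use agree in auto)
      have "dist v (\<omega> n) \<le> 4 / 3 * q n" using point_local(1)[OF \<omega>, of n] by (simp add: v_def ce)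
      then have v: "norm v \<le> 1 + \<tau>"
        using paths_norm_le[OF \<omega>, of n] norm_triangle_sub[of v "\<omega> n"] q by (simp add: dist_norm)
      have uv: "3 / 2 - 4 * \<tau> < norm (u - v)"
        using True unfolding nx \<epsilon>_def by (simp add: mult_less_cancel_right_pos)
      have "c \<le> \<sigma> * \<Omega> (sgn (u - v))"
      proof (rule pos[OF _ sgn_near_pole[OF e \<tau> u v uv]])
        have "u - v \<noteq> 0" using uv \<tau> by auto
        then show "norm (sgn (u - v)) = 1" by (simp add: norm_sgn)
      qed
      moreover have "sgn (x - point \<omega>) = sgn (u - v)" unfolding xv by (simp add: sgn_scaleR)
      ultimately have s: "c \<le> \<sigma> * \<Omega> (sgn (x - point \<omega>))" by simp
      have np: "norm (x - point \<omega>) > 0" using True \<epsilon> by linarith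
      have "g \<omega> = hk.K (x - point \<omega>)" using True by (simp add: g_def)
      then have "\<sigma> * g \<omega> = \<sigma> * \<Omega> (sgn (x - point \<omega>)) / norm (x - point \<omega>) ^ m"
        by (simp add: homogeneous_kernel_sgn)
      also have "\<dots> \<ge> c / norm (x - point \<omega>) ^ m" using s by (intro divide_right_mono) auto
      also have "c / norm (x - point \<omega>) ^ m \<ge> c / (4 * r n) ^ m"
        using True np c r_pos[of n] by (intro divide_left_mono power_mono mult_pos_pos zero_less_power) auto
      finally have "c / (4 * r n) ^ m \<le> \<sigma> * g \<omega>" .
      moreover have "c / (4 * r n) ^ m * indicator S \<omega> \<le> c / (4 * r n) ^ m"
        using c r_pos[of n] by (simp add: indicator_def)
      ultimately show ?thesis by linarith
    next
      case False
      have "\<omega> \<notin> S"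
      proof
        assume "\<omega> \<in> S"
        then obtain b where b: "b \<in> B" "\<omega> \<in> cyl (Suc n) (\<zeta>(n := b))" by (auto simp: S_def)
        have vb: "dist v b \<le> 4 / 3 * q n" using cell_local(1)[OF \<zeta> \<omega> b(2)] by (simp add: v_def)
        have bb: "norm (b - b0) < \<tau>" using b(1) by (simp add: B_def dist_norm norm_minus_commute)
        have vb0: "norm (v - b0) < 2 * \<tau>"
          using vb bb q norm_triangle_ineq[of "v - b" "b - b0"] by (simp add: dist_norm)
        have "e /\<^sub>R 2 - b0 = (3 / 2 - \<tau>) *\<^sub>R e"
        proof -
          have "(3 / 2 - \<tau>) *\<^sub>R e = (1 / 2 + (1 - \<tau>)) *\<^sub>R e" by simp
          then show ?thesis unfolding scaleR_add_left by (simp add: b0_def)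
        qed
        then have eb: "norm (e /\<^sub>R 2 - b0) = 3 / 2 - \<tau>" using e \<tau> by simp
        have "norm (e /\<^sub>R 2 - b0) \<le> norm (u - v) + norm (u - e /\<^sub>R 2) + norm (v - b0)"
        proof -
          have "e /\<^sub>R 2 - b0 = (u - v) - (u - e /\<^sub>R 2) + (v - b0)" by simp
          then have "norm (e /\<^sub>R 2 - b0) = norm ((u - v) - (u - e /\<^sub>R 2) + (v - b0))" by (rule arg_cong)
          then show ?thesis
            using norm_triangle_ineq[of "(u - v) - (u - e /\<^sub>R 2)" "v - b0"]
              norm_triangle_ineq4[of "u - v" "u - e /\<^sub>R 2"] by linarith
        qed
        then have 1: "3 / 2 - 4 * \<tau> < norm (u - v)" using eb u vb0 by linarith
        have "norm b0 = 1 - \<tau>" using e \<tau> by (simp add: b0_def)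
        then have "norm v \<le> 1 + \<tau>" using vb0 norm_triangle_sub[of v b0] by linarith
        then have 2: "norm (u - v) \<le> 4" using un \<tau> norm_triangle_ineq4[of u v] by linarith
        have "\<epsilon> < norm (x - point \<omega>) \<and> norm (x - point \<omega>) \<le> 4 * r n"
          unfolding nx \<epsilon>_def using 1 2 by (auto intro: mult_strict_right_mono mult_right_mono)
        then show False using False by simp
      qed
      moreover have "g \<omega> = 0"
        using False \<epsilon> by (auto simp: g_def indicator_def)
      ultimately show ?thesis by simp
    qed
  qed
  have "f * c / 4 ^ m = c / (4 * r n) ^ m * (f * r n ^ m)" by (simp add: power_mult_distrib)
  also have "\<dots> \<le> c / (4 * r n) ^ m * measure P S" using mS c by (intro mult_left_mono) auto
  also have "\<dots> = (LINT \<omega>|P. c / (4 * r n) ^ m * indicator S \<omega>)" by simp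
  also have "\<dots> \<le> (LINT \<omega>|P. \<sigma> * g \<omega>)"
  proof (rule integral_mono_AE)
    show "integrable P (\<lambda>\<omega>. c / (4 * r n) ^ m * indicator S \<omega>)"
      by (intro integrable_mult_right) (simp add: integrable_indicator_iff P.emeasure_eq_measure)
    show "AE \<omega> in P. c / (4 * r n) ^ m * indicator S \<omega> \<le> \<sigma> * g \<omega>"
      using AE_paths by eventually_elim (rule low)
  qed (use gint in simp)
  also have "\<dots> = \<sigma> * (LINT \<omega>|P. g \<omega>)" by simp
  finally show ?thesis unfolding gval \<epsilon>_def .
qed

text \<open>Almost every point lies in \<open>U n\<close> for infinitely many \<open>n\<close>.
  There two truncation radii of order \<open>r n\<close> give values differing by at least a fixed
  \<open>\<kappa>\<close>, so the truncations are not Cauchy as the radius tends to 0.\<close>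

lemma no_principal_value:
  assumes e: "norm e = 1" and \<rho>: "\<rho> > 0" and c: "c > 0" and \<sigma>: "\<bar>\<sigma>\<bar> = 1"
    and pos: "\<And>\<xi>. norm \<xi> = 1 \<Longrightarrow> norm (\<xi> - e) < \<rho> \<Longrightarrow> c \<le> \<sigma> * \<Omega> \<xi>"
  shows "AE x in \<mu>. \<not> (\<exists>l. ((\<lambda>\<epsilon>. truncated_potential m \<Omega> \<mu> \<epsilon> x) \<longlongrightarrow> l) (at_right 0))"
proof -
  define \<tau> where "\<tau> = min (1 / 16) ((\<rho> / 12)\<^sup>2)"
  have \<tau>: "0 < \<tau>" "\<tau> \<le> 1 / 16" "12 * sqrt \<tau> \<le> \<rho>"
  proof -
    show "0 < \<tau>" "\<tau> \<le> 1 / 16" using \<rho> by (auto simp: \<tau>_def)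
    have "sqrt \<tau> \<le> sqrt ((\<rho> / 12)\<^sup>2)" by (simp add: \<tau>_def del: real_sqrt_abs)
    then show "12 * sqrt \<tau> \<le> \<rho>" using \<rho> by simp
  qed
  define f where "f = (\<tau> / 2) ^ DIM('a) / 2"
  have f: "f > 0" using \<tau> by (simp add: f_def)
  have nb: "norm (- ((1 - \<tau>) *\<^sub>R e)) + \<tau> \<le> 1" using e \<tau> by simp
  have ev1: "\<forall>\<^sub>F n in sequentially. f \<le> real (card (A n \<inter> ball (- ((1 - \<tau>) *\<^sub>R e)) \<tau>)) / real (card (A n))"
    unfolding f_def by (rule eventually_grid_fraction[OF nb \<tau>(1)])
  have ev2: "\<forall>\<^sub>F n in sequentially. \<delta> n < \<tau>" by (rule order_tendstoD(2)[OF \<delta>_tendsto_0 \<tau>(1)])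
  obtain n0 where n0: "\<And>n. n \<ge> n0 \<Longrightarrow> f \<le> real (card (A n \<inter> ball (- ((1 - \<tau>) *\<^sub>R e)) \<tau>)) / real (card (A n))"
      "\<And>n. n \<ge> n0 \<Longrightarrow> \<delta> n < \<tau>"
    using eventually_conj[OF ev1 ev2] unfolding eventually_sequentially by blast
  have qn: "4 / 3 * q n \<le> \<tau> / 2" if "n \<ge> n0" for n
    using n0(2)[OF that] q_le_h[of n] G(4)[of n] h_pos[of n] by simp
  \<comment> \<open>The conclusion concerns points, not paths; \<open>U n\<close> expresses the
    favourable step through the position alone, so that \<open>W\<close> is a Borel set.\<close>
  define U where "U n = (\<Union>z\<in>centers n. ball (z + (r n / 2) *\<^sub>R e) (\<tau> * r n))" for n
  have Uo: "open (U n)" for n unfolding U_def by blast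
  define W where "W = (\<Inter>N. \<Union>n\<in>{N..}. U n)"
  have Wm: "W \<in> sets borel"
    unfolding W_def using Uo by (intro sets.countable_INT) (auto intro!: borel_open)
  have nh: "norm (e /\<^sub>R 2) + \<tau> / 2 \<le> 1" using e \<tau> by simp
  have freq: "AE \<omega> in P. \<forall>N. \<exists>n\<ge>N. \<omega> n \<in> ball (e /\<^sub>R 2) (\<tau> / 2)"
    by (rule AE_frequently[OF nh]) (use \<tau>(1) in simp)
  have "AE \<omega> in P. point \<omega> \<in> W"
    using freq AE_paths
  proof eventually_elim
    case (elim \<omega>)
    show "point \<omega> \<in> W"
      unfolding W_def
    proof safe
      fix N
      obtain n where n: "n \<ge> max N n0" "dist (e /\<^sub>R 2) (\<omega> n) < \<tau> / 2"
        using spec[OF elim(1), of "max N n0"] unfolding mem_ball by blast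
      define v where "v = (point \<omega> - center \<omega> n) /\<^sub>R r n"
      have "dist v (\<omega> n) \<le> \<tau> / 2" using point_local(1)[OF elim(2), of n] qn[of n] n(1) by (simp add: v_def)
      then have "dist (e /\<^sub>R 2) v < \<tau>" using n(2) dist_triangle2[of "e /\<^sub>R 2" v "\<omega> n"] by linarith
      then have v: "norm (e /\<^sub>R 2 - v) < \<tau>" by (simp add: dist_norm)
      have "center \<omega> n + (r n / 2) *\<^sub>R e - point \<omega> = r n *\<^sub>R (e /\<^sub>R 2 - v)"
        by (simp add: v_def scaleR_diff_right)
      then have "dist (center \<omega> n + (r n / 2) *\<^sub>R e) (point \<omega>) = r n * norm (e /\<^sub>R 2 - v)" by (simp add: dist_norm)
      also have "\<dots> < \<tau> * r n" using v by (simp add: mult.commute)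
      finally have "point \<omega> \<in> U n" using elim(2) by (auto simp: U_def centers_def)
      then show "point \<omega> \<in> (\<Union>n\<in>{N..}. U n)" using n(1) by auto
    qed
  qed
  then have "AE x in \<mu>. x \<in> W" unfolding \<mu>_def using Wm by (subst AE_distr_iff) auto
  then show ?thesis
  proof eventually_elim
    case (elim x)
    show ?case
    proof
      assume "\<exists>l. ((\<lambda>\<epsilon>. truncated_potential m \<Omega> \<mu> \<epsilon> x) \<longlongrightarrow> l) (at_right 0)"
      then obtain l where l: "((\<lambda>\<epsilon>. truncated_potential m \<Omega> \<mu> \<epsilon> x) \<longlongrightarrow> l) (at_right 0)" by blast
      define \<kappa> where "\<kappa> = f * c / 4 ^ m"
      have \<kappa>: "\<kappa> > 0" using f c by (simp add: \<kappa>_def)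
      have "\<forall>\<^sub>F \<epsilon> in at_right 0. dist (truncated_potential m \<Omega> \<mu> \<epsilon> x) l < \<kappa> / 2"
        by (rule tendstoD[OF l]) (use \<kappa> in simp)
      then obtain s where s: "s > 0" "\<And>\<epsilon>. 0 < \<epsilon> \<Longrightarrow> \<epsilon> < s \<Longrightarrow> dist (truncated_potential m \<Omega> \<mu> \<epsilon> x) l < \<kappa> / 2"
        unfolding eventually_at_right_field by blast
      have "\<forall>\<^sub>F n in sequentially. r n < s / 4" by (rule order_tendstoD(2)[OF r_tendsto_0]) (use s in simp)
      then obtain n1 where n1: "\<And>n. n \<ge> n1 \<Longrightarrow> r n < s / 4" unfolding eventually_sequentially by blast
      have "x \<in> (\<Union>n\<in>{max n0 n1..}. U n)" using INT_D[OF elim[unfolded W_def] UNIV_I] .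
      then obtain n where n: "n \<ge> max n0 n1" "x \<in> U n" by (auto simp only: UN_iff atLeast_iff)
      then obtain \<zeta> where \<zeta>: "\<zeta> \<in> paths" "dist x (center \<zeta> n + (r n / 2) *\<^sub>R e) < \<tau> * r n"
        by (auto simp: U_def centers_def dist_commute)
      have "4 / 3 * q n \<le> \<tau>" using qn[of n] n(1) \<tau>(1) by simp
      then have "\<kappa> \<le> \<sigma> * (truncated_potential m \<Omega> \<mu> ((3 / 2 - 4 * \<tau>) * r n) x - truncated_potential m \<Omega> \<mu> (4 * r n) x)"
        unfolding \<kappa>_def using n(1) by (intro truncation_oscillation[OF e \<tau> c pos \<zeta>] n0(1)) auto
      also have "\<dots> \<le> \<bar>truncated_potential m \<Omega> \<mu> ((3 / 2 - 4 * \<tau>) * r n) x - truncated_potential m \<Omega> \<mu> (4 * r n) x\<bar>"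
        using abs_ge_self[of "\<sigma> * (truncated_potential m \<Omega> \<mu> ((3 / 2 - 4 * \<tau>) * r n) x - truncated_potential m \<Omega> \<mu> (4 * r n) x)"] \<sigma>
        by (simp add: abs_mult)
      finally have big: "\<kappa> \<le> dist (truncated_potential m \<Omega> \<mu> ((3 / 2 - 4 * \<tau>) * r n) x) (truncated_potential m \<Omega> \<mu> (4 * r n) x)"
        by (simp add: dist_real_def)
      have rs: "4 * r n < s" using n1[of n] n(1) by simp
      have le: "(3 / 2 - 4 * \<tau>) * r n \<le> 4 * r n" using \<tau> by (intro mult_right_mono) auto
      have 1: "dist (truncated_potential m \<Omega> \<mu> ((3 / 2 - 4 * \<tau>) * r n) x) l < \<kappa> / 2"
        by (intro s(2) le_less_trans[OF le rs]) (use \<tau> in auto)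
      have 2: "dist (truncated_potential m \<Omega> \<mu> (4 * r n) x) l < \<kappa> / 2" using rs by (intro s(2)) auto
      show False using big 1 2 dist_triangle2[of "truncated_potential m \<Omega> \<mu> ((3 / 2 - 4 * \<tau>) * r n) x" "truncated_potential m \<Omega> \<mu> (4 * r n) x" l]
        by linarith
    qed
  qed
qed

end

section \<open>Second moments\<close>

lemma cantor_exists:
  assumes d: "DIM('a::euclidean_space) = Suc (Suc m)" and m: "m \<ge> 1"
  obtains A :: "nat \<Rightarrow> 'a::euclidean_space set" and h q \<delta> \<delta>0 where "cantor m A h q \<delta> \<delta>0"
proof -
  let ?v = "unit_ball_vol (real DIM('a))"
  have v: "?v > 0" by (simp add: unit_ball_vol_pos)
  define \<delta>0 where "\<delta>0 = min (1 / 128) (?v / 2)"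
  have \<delta>0: "0 < \<delta>0" "\<delta>0 \<le> 1 / 128" "\<delta>0 \<le> ?v / 2" using v by (auto simp: \<delta>0_def)
  have "\<delta>0 ^ DIM('a) \<le> \<delta>0" using power_decreasing[of 1 "DIM('a)" \<delta>0] \<delta>0 d by simp
  then have \<delta>0v: "\<delta>0 ^ DIM('a) \<le> ?v / 2" using \<delta>0 by linarith
  define \<delta> where "\<delta> k = \<delta>0 * (1 / 2) ^ k" for k :: nat
  have \<delta>: "0 < \<delta> k" "\<delta> k ^ DIM('a) \<le> ?v / 2" for k
  proof -
    show 1: "0 < \<delta> k" using \<delta>0 by (simp add: \<delta>_def)
    have "\<delta>0 * (1 / 2) ^ k \<le> \<delta>0 * 1" using \<delta>0 by (intro mult_left_mono power_le_one) auto
    then have "\<delta> k ^ DIM('a) \<le> \<delta>0 ^ DIM('a)" using 1 by (intro power_mono) (auto simp: \<delta>_def)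
    then show "\<delta> k ^ DIM('a) \<le> ?v / 2" using \<delta>0v by linarith
  qed
  have "\<forall>k. \<exists>X. is_grid (fst X :: 'a set) (fst (snd X)) (\<delta> k) \<and> snd (snd X) > 0 \<and> snd (snd X) ^ m * real (card (fst X)) = 1
      \<and> snd (snd X) \<le> \<delta> k * fst (snd X)"
  proof
    fix k
    obtain A :: "'a set" and h q where "is_grid A h (\<delta> k)" "q > 0" "q ^ m * real (card A) = 1" "q \<le> \<delta> k * h"
      by (rule sparse_grid_exists[OF d m \<delta>])
    then show "\<exists>X. is_grid (fst X :: 'a set) (fst (snd X)) (\<delta> k) \<and> snd (snd X) > 0 \<and> snd (snd X) ^ m * real (card (fst X)) = 1
      \<and> snd (snd X) \<le> \<delta> k * fst (snd X)"
      by (intro exI[of _ "(A, h, q)"]) simp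
  qed
  then obtain X where X: "\<And>k. is_grid (fst (X k) :: 'a set) (fst (snd (X k))) (\<delta> k) \<and> snd (snd (X k)) > 0
      \<and> snd (snd (X k)) ^ m * real (card (fst (X k))) = 1 \<and> snd (snd (X k)) \<le> \<delta> k * fst (snd (X k))"
    using choice[of "\<lambda>k X. is_grid (fst X :: 'a set) (fst (snd X)) (\<delta> k) \<and> snd (snd X) > 0 \<and> snd (snd X) ^ m * real (card (fst X)) = 1
      \<and> snd (snd X) \<le> \<delta> k * fst (snd X)"] by blast
  have "cantor m (\<lambda>k. fst (X k)) (\<lambda>k. fst (snd (X k))) (\<lambda>k. snd (snd (X k))) \<delta> \<delta>0"
    by (unfold_locales; (use X in blast)?) (use d m \<delta>0 \<delta>0v in \<open>auto simp: \<delta>_def\<close>)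
  then show thesis by (rule that)
qed

locale sphere_kernel = cantor_kernel m A h q \<delta> \<delta>0 \<Omega> \<alpha> C M
  for m and A :: "nat \<Rightarrow> (real ^ 'n::finite) set" and h q \<delta> \<delta>0 \<Omega> \<alpha> C M +
  assumes cont: "continuous_on (sphere 0 1) \<Omega>"
    and even: "\<forall>\<xi>\<in>sphere 0 1. \<Omega> (- \<xi>) = \<Omega> \<xi>"
    and mean: "sphere_integral \<Omega> = 0"
begin

text \<open>Second moments with respect to the cone measure, the form in which polar coordinates
  produce them; those of the statement differ by a positive factor.\<close>

definition moment :: "'n \<Rightarrow> 'n \<Rightarrow> real" where
  "moment i j = (LINT z:cball 0 1|lborel. sgn z $ i * sgn z $ j * \<Omega> (sgn z))"

lemma moment_eq_0_iff:
  "moment i j = 0 \<longleftrightarrow> sphere_integral (\<lambda>\<xi>. \<xi> $ i * \<xi> $ j * \<Omega> \<xi>) = 0"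
  and mean_cone: "(LINT z:cball 0 1|lborel. \<Omega> (sgn z)) = 0"
proof -
  have "CARD('n) \<ge> 2" using d by simp
  then obtain c where c: "c > 0" "\<And>f :: real ^ 'n \<Rightarrow> real. continuous_on (sphere 0 1) f \<Longrightarrow>
      sphere_integral f = c * (LINT z:cball 0 1|lborel. f (sgn z))"
    using sphere_integral_eq_cone by metis
  have "continuous_on (sphere 0 1) (\<lambda>\<xi>. \<xi> $ i * \<xi> $ j * \<Omega> \<xi>)"
    by (intro continuous_intros cont)
  from c(2)[OF this] show "moment i j = 0 \<longleftrightarrow> sphere_integral (\<lambda>\<xi>. \<xi> $ i * \<xi> $ j * \<Omega> \<xi>) = 0"
    using c(1) by (simp add: moment_def)
  show "(LINT z:cball 0 1|lborel. \<Omega> (sgn z)) = 0" using c(2)[OF cont] c(1) mean by simp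
qed

lemma moment_sym: "moment i j = moment j i"
  by (simp add: moment_def mult.commute mult.left_commute)

lemma I_eq:
  assumes u: "norm u \<le> 1"
  shows "I u = real CARD('n) * (\<Sum>i\<in>UNIV. \<Sum>j\<in>UNIV. u $ i * u $ j * moment i j)"
proof -
  note hk.meas[measurable]
  have [measurable]: "(\<lambda>z :: real ^ 'n. sgn z $ k) \<in> borel_measurable borel" for k :: 'n
  proof -
    have "(\<lambda>z :: real ^ 'n. z $ k) \<in> borel_measurable borel"
      by (intro borel_measurable_continuous_onI continuous_intros)
    from measurable_compose[OF borel_measurable_sgn_vec this] show ?thesis .
  qed
  \<comment> \<open>Since \<open>sgn 0 = 0\<close>, the value \<open>\<Omega> 0\<close> occurs, and
    \<open>M\<close> bounds \<Omega> on the sphere only.\<close>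
  define M' where "M' = max M \<bar>\<Omega> 0\<bar>"
  have bd: "\<bar>\<Omega> (sgn z)\<bar> \<le> M'" for z
    using hk.M[of "sgn z"] by (cases "z = 0") (auto simp: M'_def norm_sgn)
  have ev: "\<Omega> (- sgn z) = \<Omega> (sgn z)" for z :: "real ^ 'n"
    using even by (cases "z = 0") (auto simp: norm_sgn)
  have int: "set_integrable lborel (cball 0 1) (\<lambda>z. u $ i * u $ j * (sgn z $ i * sgn z $ j * \<Omega> (sgn z)))" for i j
  proof (intro set_integrable_mult_right integrable_bounded_cball)
    fix z :: "real ^ 'n"
    have c: "\<bar>sgn z $ k\<bar> \<le> 1" for k
      using component_le_norm_cart[of "sgn z" k] by (simp add: norm_sgn split: if_splits)
    have "\<bar>sgn z $ i\<bar> * \<bar>sgn z $ j\<bar> * \<bar>\<Omega> (sgn z)\<bar> \<le> 1 * 1 * M'"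
      using bd c by (intro mult_mono) auto
    then show "\<bar>sgn z $ i * sgn z $ j * \<Omega> (sgn z)\<bar> \<le> M'" by (simp add: abs_mult)
  qed measurable
  have "I u = real DIM(real ^ 'n) * (LINT z:cball 0 1|lborel. \<Omega> (sgn z) * (u \<bullet> sgn z)\<^sup>2)"
    unfolding I_def homogeneous_kernel_sgn
    by (rule integral_kernel_cball_even(2)[OF d u hk.meas bd ev mean_cone])
  also have "(\<lambda>z. \<Omega> (sgn z) * (u \<bullet> sgn z)\<^sup>2)
     = (\<lambda>z. \<Sum>i\<in>UNIV. \<Sum>j\<in>UNIV. u $ i * u $ j * (sgn z $ i * sgn z $ j * \<Omega> (sgn z)))"
    by (simp add: fun_eq_iff inner_vec_def power2_eq_square sum_product sum_distrib_left ac_simps)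
  also have "(LINT z:cball 0 1|lborel. (\<Sum>i\<in>UNIV. \<Sum>j\<in>UNIV. u $ i * u $ j * (sgn z $ i * sgn z $ j * \<Omega> (sgn z))))
     = (\<Sum>i\<in>UNIV. \<Sum>j\<in>UNIV. LINT z:cball 0 1|lborel. u $ i * u $ j * (sgn z $ i * sgn z $ j * \<Omega> (sgn z)))"
    using int unfolding set_lebesgue_integral_def set_integrable_def scaleR_sum_right
    by (subst Bochner_Integration.integral_sum)
       (rule Bochner_Integration.integrable_sum sum.cong Bochner_Integration.integral_sum refl | assumption)+
  also have "\<dots> = (\<Sum>i\<in>UNIV. \<Sum>j\<in>UNIV. u $ i * u $ j * moment i j)"
    by (simp add: moment_def)
  finally show ?thesis by simp
qed

definition quad :: "real ^ 'n \<Rightarrow> real" where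
  "quad u = (\<Sum>i\<in>UNIV. \<Sum>j\<in>UNIV. u $ i * u $ j * moment i j)"

lemma quad_scale: "quad (t *\<^sub>R u) = t\<^sup>2 * quad u"
  by (simp add: quad_def sum_distrib_left power2_eq_square ac_simps)

text \<open>Polarization: the moments are symmetric in \<open>i\<close> and \<open>j\<close>, so a
  vanishing quadratic form forces each of them to vanish.\<close>

lemma moment_eq_polarization:
  "2 * moment i j = quad (axis i 1 + axis j 1) - quad (axis i 1) - quad (axis j 1)"
proof -
  have bil: "(\<Sum>k\<in>UNIV. \<Sum>l\<in>UNIV. axis a 1 $ k * axis b 1 $ l * moment k l) = moment a b" for a b :: 'n
  proof -
    have "(\<Sum>l\<in>UNIV. axis a 1 $ k * axis b 1 $ l * moment k l) = (if k = a then moment a b else 0)" for k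
    proof -
      have "axis a 1 $ k * axis b 1 $ l * moment k l = (if l = b then if k = a then moment a b else 0 else 0)" for l
        by (simp add: axis_def)
      then show ?thesis by simp
    qed
    then show ?thesis by simp
  qed
  have "quad (axis i 1 + axis j 1) = (\<Sum>k\<in>UNIV. \<Sum>l\<in>UNIV. axis i 1 $ k * axis i 1 $ l * moment k l)
      + (\<Sum>k\<in>UNIV. \<Sum>l\<in>UNIV. axis i 1 $ k * axis j 1 $ l * moment k l)
      + (\<Sum>k\<in>UNIV. \<Sum>l\<in>UNIV. axis j 1 $ k * axis i 1 $ l * moment k l)
      + (\<Sum>k\<in>UNIV. \<Sum>l\<in>UNIV. axis j 1 $ k * axis j 1 $ l * moment k l)"
    unfolding quad_def by (simp add: distrib_left distrib_right sum.distrib)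
  then show ?thesis unfolding bil using moment_sym[of j i] by (simp add: quad_def bil)
qed

theorem bounded_iff:
  "essentially_bounded (lebesgue_on (- E)) (potential m \<Omega> \<mu>)
    \<longleftrightarrow> (\<forall>i j. sphere_integral (\<lambda>\<xi>. \<xi> $ i * \<xi> $ j * \<Omega> \<xi>) = 0)"
proof
  assume "\<forall>i j. sphere_integral (\<lambda>\<xi>. \<xi> $ i * \<xi> $ j * \<Omega> \<xi>) = 0"
  then have "moment i j = 0" for i j by (simp add: moment_eq_0_iff)
  then have "I u = 0" if "norm u \<le> 1" for u using I_eq[OF that] by simp
  then show "essentially_bounded (lebesgue_on (- E)) (potential m \<Omega> \<mu>)" by (rule potential_bounded)
next
  assume bdd: "essentially_bounded (lebesgue_on (- E)) (potential m \<Omega> \<mu>)"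
  have "quad u0 = 0" for u0
  proof (rule ccontr)
    assume q0: "quad u0 \<noteq> 0"
    then have u0: "u0 \<noteq> 0" by (auto simp: quad_def)
    \<comment> \<open>Norm \<open>1 / 2\<close> leaves room for a ball around \<open>p\<close>
      inside the unit ball on which, by continuity, the form keeps its sign.\<close>
    define p where "p = (1 / (2 * norm u0)) *\<^sub>R u0"
    have np: "norm p = 1 / 2" using u0 by (simp add: p_def)
    have qp: "quad p \<noteq> 0" using q0 u0 by (simp add: p_def quad_scale)
    define \<sigma> where "\<sigma> = sgn (quad p)"
    have \<sigma>: "\<bar>\<sigma>\<bar> = 1" "\<sigma> * quad p = \<bar>quad p\<bar>"
      using qp by (simp_all add: \<sigma>_def abs_sgn mult_sgn_abs mult.commute)
    have "isCont quad p" unfolding quad_def by (intro continuous_intros)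
    then have "\<forall>\<^sub>F u in nhds p. dist (quad u) (quad p) < \<bar>quad p\<bar> / 2"
      using qp by (intro tendstoD) (auto simp: continuous_within tendsto_at_within_iff_tendsto_nhds)
    then obtain \<rho> where \<rho>: "\<rho> > 0" "\<And>u. dist u p < \<rho> \<Longrightarrow> dist (quad u) (quad p) < \<bar>quad p\<bar> / 2"
      unfolding eventually_nhds_metric by blast
    define \<tau> where "\<tau> = min (1 / 4) (\<rho> / 2)"
    have \<tau>: "\<tau> > 0" "2 * \<tau> \<le> \<rho>" "norm p + \<tau> \<le> 1" using \<rho>(1) np by (auto simp: \<tau>_def)
    have n: "real CARD('n) > 0" by simp
    have "\<not> essentially_bounded (lebesgue_on (- E)) (potential m \<Omega> \<mu>)"
    proof (rule potential_unbounded[OF \<tau>(3,1) _ \<sigma>(1)])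
      show "0 < real CARD('n) * (\<bar>quad p\<bar> / 2)" using qp by simp
      fix u assume u: "u \<in> ball p (2 * \<tau>)" "norm u \<le> 1"
      then have "dist (quad u) (quad p) < \<bar>quad p\<bar> / 2" using \<tau> by (intro \<rho>(2)) (auto simp: dist_commute)
      then have "\<bar>\<sigma> * (quad u - quad p)\<bar> < \<bar>quad p\<bar> / 2" using \<sigma> by (simp add: dist_real_def abs_mult)
      then have "\<bar>quad p\<bar> / 2 \<le> \<sigma> * quad u" using \<sigma>(2) unfolding right_diff_distrib by linarith
      then have "real CARD('n) * (\<bar>quad p\<bar> / 2) \<le> real CARD('n) * (\<sigma> * quad u)" by (intro mult_left_mono) auto
      moreover have "I u = real CARD('n) * quad u" unfolding quad_def by (rule I_eq[OF u(2)])
      ultimately show "real CARD('n) * (\<bar>quad p\<bar> / 2) \<le> \<sigma> * I u" by (simp add: ac_simps)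
    qed
    then show False using bdd by simp
  qed
  then have "moment i j = 0" for i j using moment_eq_polarization[of i j] by simp
  then show "\<forall>i j. sphere_integral (\<lambda>\<xi>. \<xi> $ i * \<xi> $ j * \<Omega> \<xi>) = 0" by (simp add: moment_eq_0_iff)
qed

theorem no_pv:
  assumes "\<exists>\<xi>\<in>sphere 0 1. \<Omega> \<xi> \<noteq> 0"
  shows "AE x in \<mu>. \<not> (\<exists>l. ((\<lambda>\<epsilon>. truncated_potential m \<Omega> \<mu> \<epsilon> x) \<longlongrightarrow> l) (at_right 0))"
proof -
  obtain e where e: "norm e = 1" "\<Omega> e \<noteq> 0" using assms by auto
  have "\<bar>\<Omega> e\<bar> / 2 > 0" using e by simp
  then obtain \<rho> where \<rho>: "\<rho> > 0" "\<And>\<xi>. \<xi> \<in> sphere 0 1 \<Longrightarrow> dist \<xi> e < \<rho> \<Longrightarrow> dist (\<Omega> \<xi>) (\<Omega> e) < \<bar>\<Omega> e\<bar> / 2"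
    using cont e(1) unfolding continuous_on_iff by (metis dist_0_norm mem_sphere)
  define \<sigma> where "\<sigma> = sgn (\<Omega> e)"
  have \<sigma>: "\<bar>\<sigma>\<bar> = 1" "\<sigma> * \<Omega> e = \<bar>\<Omega> e\<bar>"
    using e by (simp_all add: \<sigma>_def abs_sgn mult.commute)
  show ?thesis
  proof (rule no_principal_value[OF e(1) \<rho>(1) \<open>\<bar>\<Omega> e\<bar> / 2 > 0\<close> \<sigma>(1)])
    fix \<xi> :: "real ^ 'n" assume "norm \<xi> = 1" "norm (\<xi> - e) < \<rho>"
    then have "dist (\<Omega> \<xi>) (\<Omega> e) < \<bar>\<Omega> e\<bar> / 2" by (intro \<rho>(2)) (auto simp: dist_norm)
    then have "\<bar>\<sigma> * (\<Omega> \<xi> - \<Omega> e)\<bar> < \<bar>\<Omega> e\<bar> / 2" using \<sigma> by (simp add: dist_real_def abs_mult)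
    then show "\<bar>\<Omega> e\<bar> / 2 \<le> \<sigma> * \<Omega> \<xi>" using \<sigma>(2) unfolding right_diff_distrib by linarith
  qed
qed

end

lemma holder_continuous_on_imp_continuous_on:
  assumes "holder_continuous_on S f" shows "continuous_on S f"
proof -
  obtain \<alpha> C where \<alpha>: "0 < \<alpha>" and H: "\<And>x y. x \<in> S \<Longrightarrow> y \<in> S \<Longrightarrow> dist (f x) (f y) \<le> C * dist x y powr \<alpha>"
    using assms unfolding holder_continuous_on_def by blast
  show ?thesis
    unfolding continuous_on_def
  proof
    fix x assume x: "x \<in> S"
    have "((\<lambda>y. C * dist y x powr \<alpha>) \<longlongrightarrow> C * dist x x powr \<alpha>) (at x within S)"
      using \<alpha> by (intro tendsto_intros) auto
    then have "((\<lambda>y. C * dist y x powr \<alpha>) \<longlongrightarrow> 0) (at x within S)" using \<alpha> by simp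
    then have "((\<lambda>y. dist (f y) (f x)) \<longlongrightarrow> 0) (at x within S)"
      by (rule Lim_null_comparison[rotated]) (use x H in \<open>auto simp: eventually_at_filter\<close>)
    then show "(f \<longlongrightarrow> f x) (at x within S)" by (rule tendsto_dist_iff[THEN iffD2])
  qed
qed

lemma (in cantor) hoelder_kernel_of_holder:
  fixes \<Omega> :: "'a \<Rightarrow> real"
  assumes "holder_continuous_on (sphere 0 1) \<Omega>"
  obtains \<alpha> C M where "hoelder_kernel \<Omega> m \<alpha> C M"
proof -
  obtain \<alpha> C where \<alpha>: "0 < \<alpha>" "\<alpha> \<le> 1"
    and H: "\<forall>x\<in>sphere 0 1. \<forall>y\<in>sphere 0 1. dist (\<Omega> x) (\<Omega> y) \<le> C * dist x y powr \<alpha>"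
    using assms unfolding holder_continuous_on_def by blast
  have cont: "continuous_on (sphere 0 1) \<Omega>" by (rule holder_continuous_on_imp_continuous_on[OF assms])
  have "bounded (\<Omega> ` sphere 0 1)" by (intro compact_imp_bounded compact_continuous_image cont compact_sphere)
  then obtain M where M: "\<forall>y\<in>\<Omega> ` sphere 0 1. norm y \<le> M" unfolding bounded_pos by blast
  \<comment> \<open>\<open>holder_continuous_on\<close> leaves the sign of \<open>C\<close> open,
    whereas the estimates multiply by it.\<close>
  have "hoelder_kernel \<Omega> m \<alpha> (max 0 C) M"
  proof
    show "\<bar>\<Omega> \<xi>\<bar> \<le> M" if "norm \<xi> = 1" for \<xi> using M that by auto
    fix \<xi> \<eta> :: 'a assume "norm \<xi> = 1" "norm \<eta> = 1"
    then have "\<bar>\<Omega> \<xi> - \<Omega> \<eta>\<bar> \<le> C * norm (\<xi> - \<eta>) powr \<alpha>" using H by (auto simp: dist_real_def dist_norm)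
    also have "\<dots> \<le> max 0 C * norm (\<xi> - \<eta>) powr \<alpha>" by (intro mult_right_mono) auto
    finally show "\<bar>\<Omega> \<xi> - \<Omega> \<eta>\<bar> \<le> max 0 C * norm (\<xi> - \<eta>) powr \<alpha>" .
  qed (use d m \<alpha> borel_measurable_comp_sgn[OF cont] in auto)
  then show thesis by (rule that)
qed

theorem theorem1p1:
  assumes "CARD('n::finite) \<ge> 3"
  shows "\<exists>(E :: (real ^ 'n) set) (\<mu> :: (real ^ 'n) measure).
    purely_unrectifiable (CARD('n) - 2) E \<and>
    prob_space \<mu> \<and> dimensional_measure (CARD('n) - 2) \<mu> \<and> measure_support \<mu> \<subseteq> E \<and>
    (\<forall>\<Omega> :: real ^ 'n \<Rightarrow> real.
       holder_continuous_on (sphere 0 1) \<Omega> \<and>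
       (\<forall>\<xi>\<in>sphere 0 1. \<Omega> (- \<xi>) = \<Omega> \<xi>) \<and>
       sphere_integral \<Omega> = 0 \<longrightarrow>
         (essentially_bounded (lebesgue_on (- measure_support \<mu>)) (potential (CARD('n) - 2) \<Omega> \<mu>)
            \<longleftrightarrow> (\<forall>i j. sphere_integral (\<lambda>\<xi>. \<xi> $ i * \<xi> $ j * \<Omega> \<xi>) = 0)) \<and>
         ((\<exists>\<xi>\<in>sphere 0 1. \<Omega> \<xi> \<noteq> 0) \<longrightarrow>
            (AE x in \<mu>. \<not> (\<exists>l. ((\<lambda>\<epsilon>. truncated_potential (CARD('n) - 2) \<Omega> \<mu> \<epsilon> x)
                                   \<longlongrightarrow> l) (at_right 0)))))"
proof -
  define m where "m = CARD('n) - 2"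
  have d: "DIM(real ^ 'n) = Suc (Suc m)" and m: "m \<ge> 1" using assms by (simp_all add: m_def)
  obtain A :: "nat \<Rightarrow> (real ^ 'n) set" and h q \<delta> \<delta>0 where cantor: "cantor m A h q \<delta> \<delta>0"
    by (rule cantor_exists[OF d m])
  then interpret cantor m A h q \<delta> \<delta>0 .
  show ?thesis
    unfolding m_def[symmetric]
  proof (intro exI[of _ E] exI[of _ \<mu>] conjI allI impI)
    show "purely_unrectifiable m E" by (rule purely_unrectifiable_E)
    show "prob_space \<mu>" by (rule prob_space_\<mu>)
    show "dimensional_measure m \<mu>" by (rule dimensional_measure_\<mu>)
    show "measure_support \<mu> \<subseteq> E" by (simp add: measure_support_\<mu>)
    \<comment> \<open>The kernel enters only here, after \<open>E\<close> and \<mu> have been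
      chosen.\<close>
    fix \<Omega> :: "real ^ 'n \<Rightarrow> real"
    assume \<Omega>: "holder_continuous_on (sphere 0 1) \<Omega> \<and> (\<forall>\<xi>\<in>sphere 0 1. \<Omega> (- \<xi>) = \<Omega> \<xi>) \<and> sphere_integral \<Omega> = 0"
    then obtain \<alpha> C M where "hoelder_kernel \<Omega> m \<alpha> C M" using hoelder_kernel_of_holder by blast
    then interpret hk: hoelder_kernel \<Omega> m \<alpha> C M .
    interpret sphere_kernel m A h q \<delta> \<delta>0 \<Omega> \<alpha> C M
      by unfold_locales (use \<Omega> holder_continuous_on_imp_continuous_on in auto)
    show "essentially_bounded (lebesgue_on (- measure_support \<mu>)) (potential m \<Omega> \<mu>)
       \<longleftrightarrow> (\<forall>i j. sphere_integral (\<lambda>\<xi>. \<xi> $ i * \<xi> $ j * \<Omega> \<xi>) = 0)"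
      unfolding measure_support_\<mu> by (rule bounded_iff)
    show "AE x in \<mu>. \<not> (\<exists>l. ((\<lambda>\<epsilon>. truncated_potential m \<Omega> \<mu> \<epsilon> x) \<longlongrightarrow> l) (at_right 0))"
      if "\<exists>\<xi>\<in>sphere 0 1. \<Omega> \<xi> \<noteq> 0" using that by (rule no_pv)
  qed
qed

end
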